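(* Let $\alpha>0$, $0<p\le\infty$ and $\tau=\bigl(\frac1p+\frac{\alpha}{d-1}\bigr)^{-1}$. Then for every $f\in H^p$ and every integer $n>0$, $$|G_n^p(f)|_{B_\tau^\alpha(H^\tau)}\le C_{p,\alpha,\phi}\,n^{\frac{\alpha}{d-1}}\,\|f\|_{H^p}.$$ In addition, if $f\in H^p$ has a representation $f(x)=\sum_{B\in\mathcal{B}}a_B\psi_B(x)$ with at most $n$ nonzero coefficients $a_B$, then $$|f|_{B_\tau^\alpha(H^\tau)}\le C_{p,\alpha,\phi}\,n^{\frac{\alpha}{d-1}}\,\Bigl\|\max_{B\in\mathcal{B}}\bigl[|a_B|\,|B|^{-\frac12}\chi_B(\cdot)\bigr]\Bigr\|_p.$$
   Context: Fix an integer $d\ge 3$; constants $C$ depend only on the parameters indicated as subscripts (and on $d$). $\mathbb{S}^{d-1}$ is the unit sphere of $\mathbb{R}^d$, $d\sigma$ is its Lebesgue (surface) measure normalized by $\int_{\mathbb{S}^{d-1}}d\sigma=1$, $|E|$ is the measure of $E\subset\mathbb{S}^{d-1}$, $\chi_E$ its characteristic function, $\|\cdot\|_p$ the $L^p(\mathbb{S}^{d-1},d\sigma)$ quasi-norm, $d(x,y)=\arccos(x\cdot y)$ the geodesic distance, $B(x,r)=\{y\in\mathbb{S}^{d-1}:d(x,y)\le r\}$. $\mathcal{S}$ is the space of $C^\infty$ functions on $\mathbb{S}^{d-1}$ with the usual test function topology, $\mathcal{S}'$ its dual (distributions), $\langle f,\varphi\rangle$ the pairing of $f\in\mathcal{S}'$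 and $\varphi\in\mathcal{S}$. $A\asymp B$ means $C_1A\le B\le C_2A$ for positive constants $C_1,C_2$ (the constants of equivalence). Hardy spaces: for $z\in\mathbb{R}^d$, $|z|<1$, let $p_z(x)=c_d\frac{1-|z|^2}{|z-x|^d}$, $x\in\mathbb{S}^{d-1}$, with $c_d$ such that $\int p_z\,d\sigma=1$. For $f\in\mathcal{S}'$ put $P^+f(x)=\sup_{0\le r<1}|\langle f,p_{rx}\rangle|$ and $\|f\|_{H^p}=\|P^+f\|_p$ for $0<p<\infty$; $H^p=H^p(\mathbb{S}^{d-1})$ is the space of $f\in\mathcal{S}'$ with $\|f\|_{H^p}<\infty$. $H^\infty$ is identified with $C(\mathbb{S}^{d-1})$ with the sup norm. $\Pi_n$ is the space of restrictions to $\mathbb{S}^{d-1}$ of polynomials in $d$ variables of total degree at most $n$. Besov quasi-norm: for $\alpha>0$, $0<q,\tau\le\infty$, $E_n(f)_{H^q}=\inf\{\|f-g\|_{H^q}:g\in\Pi_n\}$ and $$|f|_{B_\tau^\alpha(H^q)}=\Bigl(\sum_{k=0}^\infty(k+1)^{\alpha\tau-1}(E_k(f)_{H^q})^\tau\Bigr)^{1/\tau}+|\langle f,1\rangle|,$$ with the first term replaced by $\sup_{k\ge0}(k+1)^\alpha E_k(f)_{H^q}$ when $\tau=\infty$. $P_k(t)=\frac{2k+d-2}{d-2}P_k^{(d-2)/2}(t)$, where $P_k^{(d-2)/2}$ is the ultraspherical (Gegenbauer) polynomial normalized by $P_k^{(d-2)/2}(1)=\frac{\Gamma(k+d-2)}{\Gamma(d-2)\Gamma(k+1)}$.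 Points and weights: there is a constant $\gamma>0$ depending only on $d$ for which the following choices are possible (a known fact), and they are fixed. For each integer $j>0$, $\{x_{j,k}:k\in\Lambda_j^d\}$ is a finite set of distinct points of $\mathbb{S}^{d-1}$ with $\min_{k\ne k'}d(x_{j,k},x_{j,k'})\ge\gamma/2^{j+4}$ and $\max_{x\in\mathbb{S}^{d-1}}\min_{k\in\Lambda_j^d}d(x,x_{j,k})<\gamma/2^{j+4}$, and $0\le\lambda_{j,k}\le C_d2^{-j(d-1)}$, $k\in\Lambda_j^d$, are numbers such that for all $f\in\Pi_{2^{j+4}}$: (i) $\int f\,d\sigma=\sum_{k\in\Lambda_j^d}\lambda_{j,k}f(x_{j,k})$; (ii) for all $0<p\le\infty$ and $0\le t\le\min\{p,1\}$, $\|f\|_p\asymp\bigl(2^{-j(d-1)}\sum_{k\in\Lambda_j^d}(2^{j(d-1)}\lambda_{j,k})^t|f(x_{j,k})|^p\bigr)^{1/p}$ if $p<\infty$ and $\|f\|_\infty\asymp\max_{k\in\Lambda_j^d}(2^{j(d-1)}\lambda_{j,k})^t|f(x_{j,k})|$ if $p=\infty$, with constants of equivalence depending only on $d$ and on $p$ when $p$ is small, and the convention $0^0=1$. For $j=0$: $\Lambda_0^d=\{0\}$, $\lambda_{0,0}=1$, $x_{0,0}$ any fixed point. Frame: $\phi$ is a nonnegative $C^\infty$ function on $\mathbb{R}$ supported in $\{\frac12\le|x|\le2\}$ with $\sum_{j=-\infty}^\infty(\phi(2^{-j}x))^2=1$ for all $x\ne0$. $G_0(t)=1$ and, for $j\ge1$,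 $G_j(t)=\sum_{k=[2^{j-2}]}^{2^j}\phi(k/2^{j-1})P_k(t)$, $t\in[-1,1]$. $\psi_{j,k}(x)=\sqrt{\lambda_{j,k}}\,G_j(x\cdot x_{j,k})$ for $j\ge0$, $k\in\Lambda_j^d$. $\mathcal{B}$ is the collection of all caps $B=B(x_{j,k},2^{-j}\pi)$, $j\ge0$, $k\in\Lambda_j^d$, and for such $B$ one writes $\psi_B=\psi_{j,k}$. Greedy algorithm: for $0<p\le\infty$, $f\in H^p$ and an integer $n>0$, $\Gamma_n=\Gamma_{n,f,p}$ denotes a set of $n$ caps $B\in\mathcal{B}$ such that $\min_{B\in\Gamma_n}|\langle f,\psi_B\rangle||B|^{\frac1p-\frac12}\ge\max_{B\in\mathcal{B}\setminus\Gamma_n}|\langle f,\psi_B\rangle||B|^{\frac1p-\frac12}$ (such a set exists), and $G_n^p(f)=\sum_{B\in\Gamma_n}\langle f,\psi_B\rangle\psi_B$. *)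

theory Defs
  imports "HOL-Analysis.Analysis" "HOL-Probability.Essential_Supremum"
begin

text \<open>
  The ambient space \<open>\<real>\<^sup>d\<close> is a type \<open>'a :: euclidean_space\<close> with \<open>d = DIM('a)\<close>. Functions on the unit
  sphere are functions on \<open>'a\<close> of which only the values on \<open>sphere 0 1\<close> matter. The scalars
  \<open>'b :: {real_normed_field, euclidean_space}\<close> are the real or the complex numbers.
\<close>

section \<open>The sphere\<close>

text \<open>The normalized surface measure of \<open>E\<close> is the proportion of the unit ball that is taken up by the
  cone over \<open>E\<close>, i.e. the image of the uniform distribution on the ball under \<open>x \<mapsto> x / |x|\<close>.\<close>

definition sphere_measure :: "'a::euclidean_space measure" where
  "sphere_measure =
     restrict_space (distr (uniform_measure lborel (ball 0 1)) borel sgn) (sphere 0 1)"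

definition geod_dist :: "'a::euclidean_space \<Rightarrow> 'a \<Rightarrow> real" where
  "geod_dist x y = arccos (x \<bullet> y)"

definition cap :: "'a::euclidean_space \<Rightarrow> real \<Rightarrow> 'a set" where
  "cap x r = {y \<in> sphere 0 1. geod_dist x y \<le> r}"

section \<open>Quasi-norms with values in the extended nonnegative reals\<close>

text \<open>Powers \<open>x\<^sup>a\<close> with a real exponent \<open>a > 0\<close>.\<close>

definition epow :: "ennreal \<Rightarrow> real \<Rightarrow> ennreal" where
  "epow x a = (if x = \<infinity> then \<infinity> else ennreal (enn2real x powr a))"

definition Lp_norm :: "ennreal \<Rightarrow> ('a::euclidean_space \<Rightarrow> ennreal) \<Rightarrow> ennreal" where
  "Lp_norm p g =
     (if p = \<infinity> then esssup sphere_measure g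
      else epow (\<integral>\<^sup>+x. epow (g x) (enn2real p) \<partial>sphere_measure) (1 / enn2real p))"

section \<open>Test functions and distributions\<close>

text \<open>\<open>iter_deriv bs f\<close> differentiates \<open>f\<close> successively in the directions listed in \<open>bs\<close>.\<close>

primrec iter_deriv ::
  "'a::euclidean_space list \<Rightarrow> ('a \<Rightarrow> 'b::real_normed_vector) \<Rightarrow> 'a \<Rightarrow> 'b" where
  "iter_deriv [] f = f"
| "iter_deriv (b # bs) f = (\<lambda>x. frechet_derivative (iter_deriv bs f) (at x) b)"

text \<open>\<open>C\<^sup>\<infinity>\<close> functions on an open set: all iterated partial derivatives exist and are differentiable.\<close>

definition smooth_fun_on :: "'a::euclidean_space set \<Rightarrow> ('a \<Rightarrow> 'b::real_normed_vector) \<Rightarrow> bool" where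
  "smooth_fun_on U f \<longleftrightarrow>
     (\<forall>bs. set bs \<subseteq> Basis \<longrightarrow> (\<forall>x\<in>U. iter_deriv bs f differentiable (at x)))"

text \<open>A function on the sphere is smooth iff its extension \<open>x \<mapsto> u (x / |x|)\<close> is smooth away from the
  origin; the derivatives of this extension also yield the seminorms of the Frechet topology of the
  space of test functions.\<close>

definition test_funs :: "('a::euclidean_space \<Rightarrow> 'b::real_normed_vector) set" where
  "test_funs = {u. smooth_fun_on (- {0}) (u \<circ> sgn)}"

definition test_seminorm :: "nat \<Rightarrow> ('a::euclidean_space \<Rightarrow> 'b::real_normed_vector) \<Rightarrow> real" where
  "test_seminorm N u =
     (\<Sum>bs | set bs \<subseteq> Basis \<and> length bs \<le> N.
        (SUP x\<in>sphere 0 1. norm (iter_deriv bs (u \<circ> sgn) x)))"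

text \<open>A distribution is a continuous linear functional on the test functions. Continuity forces
  \<open>f u\<close> to depend only on the values of \<open>u\<close> on the sphere. What \<open>f\<close> does to functions that are
  not test functions is irrelevant.\<close>

type_synonym ('a, 'b) functional = "('a \<Rightarrow> 'b) \<Rightarrow> 'b"

definition distributions ::
  "('a::euclidean_space, 'b::{real_normed_field,euclidean_space}) functional set" where
  "distributions = {f.
     (\<forall>u\<in>test_funs. \<forall>v\<in>test_funs. f (\<lambda>x. u x + v x) = f u + f v) \<and>
     (\<forall>c. \<forall>u\<in>test_funs. f (\<lambda>x. c * u x) = c * f u) \<and>
     (\<exists>N C. \<forall>u\<in>test_funs. norm (f u) \<le> C * test_seminorm N u)}"

definition distr_of ::
  "('a::euclidean_space \<Rightarrow> 'b) \<Rightarrow> ('a, 'b::{real_normed_field,euclidean_space}) functional" where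
  "distr_of g = (\<lambda>u. \<integral>x. g x * u x \<partial>sphere_measure)"

definition distr_eq ::
  "('a::euclidean_space, 'b::{real_normed_field,euclidean_space}) functional
     \<Rightarrow> ('a, 'b) functional \<Rightarrow> bool" where
  "distr_eq f g \<longleftrightarrow> (\<forall>u\<in>test_funs. f u = g u)"

section \<open>Hardy spaces\<close>

text \<open>The normalizing constant of the Poisson kernel is \<open>1\<close>, because the kernel is identically \<open>1\<close> for
  \<open>z = 0\<close> and \<open>sphere_measure\<close> has total mass \<open>1\<close>.\<close>

definition poisson :: "'a::euclidean_space \<Rightarrow> 'a \<Rightarrow> real" where
  "poisson z x = (1 - norm z ^ 2) / norm (z - x) ^ DIM('a)"

definition radial_max ::
  "('a::euclidean_space, 'b::{real_normed_field,euclidean_space}) functional \<Rightarrow> 'a \<Rightarrow> ennreal" where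
  "radial_max f x = (SUP r\<in>{0..<1}. ennreal (norm (f (\<lambda>y. of_real (poisson (r *\<^sub>R x) y)))))"

text \<open>For \<open>p = \<infinity>\<close> this is the sup norm of the (unique) continuous function representing \<open>f\<close>, and
  \<open>\<infinity>\<close> if there is no such function.\<close>

definition Hardy_norm ::
  "ennreal \<Rightarrow> ('a::euclidean_space, 'b::{real_normed_field,euclidean_space}) functional \<Rightarrow> ennreal" where
  "Hardy_norm p f =
     (if p = \<infinity>
      then (INF g\<in>{g. continuous_on (sphere 0 1) g \<and> distr_eq f (distr_of g)}.
              SUP x\<in>sphere 0 1. ennreal (norm (g x)))
      else Lp_norm p (radial_max f))"

definition Hardy_space ::
  "ennreal \<Rightarrow> ('a::euclidean_space, 'b::{real_normed_field,euclidean_space}) functional set" where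
  "Hardy_space p = {f \<in> distributions. Hardy_norm p f < \<infinity>}"

section \<open>Polynomials and Besov quasi-norms\<close>

definition multi_indices :: "nat \<Rightarrow> ('a::euclidean_space \<Rightarrow> nat) set" where
  "multi_indices n = {m. (\<forall>b. b \<notin> Basis \<longrightarrow> m b = 0) \<and> (\<Sum>b\<in>Basis. m b) \<le> n}"

lemma finite_multi_indices: "finite (multi_indices n :: ('a::euclidean_space \<Rightarrow> nat) set)"
proof (rule finite_subset)
  show "multi_indices n \<subseteq> {m. \<forall>b::'a. (b \<in> Basis \<longrightarrow> m b \<in> {..n}) \<and> (b \<notin> Basis \<longrightarrow> m b = 0)}"
  proof
    fix m :: "'a \<Rightarrow> nat" assume m: "m \<in> multi_indices n"
    have "m b \<le> n" if "b \<in> Basis" for b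
      using m member_le_sum[OF that, of m] by (auto simp: multi_indices_def)
    with m show "m \<in> {m. \<forall>b::'a. (b \<in> Basis \<longrightarrow> m b \<in> {..n}) \<and> (b \<notin> Basis \<longrightarrow> m b = 0)}"
      by (auto simp: multi_indices_def)
  qed
qed (intro finite_set_of_finite_funs finite_Basis finite_atMost)

definition sphere_polys :: "nat \<Rightarrow> ('a::euclidean_space \<Rightarrow> 'b::real_normed_field) set" where
  "sphere_polys n = {g. \<exists>c. \<forall>x\<in>sphere 0 1.
     g x = (\<Sum>m\<in>multi_indices n. c m * of_real (\<Prod>b\<in>Basis. (x \<bullet> b) ^ m b))}"

definition best_approx ::
  "nat \<Rightarrow> ennreal \<Rightarrow> ('a::euclidean_space, 'b::{real_normed_field,euclidean_space}) functional
     \<Rightarrow> ennreal" where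
  "best_approx n q f = (INF g\<in>sphere_polys n. Hardy_norm q (\<lambda>u. f u - distr_of g u))"

definition Besov_norm ::
  "real \<Rightarrow> ennreal \<Rightarrow> ennreal
     \<Rightarrow> ('a::euclidean_space, 'b::{real_normed_field,euclidean_space}) functional \<Rightarrow> ennreal" where
  "Besov_norm \<alpha> \<tau> q f =
     (if \<tau> = \<infinity> then (SUP k. ennreal ((real k + 1) powr \<alpha>) * best_approx k q f)
      else epow (\<Sum>k. ennreal ((real k + 1) powr (\<alpha> * enn2real \<tau> - 1)) *
                     epow (best_approx k q f) (enn2real \<tau>)) (1 / enn2real \<tau>))
     + ennreal (norm (f (\<lambda>_. 1)))"

section \<open>Points and weights\<close>

text \<open>Real powers with the convention \<open>0\<^sup>0 = 1\<close>, whereas \<open>0 powr 0 = 0\<close>.\<close>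

definition rpow :: "real \<Rightarrow> real \<Rightarrow> real" where
  "rpow x t = (if t = 0 then 1 else x powr t)"

definition equiv_consts :: "(ennreal \<Rightarrow> real) \<Rightarrow> (ennreal \<Rightarrow> real) \<Rightarrow> bool" where
  "equiv_consts c1 c2 \<longleftrightarrow>
     (\<forall>p>0. 0 < c1 p \<and> 0 < c2 p) \<and>
     (\<exists>p0. 0 < p0 \<and> p0 < \<infinity> \<and> (\<forall>p\<ge>p0. c1 p = c1 \<infinity> \<and> c2 p = c2 \<infinity>))"

definition disc_norm ::
  "nat \<Rightarrow> nat set \<Rightarrow> (nat \<Rightarrow> 'a::euclidean_space) \<Rightarrow> (nat \<Rightarrow> real) \<Rightarrow> ennreal \<Rightarrow> real
     \<Rightarrow> ('a \<Rightarrow> real) \<Rightarrow> real" where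
  "disc_norm j I y w p t f =
     (if p = \<infinity>
      then (MAX k\<in>I. rpow (2 ^ (j * (DIM('a) - 1)) * w k) t * \<bar>f (y k)\<bar>)
      else (1 / 2 ^ (j * (DIM('a) - 1)) *
             (\<Sum>k\<in>I. rpow (2 ^ (j * (DIM('a) - 1)) * w k) t * \<bar>f (y k)\<bar> powr enn2real p))
           powr (1 / enn2real p))"

text \<open>\<open>I j\<close> is the index set \<open>\<Lambda>\<^sub>j\<close>, \<open>y j k\<close> are the points and \<open>w j k\<close> the weights. Cubature and
  norm equivalence are only required for real polynomials: the former then also holds for
  complex ones, and so does the latter, with other constants.\<close>

definition point_system ::
  "real \<Rightarrow> real \<Rightarrow> (ennreal \<Rightarrow> real) \<Rightarrow> (ennreal \<Rightarrow> real)
     \<Rightarrow> (nat \<Rightarrow> nat set) \<Rightarrow> (nat \<Rightarrow> nat \<Rightarrow> 'a::euclidean_space) \<Rightarrow> (nat \<Rightarrow> nat \<Rightarrow> real) \<Rightarrow> bool" where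
  "point_system \<gamma> C0 c1 c2 I y w \<longleftrightarrow>
     I 0 = {0} \<and> w 0 0 = 1 \<and> y 0 0 \<in> sphere 0 1 \<and>
     (\<forall>j>0.
        finite (I j) \<and> inj_on (y j) (I j) \<and> y j ` I j \<subseteq> sphere 0 1 \<and>
        (\<forall>k\<in>I j. \<forall>l\<in>I j. k \<noteq> l \<longrightarrow> geod_dist (y j k) (y j l) \<ge> \<gamma> / 2 ^ (j + 4)) \<and>
        (\<forall>x\<in>sphere 0 1. \<exists>k\<in>I j. geod_dist x (y j k) < \<gamma> / 2 ^ (j + 4)) \<and>
        (\<forall>k\<in>I j. 0 \<le> w j k \<and> w j k \<le> C0 / 2 ^ (j * (DIM('a) - 1))) \<and>
        (\<forall>f\<in>sphere_polys (2 ^ (j + 4)).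
           (\<integral>x. f x \<partial>sphere_measure) = (\<Sum>k\<in>I j. w j k * f (y j k)) \<and>
           (\<forall>p>0. \<forall>t\<ge>0. ennreal t \<le> min p 1 \<longrightarrow>
              ennreal (c1 p) * Lp_norm p (\<lambda>x. ennreal \<bar>f x\<bar>)
                \<le> ennreal (disc_norm j (I j) (y j) (w j) p t f) \<and>
              ennreal (disc_norm j (I j) (y j) (w j) p t f)
                \<le> ennreal (c2 p) * Lp_norm p (\<lambda>x. ennreal \<bar>f x\<bar>))))"

section \<open>The frame\<close>

fun gegenbauer :: "real \<Rightarrow> nat \<Rightarrow> real \<Rightarrow> real" where
  "gegenbauer l 0 t = 1"
| "gegenbauer l (Suc 0) t = 2 * l * t"
| "gegenbauer l (Suc (Suc n)) t =
     (2 * (real n + 1 + l) * t * gegenbauer l (Suc n) t - (real n + 2 * l) * gegenbauer l n t)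
       / (real n + 2)"

lemma gegenbauer_1: "gegenbauer l k 1 = pochhammer (2 * l) k / fact k"
proof (induction l k "1::real" rule: gegenbauer.induct)
  case (3 l n)
  define q where "q = gegenbauer l n 1"
  have poch: "pochhammer (2 * l) n = q * fact n"
    using 3 by (simp add: q_def)
  have Suc: "gegenbauer l (Suc n) 1 = q * (2 * l + real n) / (real n + 1)"
    using 3 by (simp add: pochhammer_Suc poch add.commute)
  have "gegenbauer l (Suc (Suc n)) 1 =
      q * (2 * l + real n) * (2 * l + (real n + 1)) / ((real n + 1) * (real n + 2))"
    unfolding gegenbauer.simps Suc q_def[symmetric]
    by (simp add: divide_simps) (simp add: algebra_simps)
  also have "\<dots> = pochhammer (2 * l) (Suc (Suc n)) / fact (Suc (Suc n))"
    unfolding pochhammer_Suc poch fact_Suc by (simp add: divide_simps) (simp add: algebra_simps)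
  finally show ?case .
qed auto

definition zonal :: "nat \<Rightarrow> nat \<Rightarrow> real \<Rightarrow> real" where
  "zonal d k t = (2 * real k + real d - 2) / (real d - 2) * gegenbauer ((real d - 2) / 2) k t"

definition cutoff :: "(real \<Rightarrow> real) \<Rightarrow> bool" where
  "cutoff \<phi> \<longleftrightarrow>
     (\<forall>x. 0 \<le> \<phi> x) \<and> smooth_fun_on UNIV \<phi> \<and>
     (\<forall>x. \<phi> x \<noteq> 0 \<longrightarrow> 1 / 2 \<le> \<bar>x\<bar> \<and> \<bar>x\<bar> \<le> 2) \<and>
     (\<forall>x. x \<noteq> 0 \<longrightarrow> ((\<lambda>j::int. (\<phi> (2 powi (- j) * x))\<^sup>2) has_sum 1) UNIV)"

text \<open>The lower summation limit is the integer part of \<open>2\<^sup>j\<^sup>-\<^sup>2\<close>.\<close>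

definition frame_kernel :: "nat \<Rightarrow> (real \<Rightarrow> real) \<Rightarrow> nat \<Rightarrow> real \<Rightarrow> real" where
  "frame_kernel d \<phi> j t =
     (if j = 0 then 1
      else (\<Sum>k = 2 ^ j div 4..2 ^ j. \<phi> (real k / 2 ^ (j - 1)) * zonal d k t))"

text \<open>The cap with centre \<open>y j k\<close> and radius \<open>\<pi> / 2\<^sup>j\<close> is represented by its index \<open>(j, k)\<close>. Different
  indices give different caps, since the points on each level are distinct and radii on different
  levels differ and are at most \<open>\<pi>\<close>.\<close>

definition cap_indices :: "(nat \<Rightarrow> nat set) \<Rightarrow> (nat \<times> nat) set" where
  "cap_indices I = (SIGMA j:UNIV. I j)"

definition cap_of :: "(nat \<Rightarrow> nat \<Rightarrow> 'a::euclidean_space) \<Rightarrow> nat \<times> nat \<Rightarrow> 'a set" where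
  "cap_of y = (\<lambda>(j, k). cap (y j k) (pi / 2 ^ j))"

definition frame_elem ::
  "(real \<Rightarrow> real) \<Rightarrow> (nat \<Rightarrow> nat \<Rightarrow> 'a::euclidean_space) \<Rightarrow> (nat \<Rightarrow> nat \<Rightarrow> real) \<Rightarrow> nat \<times> nat
     \<Rightarrow> 'a \<Rightarrow> 'b::real_normed_field" where
  "frame_elem \<phi> y w =
     (\<lambda>(j, k) x. of_real (sqrt (w j k) * frame_kernel DIM('a) \<phi> j (x \<bullet> y j k)))"

section \<open>The greedy algorithm\<close>

definition greedy_weight ::
  "ennreal \<Rightarrow> (real \<Rightarrow> real) \<Rightarrow> (nat \<Rightarrow> nat \<Rightarrow> 'a) \<Rightarrow> (nat \<Rightarrow> nat \<Rightarrow> real)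
     \<Rightarrow> ('a::euclidean_space, 'b::{real_normed_field,euclidean_space}) functional
     \<Rightarrow> nat \<times> nat \<Rightarrow> real" where
  "greedy_weight p \<phi> y w f B =
     norm (f (frame_elem \<phi> y w B)) *
     measure sphere_measure (cap_of y B) powr (enn2real (inverse p) - 1 / 2)"

definition greedy_set ::
  "ennreal \<Rightarrow> (real \<Rightarrow> real) \<Rightarrow> (nat \<Rightarrow> nat set) \<Rightarrow> (nat \<Rightarrow> nat \<Rightarrow> 'a) \<Rightarrow> (nat \<Rightarrow> nat \<Rightarrow> real)
     \<Rightarrow> ('a::euclidean_space, 'b::{real_normed_field,euclidean_space}) functional
     \<Rightarrow> nat \<Rightarrow> (nat \<times> nat) set \<Rightarrow> bool" where
  "greedy_set p \<phi> I y w f n G \<longleftrightarrow>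
     G \<subseteq> cap_indices I \<and> finite G \<and> card G = n \<and>
     (\<forall>B\<in>G. \<forall>B'\<in>cap_indices I - G. greedy_weight p \<phi> y w f B' \<le> greedy_weight p \<phi> y w f B)"

definition greedy_approx ::
  "(real \<Rightarrow> real) \<Rightarrow> (nat \<Rightarrow> nat \<Rightarrow> 'a) \<Rightarrow> (nat \<Rightarrow> nat \<Rightarrow> real)
     \<Rightarrow> ('a::euclidean_space, 'b::{real_normed_field,euclidean_space}) functional
     \<Rightarrow> (nat \<times> nat) set \<Rightarrow> 'a \<Rightarrow> 'b" where
  "greedy_approx \<phi> y w f G x = (\<Sum>B\<in>G. f (frame_elem \<phi> y w B) * frame_elem \<phi> y w B x)"

end

theory Submission
 imports Defs "HOL-Computational_Algebra.Formal_Power_Series" "HOL-Probability.Probability_Measure"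
begin

text \<open>
 Both inequalities bound the Besov quasi-norm of a finite frame sum \<open>\<Sum>B\<in>S. a B * \<psi> B\<close>. For the first one the
 coefficients are those of \<open>f\<close>. Write \<open>|B|\<close> for the measure of a cap, \<open>c B = |a B| |B| powr (- 1 / 2)\<close> for the
 normalized coefficients, \<open>j B\<close> for the level, and \<open>s x\<close> for the maximum of \<open>c B\<close> over the caps \<open>B\<close> that
 contain \<open>x\<close>.

 \<^bold>\<open>The Besov norm of a frame sum is at most \<open>C * n powr (\<alpha> / (d - 1))\<close> times the \<open>p\<close>-norm of \<open>s\<close>\<close>
 (\<open>Besov_norm_frame_sum_le\<close>). A frame element of level \<open>j\<close> is a polynomial of degree \<open>2 ^ j\<close>, so that only the
 levels with \<open>2 ^ j > k\<close> contribute to the error of approximation of degree \<open>k\<close>. Its radial maximal function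
 decays rapidly away from the centre of the cap on the scale \<open>1 / 2 ^ j\<close>, because the factors \<open>r ^ k\<close>
 introduced by the Poisson kernel do not spoil the smoothness of the coefficients \<open>\<phi> (k / N)\<close>
 (\<open>poisson_kernel_decay\<close>). For such kernels the power \<open>\<tau>\<close> of a sum is at most the sum of the powers, up to a
 factor that grows slowly with the level (\<open>powr_sum_caps_le\<close>). Integration over the sphere and summation over \<open>k\<close>
 leave the sum of \<open>(c B) powr \<tau> * 2 powr (\<alpha> * \<tau> * j B) * |B|\<close>. The weights \<open>1 / |B|\<close> of the caps that contain a
 given point grow geometrically with the level, hence that sum is at most the integral of \<open>s powr \<tau>\<close> times the power
 \<open>\<delta> = \<alpha> * \<tau> / (d - 1)\<close> of the total weight \<open>\<Sum>B. \<chi> B / |B|\<close>. The total weight has integral at most \<open>C * n\<close>, and Hoelder's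
 inequality finishes this part, since \<open>\<tau> / p + \<delta> = 1\<close> (\<open>sum_caps_le_Lp_norm\<close>).

 \<^bold>\<open>If the coefficients are those of \<open>f\<close>, then the \<open>p\<close>-norm of \<open>s\<close> is at most \<open>C\<close> times the Hardy norm\<close>, for
 every finite family of caps (\<open>cap_sup_le_Hardy_norm\<close>). For \<open>p < \<infinity>\<close> let \<open>u\<close> be the harmonic extension of \<open>f\<close> to
 the unit ball. A coefficient of level \<open>j\<close> is an integral of \<open>u\<close> over the sphere of radius \<open>exp (- 1 / N)\<close>,
 \<open>N = 2 ^ (j - 1)\<close>, against a kernel that is as well localized as the frame element. For \<open>q = p / 2\<close> the function
 \<open>|u| powr q\<close> is at most a multiple of its averages over balls, by an argument of Fefferman and Stein
 (\<open>power_sub_mean_value_small\<close>). Hence \<open>|u| powr q\<close> at distance about \<open>1 / N\<close> from the sphere is at most an average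
 of the power \<open>q\<close> of the radial maximal function over a cap of radius about \<open>1 / N\<close>. So \<open>s powr q\<close> is at most a multiple
 of a Hardy-Littlewood maximal function (\<open>frame_kernel_le_maxfun\<close>), and the maximal inequality for square integrable
 functions applies. For \<open>p = \<infinity>\<close>, \<open>f\<close> is a continuous function and the frame kernels have bounded integrals.

 \<^bold>\<open>Harmonic analysis on the sphere\<close> is derived from the zonal polynomials alone. Integrals over the sphere are
 integrals over the ball of functions of the direction. The zonal polynomials extend to homogeneous harmonic
 polynomials on the ball, for which the divergence theorem gives orthogonality and the mean value property; the
 Poisson kernel is their generating function and an approximate identity, which gives the reproducing property. The
 decay of zonal kernels comes from summation by parts: multiplication by \<open>1 - x \<bullet> y = |x - y|\<^sup>2 / 2\<close> acts on the
 coefficients like a second difference. A distribution is expanded into homogeneous harmonic components of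
 polynomial growth; it commutes with geometrically convergent zonal series, as it is controlled by finitely many
 derivatives, and with integrals of polynomial kernels, as these are finite sums of products.
\<close>

notation sphere_measure ("\<sigma>")

section \<open>Solid Gegenbauer polynomials\<close>

text \<open>The polynomial \<open>w \<mapsto> solid l n (x \<bullet> w) (w \<bullet> w)\<close> is the homogeneous extension of degree \<open>n\<close> of a Gegenbauer
 polynomial from the sphere to the whole space.\<close>

fun solid :: "real => nat => real => real => real" where
 "solid l 0 s q = 1"
| "solid l (Suc 0) s q = 2 * l * s"
| "solid l (Suc (Suc n)) s q =
   (2 * (real n + 1 + l) * s * solid l (Suc n) s q - (real n + 2 * l) * q * solid l n s q)
    / (real n + 2)"

lemma solid_1: "solid l n t 1 = gegenbauer l n t"
 by (induction l n t rule: gegenbauer.induct) auto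

lemma solid_scale: "solid l n (c * s) (c\<^sup>2 * q) = c ^ n * solid l n s q"
 by (induction l n s q rule: solid.induct) (auto simp: algebra_simps power2_eq_square diff_divide_distrib add_divide_distrib)

lemma solid_rec:
 "(real n + 2) * solid l (Suc (Suc n)) s q =
  2 * (real n + 1 + l) * s * solid l (Suc n) s q - (real n + 2 * l) * q * solid l n s q"
 by simp

text \<open>Comparison of coefficients in \<open>Q powr (- l) = Q * Q powr (- (l + 1))\<close>, where \<open>Q = 1 - 2 * s * z + q * z\<^sup>2\<close> and the
 generating function of \<open>solid l\<close> is \<open>Q powr (- l)\<close>.\<close>

lemma solid_contiguous:
 "solid l (Suc (Suc n)) s q = solid (l + 1) (Suc (Suc n)) s q - 2 * s * solid (l + 1) (Suc n) s q
   + q * solid (l + 1) n s q"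
proof -
 have "(\<forall>m\<in>{n, Suc n}. solid l (Suc (Suc m)) s q =
   solid (l + 1) (Suc (Suc m)) s q - 2 * s * solid (l + 1) (Suc m) s q + q * solid (l + 1) m s q)"
 proof (induction n)
  case 0
  show ?case by (simp add: field_simps)
 next
  case (Suc n)
  define F where "F = (%n. solid l n s q)"
  define X where "X = (%n. solid (l + 1) n s q)"
  have IH: "F (Suc (Suc n)) = X (Suc (Suc n)) - 2 * s * X (Suc n) + q * X n"
   "F (Suc (Suc (Suc n))) = X (Suc (Suc (Suc n))) - 2 * s * X (Suc (Suc n)) + q * X (Suc n)"
   using Suc by (auto simp: F_def X_def simp del: solid.simps)
  have RF: "(real n + 4) * F (Suc (Suc (Suc (Suc n)))) =
    2 * (real n + 3 + l) * s * F (Suc (Suc (Suc n))) - (real n + 2 + 2 * l) * q * F (Suc (Suc n))"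
   using solid_rec[of "Suc (Suc n)" l s q] by (simp add: F_def algebra_simps del: solid.simps)
  have RX: "(real n + 2) * X (Suc (Suc n)) =
    2 * (real n + 2 + l) * s * X (Suc n) - (real n + 2 + 2 * l) * q * X n"
   using solid_rec[of n "l+1" s q] by (simp add: X_def algebra_simps del: solid.simps)
  have RX1: "(real n + 3) * X (Suc (Suc (Suc n))) =
    2 * (real n + 3 + l) * s * X (Suc (Suc n)) - (real n + 3 + 2 * l) * q * X (Suc n)"
   using solid_rec[of "Suc n" "l+1" s q] by (simp add: X_def algebra_simps del: solid.simps)
  have RX2: "(real n + 4) * X (Suc (Suc (Suc (Suc n)))) =
    2 * (real n + 4 + l) * s * X (Suc (Suc (Suc n))) - (real n + 4 + 2 * l) * q * X (Suc (Suc n))"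
   using solid_rec[of "Suc (Suc n)" "l+1" s q] by (simp add: X_def algebra_simps del: solid.simps)
  have "(real n + 4) * F (Suc (Suc (Suc (Suc n)))) = (real n + 4) *
    (X (Suc (Suc (Suc (Suc n)))) - 2 * s * X (Suc (Suc (Suc n))) + q * X (Suc (Suc n)))"
   using RF RX RX1 RX2 unfolding IH by algebra
  hence "F (Suc (Suc (Suc (Suc n)))) =
    (X (Suc (Suc (Suc (Suc n)))) - 2 * s * X (Suc (Suc (Suc n))) + q * X (Suc (Suc n)))"
   by (simp del: solid.simps)
  thus ?case using Suc by (auto simp: F_def X_def simp del: solid.simps)
 qed
 thus ?thesis by blast
qed

text \<open>Integer indices, with the value \<open>0\<close> at the negative ones, make the contiguity and derivative
 relations free of case distinctions.\<close>

definition sol :: "real => int => real => real => real" where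
 "sol l n s q = (if n < 0 then 0 else solid l (nat n) s q)"

lemma sol_rec:
 "(of_int n + 2) * sol l (n + 2) s q =
  2 * (of_int n + 1 + l) * s * sol l (n + 1) s q - (of_int n + 2 * l) * q * sol l n s q"
proof -
 consider "n < - 2" | "n = -2" | "n = -1" | "n >= 0" by linarith
 thus ?thesis
 proof cases
  case 4
  hence "nat (n + 2) = Suc (Suc (nat n))" "nat (n + 1) = Suc (nat n)" by auto
  thus ?thesis using solid_rec[of "nat n" l s q] 4 by (simp add: sol_def del: solid.simps)
 qed (auto simp: sol_def)
qed

lemma sol_contiguous: "sol l n s q = sol (l + 1) n s q - 2 * s * sol (l + 1) (n - 1) s q + q * sol (l + 1) (n - 2) s q"
proof -
 consider "n < 0" | "n = 0" | "n = 1" | "n >= 2" by linarith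
 thus ?thesis
 proof cases
  case 4
  hence "nat n = Suc (Suc (nat (n - 2)))" "nat (n - 1) = Suc (nat (n - 2))" by auto
  thus ?thesis using 4 solid_contiguous[of l "nat (n - 2)" s q] by (simp add: sol_def del: solid.simps)
 qed (auto simp: sol_def algebra_simps)
qed

text \<open>The derivatives of the generating function \<open>Q powr (- l)\<close> in \<open>s\<close> and in \<open>q\<close> are \<open>2 * l * z\<close> and \<open>- l * z\<^sup>2\<close> times
 \<open>Q powr (- (l + 1))\<close>. The proof is an induction along the recursion, by means of the contiguity relation.\<close>

lemma has_derivative_sol:
 assumes f: "(f has_derivative f') (at w)" and g: "(g has_derivative g') (at w)"
 shows "((%w. sol l n (f w) (g w)) has_derivative
   (%v. 2 * l * sol (l + 1) (n - 1) (f w) (g w) * f' v - l * sol (l + 1) (n - 2) (f w) (g w) * g' v)) (at w)"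
  (is "?D n")
proof -
 have "?D (int m)" for m
 proof (induction m rule: induct_nat_012)
  case 0
  show ?case by (simp add: sol_def)
 next
  case 1
  show ?case unfolding sol_def using f by (auto intro!: derivative_eq_intros)
 next
  case (ge2 m)
  define s where "s = f w"
  define q where "q = g w"
  define S where "S = (%n. sol l n s q)"
  define X where "X = (%n. sol (l + 1) n s q)"
  define n where "n = int m"
  have idx: "int (Suc (Suc m)) = n + 2" "int (Suc m) = n + 1" "int m = n" "real m = of_int n" by (simp_all add: n_def)
  have eq: "sol l (n + 2) (f w) (g w) = (2 * (of_int n + 1 + l) * (f w * sol l (n + 1) (f w) (g w))
    - (of_int n + 2 * l) * (g w * sol l n (f w) (g w))) / (of_int n + 2)" for w
   using sol_rec[of n l "f w" "g w"] by (simp add: field_simps n_def)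
  have X: "(of_int k + 2) * X (k + 2) = 2 * (of_int k + 2 + l) * s * X (k + 1) - (of_int k + 2 * l + 2) * q * X k" for k
   using sol_rec[of k "l + 1" s q] by (simp add: X_def algebra_simps)
  have S: "S k = X k - 2 * s * X (k - 1) + q * X (k - 2)" for k
   unfolding S_def X_def by (rule sol_contiguous)
  have id1: "2 * (of_int n + 1 + l) * (S (n + 1) + s * (2 * l * X n)) - (of_int n + 2 * l) * q * (2 * l * X (n - 1))
    = (of_int n + 2) * (2 * l * X (n + 1))"
   unfolding S using X[of "n - 1"] by (simp add: add.commute[of n]) algebra
  have id2: "2 * (of_int n + 1 + l) * s * (- l * X (n - 1)) - (of_int n + 2 * l) * (S n + q * (- l * X (n - 2)))
    = (of_int n + 2) * (- l * X n)"
   unfolding S using X[of "n - 2"] by simp algebra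
  have pos: "of_int n + 2 > (0::real)" by (simp add: n_def)
  have IH: "((%w. sol l n (f w) (g w)) has_derivative (%v. 2 * l * X (n - 1) * f' v - l * X (n - 2) * g' v)) (at w)"
   "((%w. sol l (n + 1) (f w) (g w)) has_derivative (%v. 2 * l * X n * f' v - l * X (n - 1) * g' v)) (at w)"
   using ge2 unfolding idx by (simp_all add: X_def s_def q_def)
  have "((%w. sol l (n + 2) (f w) (g w)) has_derivative
    (%v. (2 * (of_int n + 1 + l) * (s * (2 * l * X n * f' v - l * X (n - 1) * g' v) + f' v * S (n + 1))
    - (of_int n + 2 * l) * (q * (2 * l * X (n - 1) * f' v - l * X (n - 2) * g' v) + g' v * S n)) / (of_int n + 2))) (at w)"
   unfolding eq s_def q_def S_def using pos
   by (auto intro!: derivative_eq_intros IH[unfolded s_def q_def] f g simp: s_def q_def S_def)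
  moreover have "(2 * (of_int n + 1 + l) * (s * (2 * l * X n * f' v - l * X (n - 1) * g' v) + f' v * S (n + 1))
    - (of_int n + 2 * l) * (q * (2 * l * X (n - 1) * f' v - l * X (n - 2) * g' v) + g' v * S n)) / (of_int n + 2)
    = 2 * l * X (n + 1) * f' v - l * X n * g' v" for v
  proof -
   have "(2 * (of_int n + 1 + l) * (s * (2 * l * X n * f' v - l * X (n - 1) * g' v) + f' v * S (n + 1))
    - (of_int n + 2 * l) * (q * (2 * l * X (n - 1) * f' v - l * X (n - 2) * g' v) + g' v * S n))
     = (of_int n + 2) * (2 * l * X (n + 1) * f' v - l * X n * g' v)"
    using id1 id2 by algebra
   with pos show ?thesis by simp
  qed
  ultimately show ?case unfolding idx X_def s_def q_def by (simp add: add.commute[of n 1])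
 qed
 from this[of "nat n"] show ?thesis
  by (cases "n < 0") (simp_all add: sol_def)
qed

lemma fps_gegenbauer_factor:
 fixes z :: complex and l :: real
 defines "A \<equiv> Abs_fps (%n. of_real (pochhammer l n / fact n) * z ^ n)"
 shows "(1 - fps_const z * fps_X) * fps_deriv A = fps_const (of_real l * z) * A"
proof (rule fps_ext)
 fix n
 define p where "p = (%n. complex_of_real (pochhammer l n / fact n))"
 have Anth: "fps_nth A n = p n * z ^ n" for n by (simp add: A_def p_def)
 have *: "p (Suc n) * of_nat (Suc n) = (of_real l + of_nat n) * p n" for n
 proof -
  have "pochhammer l (Suc n) / fact (Suc n) * real (Suc n) = (l + real n) * (pochhammer l n / fact n)"
   by (simp add: pochhammer_Suc field_simps del: of_nat_Suc)
  hence "complex_of_real (pochhammer l (Suc n) / fact (Suc n) * real (Suc n))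
    = complex_of_real ((l + real n) * (pochhammer l n / fact n))" by simp
  thus ?thesis by (simp only: p_def of_real_mult of_real_add of_real_of_nat_eq)
 qed
 have "fps_nth ((1 - fps_const z * fps_X) * fps_deriv A) n =
   of_nat (Suc n) * fps_nth A (Suc n) - z * (if n = 0 then 0 else of_nat n * fps_nth A n)"
  by (cases n) (simp_all add: algebra_simps fps_X_mult_nth mult.assoc del: of_nat_Suc)
 also have "... = of_nat (Suc n) * fps_nth A (Suc n) - z * of_nat n * fps_nth A n" by simp
 also have "... = of_real l * z * fps_nth A n"
  using arg_cong[OF *[of n], of "%x. x * z ^ Suc n"]
  unfolding Anth by (simp add: algebra_simps del: of_nat_Suc)
 finally show "fps_nth ((1 - fps_const z * fps_X) * fps_deriv A) n = fps_nth (fps_const (of_real l * z) * A) n"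
  by (simp add: mult.assoc)
qed

text \<open>For \<open>t = cos \<theta>\<close> and \<open>z = exp (\<i> * \<theta>)\<close> the generating function \<open>(1 - 2 * t * X + X\<^sup>2) powr (- l)\<close> is the product
 of \<open>(1 - z * X) powr (- l)\<close> and \<open>(1 - w * X) powr (- l)\<close>.\<close>

lemma gegenbauer_complex_expansion:
 fixes z w :: complex
 assumes "z * w = 1" "z + w = 2 * of_real t"
 shows "of_real (gegenbauer l n t) =
  (\<Sum>i\<le>n. of_real (pochhammer l i / fact i * (pochhammer l (n - i) / fact (n - i))) * (z ^ i * w ^ (n - i)))"
proof -
 define A where "A = (%z::complex. Abs_fps (%n. of_real (pochhammer l n / fact n) * z ^ n))"
 define F where "F = A z * A w"
 have A: "(1 - fps_const z * fps_X) * fps_deriv (A z) = fps_const (of_real l * z) * A z" for z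
  unfolding A_def by (rule fps_gegenbauer_factor)
 have "(1 - fps_const z * fps_X) * (1 - fps_const w * fps_X) * fps_deriv F
   = (1 - fps_const w * fps_X) * ((1 - fps_const z * fps_X) * fps_deriv (A z)) * A w
   + (1 - fps_const z * fps_X) * ((1 - fps_const w * fps_X) * fps_deriv (A w)) * A z"
  unfolding F_def fps_deriv_mult by algebra
 also have "... = (fps_const (of_real l * z) * (1 - fps_const w * fps_X) +
    fps_const (of_real l * w) * (1 - fps_const z * fps_X)) * F"
  unfolding A by (simp add: F_def algebra_simps flip: fps_const_add)
 also have "fps_const (of_real l * z) * (1 - fps_const w * fps_X) +
    fps_const (of_real l * w) * (1 - fps_const z * fps_X) =
   fps_const (of_real l * (z + w)) - fps_const (2 * of_real l * (z * w)) * fps_X"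
  by (simp add: algebra_simps flip: fps_const_add fps_const_mult)
 also have "(1 - fps_const z * fps_X) * (1 - fps_const w * fps_X) =
   1 - fps_const (z + w) * fps_X + fps_const (z * w) * (fps_X * fps_X)"
  by (simp add: algebra_simps flip: fps_const_add fps_const_mult)
 finally have ode: "fps_deriv F - fps_X * (fps_const (2 * of_real t) * fps_deriv F) + fps_X * (fps_X * fps_deriv F) =
   fps_const (2 * of_real l * of_real t) * F - fps_X * (fps_const (2 * of_real l) * F)"
  unfolding assms by (simp add: algebra_simps)
 have rec: "of_nat (Suc (Suc n)) * fps_nth F (Suc (Suc n)) =
   2 * of_real t * (of_nat (Suc n) + of_real l) * fps_nth F (Suc n) - (of_nat n + 2 * of_real l) * fps_nth F n" for n
  using arg_cong[OF ode, of "%G. fps_nth G (Suc n)"] unfolding fps_add_nth fps_sub_nth fps_X_mult_nth fps_mult_left_const_nth fps_deriv_nth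
  by (cases n) (simp_all add: algebra_simps)
 have "fps_nth F n = of_real (gegenbauer l n t)"
 proof (induction n rule: induct_nat_012)
  case 0 show ?case by (simp add: F_def A_def)
 next
  case 1
  show ?case using arg_cong[OF ode, of "%G. fps_nth G 0"] by (simp add: F_def A_def)
 next
  case (ge2 n)
  have "complex_of_real ((real n + 2) * gegenbauer l (Suc (Suc n)) t) =
   of_real (2 * (real n + 1 + l) * t * gegenbauer l (Suc n) t - (real n + 2 * l) * gegenbauer l n t)"
   by simp
  also have "... = of_nat (Suc (Suc n)) * fps_nth F (Suc (Suc n))"
   unfolding rec ge2 by (simp add: algebra_simps)
  finally have "of_nat (Suc (Suc n)) * complex_of_real (gegenbauer l (Suc (Suc n)) t) = of_nat (Suc (Suc n)) * fps_nth F (Suc (Suc n))"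
   by (simp add: algebra_simps del: gegenbauer.simps)
  thus ?case by (simp only: mult_left_cancel[OF of_nat_neq_0])
 qed
 thus ?thesis
  unfolding F_def fps_mult_nth atLeast0AtMost A_def fps_nth_Abs_fps by (simp add: algebra_simps)
qed

text \<open>The coefficients of the complex expansion are nonnegative, and it becomes the value at \<open>1\<close> when the two
 unimodular numbers are replaced by \<open>1\<close>.\<close>

lemma abs_gegenbauer_le:
 assumes "l > 0" "\<bar>t\<bar> <= 1"
 shows "\<bar>gegenbauer l n t\<bar> <= gegenbauer l n 1"
proof -
 define u where "u = (%i. pochhammer l i / fact i * (pochhammer l (n - i) / fact (n - i)))"
 have u: "u i >= 0" for i
  using assms by (auto simp: u_def intro!: divide_nonneg_nonneg mult_nonneg_nonneg pochhammer_nonneg)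
 have "complex_of_real (gegenbauer l n t) =
   (\<Sum>i\<le>n. of_real (u i) * (cis (arccos t) ^ i * cis (- arccos t) ^ (n - i)))"
  unfolding u_def
  by (rule gegenbauer_complex_expansion) (use assms in \<open>auto simp: cis_mult complex_eq_iff\<close>)
 hence "\<bar>gegenbauer l n t\<bar> = cmod (\<Sum>i\<le>n. of_real (u i) * (cis (arccos t) ^ i * cis (- arccos t) ^ (n - i)))"
  by (metis norm_of_real real_norm_def)
 also have "... <= (\<Sum>i\<le>n. u i)"
  by (rule sum_norm_le) (auto simp: norm_mult norm_power u)
 also have "... = gegenbauer l n 1"
 proof -
  have "complex_of_real (gegenbauer l n 1) = (\<Sum>i\<le>n. of_real (u i) * (1 ^ i * 1 ^ (n - i)))"
   unfolding u_def by (rule gegenbauer_complex_expansion) auto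
  hence "complex_of_real (gegenbauer l n 1) = of_real (\<Sum>i\<le>n. u i)" by simp
  thus ?thesis by (simp only: of_real_eq_iff)
 qed
 finally show ?thesis .
qed

lemma gegenbauer_1_le:
 assumes "m >= 1"
 shows "gegenbauer (real m / 2) k 1 <= (real k + 1) ^ (m - 1)"
proof (induction k)
 case (Suc k)
 have "gegenbauer (real m / 2) (Suc k) 1 = gegenbauer (real m / 2) k 1 * ((real m + real k) / (real k + 1))"
  by (simp add: gegenbauer_1 pochhammer_Suc field_simps)
 also have "... <= (real k + 1) ^ (m - 1) * ((real m + real k) / (real k + 1))"
  by (intro mult_right_mono Suc) auto
 also have "(real m + real k) / (real k + 1) = 1 + real (m - 1) * (1 / (real k + 1))"
  using assms by (simp add: field_simps of_nat_diff)
 also have "... <= (1 + 1 / (real k + 1)) ^ (m - 1)"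
  by (rule Bernoulli_inequality) (auto simp: field_simps)
 also have "(real k + 1) ^ (m - 1) * (1 + 1 / (real k + 1)) ^ (m - 1) = (real (Suc k) + 1) ^ (m - 1)"
  by (simp add: power_mult_distrib[symmetric] field_simps)
 finally show ?case by (simp add: mult_left_mono)
qed auto

lemma abs_gegenbauer_half_le:
 assumes "m >= 1" "\<bar>t\<bar> <= 1"
 shows "\<bar>gegenbauer (real m / 2) k t\<bar> <= (real k + 1) ^ (m - 1)"
 using abs_gegenbauer_le[of "real m / 2" t k] gegenbauer_1_le[of m k] assms by auto

definition sol_grad :: "real => int => 'a::euclidean_space => 'a => 'a" where
 "sol_grad l n x w = (2 * l * sol (l + 1) (n - 1) (x \<bullet> w) (w \<bullet> w)) *\<^sub>R x
   - (2 * l * sol (l + 1) (n - 2) (x \<bullet> w) (w \<bullet> w)) *\<^sub>R w"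

lemma has_derivative_sol_inner:
 "((%w. sol l n (x \<bullet> w) (w \<bullet> w)) has_derivative (%v. v \<bullet> sol_grad l n x w)) (at w)"
proof -
 have "((%w. sol l n (x \<bullet> w) (w \<bullet> w)) has_derivative
   (%v. 2 * l * sol (l + 1) (n - 1) (x \<bullet> w) (w \<bullet> w) * (x \<bullet> v)
    - l * sol (l + 1) (n - 2) (x \<bullet> w) (w \<bullet> w) * (2 * (w \<bullet> v)))) (at w)"
  by (intro has_derivative_sol) (auto intro!: derivative_eq_intros simp: inner_commute)
 thus ?thesis
  by (simp add: sol_grad_def inner_diff_right inner_commute mult_ac)
qed

lemma continuous_sol [continuous_intros]:
 "continuous_on S f ==> continuous_on S g ==> continuous_on S (%w. sol l n (f w) (g w))"
proof -
 assume "continuous_on S f" "continuous_on S g"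
 moreover have "continuous_on S (%w. solid l m (f w) (g w))" if "continuous_on S f" "continuous_on S g" for m
  by (induction m rule: induct_nat_012) (auto intro!: continuous_intros that)
 ultimately show ?thesis by (cases "n < 0") (auto simp: sol_def)
qed

definition sol_hess :: "real => int => 'a::euclidean_space => 'a => 'a => 'a" where
 "sol_hess l n x w v = (2 * l * (v \<bullet> sol_grad (l + 1) (n - 1) x w)) *\<^sub>R x
   - ((2 * l * sol (l + 1) (n - 2) (x \<bullet> w) (w \<bullet> w)) *\<^sub>R v
   + (2 * l * (v \<bullet> sol_grad (l + 1) (n - 2) x w)) *\<^sub>R w)"

lemma has_derivative_sol_grad: "(sol_grad l n x has_derivative sol_hess l n x w) (at w)"
proof -
 have "sol_grad l n x = (%w. (2 * l * sol (l + 1) (n - 1) (x \<bullet> w) (w \<bullet> w)) *\<^sub>R x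
   - (2 * l * sol (l + 1) (n - 2) (x \<bullet> w) (w \<bullet> w)) *\<^sub>R w)"
  by (simp add: fun_eq_iff sol_grad_def)
 thus ?thesis
  unfolding sol_hess_def[abs_def] by (auto intro!: derivative_eq_intros has_derivative_sol_inner)
qed

lemma continuous_sol_grad [continuous_intros]:
 "continuous_on S f ==> continuous_on S (%w. sol_grad l n x (f w))"
 unfolding sol_grad_def by (intro continuous_intros)

lemma continuous_sol_hess [continuous_intros]:
 "continuous_on S f ==> continuous_on S (%w. sol_hess l n x (f w) v)"
 unfolding sol_hess_def by (intro continuous_intros)

text \<open>The solid polynomials are harmonic because of \<open>2 * (l + 1) = d\<close>.\<close>

lemma sol_hess_trace:
 fixes x w :: "'a::euclidean_space"
 assumes x: "norm x = 1" and l: "2 * (l + 1) = real DIM('a)"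
 shows "(\<Sum>b\<in>Basis. sol_hess l n x w b \<bullet> b) = 0"
proof -
 define Y where "Y = (%n. sol (l + 2) n (x \<bullet> w) (w \<bullet> w))"
 have xx: "x \<bullet> x = 1" using x by (simp add: norm_eq_1)
 have grad: "sol_grad (l + 1) k x w = (2 * (l + 1) * Y (k - 1)) *\<^sub>R x - (2 * (l + 1) * Y (k - 2)) *\<^sub>R w" for k
  by (simp add: sol_grad_def Y_def add.commute[of 2 l])
 have e: "(\<Sum>b\<in>Basis. (b \<bullet> g) * (x \<bullet> b)) = x \<bullet> g" for x g :: 'a
  by (subst euclidean_inner) (simp add: inner_commute mult.commute)
 have "(\<Sum>b\<in>Basis. sol_hess l n x w b \<bullet> b) = 2 * l * (x \<bullet> sol_grad (l + 1) (n - 1) x w)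
   - 2 * l * sol (l + 1) (n - 2) (x \<bullet> w) (w \<bullet> w) * real DIM('a)
   - 2 * l * (w \<bullet> sol_grad (l + 1) (n - 2) x w)"
  unfolding sol_hess_def inner_diff_left inner_add_left inner_scaleR_left sum_subtractf sum.distrib mult.assoc
   sum_distrib_left[symmetric] e by (simp add: inner_commute)
 also have "... = 0"
 proof -
  have c: "sol (l + 1) (n - 2) (x \<bullet> w) (w \<bullet> w) = Y (n - 2) - 2 * (x \<bullet> w) * Y (n - 3) + (w \<bullet> w) * Y (n - 4)"
   using sol_contiguous[of "l + 1" "n - 2" "x \<bullet> w" "w \<bullet> w"] by (simp add: Y_def add.commute)
  show ?thesis
   unfolding grad c l[symmetric] inner_diff_right inner_scaleR_right xx
   by (simp add: inner_commute algebra_simps)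
 qed
 finally show ?thesis .
qed

lemma sol_scale:
 "n >= 0 ==> sol l n (x \<bullet> (t *\<^sub>R w)) ((t *\<^sub>R w) \<bullet> (t *\<^sub>R w)) = t ^ nat n * sol l n (x \<bullet> w) (w \<bullet> w)"
 using solid_scale[of l "nat n" t "x \<bullet> w" "w \<bullet> w"] by (simp add: sol_def power2_eq_square mult_ac)

text \<open>Euler's identity for homogeneous functions.\<close>

lemma inner_sol_grad: "w \<bullet> sol_grad l n x w = of_int n * sol l n (x \<bullet> w) (w \<bullet> w)"
proof (cases "n < 0")
 case False
 have "((%t. sol l n (x \<bullet> (t *\<^sub>R w)) ((t *\<^sub>R w) \<bullet> (t *\<^sub>R w))) has_derivative (%t. t * (w \<bullet> sol_grad l n x w))) (at 1)"
  by (rule has_derivative_eq_rhs, rule has_derivative_compose[where g="%w. sol l n (x \<bullet> w) (w \<bullet> w)" and f="%t. t *\<^sub>R w"])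
   (auto intro!: derivative_eq_intros has_derivative_sol_inner)
 moreover have "((%t. t ^ nat n * sol l n (x \<bullet> w) (w \<bullet> w)) has_derivative (%t. t * (of_int n * sol l n (x \<bullet> w) (w \<bullet> w)))) (at (1::real))"
  using False by (auto intro!: derivative_eq_intros)
 ultimately have "(%t. t * (w \<bullet> sol_grad l n x w)) = (%t. t * (of_int n * sol l n (x \<bullet> w) (w \<bullet> w)))"
  using False unfolding sol_scale[of n l x _ w, OF leI[OF False]] by (intro has_derivative_unique) auto
 from fun_cong[OF this, of 1] show ?thesis by simp
qed (simp add: sol_grad_def sol_def)

section \<open>Generating functions\<close>

lemma summable_power_mult_geometric:
 fixes r :: real
 assumes "\<bar>r\<bar> < 1"
 shows "summable (%k. (real k + 1) ^ a * r ^ k)"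
proof -
 have "\<forall>x::real. norm x < 1 --> summable (%k. (real k + 1) ^ a * x ^ k)"
 proof (induction a)
  case (Suc a)
  show ?case
  proof (intro allI impI)
   fix x :: real assume x: "norm x < 1"
   have "summable (%k. diffs (%k. (real k + 1) ^ a) k * (norm x) ^ k)"
    by (rule termdiff_converges[of _ 1]) (use x Suc in auto)
   thus "summable (%k. (real k + 1) ^ Suc a * x ^ k)"
    by (rule summable_comparison_test[rotated], intro exI[of _ 0])
     (auto simp: diffs_def abs_mult power_abs add.commute intro!: mult_mono mult_right_mono power_mono)
  qed
 qed (auto intro: summable_geometric)
 thus ?thesis using assms by auto
qed

text \<open>The recursion of the Gegenbauer polynomials is the differential equation \<open>Q * f' = 2 * l * (t - r) * f\<close> for their
 generating function \<open>f\<close>, where \<open>Q = 1 - 2 * t * r + r\<^sup>2\<close>; hence \<open>f * Q powr l\<close> is constant. The factor \<open>(k + l) / l\<close>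
 of the zonal polynomials turns \<open>f\<close> into \<open>f + r * f' / l\<close>.\<close>

lemma zonal_generating_function:
 assumes d: "d >= 3" and t: "\<bar>t\<bar> <= 1" and r: "0 <= r" "r < 1"
 shows "(%k. zonal d k t * r ^ k) sums ((1 - r\<^sup>2) / (1 - 2 * t * r + r\<^sup>2) powr (real d / 2))"
proof -
 define l where "l = (real d - 2) / 2"
 have l: "l > 0" "l = real (d - 2) / 2" using d by (auto simp: l_def of_nat_diff)
 define c where "c = (%k. gegenbauer l k t)"
 define Q where "Q = (%r. 1 - 2 * t * r + r\<^sup>2)"
 have c_le: "\<bar>c k\<bar> <= (real k + 1) ^ (d - 3)" for k
  using abs_gegenbauer_half_le[of "d - 2" t k] d t by (simp add: c_def l(2))
 have sm: "summable (%k. c k * x ^ k)" if "norm x < 1" for x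
  by (rule summable_comparison_test[OF _ summable_power_mult_geometric[of "norm x" "d - 3"]], intro exI[of _ 0])
   (use that in \<open>auto simp: abs_mult power_abs intro!: mult_right_mono c_le\<close>)
 have smd: "summable (%k. diffs c k * x ^ k)" if "norm x < 1" for x
  by (rule termdiff_converges[of _ 1]) (use that sm in auto)
 define f where "f = (%x. \<Sum>k. c k * x ^ k)"
 define f' where "f' = (%x. \<Sum>k. diffs c k * x ^ k)"
 have f': "(f has_real_derivative f' x) (at x)" if "norm x < 1" for x
  unfolding f_def f'_def by (rule termdiffs_strong'[of 1]) (use that sm in auto)
 have Qpos: "Q x > 0" if "norm x < 1" for x
 proof -
  have "\<bar>t * x\<bar> <= \<bar>x\<bar>" using t by (simp add: abs_mult mult_left_le_one_le)
  hence "t * x <= \<bar>x\<bar>" by linarith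
  moreover have "(1 - \<bar>x\<bar>)\<^sup>2 > 0" using that by simp
  ultimately show ?thesis by (simp add: Q_def power2_eq_square algebra_simps)
 qed
 have c0: "c 0 = 1" and c1: "c (Suc 0) = 2 * l * t" by (simp_all add: c_def)
 have ode: "Q x * f' x = 2 * l * (t - x) * f x" if x: "norm x < 1" for x
 proof -
  have S: "(%k. c k * x ^ k) sums f x" and S': "(%k. diffs c k * x ^ k) sums f' x"
   unfolding f_def f'_def using sm[OF x] smd[OF x] by (auto intro: summable_sums)
  have S'': "(%k. real k * c k * x ^ k) sums (x * f' x)"
  proof -
   have "(%k. real (Suc k) * c (Suc k) * x ^ Suc k) sums (x * f' x)"
    using sums_mult[OF S', of x] by (simp add: diffs_def mult_ac)
   from sums_Suc[OF this] show ?thesis by simp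
  qed
  have A: "(%k. real (Suc (Suc k)) * c (Suc (Suc k)) * x ^ Suc k) sums (f' x - c (Suc 0))"
   using sums_split_initial_segment[OF S', of 1] by (simp add: diffs_def)
  have B: "(%k. c (Suc k) * x ^ Suc k) sums (f x - 1)"
   using sums_split_initial_segment[OF S, of 1] by (simp add: c0)
  have C: "(%k. real (Suc k) * c (Suc k) * x ^ Suc k) sums (x * f' x)"
   using sums_split_initial_segment[OF S'', of 1] by simp
  have "(%k. 2 * t * (real (Suc k) * c (Suc k) * x ^ Suc k) + 2 * l * t * (c (Suc k) * x ^ Suc k)
    - (x * (real k * c k * x ^ k) + 2 * l * x * (c k * x ^ k))) sums
    (2 * t * (x * f' x) + 2 * l * t * (f x - 1) - (x * (x * f' x) + 2 * l * x * f x))"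
   by (intro sums_add sums_diff sums_mult S S'' B C)
  also have "(%k. 2 * t * (real (Suc k) * c (Suc k) * x ^ Suc k) + 2 * l * t * (c (Suc k) * x ^ Suc k)
    - (x * (real k * c k * x ^ k) + 2 * l * x * (c k * x ^ k)))
    = (%k. real (Suc (Suc k)) * c (Suc (Suc k)) * x ^ Suc k)"
  proof
   fix k
   have rec: "real (Suc (Suc k)) * c (Suc (Suc k)) =
     2 * (real k + 1 + l) * t * c (Suc k) - (real k + 2 * l) * c k"
    by (simp add: c_def add.commute[of 2])
   show "2 * t * (real (Suc k) * c (Suc k) * x ^ Suc k) + 2 * l * t * (c (Suc k) * x ^ Suc k)
    - (x * (real k * c k * x ^ k) + 2 * l * x * (c k * x ^ k))
    = real (Suc (Suc k)) * c (Suc (Suc k)) * x ^ Suc k"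
    unfolding rec by (simp add: algebra_simps)
  qed
  finally have "f' x - c (Suc 0) = 2 * t * (x * f' x) + 2 * l * t * (f x - 1) - (x * (x * f' x) + 2 * l * x * f x)"
   using A sums_unique2 by blast
  thus ?thesis by (simp add: Q_def c1 algebra_simps power2_eq_square)
 qed
 have fQ: "f x * Q x powr l = 1" if x: "0 <= x" "x < 1" for x
 proof -
  have "((%x. f x * Q x powr l) has_real_derivative 0) (at y)" if y: "norm y < 1" for y
  proof -
   have Q': "(Q has_real_derivative (2 * y - 2 * t)) (at y)"
    unfolding Q_def by (auto intro!: derivative_eq_intros)
   have "((%x. f x * Q x powr l) has_real_derivative
     (f' y * Q y powr l + f y * (l * Q y powr (l - 1) * (2 * y - 2 * t)))) (at y)"
    using Qpos[OF y] by (auto intro!: derivative_eq_intros f' y Q' simp: powr_diff) (simp add: algebra_simps)?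
   moreover have "f' y * Q y powr l = (Q y * f' y) * Q y powr (l - 1)"
    using Qpos[OF y] by (simp add: powr_diff)
   ultimately show ?thesis unfolding ode[OF y] by (simp add: algebra_simps)
  qed
  hence D: "((%x. f x * Q x powr l) has_real_derivative 0) (at y)" if "0 <= y" "y <= x" for y
   using that x by simp
  have "f x * Q x powr l = f 0 * Q 0 powr l"
  proof (cases "x = 0")
   case False
   thus ?thesis
    using x by (intro DERIV_isconst2[where a=0 and b=x and f="%x. f x * Q x powr l"] D
     continuous_at_imp_continuous_on ballI DERIV_isCont[OF D]) auto
  qed simp
  also have "... = 1" unfolding f_def Q_def by (subst powser_zero) (simp add: c0)
  finally show ?thesis .
 qed
 have rn: "norm r < 1" using r by simp
 have "(%k. c k * r ^ k) sums f r" unfolding f_def using sm[OF rn] by (rule summable_sums)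
 moreover have "(%k. real k * c k * r ^ k) sums (r * f' r)"
 proof -
  have "(%k. diffs c k * r ^ k) sums f' r" unfolding f'_def using smd[OF rn] by (rule summable_sums)
  from sums_mult[OF this, of r] have "(%k. real (Suc k) * c (Suc k) * r ^ Suc k) sums (r * f' r)"
   by (simp add: diffs_def mult_ac)
  from sums_Suc[OF this] show ?thesis by simp
 qed
 ultimately have "(%k. c k * r ^ k + (1 / l) * (real k * c k * r ^ k)) sums (f r + (1 / l) * (r * f' r))"
  by (intro sums_add sums_mult)
 also have "(%k. c k * r ^ k + (1 / l) * (real k * c k * r ^ k)) = (%k. zonal d k t * r ^ k)"
 proof
  fix k
  have "(2 * real k + real d - 2) / (real d - 2) = 1 + real k / l"
   using d by (simp add: l_def field_simps)
  thus "c k * r ^ k + (1 / l) * (real k * c k * r ^ k) = zonal d k t * r ^ k"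
   by (simp add: zonal_def c_def l_def[symmetric] algebra_simps)
 qed
 also have "f r + (1 / l) * (r * f' r) = (1 - r\<^sup>2) / Q r powr (real d / 2)"
 proof -
  have Q: "Q r > 0" by (rule Qpos[OF rn])
  have "f' r = 2 * l * (t - r) * f r / Q r" using ode[OF rn] Q by (simp add: field_simps)
  hence "f r + (1 / l) * (r * f' r) = f r + (1 / l) * (r * (2 * l * (t - r) * f r / Q r))" by simp
  also have "... = f r * (Q r + 2 * r * (t - r)) / Q r"
   using l(1) Q by (simp add: field_simps)
  also have "Q r + 2 * r * (t - r) = 1 - r\<^sup>2" by (simp add: Q_def power2_eq_square algebra_simps)
  also have "f r * (1 - r\<^sup>2) / Q r = 1 / Q r powr l * (1 - r\<^sup>2) / Q r"
   using fQ[OF r] Q by (simp add: field_simps)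
  also have "1 / Q r powr l * (1 - r\<^sup>2) / Q r = (1 - r\<^sup>2) / Q r powr (l + 1)"
   using Q by (simp add: powr_add)
  also have "l + 1 = real d / 2" by (simp add: l_def field_simps)
  finally show ?thesis .
 qed
 finally show ?thesis by (simp add: Q_def)
qed

section \<open>Polar coordinates\<close>

definition unif_ball :: "'a::euclidean_space measure" where
 "unif_ball = uniform_measure lborel (ball 0 1)"

lemma sets_unif_ball [measurable_cong, simp]: "sets unif_ball = sets borel"
 by (simp add: unif_ball_def)

lemma space_unif_ball [simp]: "space unif_ball = UNIV"
 by (simp add: unif_ball_def)

lemma emeasure_unit_ball:
 "emeasure lborel (ball (0::'a::euclidean_space) 1) = ennreal (measure lborel (ball (0::'a) 1))"
 using emeasure_lborel_ball_finite[of "0::'a" 1] by (subst emeasure_eq_ennreal_measure) auto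

lemma prob_space_unif_ball: "prob_space (unif_ball :: 'a::euclidean_space measure)"
 unfolding unif_ball_def
 using emeasure_lborel_ball_finite[of "0::'a" 1] by (intro prob_space_uniform_measure) (auto simp: emeasure_unit_ball)

interpretation unif_ball: prob_space "unif_ball :: 'a::euclidean_space measure"
 by (rule prob_space_unif_ball)

lemma emeasure_unif_ball:
 "A \<in> sets borel ==> emeasure unif_ball A =
   emeasure lborel (ball (0::'a::euclidean_space) 1 \<inter> A) / emeasure lborel (ball (0::'a) 1)"
 by (simp add: unif_ball_def)

lemma AE_unif_ball_ne0: "AE w in (unif_ball :: 'a::euclidean_space measure). w ~= 0"
proof (rule AE_I')
 show "{0::'a} \<in> null_sets unif_ball"
  by (auto intro!: null_setsI simp: emeasure_unif_ball Int_insert_right)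
qed auto

lemma borel_measurable_sgn' [measurable]: "(sgn :: 'a::euclidean_space => 'a) \<in> borel_measurable borel"
 unfolding sgn_div_norm[abs_def] by measurable

lemma sphere_borel [measurable]: "sphere (0::'a::euclidean_space) 1 \<in> sets borel"
 by (intro borel_closed closed_sphere)

lemma sets_sphere_measure [measurable_cong]: "sets (\<sigma> :: 'a::euclidean_space measure) = sets (restrict_space borel (sphere 0 1))"
 by (simp add: sphere_measure_def sets_restrict_space)

lemma space_sphere_measure [simp]: "space (\<sigma> :: 'a::euclidean_space measure) = sphere 0 1"
 by (simp add: sphere_measure_def space_restrict_space)

lemma borel_measurable_sphere_measure [measurable (raw)]:
 "f \<in> borel_measurable borel ==> f \<in> borel_measurable (\<sigma> :: 'a::euclidean_space measure)"
 by (simp add: measurable_cong_sets[OF sets_sphere_measure refl] measurable_restrict_space1)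

lemma sphere_measure_sets [intro]: "A \<in> sets borel ==> A \<inter> sphere 0 1 \<in> sets (\<sigma> :: 'a::euclidean_space measure)"
 by (auto simp: sphere_measure_def sets_restrict_space)

lemma nn_integral_sphere_measure:
 assumes [measurable]: "f \<in> borel_measurable borel"
 shows "(\<integral>\<^sup>+x. f x \<partial>\<sigma>) = (\<integral>\<^sup>+w. f (sgn w) \<partial>(unif_ball :: 'a::euclidean_space measure))"
proof -
 have "(\<integral>\<^sup>+x. f x \<partial>\<sigma>) = (\<integral>\<^sup>+x. f x * indicator (sphere 0 1) x \<partial>distr unif_ball borel sgn)"
  unfolding sphere_measure_def unif_ball_def by (subst nn_integral_restrict_space) auto
 also have "... = (\<integral>\<^sup>+w. f (sgn w) * indicator (sphere 0 1) (sgn w) \<partial>unif_ball)"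
  by (subst nn_integral_distr) auto
 also have "... = (\<integral>\<^sup>+w. f (sgn w) \<partial>unif_ball)"
  by (rule nn_integral_cong_AE) (use AE_unif_ball_ne0 in eventually_elim, auto simp: norm_sgn)
 finally show ?thesis .
qed

lemma emeasure_sphere_measure:
 assumes [measurable]: "A \<in> sets borel"
 shows "emeasure (\<sigma> :: 'a::euclidean_space measure) (A \<inter> sphere 0 1) = emeasure unif_ball (sgn -` A)"
proof -
 have [measurable]: "sgn -` A \<in> sets borel" using measurable_sets_borel[OF borel_measurable_sgn' assms] by simp
 have "emeasure \<sigma> (A \<inter> sphere 0 1) = (\<integral>\<^sup>+x. indicator (A \<inter> sphere 0 1) x \<partial>\<sigma>)"
  by (rule nn_integral_indicator[symmetric]) auto
 also have "... = (\<integral>\<^sup>+x. indicator A x \<partial>\<sigma>)"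
  by (rule nn_integral_cong) (auto split: split_indicator)
 also have "... = (\<integral>\<^sup>+x. indicator (sgn -` A) x \<partial>unif_ball)"
  by (subst nn_integral_sphere_measure) (auto simp del: nn_integral_indicator intro!: nn_integral_cong split: split_indicator)
 finally show ?thesis by simp
qed

lemma prob_space_sphere_measure: "prob_space (\<sigma> :: 'a::euclidean_space measure)"
proof
 show "emeasure \<sigma> (space (\<sigma> :: 'a measure)) = 1"
  using emeasure_sphere_measure[of "UNIV :: 'a set"] unif_ball.emeasure_space_1 by simp
qed

interpretation sphere_measure: prob_space "\<sigma> :: 'a::euclidean_space measure"
 by (rule prob_space_sphere_measure)

text \<open>A cone cut off at the radius \<open>t\<close> is the dilation by \<open>t\<close> of the part of the cone in the unit ball.\<close>

lemma emeasure_cone: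
 assumes [measurable]: "A \<in> sets borel" and t: "0 < t" "t <= 1"
 shows "emeasure unif_ball (sgn -` A \<inter> {w::'a::euclidean_space. norm w < t}) =
  ennreal (t ^ DIM('a)) * emeasure unif_ball (sgn -` A)"
proof -
 have [measurable]: "sgn -` A \<in> sets borel" using measurable_sets_borel[OF borel_measurable_sgn' assms(1)] by simp
 have "emeasure lborel (ball 0 1 \<inter> (sgn -` A \<inter> {w::'a. norm w < t})) =
   emeasure (density (distr lborel borel (%x. 0 + t *\<^sub>R x)) (%_. ennreal (\<bar>t\<bar> ^ DIM('a))))
   (ball 0 1 \<inter> (sgn -` A \<inter> {w::'a. norm w < t}))"
  using t by (subst lborel_affine[of t 0]) auto
 also have "... = ennreal (t ^ DIM('a)) *
   emeasure (distr lborel borel (%x. 0 + t *\<^sub>R x)) (ball 0 1 \<inter> (sgn -` A \<inter> {w::'a. norm w < t}))"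
  using t by (subst emeasure_density_const) (auto simp: emeasure_distr)
 also have "emeasure (distr lborel borel (%x. 0 + t *\<^sub>R x)) (ball 0 1 \<inter> (sgn -` A \<inter> {w::'a. norm w < t})) =
   emeasure lborel ((%x. t *\<^sub>R x) -` (ball 0 1 \<inter> (sgn -` A \<inter> {w::'a. norm w < t})))"
  by (subst emeasure_distr) auto
 also have "(%x. t *\<^sub>R x) -` (ball 0 1 \<inter> (sgn -` A \<inter> {w::'a. norm w < t})) = ball 0 1 \<inter> sgn -` A"
 proof -
  have "t * norm x < 1" if "norm x < 1" for x :: 'a
   using mult_mono[of t 1 "norm x" "norm x"] t that by auto
  thus ?thesis using t by (auto simp: sgn_scaleR)
 qed
 finally show ?thesis
  by (simp add: emeasure_unif_ball ennreal_times_divide)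
qed

text \<open>By the scaling of cones, the radius falls below \<open>t\<close> with the same probability \<open>t ^ d\<close> in every set of directions; the
 intervals \<open>{..<t}\<close> generate the Borel sets.\<close>

lemma distr_norm_sgn:
 "distr unif_ball borel (norm :: 'a => real) \<Otimes>\<^sub>M distr unif_ball borel (sgn :: 'a::euclidean_space => 'a) =
   distr unif_ball (borel \<Otimes>\<^sub>M borel) (%x. (norm x, sgn x))"
proof -
 have prod: "emeasure unif_ball (norm -` A \<inter> sgn -` B) = emeasure unif_ball ((norm :: 'a => real) -` A) * emeasure unif_ball (sgn -` B)"
  if A[measurable]: "A \<in> sets borel" and B[measurable]: "B \<in> sets borel" for A and B :: "'a set"
 proof -
  have [measurable]: "sgn -` B \<in> sets borel" using measurable_sets_borel[OF borel_measurable_sgn' B] by simp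
  define M where "M = distr (density unif_ball (indicator (sgn -` B) :: 'a => ennreal)) borel norm"
  define N where "N = scale_measure (emeasure unif_ball (sgn -` B)) (distr unif_ball borel (norm :: 'a => real))"
  have M: "emeasure M C = emeasure unif_ball (norm -` C \<inter> sgn -` B)" if [measurable]: "C \<in> sets borel" for C
  proof -
   have [measurable]: "norm -` C \<in> sets (borel :: 'a measure)" by (rule measurable_sets_borel[of norm borel]) auto
   show ?thesis unfolding M_def
    by (simp add: emeasure_distr emeasure_density indicator_inter_arith[symmetric] Int_commute)
  qed
  have N: "emeasure N C = emeasure unif_ball (sgn -` B) * emeasure unif_ball ((norm :: 'a => real) -` C)" if "C \<in> sets borel" for C
   using that by (simp add: N_def emeasure_distr)
  have less: "emeasure unif_ball ((norm -` {..<t}) \<inter> sgn -` B) = emeasure unif_ball (sgn -` B) * emeasure unif_ball ((norm :: 'a => real) -` {..<t})" for t :: real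
  proof -
   consider "t <= 0" | "0 < t" "t <= 1" | "1 < t" by linarith
   thus ?thesis
   proof cases
    case 1
    hence "norm -` {..<t} = ({} :: 'a set)" by (auto simp: not_less dest: order_less_le_trans[OF le_less_trans[OF norm_ge_zero]])
    thus ?thesis by simp
   next
    case 2
    have "emeasure unif_ball {w::'a. norm w < t} = ennreal (t ^ DIM('a)) * 1"
     using emeasure_cone[of "UNIV :: 'a set" t] 2 unif_ball.emeasure_space_1[where 'a='a] by simp
    moreover have "norm -` {..<t} = {w::'a. norm w < t}" by auto
    ultimately show ?thesis using emeasure_cone[OF B 2] by (simp add: Int_commute mult.commute)
   next
    case 3
    have *: "emeasure unif_ball (norm -` {..<t} \<inter> D) = emeasure unif_ball D" if [measurable]: "D \<in> sets borel" for D :: "'a set"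
    proof -
     have [measurable]: "norm -` {..<t} \<in> sets (borel :: 'a measure)" by (rule measurable_sets_borel[of norm borel]) auto
     have "ball 0 1 \<inter> (norm -` {..<t} \<inter> D) = ball 0 1 \<inter> D" using 3 by auto
     thus ?thesis by (simp add: emeasure_unif_ball)
    qed
    show ?thesis using *[of "sgn -` B"] *[of UNIV] unif_ball.emeasure_space_1[where 'a='a] by simp
   qed
  qed
  have "M = N"
  proof (rule measure_eqI_generator_eq[where E="range lessThan" and \<Omega>=UNIV and A="%n. {..<real n}"])
   show "Int_stable (range (lessThan :: real => _))"
   proof -
    have "{..<a} \<inter> {..<b} = {..<min a b}" for a b :: real by auto
    thus ?thesis by (auto simp: Int_stable_def)
   qed
   show "sets M = sigma_sets UNIV (range lessThan)" "sets N = sigma_sets UNIV (range lessThan)"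
    by (simp_all add: M_def N_def borel_Iio)
   show "emeasure M X = emeasure N X" if "X \<in> range lessThan" for X
    using that less by (auto simp: M N)
   show "(\<Union>i. {..<real i}) = UNIV" by (auto simp: reals_Archimedean2)
   show "emeasure M {..<real i} ~= \<infinity>" for i by (simp add: M unif_ball.emeasure_eq_measure)
  qed auto
  hence "emeasure M A = emeasure N A" by simp
  thus ?thesis by (simp add: M N mult.commute)
 qed
 show ?thesis
 proof (rule pair_measure_eqI)
  fix A :: "real set" and B :: "'a set"
  assume "A \<in> sets (distr unif_ball borel (norm :: 'a => real))" "B \<in> sets (distr unif_ball borel (sgn :: 'a => 'a))"
  hence [measurable]: "A \<in> sets borel" "B \<in> sets borel" by auto
  have "(%x. (norm x, sgn x)) -` (A \<times> B) = norm -` A \<inter> sgn -` B" by auto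
  thus "emeasure (distr unif_ball borel (norm :: 'a => real)) A * emeasure (distr unif_ball borel (sgn :: 'a => 'a)) B =
    emeasure (distr unif_ball (borel \<Otimes>\<^sub>M borel) (%x. (norm x, sgn x))) (A \<times> B)"
   by (simp add: emeasure_distr prod)
 qed (auto intro!: prob_space_imp_sigma_finite unif_ball.prob_space_distr cong: sets_pair_measure_cong)
qed

lemma nn_integral_polar:
 assumes [measurable]: "a \<in> borel_measurable borel" "g \<in> borel_measurable borel"
 shows "(\<integral>\<^sup>+w. a (norm w) * g (sgn w) \<partial>(unif_ball :: 'a::euclidean_space measure)) =
  (\<integral>\<^sup>+w. a (norm w) \<partial>(unif_ball :: 'a::euclidean_space measure)) * (\<integral>\<^sup>+x. g x \<partial>\<sigma>)"
proof -
 define D1 where "D1 = distr unif_ball borel (norm :: 'a => real)"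
 define D2 where "D2 = distr unif_ball borel (sgn :: 'a => 'a)"
 have eq: "D1 \<Otimes>\<^sub>M D2 = distr unif_ball (borel \<Otimes>\<^sub>M borel) (%x. (norm x, sgn x))"
  unfolding D1_def D2_def by (rule distr_norm_sgn)
 interpret D2: prob_space D2 unfolding D2_def by (rule unif_ball.prob_space_distr) simp
 have [measurable_cong]: "sets D1 = sets borel" "sets D2 = sets borel" by (simp_all add: D1_def D2_def)
 have "(\<integral>\<^sup>+w. a (norm w) * g (sgn w) \<partial>unif_ball) = (\<integral>\<^sup>+p. a (fst p) * g (snd p) \<partial>(D1 \<Otimes>\<^sub>M D2))"
  unfolding eq by (subst nn_integral_distr) auto
 also have "... = (\<integral>\<^sup>+s. \<integral>\<^sup>+x. a s * g x \<partial>D2 \<partial>D1)"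
  by (subst D2.nn_integral_fst[symmetric]) auto
 also have "... = (\<integral>\<^sup>+s. a s \<partial>D1) * (\<integral>\<^sup>+x. g x \<partial>D2)"
  by (simp add: nn_integral_cmult nn_integral_multc)
 also have "(\<integral>\<^sup>+s. a s \<partial>D1) = (\<integral>\<^sup>+w. a (norm w) \<partial>(unif_ball :: 'a measure))"
  unfolding D1_def by (subst nn_integral_distr) auto
 also have "(\<integral>\<^sup>+x. g x \<partial>D2) = (\<integral>\<^sup>+x. g x \<partial>\<sigma>)"
  unfolding D2_def by (subst nn_integral_distr) (auto simp: nn_integral_sphere_measure)
 finally show ?thesis .
qed

lemma integral_sphere_measure:
 fixes f :: "'a::euclidean_space => 'b::{banach, second_countable_topology}"
 assumes [measurable]: "f \<in> borel_measurable borel"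
 shows "(\<integral>x. f x \<partial>\<sigma>) = (\<integral>w. f (sgn w) \<partial>unif_ball)"
proof -
 have "(\<integral>x. f x \<partial>\<sigma>) = (\<integral>x. indicator (sphere 0 1) x *\<^sub>R f x \<partial>distr unif_ball borel sgn)"
  unfolding sphere_measure_def unif_ball_def by (subst integral_restrict_space) auto
 also have "... = (\<integral>w. indicator (sphere 0 1) (sgn w) *\<^sub>R f (sgn w) \<partial>unif_ball)"
  by (subst integral_distr) auto
 also have "... = (\<integral>w. f (sgn w) \<partial>unif_ball)"
  by (rule integral_cong_AE) (auto intro!: eventually_mono[OF AE_unif_ball_ne0] simp: norm_sgn)
 finally show ?thesis .
qed

lemma integral_polar:
 fixes a :: "real => real" and g :: "'a::euclidean_space => real"
 assumes [measurable]: "a \<in> borel_measurable borel" "g \<in> borel_measurable borel"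
  and "integrable unif_ball (%w::'a. a (norm w))" "integrable unif_ball (%w. g (sgn w))"
 shows "(\<integral>w. a (norm w) * g (sgn w) \<partial>unif_ball) = (\<integral>w. a (norm w) \<partial>(unif_ball :: 'a measure)) * (\<integral>x. g x \<partial>\<sigma>)"
proof -
 define D1 where "D1 = distr unif_ball borel (norm :: 'a => real)"
 define D2 where "D2 = distr unif_ball borel (sgn :: 'a => 'a)"
 have eq: "D1 \<Otimes>\<^sub>M D2 = distr unif_ball (borel \<Otimes>\<^sub>M borel) (%x. (norm x, sgn x))"
  unfolding D1_def D2_def by (rule distr_norm_sgn)
 interpret D1: prob_space D1 unfolding D1_def by (rule unif_ball.prob_space_distr) simp
 interpret D2: prob_space D2 unfolding D2_def by (rule unif_ball.prob_space_distr) simp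
 interpret pair_sigma_finite D1 D2 ..
 have [measurable_cong]: "sets D1 = sets borel" "sets D2 = sets borel" by (simp_all add: D1_def D2_def)
 have i: "integrable D1 a" "integrable D2 g"
  unfolding D1_def D2_def using assms by (subst integrable_distr_eq; simp)+
 have "integrable (D1 \<Otimes>\<^sub>M D2) (%p. a (fst p) * g (snd p))"
  by (rule Fubini_integrable) (auto simp: abs_mult i)
 hence "(\<integral>p. a (fst p) * g (snd p) \<partial>(D1 \<Otimes>\<^sub>M D2)) = (\<integral>s. \<integral>x. a s * g x \<partial>D2 \<partial>D1)"
  using integral_fst'[of "%p. a (fst p) * g (snd p)"] by simp
 also have "... = (\<integral>s. a s \<partial>D1) * (\<integral>x. g x \<partial>D2)" by simp
 also have "(\<integral>p. a (fst p) * g (snd p) \<partial>(D1 \<Otimes>\<^sub>M D2)) = (\<integral>w. a (norm w) * g (sgn w) \<partial>unif_ball)"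
  unfolding eq by (subst integral_distr) auto
 also have "(\<integral>s. a s \<partial>D1) = (\<integral>w. a (norm w) \<partial>(unif_ball :: 'a measure))"
  unfolding D1_def by (subst integral_distr) auto
 also have "(\<integral>x. g x \<partial>D2) = (\<integral>x. g x \<partial>\<sigma>)"
  unfolding D2_def by (subst integral_distr) (auto simp: integral_sphere_measure)
 finally show ?thesis .
qed

lemma emeasure_unif_ball_ball:
 assumes "0 <= t" "t <= 1"
 shows "emeasure unif_ball {w::'a::euclidean_space. norm w < t} = ennreal (t ^ DIM('a))"
proof (cases "t = 0")
 case False
 thus ?thesis
  using emeasure_cone[of "UNIV :: 'a set" t] assms unif_ball.emeasure_space_1[where 'a='a] by simp
qed simp

lemma measure_unif_ball_annulus:
 assumes "0 <= s" "s <= t" "t <= 1"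
 shows "measure unif_ball {w::'a::euclidean_space. s <= norm w \<and> norm w < t} = t ^ DIM('a) - s ^ DIM('a)"
proof -
 have m: "measure unif_ball {w::'a. norm w < r} = r ^ DIM('a)" if "0 <= r" "r <= 1" for r
  using emeasure_unif_ball_ball[OF that, where 'a='a] that by (simp add: measure_def)
 have "{w::'a. s <= norm w \<and> norm w < t} = {w. norm w < t} - {w. norm w < s}" by auto
 thus ?thesis using assms
  by (simp add: m unif_ball.finite_measure_Diff[of "{w. norm w < t}" "{w. norm w < s}"] Collect_mono order_less_le_trans)
qed

lemma nn_integral_annulus:
 assumes [measurable]: "g \<in> borel_measurable borel" and "0 <= s" "s <= t" "t <= 1"
 shows "(\<integral>\<^sup>+w. indicator {s..<t} (norm w) * g (sgn w) \<partial>(unif_ball :: 'a::euclidean_space measure)) =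
  ennreal (t ^ DIM('a) - s ^ DIM('a)) * (\<integral>\<^sup>+x. g x \<partial>\<sigma>)"
proof -
 have "(\<integral>\<^sup>+w. indicator {s..<t} (norm w) \<partial>(unif_ball :: 'a measure)) = emeasure unif_ball {w::'a. s <= norm w \<and> norm w < t}"
  by (subst nn_integral_indicator[symmetric]) (auto simp del: nn_integral_indicator intro!: nn_integral_cong split: split_indicator)
 also have "... = ennreal (t ^ DIM('a) - s ^ DIM('a))"
  using measure_unif_ball_annulus[OF assms(2-4), where 'a='a] by (simp add: unif_ball.emeasure_eq_measure)
 finally show ?thesis by (subst nn_integral_polar) auto
qed

section \<open>Caps\<close>

lemma measure_sphere_cball_annulus:
 fixes x :: "'a::euclidean_space"
 assumes "0 <= s" "s <= 1"
 shows "measure unif_ball {w. s <= norm w \<and> norm w < 1 \<and> sgn w \<in> cball x r} =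
   (1 - s ^ DIM('a)) * measure \<sigma> (cball x r \<inter> sphere 0 1)"
proof -
 have [measurable]: "cball x r \<in> sets borel" by (intro borel_closed closed_cball)
 have 1: "1 - s ^ DIM('a) >= 0" using assms by (simp add: power_le_one)
 have "emeasure unif_ball {w. s <= norm w \<and> norm w < 1 \<and> sgn w \<in> cball x r} =
   (\<integral>\<^sup>+w. indicator {s..<1} (norm w) * indicator (cball x r) (sgn w) \<partial>unif_ball)"
  by (subst nn_integral_indicator[symmetric]) (auto simp del: nn_integral_indicator intro!: nn_integral_cong split: split_indicator)
 also have "... = ennreal (1 ^ DIM('a) - s ^ DIM('a)) * (\<integral>\<^sup>+x'. indicator (cball x r) x' \<partial>\<sigma>)"
  by (rule nn_integral_annulus) (use assms in auto)
 also have "(\<integral>\<^sup>+x'. indicator (cball x r) x' \<partial>\<sigma>) = emeasure \<sigma> (cball x r \<inter> sphere 0 1)"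
  by (subst nn_integral_indicator[symmetric]) (auto simp del: nn_integral_indicator intro!: nn_integral_cong split: split_indicator)
 finally show ?thesis
  using 1 by (simp add: sphere_measure.emeasure_eq_measure unif_ball.emeasure_eq_measure flip: ennreal_mult)
qed

lemma measure_unif_ball_le:
 fixes x :: "'a::euclidean_space"
 assumes "r >= 0"
 shows "measure unif_ball (cball x r) <= r ^ DIM('a)"
  and "ball x r \<subseteq> ball 0 1 ==> measure unif_ball (ball x r) = r ^ DIM('a)"
proof -
 have v: "measure lborel (ball (0::'a) 1) > 0" by (simp add: content_ball_pos)
 have le: "measure unif_ball A <= r ^ DIM('a)" if "A \<in> sets borel" "A \<subseteq> cball x r" for A
 proof -
  have "emeasure lborel (ball 0 1 \<inter> A) <= emeasure lborel (cball x r)"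
   using that by (intro emeasure_mono) auto
  also have "... = ennreal (measure lborel (cball x r))"
   using emeasure_lborel_cball_finite[of x r] by (subst emeasure_eq_ennreal_measure) auto
  also have "measure lborel (cball x r) = r ^ DIM('a) * measure lborel (ball (0::'a) 1)"
   using content_ball_conv_unit_ball[OF assms, of x] by (simp add: content_ball content_cball assms)
  finally have "emeasure unif_ball A <= ennreal (r ^ DIM('a) * measure lborel (ball (0::'a) 1)) / ennreal (measure lborel (ball (0::'a) 1))"
   unfolding emeasure_unif_ball[OF that(1)] emeasure_unit_ball by (rule divide_right_mono_ennreal)
  also have "... = ennreal (r ^ DIM('a))"
   using v assms by (simp add: divide_ennreal)
  finally show ?thesis using assms by (simp add: unif_ball.emeasure_eq_measure)
 qed
 show "measure unif_ball (cball x r) <= r ^ DIM('a)" by (rule le) auto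
 assume sub: "ball x r \<subseteq> ball 0 1"
 have "emeasure unif_ball (ball x r) = emeasure lborel (ball x r) / ennreal (measure lborel (ball (0::'a) 1))"
  using sub by (simp add: emeasure_unif_ball emeasure_unit_ball Int_absorb1)
 also have "emeasure lborel (ball x r) = ennreal (r ^ DIM('a) * measure lborel (ball (0::'a) 1))"
  using emeasure_lborel_ball_finite[of x r] content_ball_conv_unit_ball[OF assms, of x]
  by (subst emeasure_eq_ennreal_measure) auto
 finally show "measure unif_ball (ball x r) = r ^ DIM('a)"
  using v assms by (simp add: divide_ennreal unif_ball.emeasure_eq_measure)
qed

lemma norm_sgn_diff_le:
 fixes v w :: "'a::real_normed_vector"
 assumes "v ~= 0"
 shows "norm (sgn w - sgn v) <= 2 * norm (w - v) / norm v"
proof (cases "w = 0")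
 case False
 have "norm v *\<^sub>R (sgn w - sgn v) = (norm v - norm w) *\<^sub>R sgn w + (w - v)"
  using assms False by (simp add: sgn_div_norm algebra_simps)
 hence "norm v * norm (sgn w - sgn v) = norm ((norm v - norm w) *\<^sub>R sgn w + (w - v))"
  by (metis norm_scaleR abs_norm_cancel)
 also have "... <= \<bar>norm v - norm w\<bar> * norm (sgn w) + norm (w - v)"
  using norm_triangle_ineq[of "(norm v - norm w) *\<^sub>R sgn w" "w - v"] by simp
 also have "... <= norm (w - v) + norm (w - v)"
  using norm_triangle_ineq3[of v w] False by (simp add: norm_sgn norm_minus_commute)
 finally show ?thesis using assms by (simp add: field_simps)
qed (use assms in \<open>simp add: norm_sgn\<close>)

text \<open>The part of the cone over the cap at distance at most \<open>r\<close> from the sphere has at least \<open>r\<close> times the measure of the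
 cap, and it lies in the ball of radius \<open>2 * r\<close> about \<open>x\<close>.\<close>

lemma measure_sphere_cball_le:
 fixes x :: "'a::euclidean_space"
 assumes x: "norm x = 1" and r: "r > 0"
 shows "measure \<sigma> (cball x r \<inter> sphere 0 1) <= 2 ^ DIM('a) * r ^ (DIM('a) - 1)"
proof (cases "r <= 1")
 case True
 have "r * measure \<sigma> (cball x r \<inter> sphere 0 1) <= (1 - (1 - r) ^ DIM('a)) * measure \<sigma> (cball x r \<inter> sphere 0 1)"
 proof (intro mult_right_mono)
  have "(1 - r) ^ DIM('a) <= (1 - r) ^ 1" using True r by (intro power_decreasing) (auto simp: Suc_leI)
  thus "r <= 1 - (1 - r) ^ DIM('a)" by simp
 qed auto
 also have "... = measure unif_ball {w. 1 - r <= norm w \<and> norm w < 1 \<and> sgn w \<in> cball x r}"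
  using True r by (subst measure_sphere_cball_annulus) auto
 also have "... <= measure unif_ball (cball x (2 * r))"
 proof (rule unif_ball.finite_measure_mono)
  show "{w. 1 - r <= norm w \<and> norm w < 1 \<and> sgn w \<in> cball x r} \<subseteq> cball x (2 * r)"
  proof
   fix w assume w: "w \<in> {w. 1 - r <= norm w \<and> norm w < 1 \<and> sgn w \<in> cball x r}"
   have "norm (sgn w - w) <= r"
   proof (cases "w = 0")
    case False
    hence "sgn w - w = (1 - norm w) *\<^sub>R sgn w" by (simp add: sgn_div_norm algebra_simps)
    hence "norm (sgn w - w) = \<bar>1 - norm w\<bar>" using False by (simp add: norm_sgn)
    thus ?thesis using w by simp
   qed (use r in simp)
   thus "w \<in> cball x (2 * r)"
    using w dist_triangle[of x w "sgn w"] by (auto simp: dist_norm)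
  qed
 qed auto
 also have "... <= (2 * r) ^ DIM('a)" by (rule measure_unif_ball_le) (use r in auto)
 also have "... = r * (2 ^ DIM('a) * r ^ (DIM('a) - 1))"
  by (simp add: power_mult_distrib power_eq_if[of r "DIM('a)"])
 finally show ?thesis using r by simp
next
 case False
 have "measure \<sigma> (cball x r \<inter> sphere 0 1) <= 1 * 1" by simp
 also have "... <= 2 ^ DIM('a) * r ^ (DIM('a) - 1)" using False by (intro mult_mono one_le_power) auto
 finally show ?thesis .
qed

text \<open>The part of the cone over the cap at distance at most \<open>r\<close> from the sphere contains the ball of radius \<open>r / 4\<close> about
 \<open>(1 - r / 2) *\<^sub>R x\<close>.\<close>

lemma measure_sphere_cball_ge:
 fixes x :: "'a::euclidean_space"
 assumes x: "norm x = 1" and r: "0 < r" "r <= 1"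
 shows "r ^ (DIM('a) - 1) <= 4 ^ DIM('a) * real DIM('a) * measure \<sigma> (cball x r \<inter> sphere 0 1)"
proof -
 define v where "v = (1 - r / 2) *\<^sub>R x"
 have v: "norm v = 1 - r / 2" using x r by (simp add: v_def)
 have v0: "v ~= 0" using v r by auto
 have sv: "sgn v = x" using x r by (simp add: v_def sgn_scaleR sgn_div_norm)
 have "ball v (r / 4) \<subseteq> {w. 1 - r <= norm w \<and> norm w < 1 \<and> sgn w \<in> cball x r}"
 proof
  fix w assume "w \<in> ball v (r / 4)"
  hence w: "norm (w - v) < r / 4" by (simp add: dist_norm norm_minus_commute)
  have "\<bar>norm w - norm v\<bar> < r / 4" using norm_triangle_ineq3[of w v] w by simp
  hence "1 - r <= norm w" "norm w < 1" using v r by linarith+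
  moreover have "norm (sgn w - x) <= r"
  proof -
   have "norm (sgn w - x) <= 2 * norm (w - v) / norm v" using norm_sgn_diff_le[OF v0, of w] sv by simp
   also have "... <= 2 * (r / 4) / (1 / 2)" using w v r by (intro frac_le mult_left_mono) auto
   finally show ?thesis by simp
  qed
  ultimately show "w \<in> {w. 1 - r <= norm w \<and> norm w < 1 \<and> sgn w \<in> cball x r}"
   using v r by (auto simp: dist_norm norm_minus_commute)
 qed
 note sub = this
 have "(r / 4) ^ DIM('a) = measure unif_ball (ball v (r / 4))"
  by (rule measure_unif_ball_le(2)[symmetric]) (use r sub in auto)
 also have "... <= measure unif_ball {w. 1 - r <= norm w \<and> norm w < 1 \<and> sgn w \<in> cball x r}"
  by (rule unif_ball.finite_measure_mono[OF sub]) auto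
 also have "... = (1 - (1 - r) ^ DIM('a)) * measure \<sigma> (cball x r \<inter> sphere 0 1)"
  using r by (subst measure_sphere_cball_annulus) auto
 also have "... <= (real DIM('a) * r) * measure \<sigma> (cball x r \<inter> sphere 0 1)"
  using Bernoulli_inequality[of "- r" "DIM('a)"] r by (intro mult_right_mono) auto
 finally have "r * r ^ (DIM('a) - 1) <= r * (4 ^ DIM('a) * real DIM('a) * measure \<sigma> (cball x r \<inter> sphere 0 1))"
  by (simp add: power_divide field_simps power_eq_if[of r "DIM('a)"])
 thus ?thesis using r by simp
qed

lemma norm_diff_sphere:
 fixes x y :: "'a::real_inner"
 assumes "norm x = 1" "norm y = 1"
 shows "(norm (x - y))\<^sup>2 = 2 * (1 - x \<bullet> y)"
 using assms by (simp add: power2_norm_eq_inner inner_diff_left inner_diff_right inner_commute norm_eq_1)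

lemma abs_inner_sphere_le:
 fixes x y :: "'a::real_inner"
 assumes "norm x = 1" "norm y = 1"
 shows "\<bar>x \<bullet> y\<bar> <= 1"
 using Cauchy_Schwarz_ineq2[of x y] assms by simp

lemma half_le_sin:
 assumes "0 <= u" "u <= pi / 2"
 shows "u / 2 <= sin u"
proof (cases "u <= pi / 3")
 case True
 show ?thesis
 proof (cases "u = 0")
  case False
  have "\<exists>z>0. z < u \<and> sin u - sin 0 = (u - 0) * cos z"
   by (rule MVT2) (use False assms in \<open>auto intro!: derivative_eq_intros\<close>)
  then obtain z where z: "0 < z" "z < u" "sin u = u * cos z" by auto
  have "cos (pi / 3) <= cos z" using z True assms by (intro cos_monotone_0_pi_le) auto
  hence "u * (1 / 2) <= u * cos z" using assms by (intro mult_left_mono) (auto simp: cos_60)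
  thus ?thesis using z by simp
 qed simp
next
 case False
 have "sin (pi / 3) <= sin u" using False assms by (intro sin_monotone_2pi_le) auto
 moreover have "sin (pi / 3) >= 17 / 20" unfolding sin_60
 proof -
  have "17 / 10 <= sqrt 3" by (rule real_le_rsqrt) (simp add: power2_eq_square)
  thus "17 / 20 <= sqrt 3 / 2" by simp
 qed
 moreover have "pi / 4 <= 17 / 20" using pi_less_4 pi_approx by simp
 ultimately show ?thesis using assms by simp
qed

lemma chord_eq:
 fixes x y :: "'a::euclidean_space"
 assumes "norm x = 1" "norm y = 1"
 shows "norm (x - y) = 2 * sin (geod_dist x y / 2)"
proof -
 have t: "-1 <= x \<bullet> y" "x \<bullet> y <= 1" using abs_inner_sphere_le[OF assms] by auto
 have u: "0 <= geod_dist x y" "geod_dist x y <= pi"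
  unfolding geod_dist_def by (auto intro: arccos_lbound arccos_ubound t)
 have "x \<bullet> y = cos (2 * (geod_dist x y / 2))" unfolding geod_dist_def using t by simp
 hence "(norm (x - y))\<^sup>2 = (2 * sin (geod_dist x y / 2))\<^sup>2"
  unfolding norm_diff_sphere[OF assms] cos_double_sin by (simp add: power2_eq_square)
 moreover have "sin (geod_dist x y / 2) >= 0" using u by (intro sin_ge_zero) auto
 ultimately show ?thesis by - (rule power2_eq_imp_eq, auto)
qed

lemma chord_le_geod_dist:
 fixes x y :: "'a::euclidean_space"
 assumes "norm x = 1" "norm y = 1"
 shows "norm (x - y) <= geod_dist x y"
proof -
 have t: "-1 <= x \<bullet> y" "x \<bullet> y <= 1" using abs_inner_sphere_le[OF assms] by auto
 have "0 <= geod_dist x y" unfolding geod_dist_def by (auto intro: arccos_lbound t)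
 thus ?thesis using sin_x_le_x[of "geod_dist x y / 2"] unfolding chord_eq[OF assms] by simp
qed

lemma geod_dist_le_chord:
 fixes x y :: "'a::euclidean_space"
 assumes "norm x = 1" "norm y = 1"
 shows "geod_dist x y <= 2 * norm (x - y)"
proof -
 have t: "-1 <= x \<bullet> y" "x \<bullet> y <= 1" using abs_inner_sphere_le[OF assms] by auto
 have "0 <= geod_dist x y" "geod_dist x y <= pi"
  unfolding geod_dist_def by (auto intro: arccos_lbound arccos_ubound t)
 thus ?thesis using half_le_sin[of "geod_dist x y / 2"] unfolding chord_eq[OF assms] by simp
qed

lemma cap_subset_cball:
 fixes x :: "'a::euclidean_space"
 assumes "norm x = 1"
 shows "cap x r \<subseteq> cball x r \<inter> sphere 0 1"
 using chord_le_geod_dist[OF assms] unfolding cap_def by (force simp: dist_norm)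

lemma cball_subset_cap:
 fixes x :: "'a::euclidean_space"
 assumes "norm x = 1" "2 * s <= r"
 shows "cball x s \<inter> sphere 0 1 \<subseteq> cap x r"
 using geod_dist_le_chord[OF assms(1)] assms(2) unfolding cap_def by (force simp: dist_norm)

lemma cap_borel:
 fixes x :: "'a::euclidean_space"
 assumes "norm x = 1"
 shows "cap x r \<in> sets borel"
proof -
 have "- 1 <= x \<bullet> y \<and> x \<bullet> y <= 1" if "y \<in> sphere 0 1" for y
  using abs_inner_sphere_le[of x y] assms that by (auto simp: abs_le_iff)
 hence "closed (sphere 0 1 \<inter> (%y. arccos (x \<bullet> y)) -` {..r})"
  by (intro continuous_closed_preimage continuous_on_arccos continuous_intros closed_sphere) auto
 moreover have "sphere 0 1 \<inter> (%y. arccos (x \<bullet> y)) -` {..r} = cap x r"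
  by (auto simp: cap_def geod_dist_def)
 ultimately show ?thesis by (metis borel_closed)
qed

lemma cball_sphere_sets [measurable, simp]: "cball x r \<inter> sphere 0 1 \<in> sets (\<sigma> :: 'a::euclidean_space measure)"
 by (rule sphere_measure_sets) (auto intro: borel_closed)

lemma measure_cap_bounds:
 obtains c where "c >= 1"
  "!!(x::'a::euclidean_space) j. norm x = 1 ==>
    measure \<sigma> (cap x (pi / 2 ^ j)) <= c / 2 ^ (j * (DIM('a) - 1))"
  "!!(x::'a::euclidean_space) j. norm x = 1 ==>
    1 / 2 ^ (j * (DIM('a) - 1)) <= c * measure \<sigma> (cap x (pi / 2 ^ j))"
proof -
 define c where "c = max (2 ^ DIM('a) * pi ^ (DIM('a) - 1)) (4 ^ DIM('a) * real DIM('a))"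
 have m: "cap x r \<in> sets \<sigma>" if "norm x = 1" for x :: 'a and r
  using sphere_measure_sets[OF cap_borel[OF that, of r]] by (simp add: cap_def Int_def conj_ac cong: conj_cong)
 show ?thesis
 proof (rule that[of c])
  have "(1::real) <= 4 ^ DIM('a) * real DIM('a)"
   using mult_mono[of 1 "4 ^ DIM('a) :: real" 1 "real DIM('a)"] by (simp add: Suc_leI)
  thus "c >= 1" by (simp add: c_def)
  fix x :: 'a and j :: nat assume x: "norm x = 1"
  have p: "((1::real) / 2 ^ j) ^ (DIM('a) - 1) = 1 / 2 ^ (j * (DIM('a) - 1))"
   by (simp add: power_divide power_mult)
  have "measure \<sigma> (cap x (pi / 2 ^ j)) <= measure \<sigma> (cball x (pi / 2 ^ j) \<inter> sphere 0 1)"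
   by (rule sphere_measure.finite_measure_mono[OF cap_subset_cball[OF x]]) auto
  also have "... <= 2 ^ DIM('a) * (pi * (1 / 2 ^ j)) ^ (DIM('a) - 1)"
   using measure_sphere_cball_le[OF x, of "pi / 2 ^ j"] by simp
  also have "... = (2 ^ DIM('a) * pi ^ (DIM('a) - 1)) * (1 / 2 ^ (j * (DIM('a) - 1)))"
   unfolding power_mult_distrib p by simp
  also have "... <= c * (1 / 2 ^ (j * (DIM('a) - 1)))" by (intro mult_right_mono) (auto simp: c_def)
  finally show "measure \<sigma> (cap x (pi / 2 ^ j)) <= c / 2 ^ (j * (DIM('a) - 1))" by simp
  have "1 / 2 ^ (j * (DIM('a) - 1)) <= 4 ^ DIM('a) * real DIM('a) * measure \<sigma> (cball x (1 / 2 ^ j) \<inter> sphere 0 1)"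
   unfolding p[symmetric] by (rule measure_sphere_cball_ge[OF x]) auto
  also have "... <= c * measure \<sigma> (cap x (pi / 2 ^ j))"
  proof (intro mult_mono sphere_measure.finite_measure_mono cball_subset_cap x m)
   show "2 * (1 / 2 ^ j) <= pi / 2 ^ j" using pi_ge_two by (simp add: divide_right_mono)
  qed (auto simp: c_def le_max_iff_disj)
  finally show "1 / 2 ^ (j * (DIM('a) - 1)) <= c * measure \<sigma> (cap x (pi / 2 ^ j))" .
 qed
qed

section \<open>Kernels that decay away from a point\<close>

text \<open>On the dyadic shell where \<open>1 + N * norm (x - y)\<close> is about \<open>2 ^ i\<close>, the kernel is about \<open>2 ^ (- i * d)\<close> and the measure
 is at most about \<open>(2 ^ i / N) ^ (d - 1)\<close>, so that the shells form a geometric series.\<close>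

lemma nn_integral_decay:
 fixes x :: "'a::euclidean_space"
 assumes x: "norm x = 1" and N: "N > 0"
 shows "(\<integral>\<^sup>+y. ennreal (1 / (1 + N * norm (x - y)) ^ DIM('a)) \<partial>\<sigma>)
   <= ennreal (4 ^ DIM('a) / N ^ (DIM('a) - 1))"
proof -
 define d where "d = DIM('a)"
 have d: "d >= 1" by (simp add: d_def Suc_leI)
 have "(\<integral>\<^sup>+y. ennreal (1 / (1 + N * norm (x - y)) ^ d) \<partial>\<sigma>)
   <= (\<integral>\<^sup>+y. (\<Sum>i. ennreal ((1 / 2 ^ i) ^ d) * indicator (cball x (2 ^ (i + 1) / N) \<inter> sphere 0 1) y) \<partial>\<sigma>)"
 proof (rule nn_integral_mono)
  fix y :: 'a assume y: "y \<in> space \<sigma>"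
  define s where "s = 1 + N * norm (x - y)"
  have s: "s >= 1" using N by (simp add: s_def)
  define i where "i = nat \<lfloor>log 2 s\<rfloor>"
  have i: "real i <= log 2 s" "log 2 s < real i + 1"
   using s by (auto simp: i_def of_nat_nat)
  have si: "2 ^ i <= s" using i(1) s by (simp add: le_log_iff powr_realpow)
  have si': "s < 2 ^ (i + 1)" using i(2) s by (simp add: log_less_iff powr_add powr_realpow)
  have "N * norm (x - y) <= 2 ^ (i + 1)" using si' by (simp add: s_def)
  hence in_ball: "y \<in> cball x (2 ^ (i + 1) / N) \<inter> sphere 0 1"
   using y N by (simp add: dist_norm pos_le_divide_eq mult.commute)
  have "1 / s ^ d <= (1 / 2 ^ i) ^ d"
   using power_mono[OF si, of d] s by (simp add: power_divide frac_le)
  hence "ennreal (1 / s ^ d) <= ennreal ((1 / 2 ^ i) ^ d) * indicator (cball x (2 ^ (i + 1) / N) \<inter> sphere 0 1) y"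
   using in_ball by (simp add: ennreal_leI)
  also have "... <= (\<Sum>i. ennreal ((1 / 2 ^ i) ^ d) * indicator (cball x (2 ^ (i + 1) / N) \<inter> sphere 0 1) y)"
  proof -
   define h :: "nat => ennreal" where "h = (%i. ennreal ((1 / 2 ^ i) ^ d) * indicator (cball x (2 ^ (i + 1) / N) \<inter> sphere 0 1) y)"
   have "sum h {i} <= suminf h" by (rule sum_le_suminf) (auto intro: summableI)
   hence "h i <= suminf h" by simp
   thus ?thesis unfolding h_def .
  qed
  finally show "ennreal (1 / (1 + N * norm (x - y)) ^ d) <= ..." by (simp add: s_def)
 qed
 also have "... = (\<Sum>i. ennreal ((1 / 2 ^ i) ^ d) * emeasure \<sigma> (cball x (2 ^ (i + 1) / N) \<inter> sphere 0 1))"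
  by (subst nn_integral_suminf) (auto simp: nn_integral_cmult_indicator)
 also have "... <= (\<Sum>i. ennreal (4 ^ d / N ^ (d - 1) * (1 / 2) ^ Suc i))"
 proof (rule suminf_le)
  fix i :: nat
  have "(1 / 2 ^ i) ^ d * measure \<sigma> (cball x (2 ^ (i + 1) / N) \<inter> sphere 0 1)
   <= (1 / 2 ^ i) ^ d * (2 ^ d * (2 ^ (i + 1) / N) ^ (d - 1))"
   unfolding d_def using N by (intro mult_left_mono measure_sphere_cball_le x) auto
  also have "... = 4 ^ d / N ^ (d - 1) * (1 / 2) ^ Suc i"
  proof -
   obtain e where e: "d = Suc e" using d by (cases d) auto
   show ?thesis using N by (simp add: e power_divide power_mult_distrib field_simps)
     (simp add: power_mult_distrib[symmetric] flip: power_mult power_add)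
  qed
  finally show "ennreal ((1 / 2 ^ i) ^ d) * emeasure \<sigma> (cball x (2 ^ (i + 1) / N) \<inter> sphere 0 1)
    <= ennreal (4 ^ d / N ^ (d - 1) * (1 / 2) ^ Suc i)"
   by (simp add: sphere_measure.emeasure_eq_measure ennreal_leI flip: ennreal_mult)
 qed auto
 also have "... = ennreal (4 ^ d / N ^ (d - 1))"
 proof (rule suminf_ennreal_eq)
  show "(%i. 4 ^ d / N ^ (d - 1) * (1 / 2) ^ Suc i) sums (4 ^ d / N ^ (d - 1))"
   using sums_mult[OF power_half_series, of "4 ^ d / N ^ (d - 1)"] by simp
 qed (use N in auto)
 finally show ?thesis by (simp add: d_def)
qed

text \<open>Caps of radius \<open>s / N\<close> about the points are disjoint, have measure about \<open>1 / N ^ (d - 1)\<close>, and the kernel varies on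
 each of them by at most a constant factor. Hence the sum is at most a constant times \<open>N ^ (d - 1)\<close> times the
 integral of the kernel.\<close>

lemma sum_decay_separated:
 assumes "c > 0"
 obtains C where "C > 0"
  "!!(x::'a::euclidean_space) N P. norm x = 1 ==> N >= 1 ==> finite P ==> P \<subseteq> sphere 0 1 ==>
    (!!y z. y \<in> P ==> z \<in> P ==> y ~= z ==> c / N <= norm (y - z)) ==>
    (\<Sum>y\<in>P. 1 / (1 + N * norm (x - y)) ^ DIM('a)) <= C"
proof -
 define d where "d = DIM('a)"
 \<comment> \<open>the caps of radius \<open>s / N\<close> are disjoint as \<open>2 * s < c\<close>, and \<open>s \<le> 1\<close> keeps the kernel comparable on them\<close>
 define s where "s = min 1 (c / 3)"
 have s: "0 < s" "s <= 1" "3 * s <= c" using assms by (auto simp: s_def)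
 define C where "C = 2 ^ d * (4 ^ d * real d / s ^ (d - 1)) * 4 ^ d"
 have d: "d >= 1" by (simp add: d_def Suc_leI)
 show ?thesis
 proof (rule that[of C])
  show "C > 0" using s d by (simp add: C_def)
  fix x :: 'a and N :: real and P :: "'a set"
  assume x: "norm x = 1" and N: "N >= 1" and P: "finite P" "P \<subseteq> sphere 0 1"
   and sep: "!!y z. y \<in> P ==> z \<in> P ==> y ~= z ==> c / N <= norm (y - z)"
  define D where "D = (%y. cball y (s / N) \<inter> sphere (0::'a) 1)"
  have Dm: "D y \<in> sets \<sigma>" for y unfolding D_def by auto
  define g where "g = (%y. 1 / (1 + N * norm (x - y)) ^ d)"
  have gpos: "g y > 0" for y using N by (auto simp: g_def intro!: divide_pos_pos zero_less_power add_pos_nonneg)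
  have disj: "disjoint_family_on D P"
   unfolding disjoint_family_on_def
  proof (intro ballI impI)
   fix y z assume yz: "y \<in> P" "z \<in> P" "y ~= z"
   have "2 * (s / N) < 3 * s / N" using s N by (simp add: divide_strict_right_mono)
   also have "... <= c / N" using s N by (simp add: divide_right_mono)
   also have "... <= dist y z" using sep[OF yz] by (simp add: dist_norm)
   finally have "2 * (s / N) < dist y z" .
   moreover have "dist y z <= 2 * (s / N)" if "u \<in> D y \<inter> D z" for u
    using that dist_triangle[of y z u] by (auto simp: D_def dist_commute)
   ultimately show "D y \<inter> D z = {}" by fastforce
  qed
  have "ennreal (\<Sum>y\<in>P. g y) = (\<Sum>y\<in>P. ennreal (g y))"
   using gpos by (simp add: sum_ennreal less_imp_le)
  also have "... <= (\<Sum>y\<in>P. ennreal (2 ^ d * (4 ^ d * real d / s ^ (d - 1)) * N ^ (d - 1)) * (\<integral>\<^sup>+z. ennreal (g z) * indicator (D y) z \<partial>\<sigma>))"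
  proof (rule sum_mono)
   fix y assume y: "y \<in> P"
   hence ny: "norm y = 1" using P by auto
   have gle: "g y <= 2 ^ d * g z" if "z \<in> D y" for z
   proof -
    have "norm (x - z) <= norm (x - y) + s / N"
     using that norm_triangle_ineq[of "x - y" "y - z"] by (auto simp: D_def dist_norm)
    hence "1 + N * norm (x - z) <= 1 + N * (norm (x - y) + s / N)" using N by simp
    also have "... <= 2 * (1 + N * norm (x - y))"
    proof -
     have "0 <= N * norm (x - y)" using N by simp
     moreover have "N * (norm (x - y) + s / N) = N * norm (x - y) + s" using N by (simp add: distrib_left)
     ultimately show ?thesis using s by (simp only:) argo
    qed
    finally have "(1 + N * norm (x - z)) ^ d <= (2 * (1 + N * norm (x - y))) ^ d"
     using N by (intro power_mono) auto
    thus ?thesis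
     unfolding g_def power_mult_distrib using N
     by (simp add: divide_simps add_pos_nonneg)
   qed
   have sN: "0 < s / N" "s / N <= 1" using s N by (auto simp: divide_le_eq)
   have "(s / N) ^ (d - 1) <= 4 ^ d * real d * measure \<sigma> (D y)"
    unfolding d_def D_def by (rule measure_sphere_cball_ge[OF ny sN])
   hence m: "1 <= (4 ^ d * real d / s ^ (d - 1)) * N ^ (d - 1) * measure \<sigma> (D y)"
    using s N by (simp add: power_divide field_simps)
   have "g y <= g y * ((4 ^ d * real d / s ^ (d - 1)) * N ^ (d - 1) * measure \<sigma> (D y))"
    using mult_left_mono[OF m, of "g y"] gpos[of y] by simp
   hence "ennreal (g y) <= ennreal (g y * ((4 ^ d * real d / s ^ (d - 1)) * N ^ (d - 1) * measure \<sigma> (D y)))"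
    by (rule ennreal_leI)
   also have "... = ennreal ((4 ^ d * real d / s ^ (d - 1)) * N ^ (d - 1)) * (ennreal (g y) * emeasure \<sigma> (D y))"
    using s N gpos[of y] by (simp add: sphere_measure.emeasure_eq_measure flip: ennreal_mult)
   also have "ennreal (g y) * emeasure \<sigma> (D y) = (\<integral>\<^sup>+z. ennreal (g y) * indicator (D y) z \<partial>\<sigma>)"
    using Dm by (simp add: nn_integral_cmult)
   finally have 1: "ennreal (g y) <= ennreal (4 ^ d * real d / s ^ (d - 1) * N ^ (d - 1)) *
     (\<integral>\<^sup>+z. ennreal (g y) * indicator (D y) z \<partial>\<sigma>)" .
   have "(\<integral>\<^sup>+z. ennreal (g y) * indicator (D y) z \<partial>\<sigma>)
     <= (\<integral>\<^sup>+z. ennreal (2 ^ d) * (ennreal (g z) * indicator (D y) z) \<partial>\<sigma>)"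
    using gle gpos by (intro nn_integral_mono) (auto split: split_indicator simp: less_imp_le simp flip: ennreal_mult intro!: ennreal_leI)
   also have "... = ennreal (2 ^ d) * (\<integral>\<^sup>+z. ennreal (g z) * indicator (D y) z \<partial>\<sigma>)"
    using Dm by (intro nn_integral_cmult) (auto simp: g_def)
   finally have "ennreal (g y) <= ennreal (4 ^ d * real d / s ^ (d - 1) * N ^ (d - 1)) *
     (ennreal (2 ^ d) * (\<integral>\<^sup>+z. ennreal (g z) * indicator (D y) z \<partial>\<sigma>))"
    by (intro order_trans[OF 1] mult_left_mono) auto
   also have "... = ennreal (2 ^ d * (4 ^ d * real d / s ^ (d - 1)) * N ^ (d - 1)) *
     (\<integral>\<^sup>+z. ennreal (g z) * indicator (D y) z \<partial>\<sigma>)"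
    unfolding mult.assoc[symmetric] using s N by (subst ennreal_mult[symmetric]) (auto simp: mult_ac)
   finally show "ennreal (g y) <= ..." .
  qed
  also have "... = ennreal (2 ^ d * (4 ^ d * real d / s ^ (d - 1)) * N ^ (d - 1)) * (\<integral>\<^sup>+z. (\<Sum>y\<in>P. ennreal (g z) * indicator (D y) z) \<partial>\<sigma>)"
   using Dm by (subst nn_integral_sum) (auto simp: g_def sum_distrib_left)
  also have "(\<integral>\<^sup>+z. (\<Sum>y\<in>P. ennreal (g z) * indicator (D y) z) \<partial>\<sigma>) <= (\<integral>\<^sup>+z. ennreal (g z) \<partial>\<sigma>)"
  proof (rule nn_integral_mono)
   fix z
   have "(\<Sum>y\<in>P. ennreal (g z) * indicator (D y) z) = ennreal (g z) * (\<Sum>y\<in>P. indicator (D y) z)"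
    by (simp add: sum_distrib_left)
   also have "(\<Sum>y\<in>P. indicator (D y) z) = (indicator (\<Union>y\<in>P. D y) z :: ennreal)"
    by (rule indicator_UN_disjoint[symmetric]) (use P disj in auto)
   also have "ennreal (g z) * ... <= ennreal (g z)" by (auto split: split_indicator)
   finally show "(\<Sum>y\<in>P. ennreal (g z) * indicator (D y) z) <= ennreal (g z)" .
  qed
  also have "(\<integral>\<^sup>+z. ennreal (g z) \<partial>\<sigma>) <= ennreal (4 ^ d / N ^ (d - 1))"
   unfolding g_def d_def by (rule nn_integral_decay) (use x N in auto)
  also have "ennreal (2 ^ d * (4 ^ d * real d / s ^ (d - 1)) * N ^ (d - 1)) * ennreal (4 ^ d / N ^ (d - 1)) = ennreal C"
   using s N by (simp add: C_def flip: ennreal_mult)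
  finally show "(\<Sum>y\<in>P. 1 / (1 + N * norm (x - y)) ^ DIM('a)) <= C"
   using s by (simp add: g_def d_def C_def mult_left_mono)
 qed
qed

section \<open>Integration by parts\<close>

text \<open>All difference quotients have integral \<open>0\<close> by translation invariance, and they converge dominatedly.\<close>

lemma integral_derivative_eq_0:
 fixes V :: "'a::euclidean_space => real"
 assumes V': "!!x. (V has_derivative V' x) (at x)"
  and cont: "continuous_on UNIV (%x. V' x b)"
  and supp: "!!x. norm x > R ==> V x = 0"
  and b: "norm b = 1"
 shows "integrable lborel (%x. V' x b)" "(\<integral>x. V' x b \<partial>lborel) = 0"
proof -
 have contV: "continuous_on UNIV V"
  using V' has_derivative_continuous continuous_at_imp_continuous_on by blast
 have meas [measurable]: "V \<in> borel_measurable borel" "(%x. V' x b) \<in> borel_measurable borel"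
  using contV cont borel_measurable_continuous_onI by blast+
 have "compact ((%x. V' x b) ` cball 0 (R + 2))"
  by (intro compact_continuous_image continuous_on_subset[OF cont]) auto
 then obtain K where K: "!!x. x \<in> cball 0 (R + 2) ==> \<bar>V' x b\<bar> <= K"
  by (force dest!: compact_imp_bounded simp: bounded_iff)
 have "compact (V ` cball 0 R)"
  by (intro compact_continuous_image continuous_on_subset[OF contV]) auto
 then obtain L where L: "!!x. x \<in> cball 0 R ==> \<bar>V x\<bar> <= L"
  by (force dest!: compact_imp_bounded simp: bounded_iff)
 have fin: "integrable lborel (%x::'a. c * indicator (cball 0 r) x)" for c r :: real
  using emeasure_lborel_cball_finite by (intro integrable_mult_right integrable_real_indicator) auto
 have intV: "integrable lborel V"
 proof (rule Bochner_Integration.integrable_bound[OF fin[of L R]])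
  show "AE x in lborel. norm (V x) <= norm (L * indicator (cball 0 R) x)"
  proof (rule AE_I2)
   fix x show "norm (V x) <= norm (L * indicator (cball 0 R) x)"
    using L[of x] supp[of x] by (cases "norm x <= R") auto
  qed
 qed simp
 define h where "h = (%n. 1 / real (Suc n))"
 have h: "0 < h n" "h n <= 1" for n by (simp_all add: h_def)
 define D where "D = (%n x. (V (x + h n *\<^sub>R b) - V x) / h n)"
 have D_le: "\<bar>D n x\<bar> <= \<bar>K\<bar> * indicator (cball 0 (R + 1)) x" for n x
 proof (cases "norm x <= R + 1")
  case True
  have "\<exists>t>0. t < h n \<and> V (x + h n *\<^sub>R b) - V (x + 0 *\<^sub>R b) = (h n - 0) * V' (x + t *\<^sub>R b) b"
  proof (rule MVT2[OF h(1)])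
   fix t :: real
   have "((%t. V (x + t *\<^sub>R b)) has_derivative (%s. V' (x + t *\<^sub>R b) (s *\<^sub>R b))) (at t)"
    by (rule has_derivative_compose[OF _ V']) (auto intro!: derivative_eq_intros)
   moreover have "V' (x + t *\<^sub>R b) (s *\<^sub>R b) = V' (x + t *\<^sub>R b) b * s" for s
    using linear_scale[OF has_derivative_linear[OF V']] by (simp add: mult.commute)
   ultimately show "((%t. V (x + t *\<^sub>R b)) has_real_derivative V' (x + t *\<^sub>R b) b) (at t)"
    by (simp add: has_field_derivative_def)
  qed
  then obtain t where t: "0 < t" "t < h n" "V (x + h n *\<^sub>R b) - V x = h n * V' (x + t *\<^sub>R b) b" by auto
  have "norm (x + t *\<^sub>R b) <= norm x + t" using norm_triangle_ineq[of x "t *\<^sub>R b"] t b by simp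
  hence "\<bar>V' (x + t *\<^sub>R b) b\<bar> <= K" using True t h[of n] by (intro K) auto
  thus ?thesis using t h[of n] True by (simp add: D_def)
 next
  case False
  have "norm x <= norm (x + h n *\<^sub>R b) + h n"
   using norm_triangle_ineq4[of "x + h n *\<^sub>R b" "h n *\<^sub>R b"] b h[of n] by simp
  thus ?thesis using False h[of n] by (simp add: D_def supp)
 qed
 have D_lim: "(%n. D n x) \<longlonglongrightarrow> V' x b" for x
 proof -
  have "((%t. V (x + t *\<^sub>R b)) has_derivative (%s. V' (x + 0 *\<^sub>R b) (s *\<^sub>R b))) (at 0)"
   by (rule has_derivative_compose[OF _ V']) (auto intro!: derivative_eq_intros)
  moreover have "V' x (s *\<^sub>R b) = V' x b * s" for s
   using linear_scale[OF has_derivative_linear[OF V']] by (simp add: mult.commute)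
  ultimately have "((%t. V (x + t *\<^sub>R b)) has_real_derivative V' x b) (at 0)"
   by (simp add: has_field_derivative_def)
  hence "((%t. (V (x + t *\<^sub>R b) - V x) / t) \<longlongrightarrow> V' x b) (at 0)"
   by (simp add: has_field_derivative_iff)
  moreover have "filterlim h (at 0) sequentially"
   unfolding filterlim_at h_def using LIMSEQ_inverse_real_of_nat by (auto simp: inverse_eq_divide)
  ultimately show ?thesis unfolding D_def by (rule filterlim_compose)
 qed
 have D_int: "(\<integral>x. D n x \<partial>lborel) = 0" for n
 proof -
  have eq: "distr lborel borel ((+) (h n *\<^sub>R b)) = (lborel :: 'a measure)" by (rule lborel_distr_plus)
  have i: "integrable lborel (%x. V (h n *\<^sub>R b + x))"
   using intV by (subst (asm) eq[symmetric]) (simp add: integrable_distr_eq)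
  have "(\<integral>x. V x \<partial>lborel) = (\<integral>x. V (h n *\<^sub>R b + x) \<partial>lborel)"
   by (subst eq[symmetric]) (simp add: integral_distr)
  thus ?thesis using i intV by (simp add: D_def add.commute)
 qed
 have conv: "integrable lborel (%x. V' x b)" "(%n. \<integral>x. D n x \<partial>lborel) \<longlonglongrightarrow> (\<integral>x. V' x b \<partial>lborel)"
  by (rule integrable_dominated_convergence[where s=D and w="%x. \<bar>K\<bar> * indicator (cball 0 (R + 1)) x"]
    integral_dominated_convergence[where s=D and w="%x. \<bar>K\<bar> * indicator (cball 0 (R + 1)) x"];
   use D_le D_lim fin in \<open>simp add: D_def[abs_def]\<close>)+
 show "integrable lborel (%x. V' x b)" by (rule conv(1))
 show "(\<integral>x. V' x b \<partial>lborel) = 0" using LIMSEQ_unique[OF conv(2)] unfolding D_int by simp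
qed

lemma integral_divergence_eq_0:
 fixes V :: "'a::euclidean_space => 'a"
 assumes V': "!!x. (V has_derivative V' x) (at x)"
  and cont: "!!b. b \<in> Basis ==> continuous_on UNIV (%x. V' x b)"
  and supp: "!!x. norm x > R ==> V x = 0"
 shows "integrable lborel (%x. \<Sum>b\<in>Basis. V' x b \<bullet> b)" "(\<integral>x. (\<Sum>b\<in>Basis. V' x b \<bullet> b) \<partial>lborel) = 0"
proof -
 have *: "integrable lborel (%x. V' x b \<bullet> b)" "(\<integral>x. V' x b \<bullet> b \<partial>lborel) = 0" if b: "b \<in> Basis" for b
  by (rule integral_derivative_eq_0[where V="%x. V x \<bullet> b" and V'="%x v. V' x v \<bullet> b" and R=R];
   use b in \<open>auto intro!: derivative_eq_intros V' continuous_intros cont simp: supp\<close>)+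
 show "integrable lborel (%x. \<Sum>b\<in>Basis. V' x b \<bullet> b)" by (intro Bochner_Integration.integrable_sum *)
 show "(\<integral>x. (\<Sum>b\<in>Basis. V' x b \<bullet> b) \<partial>lborel) = 0" by (simp add: *)
qed

text \<open>The square of this weight is continuously differentiable on the whole space, with gradient \<open>- 4 * bump w *\<^sub>R w\<close>. After
 multiplication by it, a vector field on the ball has compact support and the divergence theorem has no boundary term.\<close>

definition bump :: "'a::euclidean_space => real" where
 "bump w = max 0 (1 - w \<bullet> w)"

lemma bump_bounds: "0 <= bump w" "bump w <= 1" "norm w >= 1 ==> bump w = 0"
proof -
 show "bump w = 0" if "norm w >= 1"
  using one_le_power[OF that, of 2] by (simp add: bump_def power2_norm_eq_inner)
qed (auto simp: bump_def)

lemma continuous_bump [continuous_intros]: "continuous_on S f ==> continuous_on S (%w. bump (f w))"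
 unfolding bump_def by (intro continuous_intros)

lemma bump_measurable [measurable]: "bump \<in> borel_measurable borel"
 by (intro borel_measurable_continuous_onI continuous_bump continuous_on_id)

lemma has_derivative_bump_square:
 "((%w. (bump w)\<^sup>2) has_derivative (%v. - 4 * bump w * (w \<bullet> v))) (at (w :: 'a::euclidean_space))"
proof -
 have "((%t. (max 0 t)\<^sup>2) has_real_derivative 2 * max 0 t) (at t)" for t :: real
 proof -
  consider "t > 0" | "t < 0" | "t = 0" by linarith
  thus ?thesis
  proof cases
   case 1
   have "((%t. t\<^sup>2) has_real_derivative 2 * t) (at t)" by (auto intro!: derivative_eq_intros)
   thus ?thesis
    using 1 by (auto intro: has_field_derivative_transform_within_open[of _ _ _ "{0<..}"])
  next
   case 2
   have "((%t. 0) has_real_derivative 0) (at t)" by simp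
   hence "((%t. (max 0 t)\<^sup>2) has_real_derivative 0) (at t)"
    by (rule has_field_derivative_transform_within_open[of _ _ _ "{..<0}"]) (use 2 in auto)
   thus ?thesis using 2 by simp
  next
   case 3
   have "((%t::real. (max 0 t)\<^sup>2 / t) \<longlongrightarrow> 0) (at 0)"
   proof (rule tendsto_rabs_zero_cancel, rule tendsto_sandwich[where f="%_. 0" and h="%t. \<bar>t\<bar>"])
    show "\<forall>\<^sub>F t in at (0::real). \<bar>(max 0 t)\<^sup>2 / t\<bar> <= \<bar>t\<bar>"
     by (rule always_eventually) (auto simp: max_def power2_eq_square)
    show "((%t::real. \<bar>t\<bar>) \<longlongrightarrow> 0) (at 0)" by (intro tendsto_rabs_zero tendsto_ident_at)
   qed auto
   thus ?thesis using 3 by (simp add: has_field_derivative_iff)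
  qed
 qed
 note sq = this[of "1 - w \<bullet> w", unfolded has_field_derivative_def]
 have "((%w. 1 - w \<bullet> w) has_derivative (%v. - 2 * (w \<bullet> v))) (at w)"
  by (auto intro!: derivative_eq_intros simp: inner_commute)
 from has_derivative_compose[OF this sq] show ?thesis
  unfolding bump_def by (rule has_derivative_eq_rhs) (simp add: fun_eq_iff)
qed

lemma integral_unif_ball:
 fixes f :: "'a::euclidean_space => real"
 assumes [measurable]: "f \<in> borel_measurable borel"
 shows "(\<integral>w. f w \<partial>unif_ball) = (\<integral>w. indicator (ball 0 1) w * f w \<partial>lborel) / measure lborel (ball (0::'a) 1)"
proof -
 have v: "measure lborel (ball (0::'a) 1) > 0" by (simp add: content_ball_pos)
 have [measurable]: "ball (0::'a) 1 \<in> sets borel" by (intro borel_open open_ball)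
 have eq: "indicator (ball 0 1) (w::'a) / emeasure lborel (ball (0::'a) 1) =
   ennreal (indicator (ball 0 1) w / measure lborel (ball (0::'a) 1))" for w
  using v by (simp add: emeasure_unit_ball divide_ennreal split: split_indicator flip: ennreal_1)
 show ?thesis
  unfolding unif_ball_def uniform_measure_def eq using v
  by (subst integral_density) auto
qed

lemma integrable_unif_ball_continuous:
 assumes "continuous_on UNIV (f :: 'a::euclidean_space => real)"
 shows "integrable unif_ball f"
proof -
 have [measurable]: "f \<in> borel_measurable borel" using assms by (rule borel_measurable_continuous_onI)
 have "compact (f ` cball 0 1)"
  by (intro compact_continuous_image continuous_on_subset[OF assms]) auto
 then obtain K where K: "!!x. x \<in> cball 0 1 ==> \<bar>f x\<bar> <= K"
  by (force dest!: compact_imp_bounded simp: bounded_iff)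
 have "AE w in unif_ball. norm (f w) <= K"
  unfolding unif_ball_def by (rule AE_uniform_measureI) (auto intro!: K)
 thus ?thesis by (intro unif_ball.integrable_const_bound) auto
qed

lemma AE_unif_ball_less_1: "AE w in (unif_ball :: 'a::euclidean_space measure). norm w < 1"
 unfolding unif_ball_def by (rule AE_uniform_measureI) auto

lemma integral_unif_ball_pos:
 fixes f :: "'a::euclidean_space => real"
 assumes f: "continuous_on UNIV f" "!!w. 0 <= f w" and pos: "!!w. 0 < norm w ==> norm w < 1 ==> 0 < f w"
 shows "(\<integral>w. f w \<partial>unif_ball) > 0"
proof -
 have "(\<integral>w. f w \<partial>unif_ball) ~= 0"
 proof
  assume "(\<integral>w. f w \<partial>unif_ball) = 0"
  hence "AE w in unif_ball. f w = 0"
   using integral_nonneg_eq_0_iff_AE[OF integrable_unif_ball_continuous[OF f(1)] AE_I2[OF f(2)]] by blast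
  hence "AE w in (unif_ball :: 'a measure). False"
   using AE_unif_ball_ne0 AE_unif_ball_less_1
  proof eventually_elim
   case (elim w)
   thus False using pos[of w] by simp
  qed
  thus False by (simp add: unif_ball.AE_False)
 qed
 moreover have "(\<integral>w. f w \<partial>unif_ball) >= 0" by (simp add: f(2))
 ultimately show ?thesis by simp
qed

lemma bump_pos: "norm w < 1 ==> bump w > 0"
 using power_strict_mono[of "norm w" 1 2] by (simp add: bump_def power2_norm_eq_inner)

lemma bump_average_pos: "(\<integral>w. bump w \<partial>(unif_ball::'a::euclidean_space measure)) > 0"
 by (rule integral_unif_ball_pos) (auto intro!: continuous_intros bump_pos simp: bump_bounds)

section \<open>Zonal harmonics\<close>

text \<open>The zonal harmonic with pole \<open>x\<close> as a homogeneous harmonic polynomial of degree \<open>k\<close>.\<close>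

definition zsol :: "nat => 'a::euclidean_space => 'a => real" where
 "zsol k x w = (2 * real k + real DIM('a) - 2) / (real DIM('a) - 2) *
   sol ((real DIM('a) - 2) / 2) (int k) (x \<bullet> w) (w \<bullet> w)"

lemma continuous_zsol [continuous_intros]:
 "continuous_on S f ==> continuous_on S g ==> continuous_on S (%w. zsol k (f w) (g w))"
 unfolding zsol_def by (intro continuous_intros)

lemma zsol_scale: "zsol k x (t *\<^sub>R w) = t ^ k * zsol k x w"
 unfolding zsol_def by (subst sol_scale) auto

lemma zsol_sphere: "norm w = 1 ==> zsol k x (w :: 'a::euclidean_space) = zonal DIM('a) k (x \<bullet> w)"
 by (simp add: zsol_def zonal_def sol_def solid_1 norm_eq_1)

lemma zsol_measurable [measurable]: "zsol k x \<in> borel_measurable borel"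
 by (intro borel_measurable_continuous_onI continuous_intros)

text \<open>Green's identity on the ball: for homogeneous harmonic \<open>u\<close> and \<open>v\<close> the divergence of \<open>(bump w)\<^sup>2\<close> times
 \<open>u \<nabla>v - v \<nabla>u\<close> is \<open>- 4 * (m - k) * bump w * u * v\<close> by Euler's identity. Polar coordinates then split off the integral
 over the sphere.\<close>

lemma zsol_orthogonal:
 fixes x z :: "'a::euclidean_space"
 assumes x: "norm x = 1" and z: "norm z = 1" and k: "k ~= m"
 shows "(\<integral>y. zsol k x y * zsol m z y \<partial>\<sigma>) = 0"
proof -
 let ?r = "%w::'a. max 0 (1 - (norm w)\<^sup>2) * norm w ^ (k + m)"
 define l where "l = (real DIM('a) - 2) / 2"
 have l: "2 * (l + 1) = real DIM('a)" by (simp add: l_def field_simps)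
 define u where "u = (%w. sol l (int k) (x \<bullet> w) (w \<bullet> w))"
 define v where "v = (%w. sol l (int m) (z \<bullet> w) (w \<bullet> w))"
 define V where "V = (%w. (bump w)\<^sup>2 *\<^sub>R (u w *\<^sub>R sol_grad l m z w - v w *\<^sub>R sol_grad l k x w))"
 define V' where "V' = (%w b. (bump w)\<^sup>2 *\<^sub>R ((u w *\<^sub>R sol_hess l m z w b + (b \<bullet> sol_grad l k x w) *\<^sub>R sol_grad l m z w)
    - (v w *\<^sub>R sol_hess l k x w b + (b \<bullet> sol_grad l m z w) *\<^sub>R sol_grad l k x w))
   + (- 4 * bump w * (w \<bullet> b)) *\<^sub>R (u w *\<^sub>R sol_grad l m z w - v w *\<^sub>R sol_grad l k x w))"
 have u': "(u has_derivative (%b. b \<bullet> sol_grad l k x w)) (at w)" for w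
  unfolding u_def by (rule has_derivative_sol_inner)
 have v': "(v has_derivative (%b. b \<bullet> sol_grad l m z w)) (at w)" for w
  unfolding v_def by (rule has_derivative_sol_inner)
 have VV': "(V has_derivative V' w) (at w)" for w
  unfolding V_def V'_def
  by (intro has_derivative_scaleR has_derivative_diff has_derivative_sol_grad has_derivative_bump_square u' v')
 have cont: "continuous_on UNIV (%w. V' w b)" for b
  unfolding V'_def u_def v_def by (intro continuous_intros)
 have supp: "V w = 0" if "norm w > 1" for w using that by (simp add: V_def bump_bounds)
 have e: "(\<Sum>b\<in>Basis. (b \<bullet> g) * (h \<bullet> b)) = h \<bullet> g" for h g :: 'a
  by (subst euclidean_inner) (simp add: inner_commute mult.commute)
 have e': "(\<Sum>b\<in>Basis. (g \<bullet> b) * (h \<bullet> b)) = h \<bullet> g" for h g :: 'a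
  by (subst euclidean_inner) (simp add: mult.commute)
 have tr: "(\<Sum>b\<in>Basis. V' w b \<bullet> b) = - 4 * (real m - real k) * (bump w * (u w * v w))" for w
 proof -
  define G1 where "G1 = sol_grad l (int k) x w"
  define G2 where "G2 = sol_grad l (int m) z w"
  have "V' w b \<bullet> b = (bump w)\<^sup>2 * (u w * (sol_hess l m z w b \<bullet> b)) + (bump w)\<^sup>2 * ((b \<bullet> G1) * (G2 \<bullet> b))
   - (bump w)\<^sup>2 * (v w * (sol_hess l k x w b \<bullet> b)) - (bump w)\<^sup>2 * ((b \<bullet> G2) * (G1 \<bullet> b))
   - 4 * bump w * u w * ((w \<bullet> b) * (G2 \<bullet> b)) + 4 * bump w * v w * ((w \<bullet> b) * (G1 \<bullet> b))" for b
   unfolding V'_def G1_def[symmetric] G2_def[symmetric] inner_add_left inner_diff_left inner_scaleR_left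
   by (simp add: algebra_simps)
  hence "(\<Sum>b\<in>Basis. V' w b \<bullet> b) = (bump w)\<^sup>2 * (u w * (\<Sum>b\<in>Basis. sol_hess l m z w b \<bullet> b)) + (bump w)\<^sup>2 * (G2 \<bullet> G1)
   - (bump w)\<^sup>2 * (v w * (\<Sum>b\<in>Basis. sol_hess l k x w b \<bullet> b)) - (bump w)\<^sup>2 * (G1 \<bullet> G2)
   - 4 * bump w * u w * (G2 \<bullet> w) + 4 * bump w * v w * (G1 \<bullet> w)"
   by (simp only: sum.distrib sum_subtractf sum_distrib_left[symmetric] e e')
  also have "... = - 4 * (real m - real k) * (bump w * (u w * v w))"
   unfolding sol_hess_trace[OF x l] sol_hess_trace[OF z l]
   using inner_sol_grad[of w l m z] inner_sol_grad[of w l k x]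
   by (simp add: inner_commute u_def v_def G1_def G2_def algebra_simps)
  finally show ?thesis .
 qed
 have "(\<integral>w. - 4 * (real m - real k) * (bump w * (u w * v w)) \<partial>lborel) = 0"
  using integral_divergence_eq_0(2)[OF VV' cont supp] unfolding tr .
 hence 0: "(\<integral>w. bump w * (u w * v w) \<partial>lborel) = 0" using k by simp
 have cuv: "continuous_on UNIV u" "continuous_on UNIV v" unfolding u_def v_def by (intro continuous_intros)+
 have [measurable]: "u \<in> borel_measurable borel" "v \<in> borel_measurable borel"
  using cuv by (auto intro: borel_measurable_continuous_onI)
 have ind: "indicator (ball 0 1) w * (bump w * (u w * v w)) = bump w * (u w * v w)" for w
  by (auto simp: bump_bounds split: split_indicator)
 have "(\<integral>w. bump w * (u w * v w) \<partial>unif_ball) = 0"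
  by (subst integral_unif_ball) (use 0 in \<open>auto simp: ind\<close>)
 moreover have "bump w * (u w * v w) = (?r w) * (u (sgn w) * v (sgn w))" for w
 proof -
  have w: "norm w *\<^sub>R sgn w = w" by (cases "w = 0") (simp_all add: sgn_div_norm)
  have "u w = norm w ^ k * u (sgn w)" "v w = norm w ^ m * v (sgn w)"
   using sol_scale[of "int k" l x "norm w" "sgn w"] sol_scale[of "int m" l z "norm w" "sgn w"]
   unfolding w u_def v_def by simp_all
  thus ?thesis by (simp only: bump_def power2_norm_eq_inner power_add mult_ac)
 qed
 ultimately have "0 = (\<integral>w. (?r w) * (u (sgn w) * v (sgn w)) \<partial>unif_ball)" by simp
 also have "... = (\<integral>w. ?r w \<partial>(unif_ball :: 'a measure)) * (\<integral>y. u y * v y \<partial>\<sigma>)"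
 proof (rule integral_polar)
  show "integrable unif_ball (%w::'a. ?r w)"
   by (intro integrable_unif_ball_continuous continuous_intros)
  have "compact ((%w. u w * v w) ` cball 0 1)"
   by (intro compact_continuous_image continuous_on_subset[OF continuous_on_mult[OF cuv]]) auto
  then obtain K where K: "!!x. x \<in> cball 0 1 ==> \<bar>u x * v x\<bar> <= K"
   by (force dest!: compact_imp_bounded simp: bounded_iff)
  show "integrable unif_ball (%w. u (sgn w) * v (sgn w))"
   by (rule unif_ball.integrable_const_bound[where B=K]) (auto intro!: K AE_I2 simp: norm_sgn)
 qed auto
 finally have "(\<integral>w. ?r w \<partial>(unif_ball :: 'a measure)) * (\<integral>y. u y * v y \<partial>\<sigma>) = 0" by simp
 moreover have "(\<integral>w. ?r w \<partial>(unif_ball :: 'a measure)) > 0"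
 proof (rule integral_unif_ball_pos)
  show "continuous_on UNIV (%w::'a. ?r w)" by (intro continuous_intros)
  show "0 < ?r w" if "0 < norm w" "norm w < 1" for w :: 'a
   using bump_pos[OF that(2)] that by (simp add: bump_def power2_norm_eq_inner)
 qed simp
 ultimately have "(\<integral>y. u y * v y \<partial>\<sigma>) = 0" by simp
 thus ?thesis unfolding zsol_def u_def v_def l_def by (simp add: mult_ac mult.left_commute[of "sol _ _ _ _"])
qed

lemma prob_sphere [simp]: "measure \<sigma> (sphere (0::'a::euclidean_space) 1) = 1"
 using sphere_measure.prob_space[where 'a='a] by simp

lemma abs_zonal_le:
 assumes "d >= 3" "\<bar>t\<bar> <= 1"
 shows "\<bar>zonal d k t\<bar> <= 2 * (real k + 1) ^ (d - 2)"
proof -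
 have g: "\<bar>gegenbauer (real (d - 2) / 2) k t\<bar> <= (real k + 1) ^ (d - 3)"
  using abs_gegenbauer_half_le[of "d - 2" t k] assms by simp
 have f: "(2 * real k + real d - 2) / (real d - 2) <= 2 * (real k + 1)"
 proof -
  have "2 * real k * 1 <= 2 * real k * (real d - 2)" using assms by (intro mult_left_mono) auto
  thus ?thesis using assms by (simp add: divide_le_eq algebra_simps)
 qed
 have "\<bar>zonal d k t\<bar> = (2 * real k + real d - 2) / (real d - 2) * \<bar>gegenbauer (real (d - 2) / 2) k t\<bar>"
  using assms by (simp add: zonal_def abs_mult of_nat_diff)
 also have "... <= (2 * (real k + 1)) * (real k + 1) ^ (d - 3)"
  using assms by (intro mult_mono f g) auto
 also have "... = 2 * (real k + 1) ^ (d - 2)"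
 proof -
  obtain e where "d = e + 3" using assms(1) by (metis add.commute le_Suc_ex)
  thus ?thesis by simp
 qed
 finally show ?thesis .
qed

text \<open>This is the generating function at \<open>t = x \<bullet> y\<close>, because \<open>|r x - y|\<^sup>2 = 1 - 2 * t * r + r\<^sup>2\<close>.\<close>

lemma poisson_sums:
 fixes x y :: "'a::euclidean_space"
 assumes d: "DIM('a) >= 3" and xy: "norm x = 1" "norm y = 1" and r: "0 <= r" "r < 1"
 shows "(%k. zonal DIM('a) k (x \<bullet> y) * r ^ k) sums poisson (r *\<^sub>R x) y"
proof -
 have t: "\<bar>x \<bullet> y\<bar> <= 1" by (rule abs_inner_sphere_le[OF xy])
 have "norm (r *\<^sub>R x - y) ^ DIM('a) = (1 - 2 * (x \<bullet> y) * r + r\<^sup>2) powr (real DIM('a) / 2)"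
 proof -
  have ne: "r *\<^sub>R x - y ~= 0"
  proof
   assume "r *\<^sub>R x - y = 0"
   hence "norm (r *\<^sub>R x) = norm y" by simp
   thus False using xy r by simp
  qed
  have "(norm (r *\<^sub>R x - y))\<^sup>2 = 1 - 2 * (x \<bullet> y) * r + r\<^sup>2"
   using xy unfolding power2_norm_eq_inner by (simp add: norm_eq_1 inner_diff_left inner_diff_right inner_commute power2_eq_square)
  moreover have "norm (r *\<^sub>R x - y) ^ DIM('a) = norm (r *\<^sub>R x - y) powr (2 * (real DIM('a) / 2))"
   using ne by (simp add: powr_realpow)
  moreover have "... = (norm (r *\<^sub>R x - y) powr 2) powr (real DIM('a) / 2)" by (simp only: powr_powr)
  moreover have "norm (r *\<^sub>R x - y) powr 2 = (norm (r *\<^sub>R x - y))\<^sup>2" using ne by (subst powr_numeral) auto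
  ultimately show ?thesis by metis
 qed
 moreover have "norm (r *\<^sub>R x) = r" using xy r by simp
 ultimately show ?thesis using zonal_generating_function[OF d t r] by (simp add: poisson_def)
qed

lemma integrable_sphere_continuous:
 fixes f :: "'a::euclidean_space => 'b::{banach, second_countable_topology}"
 assumes "continuous_on UNIV f"
 shows "integrable \<sigma> f"
proof -
 have [measurable]: "f \<in> borel_measurable borel" using assms by (rule borel_measurable_continuous_onI)
 have "compact (f ` sphere 0 1)"
  by (intro compact_continuous_image continuous_on_subset[OF assms]) auto
 then obtain K where K: "!!x. x \<in> sphere 0 1 ==> norm (f x) <= K"
  by (force dest!: compact_imp_bounded simp: bounded_iff)
 show ?thesis by (rule sphere_measure.integrable_const_bound[where B=K]) (auto intro!: K AE_I2)
qed

lemma poisson_nonneg: "norm z <= 1 ==> poisson z y >= 0"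
 by (auto simp: poisson_def power_le_one intro!: divide_nonneg_nonneg)

text \<open>Termwise integration of the expansion of the Poisson kernel; orthogonality leaves the term of degree \<open>m\<close>.\<close>

lemma poisson_integral_zsol:
 fixes x z :: "'a::euclidean_space"
 assumes d: "DIM('a) >= 3" and xz: "norm x = 1" "norm z = 1" and r: "0 <= r" "r < 1"
 shows "integrable \<sigma> (%y. poisson (r *\<^sub>R x) y * zsol m z y)"
  and "(\<integral>y. poisson (r *\<^sub>R x) y * zsol m z y \<partial>\<sigma>) = r ^ m * (\<integral>y. zsol m x y * zsol m z y \<partial>\<sigma>)"
proof -
 let ?B = "%k. 2 * (real k + 1) ^ (DIM('a) - 2) * r ^ k * (2 * (real m + 1) ^ (DIM('a) - 2))"
 define f where "f = (%k y. r ^ k * (zsol k x y * zsol m z y))"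
 have int: "integrable \<sigma> (f k)" for k
  unfolding f_def by (intro integrable_sphere_continuous continuous_intros)
 have bnd: "norm (f k y) <= ?B k" if "y \<in> sphere 0 1" for k y
 proof -
  have y: "norm y = 1" using that by simp
  have "\<bar>zsol k x y\<bar> <= 2 * (real k + 1) ^ (DIM('a) - 2)" "\<bar>zsol m z y\<bar> <= 2 * (real m + 1) ^ (DIM('a) - 2)"
   unfolding zsol_sphere[OF y] by (intro abs_zonal_le d abs_inner_sphere_le xz y)+
  hence "\<bar>zsol k x y\<bar> * \<bar>zsol m z y\<bar> * r ^ k <= 2 * (real k + 1) ^ (DIM('a) - 2) * (2 * (real m + 1) ^ (DIM('a) - 2)) * r ^ k"
   using r by (intro mult_mono) auto
  thus ?thesis using r by (simp add: f_def abs_mult mult_ac)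
 qed
 have sm: "summable (%k. ?B k)"
  unfolding mult.assoc using r by (intro summable_mult summable_mult2) (simp add: mult.assoc[symmetric] summable_mult2 summable_power_mult_geometric)
 have AE: "AE y in sphere_measure. summable (%k. norm (f k y))"
 proof (rule AE_I2, rule summable_comparison_test[OF _ sm], intro exI[of _ 0] allI impI)
  fix y :: 'a and k assume "y \<in> space \<sigma>"
  thus "norm (norm (f k y)) <= ?B k"
   using bnd[of y k] by simp
 qed
 have smi: "summable (%k. \<integral>y. norm (f k y) \<partial>\<sigma>)"
 proof (rule summable_comparison_test[OF _ sm], intro exI[of _ 0] allI impI)
  fix k
  have "(\<integral>y. norm (f k y) \<partial>\<sigma>) <= (\<integral>y. ?B k \<partial>(\<sigma> :: 'a measure))"
   by (rule integral_mono) (use bnd in \<open>auto intro!: integrable_norm int simp del: real_norm_def\<close>)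
  thus "norm (\<integral>y. norm (f k y) \<partial>\<sigma>) <= ?B k"
   by (simp add: sphere_measure.prob_space)
 qed
 have eq: "(\<Sum>k. f k y) = poisson (r *\<^sub>R x) y * zsol m z y" if "y \<in> sphere 0 1" for y
 proof -
  have y: "norm y = 1" using that by simp
  have "(%k. zonal DIM('a) k (x \<bullet> y) * r ^ k * zsol m z y) sums (poisson (r *\<^sub>R x) y * zsol m z y)"
   by (intro sums_mult2 poisson_sums d xz y r)
  from sums_unique[OF this] show ?thesis by (simp add: f_def zsol_sphere[OF y] mult_ac)
 qed
 show "integrable \<sigma> (%y. poisson (r *\<^sub>R x) y * zsol m z y)"
  using integrable_suminf[OF int AE smi] by (rule Bochner_Integration.integrable_cong[THEN iffD1, rotated -1]) (auto simp: eq)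
 have "(\<integral>y. poisson (r *\<^sub>R x) y * zsol m z y \<partial>\<sigma>) = (\<integral>y. (\<Sum>k. f k y) \<partial>\<sigma>)"
  by (rule Bochner_Integration.integral_cong) (auto simp: eq)
 also have "... = (\<Sum>k. \<integral>y. f k y \<partial>\<sigma>)"
  by (rule integral_suminf[OF int AE smi])
 also have "(%k. \<integral>y. f k y \<partial>\<sigma>) = (%k. if k = m then r ^ m * (\<integral>y. zsol m x y * zsol m z y \<partial>\<sigma>) else 0)"
  by (auto simp: f_def zsol_orthogonal[OF xz])
 also have "suminf ... = r ^ m * (\<integral>y. zsol m x y * zsol m z y \<partial>\<sigma>)"
  by (rule sums_unique[symmetric]) (rule sums_single)
 finally show "(\<integral>y. poisson (r *\<^sub>R x) y * zsol m z y \<partial>\<sigma>) = r ^ m * (\<integral>y. zsol m x y * zsol m z y \<partial>\<sigma>)" .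
qed

lemma zsol_0 [simp]: "DIM('a) >= 3 ==> zsol 0 (x::'a::euclidean_space) w = 1"
 by (simp add: zsol_def sol_def)

lemma poisson_integral:
 fixes x :: "'a::euclidean_space"
 assumes d: "DIM('a) >= 3" and x: "norm x = 1" and r: "0 <= r" "r < 1"
 shows "integrable \<sigma> (poisson (r *\<^sub>R x))" "(\<integral>y. poisson (r *\<^sub>R x) y \<partial>\<sigma>) = 1"
 using poisson_integral_zsol[OF d x x r, of 0] d by (simp_all add: sphere_measure.prob_space)

text \<open>The Poisson kernels are an approximate identity. Testing them against \<open>zsol m z\<close> turns orthogonality into the
 reproducing property.\<close>

lemma zsol_reproducing:
 fixes x z :: "'a::euclidean_space"
 assumes d: "DIM('a) >= 3" and xz: "norm x = 1" "norm z = 1"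
 shows "(\<integral>y. zsol k x y * zsol m z y \<partial>\<sigma>) = (if k = m then zsol k z x else 0)"
proof -
 define F where "F = (\<integral>y. zsol m x y * zsol m z y \<partial>\<sigma>)"
 define g where "g = zsol m z"
 have cg: "continuous_on UNIV g" unfolding g_def by (intro continuous_intros)
 have ig: "integrable \<sigma> (%y. poisson (r *\<^sub>R x) y * g y)" if "0 <= r" "r < 1" for r
  unfolding g_def by (rule poisson_integral_zsol[OF d xz that])
 have "uniformly_continuous_on (sphere 0 1) g"
  by (rule compact_uniformly_continuous[OF continuous_on_subset[OF cg subset_UNIV] compact_sphere])
 hence uc: "\<exists>\<delta>>0. \<forall>y\<in>sphere 0 1. dist y x < \<delta> --> \<bar>g y - g x\<bar> < e" if "e > 0" for e
 proof -
  have "\<exists>d>0. \<forall>x\<in>sphere 0 1. \<forall>y\<in>sphere 0 1. dist y x < d --> dist (g y) (g x) < e"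
   using \<open>uniformly_continuous_on (sphere 0 1) g\<close> that unfolding uniformly_continuous_on_def by simp
  then obtain d where "d > 0" "\<forall>x\<in>sphere 0 1. \<forall>y\<in>sphere 0 1. dist y x < d --> dist (g y) (g x) < e" by blast
  thus ?thesis using xz by (intro exI[of _ d]) (auto simp: dist_real_def)
 qed
 have "compact (g ` sphere 0 1)"
  by (intro compact_continuous_image continuous_on_subset[OF cg]) auto
 then obtain K where K: "!!y. y \<in> sphere 0 1 ==> \<bar>g y\<bar> <= K"
  by (force dest!: compact_imp_bounded simp: bounded_iff)
 have K0: "K >= 0" using K[of x] xz by auto
 have "((%r. r ^ m * F) \<longlongrightarrow> g x) (at_left 1)"
 proof (rule tendstoI)
  fix e :: real assume e: "e > 0"
  then obtain \<delta> where \<delta>: "\<delta> > 0" "!!y. y \<in> sphere 0 1 ==> dist y x < \<delta> ==> \<bar>g y - g x\<bar> < e / 2"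
   using uc[of "e / 2"] by auto
  let ?e = "%r. 2 * K * (2 * (1 - r) / (\<delta> / 2) ^ DIM('a))"
  have lim: "((%r. ?e r) \<longlongrightarrow> 2 * K * (2 * (1 - 1) / (\<delta> / 2) ^ DIM('a))) (at_left 1)"
   by (intro tendsto_intros) (use \<delta> in auto)
  have "\<forall>\<^sub>F r in at_left 1. ?e r < e / 2"
   by (rule order_tendstoD(2)[OF lim]) (use e in simp)
  moreover have "\<forall>\<^sub>F r in at_left (1::real). r \<in> {max 0 (1 - \<delta> / 2)<..<1}"
   by (rule eventually_at_left_real) (use \<delta> in auto)
  ultimately show "\<forall>\<^sub>F r in at_left 1. dist (r ^ m * F) (g x) < e"
  proof eventually_elim
   case (elim r)
   hence r: "0 <= r" "r < 1" "1 - r < \<delta> / 2" by auto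
   note P = poisson_integral[OF d xz(1) r(1,2)]
   have pt: "poisson (r *\<^sub>R x) y * \<bar>g y - g x\<bar> <= e / 2 * poisson (r *\<^sub>R x) y + ?e r"
    if y: "y \<in> sphere 0 1" for y
   proof (cases "dist y x < \<delta>")
    case True
    have "poisson (r *\<^sub>R x) y >= 0" by (rule poisson_nonneg) (use xz r in auto)
    from mult_left_mono[OF less_imp_le[OF \<delta>(2)[OF y True]] this]
    show ?thesis using K0 r \<delta>(1) by (simp add: mult.commute add_increasing2)
   next
    case False
    have "norm (x - y) <= norm (x - r *\<^sub>R x) + norm (r *\<^sub>R x - y)"
     using norm_triangle_ineq[of "x - r *\<^sub>R x" "r *\<^sub>R x - y"] by simp
    moreover have "x - r *\<^sub>R x = (1 - r) *\<^sub>R x" by (simp add: algebra_simps)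
    ultimately have "\<delta> / 2 <= norm (r *\<^sub>R x - y)"
     using False xz r by (simp add: dist_norm norm_minus_commute)
    hence "(\<delta> / 2) ^ DIM('a) <= norm (r *\<^sub>R x - y) ^ DIM('a)" using \<delta>(1) by (intro power_mono) auto
    moreover have "1 - r\<^sup>2 <= 2 * (1 - r)" using zero_le_power2[of "1 - r"] by (simp add: power2_eq_square algebra_simps)
    moreover have "0 <= 1 - r\<^sup>2" using r by (simp add: power_le_one)
    ultimately have p: "poisson (r *\<^sub>R x) y <= 2 * (1 - r) / (\<delta> / 2) ^ DIM('a)"
     using xz r \<delta>(1) unfolding poisson_def by (simp del: power_divide) (intro frac_le, auto)
    have p0: "poisson (r *\<^sub>R x) y >= 0" by (rule poisson_nonneg) (use xz r in auto)
    have "\<bar>g y - g x\<bar> <= 2 * K" using K[OF y] K[of x] xz by auto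
    hence "poisson (r *\<^sub>R x) y * \<bar>g y - g x\<bar> <= (2 * (1 - r) / (\<delta> / 2) ^ DIM('a)) * (2 * K)"
     by (intro mult_mono p) (use p p0 in auto)
    thus ?thesis using p0 e by (simp add: mult.commute add_increasing)
   qed
   have "r ^ m * F - g x = (\<integral>y. poisson (r *\<^sub>R x) y * g y \<partial>\<sigma>) - (\<integral>y. poisson (r *\<^sub>R x) y * g x \<partial>\<sigma>)"
    using poisson_integral_zsol(2)[OF d xz r(1,2), of m] P by (simp add: F_def g_def)
   also have "... = (\<integral>y. poisson (r *\<^sub>R x) y * (g y - g x) \<partial>\<sigma>)"
    using ig[OF r(1,2)] P(1) by (subst Bochner_Integration.integral_diff[symmetric]) (auto simp: right_diff_distrib)
   finally have "\<bar>r ^ m * F - g x\<bar> <= (\<integral>y. \<bar>poisson (r *\<^sub>R x) y * (g y - g x)\<bar> \<partial>\<sigma>)"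
    by (simp add: integral_abs_bound)
   also have "... <= (\<integral>y. e / 2 * poisson (r *\<^sub>R x) y + ?e r \<partial>\<sigma>)"
   proof (rule integral_mono)
    show "integrable \<sigma> (%y. \<bar>poisson (r *\<^sub>R x) y * (g y - g x)\<bar>)"
     using ig[OF r(1,2)] P(1) by (intro integrable_abs) (auto simp: right_diff_distrib)
    show "integrable \<sigma> (%y. e / 2 * poisson (r *\<^sub>R x) y + ?e r)"
     using P(1) by auto
    fix y :: 'a assume "y \<in> space \<sigma>"
    thus "\<bar>poisson (r *\<^sub>R x) y * (g y - g x)\<bar> <= e / 2 * poisson (r *\<^sub>R x) y + ?e r"
     using pt[of y] poisson_nonneg[of "r *\<^sub>R x" y] xz r by (simp add: abs_mult)
   qed
   also have "... = e / 2 + ?e r"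
    using P by (simp add: sphere_measure.prob_space)
   also have "... < e" using elim by simp
   finally show ?case by (simp add: dist_real_def)
  qed
 qed
 moreover have "((%r. r ^ m * F) \<longlongrightarrow> 1 ^ m * F) (at_left 1)" by (intro tendsto_intros)
 ultimately have "F = g x" using tendsto_unique[OF trivial_limit_at_left_real] by fastforce
 thus ?thesis using zsol_orthogonal[OF xz] by (auto simp: F_def g_def)
qed

section \<open>The mean value property\<close>

lemma integral_bump_lborel:
 fixes f :: "'a::euclidean_space => real"
 assumes "continuous_on UNIV f"
 shows "(\<integral>w. bump w * f w \<partial>lborel) = integral (cbox (- One) One) (%w. bump w * f w)"
  and "(\<integral>w. bump w * f w \<partial>unif_ball) = integral (cbox (- One) One) (%w. bump w * f w) / measure lborel (ball (0::'a) 1)"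
proof -
 let ?S = "cbox (- One) One :: 'a set"
 have c: "continuous_on S (%w. bump w * f w)" for S
  by (intro continuous_intros continuous_on_subset[OF assms]) auto
 have [measurable]: "f \<in> borel_measurable borel" using assms by (rule borel_measurable_continuous_onI)
 have in_box: "w \<in> ?S" if "norm w < 1" for w :: 'a
  using that Basis_le_norm[of _ w] by (force simp: mem_box abs_le_iff)
 have i: "set_integrable lborel ?S (%w. bump w * f w)"
  unfolding set_integrable_def by (rule borel_integrable_compact) (auto intro: c)
 have "(\<integral>w. bump w * f w \<partial>lborel) = (LINT w:?S|lborel. bump w * f w)"
  unfolding set_lebesgue_integral_def
 proof (rule Bochner_Integration.integral_cong)
  fix w :: 'a
  show "bump w * f w = indicator ?S w *\<^sub>R (bump w * f w)"
   using in_box[of w] bump_bounds(3)[of w] by (cases "norm w < 1") (auto split: split_indicator)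
 qed simp
 thus 1: "(\<integral>w. bump w * f w \<partial>lborel) = integral ?S (%w. bump w * f w)"
  using set_borel_integral_eq_integral(2)[OF i] by simp
 have eq: "(%w. indicator (ball 0 1) w * (bump w * f w)) = (%w. bump w * f w)"
  by (auto simp: fun_eq_iff bump_bounds split: split_indicator)
 show "(\<integral>w. bump w * f w \<partial>unif_ball) = integral ?S (%w. bump w * f w) / measure lborel (ball (0::'a) 1)"
  by (subst integral_unif_ball) (simp_all only: eq 1, measurable)
qed

text \<open>The derivative with respect to \<open>t\<close> of the average with radius \<open>t\<close> is the integral of \<open>bump w * (w \<bullet> \<nabla>u (z + t w))\<close>. Since
 \<open>u\<close> is harmonic, this is the integral of the divergence of \<open>(bump w)\<^sup>2 *\<^sub>R \<nabla>u (z + t w)\<close>, up to the factor \<open>- 1 / 4\<close>.\<close>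

lemma zsol_mean_value:
 fixes x z :: "'a::euclidean_space"
 assumes x: "norm x = 1"
 shows "(\<integral>w. bump w * zsol k x (z + r *\<^sub>R w) \<partial>unif_ball) = (\<integral>w. bump w \<partial>(unif_ball :: 'a measure)) * zsol k x z"
proof -
 define l where "l = (real DIM('a) - 2) / 2"
 have l: "2 * (l + 1) = real DIM('a)" by (simp add: l_def field_simps)
 define u where "u = (%w. sol l (int k) (x \<bullet> w) (w \<bullet> w))"
 define g where "g = (%t w. bump w * u (z + t *\<^sub>R w))"
 define g' where "g' = (%t w. bump w * (w \<bullet> sol_grad l k x (z + t *\<^sub>R w)))"
 define F where "F = (%t. integral (cbox (- One) One) (g t))"
 have cont_u: "continuous_on S (%p. u (f p))" if "continuous_on S f" for S and f :: "'c::topological_space => 'a"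
  unfolding u_def by (intro continuous_intros that)
 have "(F has_field_derivative integral (cbox (- One) One) (g' t)) (at t within UNIV)" for t
  unfolding F_def
 proof (rule leibniz_rule_field_derivative)
  fix t :: real and w :: 'a
  have "((%t. u (z + t *\<^sub>R w)) has_derivative (%s. (s *\<^sub>R w) \<bullet> sol_grad l k x (z + t *\<^sub>R w))) (at t)"
   unfolding u_def
   by (rule has_derivative_compose[OF _ has_derivative_sol_inner]) (auto intro!: derivative_eq_intros)
  hence "((%t. u (z + t *\<^sub>R w)) has_real_derivative (w \<bullet> sol_grad l k x (z + t *\<^sub>R w))) (at t)"
   by (simp add: has_field_derivative_def mult.commute[of _ "w \<bullet> _"])
  thus "((%t. g t w) has_real_derivative g' t w) (at t within UNIV)"
   unfolding g_def g'_def by (rule DERIV_cmult)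
  show "g t integrable_on cbox (- One) One"
   unfolding g_def by (intro integrable_continuous continuous_intros cont_u)
  show "continuous_on (UNIV \<times> cbox (- One) One) (%(t, w). g' t w)"
   unfolding g'_def split_beta by (intro continuous_intros)
 qed auto
 moreover have "integral (cbox (- One) One) (g' t) = 0" for t
 proof -
  define V where "V = (%w. (bump w)\<^sup>2 *\<^sub>R sol_grad l k x (z + t *\<^sub>R w))"
  define V' where "V' = (%w b. (bump w)\<^sup>2 *\<^sub>R (sol_hess l k x (z + t *\<^sub>R w) (t *\<^sub>R b))
    + (- 4 * bump w * (w \<bullet> b)) *\<^sub>R sol_grad l k x (z + t *\<^sub>R w))"
  have "((%w. sol_grad l k x (z + t *\<^sub>R w)) has_derivative (%b. sol_hess l k x (z + t *\<^sub>R w) (t *\<^sub>R b))) (at w)" for w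
   by (rule has_derivative_compose[OF _ has_derivative_sol_grad]) (auto intro!: derivative_eq_intros)
  hence VV': "(V has_derivative V' w) (at w)" for w
   unfolding V_def V'_def by (intro has_derivative_scaleR has_derivative_bump_square)
  have cont: "continuous_on UNIV (%w. V' w b)" for b
   unfolding V'_def by (intro continuous_intros)
  have supp: "V w = 0" if "norm w > 1" for w using that by (simp add: V_def bump_bounds)
  have hess: "sol_hess l k x y (t *\<^sub>R b) = t *\<^sub>R sol_hess l k x y b" for y b
   by (simp add: sol_hess_def algebra_simps)
  have "(\<Sum>b\<in>Basis. V' w b \<bullet> b) = - 4 * g' t w" for w
  proof -
   define G where "G = sol_grad l k x (z + t *\<^sub>R w)"
   have "V' w b \<bullet> b = (bump w)\<^sup>2 * t * (sol_hess l k x (z + t *\<^sub>R w) b \<bullet> b) - 4 * bump w * ((w \<bullet> b) * (G \<bullet> b))" for b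
    unfolding V'_def hess G_def[symmetric] inner_add_left inner_scaleR_left by simp
   hence "(\<Sum>b\<in>Basis. V' w b \<bullet> b) = (bump w)\<^sup>2 * t * (\<Sum>b\<in>Basis. sol_hess l k x (z + t *\<^sub>R w) b \<bullet> b) - 4 * bump w * (w \<bullet> G)"
    by (simp only: sum_subtractf sum_distrib_left[symmetric] euclidean_inner[of w G])
   thus ?thesis unfolding sol_hess_trace[OF x l] by (simp add: g'_def G_def)
  qed
  hence "(\<integral>w. - 4 * g' t w \<partial>lborel) = 0"
   using integral_divergence_eq_0(2)[OF VV' cont supp] by simp
  hence "(\<integral>w. g' t w \<partial>lborel) = 0" by simp
  thus ?thesis
   unfolding g'_def by (subst (asm) integral_bump_lborel) (auto intro!: continuous_intros)
 qed
 ultimately have "F r = F 0"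
  using DERIV_isconst_all[of F r 0] by auto
 moreover have "F 0 = integral (cbox (- One) One) (bump :: 'a => real) * u z"
  by (simp add: F_def g_def)
 ultimately have *: "integral (cbox (- One) One) (%w. bump w * u (z + r *\<^sub>R w)) = integral (cbox (- One) One) (bump :: 'a => real) * u z"
  by (simp add: F_def g_def)
 have "(\<integral>w. bump w * u (z + r *\<^sub>R w) \<partial>unif_ball) = (\<integral>w. bump w \<partial>(unif_ball :: 'a measure)) * u z"
  using integral_bump_lborel(2)[of "%w. u (z + r *\<^sub>R w)"] integral_bump_lborel(2)[of "%w::'a. 1"] *
  by (simp add: cont_u continuous_intros)
 thus ?thesis
  unfolding zsol_def u_def l_def by (simp add: mult.left_commute[of "bump _"])
qed

section \<open>Localization of zonal kernels\<close>

definition fdiff :: "(nat => real) => nat => real" where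
 "fdiff a k = a (Suc k) - a k"

text \<open>Discrete symbols of order \<open>- m\<close>: families of sequences, indexed by \<open>p \<in> P\<close> and living at the frequency \<open>N p\<close>, for which
 every difference gains a factor \<open>1 / N p\<close>, uniformly in \<open>p\<close>. Only frequencies from \<open>N p / 4\<close> on count, as otherwise
 factors like \<open>1 / (k + c)\<close> would not be of order \<open>- 1\<close>.\<close>

definition symbols :: "'p set => ('p => real) => nat => ('p => nat => real) => bool" where
 "symbols P N m a \<longleftrightarrow>
   (\<forall>i. \<exists>C. \<forall>p\<in>P. \<forall>k. N p / 4 <= real k --> \<bar>(fdiff ^^ i) (a p) k\<bar> <= C / N p ^ (m + i))"

lemma symbolsD:
 assumes "symbols P N m a"
 obtains C where "C > 0" "!!p k. p \<in> P ==> N p > 0 ==> N p / 4 <= real k ==> \<bar>(fdiff ^^ i) (a p) k\<bar> <= C / N p ^ (m + i)"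
proof -
 obtain C where C: "!!p k. p \<in> P ==> N p / 4 <= real k ==> \<bar>(fdiff ^^ i) (a p) k\<bar> <= C / N p ^ (m + i)"
  using assms unfolding symbols_def by metis
 show ?thesis
 proof (rule that[of "\<bar>C\<bar> + 1"])
  fix p k assume "p \<in> P" "N p > 0" "N p / 4 <= real k"
  hence "\<bar>(fdiff ^^ i) (a p) k\<bar> <= C / N p ^ (m + i)" by (intro C) auto
  also have "... <= (\<bar>C\<bar> + 1) / N p ^ (m + i)" using \<open>N p > 0\<close> by (intro divide_right_mono) auto
  finally show "\<bar>(fdiff ^^ i) (a p) k\<bar> <= (\<bar>C\<bar> + 1) / N p ^ (m + i)" .
 qed auto
qed

lemma fdiff_pow_Suc: "(fdiff ^^ Suc i) a = (fdiff ^^ i) (fdiff a)"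
 by (simp only: funpow_Suc_right o_apply)

lemma symbols_fdiff: "symbols P N m a ==> symbols P N (Suc m) (%p. fdiff (a p))"
 unfolding symbols_def fdiff_pow_Suc[symmetric] by (metis add_Suc add_Suc_right)

lemma fdiff_pow_shift: "(fdiff ^^ i) (%k. a (Suc k)) k = (fdiff ^^ i) a (Suc k)"
 by (induction i arbitrary: k) (auto simp: fdiff_def)

lemma symbols_shift: "symbols P N m a ==> symbols P N m (%p k. a p (Suc k))"
 unfolding symbols_def fdiff_pow_shift by (metis le_SucI of_nat_le_iff order_trans lessI less_imp_le)

lemma fdiff_pow_add: "(fdiff ^^ i) (%k. a k + b k) k = (fdiff ^^ i) a k + (fdiff ^^ i) b k"
 by (induction i arbitrary: k) (auto simp: fdiff_def)

lemma fdiff_pow_cmult: "(fdiff ^^ i) (%k. c * a k) k = c * (fdiff ^^ i) a k"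
 by (induction i arbitrary: k) (auto simp: fdiff_def algebra_simps)

lemma symbols_add:
 assumes "symbols P N m a" "symbols P N m b"
 shows "symbols P N m (%p k. a p k + b p k)"
 unfolding symbols_def
proof
 fix i
 obtain A where A: "!!p k. p \<in> P ==> N p / 4 <= real k ==> \<bar>(fdiff ^^ i) (a p) k\<bar> <= A / N p ^ (m + i)"
  using assms(1) unfolding symbols_def by metis
 obtain B where B: "!!p k. p \<in> P ==> N p / 4 <= real k ==> \<bar>(fdiff ^^ i) (b p) k\<bar> <= B / N p ^ (m + i)"
  using assms(2) unfolding symbols_def by metis
 show "\<exists>C. \<forall>p\<in>P. \<forall>k. N p / 4 <= real k --> \<bar>(fdiff ^^ i) (%k. a p k + b p k) k\<bar> <= C / N p ^ (m + i)"
  unfolding fdiff_pow_add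
  by (rule exI[of _ "A + B"]) (auto simp: add_divide_distrib intro!: order_trans[OF abs_triangle_ineq] add_mono A B)
qed

lemma symbols_cmult:
 assumes "symbols P N m a"
 shows "symbols P N m (%p k. c * a p k)"
 unfolding symbols_def fdiff_pow_cmult
proof
 fix i
 obtain A where A: "!!p k. p \<in> P ==> N p / 4 <= real k ==> \<bar>(fdiff ^^ i) (a p) k\<bar> <= A / N p ^ (m + i)"
  using assms(1) unfolding symbols_def by metis
 show "\<exists>C. \<forall>p\<in>P. \<forall>k. N p / 4 <= real k --> \<bar>c * (fdiff ^^ i) (a p) k\<bar> <= C / N p ^ (m + i)"
  by (rule exI[of _ "\<bar>c\<bar> * A"]) (auto simp: abs_mult simp flip: times_divide_eq_right intro!: mult_left_mono A)
qed

text \<open>Induction on the order of the difference, with the discrete product rule.\<close>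

lemma symbols_mult:
 assumes "symbols P N m a" "symbols P N n b" and N: "!!p. p \<in> P ==> N p > 0"
 shows "symbols P N (m + n) (%p k. a p k * b p k)"
 unfolding symbols_def
proof
 fix i
 show "\<exists>C. \<forall>p\<in>P. \<forall>k. N p / 4 <= real k --> \<bar>(fdiff ^^ i) (%k. a p k * b p k) k\<bar> <= C / N p ^ (m + n + i)"
  using assms(1,2)
 proof (induction i arbitrary: a b m n)
  case 0
  obtain A where A: "A > 0" "!!p k. p \<in> P ==> N p > 0 ==> N p / 4 <= real k ==> \<bar>(fdiff ^^ 0) (a p) k\<bar> <= A / N p ^ (m + 0)"
   using symbolsD[OF 0(1)] by metis
  obtain B where B: "B > 0" "!!p k. p \<in> P ==> N p > 0 ==> N p / 4 <= real k ==> \<bar>(fdiff ^^ 0) (b p) k\<bar> <= B / N p ^ (n + 0)"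
   using symbolsD[OF 0(2)] by metis
  show ?case
  proof (intro exI[of _ "A * B"] ballI allI impI)
   fix p k assume p: "p \<in> P" and k: "N p / 4 <= real k"
   have "\<bar>a p k\<bar> * \<bar>b p k\<bar> <= (A / N p ^ m) * (B / N p ^ n)"
    using A(2)[OF p N[OF p] k] B(2)[OF p N[OF p] k] A(1) N[OF p] by (intro mult_mono) auto
   thus "\<bar>(fdiff ^^ 0) (%k. a p k * b p k) k\<bar> <= A * B / N p ^ (m + n + 0)"
    by (simp add: abs_mult power_add)
  qed
 next
  case (Suc i)
  have e: "fdiff (%k. a p k * b p k) = (%k. fdiff (a p) k * b p (Suc k) + a p k * fdiff (b p) k)" for p
   by (auto simp: fdiff_def algebra_simps)
  obtain A where A: "!!p k. p \<in> P ==> N p / 4 <= real k ==> \<bar>(fdiff ^^ i) (%k. fdiff (a p) k * b p (Suc k)) k\<bar> <= A / N p ^ (m + n + Suc i)"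
   using Suc.IH[OF symbols_fdiff[OF Suc.prems(1)] symbols_shift[OF Suc.prems(2)]] by auto
  obtain B where B: "!!p k. p \<in> P ==> N p / 4 <= real k ==> \<bar>(fdiff ^^ i) (%k. a p k * fdiff (b p) k) k\<bar> <= B / N p ^ (m + n + Suc i)"
   using Suc.IH[OF Suc.prems(1) symbols_fdiff[OF Suc.prems(2)]] by auto
  show ?case unfolding fdiff_pow_Suc e fdiff_pow_add
   by (rule exI[of _ "A + B"]) (auto simp only: add_divide_distrib intro!: order_trans[OF abs_triangle_ineq] add_mono A B)
 qed
qed

lemma symbols_inverse:
 assumes c: "c > 0" and N: "!!p. p \<in> P ==> N p > 0"
 shows "symbols P N 1 (%p k. 1 / (real k + c))"
 unfolding symbols_def
proof
 fix i
 have eq: "(fdiff ^^ i) (%k. 1 / (real k + c)) k = (- 1) ^ i * fact i / pochhammer (real k + c) (Suc i)" for k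
 proof (induction i arbitrary: k)
  case (Suc i)
  have pos: "real k + c + real j > 0" for j using c by simp
  define x where "x = real k + c"
  have x: "x > 0" "x + real (Suc i) > 0" using c by (auto simp: x_def)
  have p: "pochhammer (x + 1) i > 0" using x by (intro pochhammer_pos) auto
  have p1: "pochhammer x (Suc i) = x * pochhammer (x + 1) i" by (simp add: pochhammer_rec)
  have p2: "pochhammer (x + 1) (Suc i) = pochhammer (x + 1) i * (x + real (Suc i))" by (simp add: pochhammer_Suc add_ac)
  have p3: "pochhammer x (Suc (Suc i)) = x * pochhammer (x + 1) i * (x + real (Suc i))"
   by (simp add: pochhammer_rec[of x "Suc i"] p2)
  have "(fdiff ^^ Suc i) (%k. 1 / (real k + c)) k =
    (- 1) ^ i * fact i / pochhammer (x + 1) (Suc i) - (- 1) ^ i * fact i / pochhammer x (Suc i)"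
   unfolding funpow.simps o_apply fdiff_def Suc x_def by (simp add: add_ac)
  also have "... = (- 1) ^ i * fact i * (1 / pochhammer (x + 1) (Suc i) - 1 / pochhammer x (Suc i))" by (simp add: right_diff_distrib)
  also have "1 / pochhammer (x + 1) (Suc i) - 1 / pochhammer x (Suc i) = - real (Suc i) / pochhammer x (Suc (Suc i))"
   unfolding p1 p2 p3 using x p by (simp add: divide_simps)
  finally show ?case by (simp add: x_def algebra_simps)
 qed simp
 show "\<exists>C. \<forall>p\<in>P. \<forall>k. N p / 4 <= real k --> \<bar>(fdiff ^^ i) (%k. 1 / (real k + c)) k\<bar> <= C / N p ^ (1 + i)"
 proof (intro exI[of _ "fact i * 4 ^ Suc i"] ballI allI impI)
  fix p k assume p: "p \<in> P" and k: "N p / 4 <= real k"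
  have "(N p / 4) ^ Suc i <= pochhammer (real k + c) (Suc i)"
  proof -
   have "(N p / 4) ^ j <= pochhammer (real k + c) j" for j
   proof (induction j)
    case (Suc j)
    have "(N p / 4) ^ j * (N p / 4) <= pochhammer (real k + c) j * (real k + c + real j)"
     using N[OF p] k c by (intro mult_mono Suc pochhammer_nonneg) auto
    thus ?case by (simp add: pochhammer_Suc power_Suc2 del: power_Suc)
   qed simp
   thus ?thesis .
  qed
  hence "fact i / pochhammer (real k + c) (Suc i) <= fact i / (N p / 4) ^ Suc i"
   using N[OF p] by (intro divide_left_mono mult_pos_pos pochhammer_pos zero_less_power) (use c in auto)
  moreover have "pochhammer (real k + c) (Suc i) > 0" using c by (intro pochhammer_pos) auto
  ultimately show "\<bar>(fdiff ^^ i) (%k. 1 / (real k + c)) k\<bar> <= fact i * 4 ^ Suc i / N p ^ (1 + i)"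
   unfolding eq by (simp add: abs_mult power_divide)
 qed
qed

lemma power_le_fact_exp: "x >= 0 ==> x ^ i <= fact i * exp (x::real)"
proof -
 assume x: "x >= 0"
 have "(%n. x ^ n /\<^sub>R fact n) sums exp x" by (rule exp_converges)
 hence "sum (%n. x ^ n /\<^sub>R fact n) {i} <= exp x"
  using x by (intro sum_le_suminf[of "%n. x ^ n /\<^sub>R fact n" "{i}", THEN order_trans]) (auto simp: sums_iff)
 thus ?thesis by (simp add: field_simps)
qed

text \<open>The \<open>i\<close>-th difference is \<open>(1 - r) ^ i * r ^ k\<close> up to sign, and \<open>((1 - r) * N) ^ i * r ^ k\<close> is bounded for \<open>k \<ge> N / 4\<close>,
 uniformly in \<open>r\<close>, since \<open>r ^ k \<le> exp (- (1 - r) * k)\<close>.\<close>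

lemma symbols_geometric:
 assumes N: "!!p. p \<in> P ==> N p > 0" and r: "!!p. p \<in> P ==> 0 <= r p \<and> r p <= 1"
 shows "symbols P N 0 (%p k. r p ^ k)"
 unfolding symbols_def
proof
 fix i
 have eq: "(fdiff ^^ i) (%k. r p ^ k) k = (r p - 1) ^ i * r p ^ k" for k p
  by (induction i arbitrary: k) (auto simp: fdiff_def algebra_simps)
 show "\<exists>C. \<forall>p\<in>P. \<forall>k. N p / 4 <= real k --> \<bar>(fdiff ^^ i) (%k. r p ^ k) k\<bar> <= C / N p ^ (0 + i)"
 proof (intro exI[of _ "fact i * 4 ^ i"] ballI allI impI)
  fix p k assume p: "p \<in> P" and k: "N p / 4 <= real k"
  define s where "s = 1 - r p"
  have s: "0 <= s" "s <= 1" using r[OF p] by (auto simp: s_def)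
  define y where "y = s * (N p / 4)"
  have y: "y >= 0" using s N[OF p] by (simp add: y_def)
  have "r p ^ k <= exp (- s) ^ k"
   using exp_ge_add_one_self[of "- s"] s by (intro power_mono) (auto simp: s_def)
  also have "... = exp (- (s * real k))" by (simp add: exp_of_nat_mult[symmetric] mult.commute)
  also have "... <= exp (- y)" unfolding y_def using mult_left_mono[OF k s(1)] by simp
  finally have "y ^ i * r p ^ k <= y ^ i * exp (- y)" using y by (intro mult_left_mono) auto
  also have "... <= fact i * exp y * exp (- y)" using power_le_fact_exp[OF y, of i] by (intro mult_right_mono) auto
  also have "... = fact i" by (simp add: mult.assoc flip: exp_add)
  finally have "(s * N p) ^ i * r p ^ k <= fact i * 4 ^ i"
   by (simp add: y_def power_divide power_mult_distrib divide_le_eq)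
  moreover have "\<bar>(fdiff ^^ i) (%k. r p ^ k) k\<bar> = s ^ i * r p ^ k"
   unfolding eq using r[OF p] s by (simp add: abs_mult power_abs s_def)
  ultimately show "\<bar>(fdiff ^^ i) (%k. r p ^ k) k\<bar> <= fact i * 4 ^ i / N p ^ (0 + i)"
   using N[OF p] by (simp add: pos_le_divide_eq power_mult_distrib mult_ac)
 qed
qed

text \<open>By the mean value theorem a difference with step \<open>1 / N\<close> is \<open>1 / N\<close> times a derivative at an intermediate point.\<close>

lemma symbols_dilation:
 assumes g: "!!i x. (g i has_real_derivative g (Suc i) x) (at x)" and bnd: "!!i. \<exists>B. \<forall>x. \<bar>g i x\<bar> <= B"
  and N: "!!p. p \<in> P ==> N p > 0"
 shows "symbols P N 0 (%p k. g 0 (real k / N p))"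
 unfolding symbols_def
proof
 fix i
 define step where "step = (%h (f :: real => real) x. f (x + h) - f x)"
 have step_Suc: "(step h ^^ Suc j) f = (%x. (step h ^^ j) f (x + h) - (step h ^^ j) f x)" for h j f
  by (simp add: step_def fun_eq_iff)
 have deriv: "((step h ^^ j) (g m) has_real_derivative (step h ^^ j) (g (Suc m)) x) (at x)" for h m x j
 proof (induction j arbitrary: x)
  case (Suc j)
  have "((%x. (step h ^^ j) (g m) (x + h)) has_real_derivative (step h ^^ j) (g (Suc m)) (x + h)) (at x)"
   using Suc DERIV_shift by blast
  thus ?case unfolding step_Suc by (intro DERIV_diff Suc)
 qed (use g in simp)
 have step_le: "\<exists>B. \<forall>h>0. \<forall>x. \<bar>(step h ^^ i) (g m) x\<bar> <= B * h ^ i" for m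
 proof (induction i arbitrary: m)
  case 0
  thus ?case using bnd[of m] by auto
 next
  case (Suc i)
  obtain B where B: "!!h x. h > 0 ==> \<bar>(step h ^^ i) (g (Suc m)) x\<bar> <= B * h ^ i" using Suc[of "Suc m"] by auto
  show ?case
  proof (intro exI[of _ B] allI impI)
   fix h x :: real assume h: "h > 0"
   have "\<exists>z>x. z < x + h \<and> (step h ^^ i) (g m) (x + h) - (step h ^^ i) (g m) x = (x + h - x) * (step h ^^ i) (g (Suc m)) z"
    by (rule MVT2) (use h deriv in auto)
   then obtain z where "(step h ^^ Suc i) (g m) x = h * (step h ^^ i) (g (Suc m)) z"
    by (auto simp: step_def)
   thus "\<bar>(step h ^^ Suc i) (g m) x\<bar> <= B * h ^ Suc i"
    using mult_left_mono[OF B[OF h, of z], of h] h by (simp add: abs_mult mult_ac)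
  qed
 qed
 have eq: "(fdiff ^^ i) (%k. g 0 (real k / N p)) k = (step (1 / N p) ^^ i) (g 0) (real k / N p)" for p k
  by (induction i arbitrary: k) (auto simp: fdiff_def step_def add_divide_distrib add.commute)
 obtain B where B: "!!h x. h > 0 ==> \<bar>(step h ^^ i) (g 0) x\<bar> <= B * h ^ i" using step_le[of 0] by auto
 show "\<exists>C. \<forall>p\<in>P. \<forall>k. N p / 4 <= real k --> \<bar>(fdiff ^^ i) (%k. g 0 (real k / N p)) k\<bar> <= C / N p ^ (0 + i)"
  unfolding eq using B[of "1 / N p" for p] N by (intro exI[of _ B]) (auto simp: power_divide)
qed

lemma zonal_rec:
 assumes "d >= 3"
 defines "l \<equiv> (real d - 2) / 2"
 shows "t * zonal d (Suc n) t = (real n + 2) / (2 * (real n + 2 + l)) * zonal d (Suc (Suc n)) t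
   + (real n + 2 * l) / (2 * (real n + l)) * zonal d n t"
proof -
 have l: "l > 0" using assms by simp
 have z: "zonal d k t = (real k + l) / l * gegenbauer l k t" for k
  using assms(1) by (simp add: zonal_def l_def field_simps)
 have c: "a / (2 * l) = a / (2 * b) * (b / l)" if "b > 0" for a b
  using that l by (simp add: field_simps)
 have "t * ((real n + 1 + l) / l * gegenbauer l (Suc n) t) = 2 * (real n + 1 + l) * t * gegenbauer l (Suc n) t / (2 * l)"
  using l by (simp add: field_simps del: gegenbauer.simps)
 also have "2 * (real n + 1 + l) * t * gegenbauer l (Suc n) t =
   (real n + 2) * gegenbauer l (Suc (Suc n)) t + (real n + 2 * l) * gegenbauer l n t" by simp
 also have "... / (2 * l) = (real n + 2) / (2 * l) * gegenbauer l (Suc (Suc n)) t + (real n + 2 * l) / (2 * l) * gegenbauer l n t"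
  unfolding add_divide_distrib[of "_ * _" "_ * _"] by (simp only: times_divide_eq_left)
 also have "(real n + 2) / (2 * l) = (real n + 2) / (2 * (real n + 2 + l)) * ((real n + 2 + l) / l)" by (rule c) (use l in simp)
 also have "(real n + 2 * l) / (2 * l) = (real n + 2 * l) / (2 * (real n + l)) * ((real n + l) / l)" by (rule c) (use l in simp)
 finally show ?thesis unfolding z by (simp add: add_ac mult.assoc del: gegenbauer.simps)
qed

text \<open>Multiplication by \<open>1 - t\<close> acts on the coefficients of a zonal expansion like a second difference plus a first
 difference divided by the degree. The result is shifted by one, so that no backward differences occur; \<open>s\<close> counts the
 shifts made before.\<close>

definition zonal_step :: "real => nat => (nat => real) => nat => real" where
 "zonal_step l s a k = - (1 / 2) * fdiff (fdiff a) k
   + - (l / 2) * (1 / (real k + (real s + 1 + l)) * (fdiff a (Suc k) + fdiff a k))"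

lemma zonal_step_sum:
 assumes d: "d >= 3" and a: "a 0 = 0" "a (Suc 0) = 0" "!!k. k >= K ==> a k = 0"
 shows "(1 - t) * (\<Sum>k<K. a k * zonal d (k + s) t) =
   (\<Sum>k<K. zonal_step ((real d - 2) / 2) s a k * zonal d (k + Suc s) t)"
proof -
 define l where "l = (real d - 2) / 2"
 have l: "l > 0" using d by (simp add: l_def)
 have shift: "(\<Sum>k<K. f k) = (\<Sum>k<K. f (Suc k))" if "f 0 = 0" "f K = 0" for f :: "nat => real"
  using sum.lessThan_Suc_shift[of f K] that by simp
 define Z where "Z = (%k. zonal d k t)"
 have 1: "(\<Sum>k<K. a k * Z (k + s)) = (\<Sum>k<K. a (Suc k) * Z (k + Suc s))"
  by (subst shift) (auto simp: a)
 define c where "c = (%k. (real (k + s) + 2 * l) / (2 * (real (k + s) + l)))"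
 have tZ: "a k * (t * Z (k + s)) = a k * ((real (k + s) + 1) / (2 * (real (k + s) + 1 + l)) * Z (k + Suc s))
    + a k * (if k = 0 then 0 else c (k - 1) * Z (k - 1 + s))" for k
 proof (cases k)
  case (Suc k')
  show ?thesis
   using zonal_rec[OF d, of t "k' + s"] Suc by (simp add: Z_def c_def l_def algebra_simps)
 qed (simp add: a)
 have "(\<Sum>k<K. a k * (if k = 0 then 0 else c (k - 1) * Z (k - 1 + s))) = (\<Sum>k<K. a (Suc k) * (c k * Z (k + s)))"
  by (subst shift) (auto simp: a)
 also have "... = (\<Sum>k<K. a (Suc (Suc k)) * (c (Suc k) * Z (k + Suc s)))"
  by (subst shift) (auto simp: a)
 finally have 2: "(\<Sum>k<K. a k * (t * Z (k + s))) = (\<Sum>k<K. a k * ((real (k + s) + 1) / (2 * (real (k + s) + 1 + l)) * Z (k + Suc s))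
    + a (Suc (Suc k)) * (c (Suc k) * Z (k + Suc s)))"
  unfolding tZ by (simp add: sum.distrib)
 have "(1 - t) * (\<Sum>k<K. a k * Z (k + s)) = (\<Sum>k<K. a k * Z (k + s)) - (\<Sum>k<K. a k * (t * Z (k + s)))"
 proof -
  have "t * (\<Sum>k<K. a k * Z (k + s)) = (\<Sum>k<K. a k * (t * Z (k + s)))"
   by (simp add: sum_distrib_left mult_ac)
  thus ?thesis by (simp add: left_diff_distrib)
 qed
 also have "... = (\<Sum>k<K. a (Suc k) * Z (k + Suc s) - (a k * ((real (k + s) + 1) / (2 * (real (k + s) + 1 + l)) * Z (k + Suc s))
    + a (Suc (Suc k)) * (c (Suc k) * Z (k + Suc s))))"
  unfolding 1 2 by (simp add: sum_subtractf)
 also have "... = (\<Sum>k<K. zonal_step l s a k * Z (k + Suc s))"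
 proof (rule sum.cong)
  fix k
  define y where "y = real k + (real s + 1 + l)"
  have y: "y > 0" using l by (simp add: y_def)
  have e: "(real (k + s) + 1) / (2 * (real (k + s) + 1 + l)) = (y - l) / (2 * y)" "c (Suc k) = (y + l) / (2 * y)"
   by (simp_all add: c_def y_def algebra_simps)
  have zs: "a (Suc k) - (a k * ((y - l) / (2 * y)) + a (Suc (Suc k)) * ((y + l) / (2 * y))) = zonal_step l s a k"
   unfolding zonal_step_def y_def[symmetric] fdiff_def using y by (simp add: field_simps)
  show "a (Suc k) * Z (k + Suc s) - (a k * ((real (k + s) + 1) / (2 * (real (k + s) + 1 + l)) * Z (k + Suc s))
    + a (Suc (Suc k)) * (c (Suc k) * Z (k + Suc s))) = zonal_step l s a k * Z (k + Suc s)"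
   unfolding e zs[symmetric] by (simp only: left_diff_distrib distrib_right mult.assoc)
 qed simp
 finally show ?thesis by (simp add: Z_def l_def)
qed

lemma symbols_zonal_step:
 assumes a: "symbols P N m a" and l: "l > 0" and N: "!!p. p \<in> P ==> N p > 0"
 shows "symbols P N (m + 2) (%p. zonal_step l s (a p))"
proof -
 have 1: "symbols P N (Suc m) (%p. fdiff (a p))" by (rule symbols_fdiff[OF a])
 have "symbols P N (m + 2) (%p k. - (1 / 2) * fdiff (fdiff (a p)) k)"
  using symbols_cmult[OF symbols_fdiff[OF 1], of "- (1 / 2)"] unfolding add_2_eq_Suc' .
 moreover have "symbols P N (1 + Suc m) (%p k. 1 / (real k + (real s + 1 + l)) * (fdiff (a p) (Suc k) + fdiff (a p) k))"
  by (intro symbols_mult symbols_inverse symbols_add symbols_shift[of P N _ "%p. fdiff (a p)"] 1 N) (use l in auto)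
 hence "symbols P N (m + 2) (%p k. - (l / 2) * (1 / (real k + (real s + 1 + l)) * (fdiff (a p) (Suc k) + fdiff (a p) k)))"
  by (intro symbols_cmult) simp
 ultimately show ?thesis unfolding zonal_step_def by (rule symbols_add)
qed

primrec zonal_steps :: "real => nat => (nat => real) => nat => real" where
 "zonal_steps l 0 a = a"
| "zonal_steps l (Suc s) a = zonal_step l s (zonal_steps l s a)"

lemma symbols_zonal_steps:
 assumes "symbols P N 0 a" "l > 0" "!!p. p \<in> P ==> N p > 0"
 shows "symbols P N (2 * s) (%p. zonal_steps l s (a p))"
proof (induction s)
 case (Suc s)
 from symbols_zonal_step[OF this assms(2,3)] show ?case by simp
qed (use assms in simp)

lemma zonal_steps_support:
 assumes "!!k. real k < L ==> a k = 0" "!!k. real k > U ==> a k = 0"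
 shows "real k + 2 * real s < L \<or> real k > U ==> zonal_steps l s a k = 0"
proof (induction s arbitrary: k)
 case (Suc s)
 have "zonal_steps l s a k = 0" "zonal_steps l s a (Suc k) = 0" "zonal_steps l s a (Suc (Suc k)) = 0"
  using Suc.prems by (auto intro!: Suc.IH)
 thus ?case by (simp add: zonal_step_def fdiff_def)
qed (use assms in auto)

lemma zonal_steps_sum:
 assumes d: "d >= 3" and a: "!!k. real k < L ==> a k = 0" "!!k. real k > U ==> a k = 0"
  and L: "2 * real s <= L" and K: "real K > U"
 shows "(1 - t) ^ s * (\<Sum>k<K. a k * zonal d k t) =
   (\<Sum>k<K. zonal_steps ((real d - 2) / 2) s a k * zonal d (k + s) t)"
 using L
proof (induction s)
 case (Suc s)
 define b where "b = zonal_steps ((real d - 2) / 2) s a"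
 have b: "b k = 0" if "real k + 2 * real s < L \<or> real k > U" for k
  unfolding b_def using zonal_steps_support[OF a that] .
 have "(1 - t) ^ Suc s * (\<Sum>k<K. a k * zonal d k t) = (1 - t) * (\<Sum>k<K. b k * zonal d (k + s) t)"
  using Suc by (simp add: b_def mult.assoc)
 also have "... = (\<Sum>k<K. zonal_step ((real d - 2) / 2) s b k * zonal d (k + Suc s) t)"
  by (rule zonal_step_sum[OF d]) (use Suc.prems K in \<open>auto intro!: b\<close>)
 finally show ?case by (simp add: b_def)
qed simp

lemma zonal_sum_le:
 assumes d: "d >= 3" and t: "\<bar>t\<bar> <= 1" and N: "real s + 1 <= N"
  and b: "!!k. \<bar>b k\<bar> <= B" "!!k. real k > 2 * N ==> b k = 0"
 shows "\<bar>\<Sum>k<K. b k * zonal d (k + s) t\<bar> <= 6 * 3 ^ (d - 2) * B * N ^ (d - 1)"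
proof -
 have B: "B >= 0" using b(1)[of 0] by linarith
 have N1: "N >= 1" using N by simp
 define A where "A = {..<K} \<inter> {..nat \<lfloor>2 * N\<rfloor>}"
 have "(\<Sum>k<K. b k * zonal d (k + s) t) = (\<Sum>k\<in>A. b k * zonal d (k + s) t)"
 proof (rule sum.mono_neutral_right)
  show "\<forall>k\<in>{..<K} - A. b k * zonal d (k + s) t = 0"
  proof
   fix k assume "k \<in> {..<K} - A"
   hence "nat \<lfloor>2 * N\<rfloor> < k" by (auto simp: A_def)
   hence "real k > 2 * N" using N1 by (simp add: nat_less_iff floor_less_iff)
   thus "b k * zonal d (k + s) t = 0" using b(2) by simp
  qed
 qed (auto simp: A_def)
 also have "\<bar>...\<bar> <= (\<Sum>k\<in>A. B * (2 * (3 * N) ^ (d - 2)))"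
 proof (rule order_trans[OF sum_abs], rule sum_mono)
  fix k assume "k \<in> A"
  hence k: "real k <= 2 * N" using N1 by (auto simp: A_def le_nat_iff le_floor_iff)
  have "\<bar>zonal d (k + s) t\<bar> <= 2 * (real (k + s) + 1) ^ (d - 2)" by (rule abs_zonal_le[OF d t])
  also have "... <= 2 * (3 * N) ^ (d - 2)" using k N by (intro mult_left_mono power_mono) auto
  finally show "\<bar>b k * zonal d (k + s) t\<bar> <= B * (2 * (3 * N) ^ (d - 2))"
   unfolding abs_mult using B by (intro mult_mono b(1)) auto
 qed
 also have "... = real (card A) * (B * (2 * (3 * N) ^ (d - 2)))" by simp
 also have "... <= (3 * N) * (B * (2 * (3 * N) ^ (d - 2)))"
 proof (rule mult_right_mono)
  have "card A <= card {..nat \<lfloor>2 * N\<rfloor>}" unfolding A_def by (intro card_mono) auto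
  hence "real (card A) <= real (nat \<lfloor>2 * N\<rfloor>) + 1" by simp
  also have "real (nat \<lfloor>2 * N\<rfloor>) <= 2 * N" using N1 by simp
  finally show "real (card A) <= 3 * N" using N1 by simp
 qed (use B N1 in auto)
 also have "... = 6 * 3 ^ (d - 2) * B * N ^ (d - 1)"
 proof -
  have "d - 1 = Suc (d - 2)" using d by simp
  thus ?thesis by (simp add: power_mult_distrib)
 qed
 finally show ?thesis .
qed

text \<open>Since \<open>|x - y|\<^sup>2 = 2 * (1 - t)\<close>, the decay of order \<open>2 * M\<close> follows from a bound for \<open>(1 - t) ^ M\<close> times the kernel. The
 \<open>M\<close> multiplications by \<open>1 - t\<close> improve the coefficients by \<open>1 / N ^ (2 * M)\<close>. They lower the frequencies by at most
 \<open>2 * M\<close>, which stays above \<open>N / 4\<close> for \<open>N \<ge> 8 * M + 8\<close>; for smaller \<open>N\<close> the decay factor is bounded below and the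
 trivial bound suffices.\<close>

lemma zonal_kernel_decay:
 assumes d: "DIM('a::euclidean_space) >= 3" and a: "symbols P N 0 a" and N: "!!p. p \<in> P ==> N p >= 1"
  and supp: "!!p k. p \<in> P ==> a p k ~= 0 ==> N p / 2 <= real k \<and> real k <= 2 * N p"
 obtains C where "C > 0"
  "!!p (x::'a) y K. p \<in> P ==> norm x = 1 ==> norm y = 1 ==> 2 * N p < real K ==>
    \<bar>\<Sum>k<K. a p k * zonal DIM('a) k (x \<bullet> y)\<bar> <= C * N p ^ (DIM('a) - 1) / (1 + N p * norm (x - y)) ^ (2 * M)"
proof -
 define d where "d = DIM('a)"
 define l where "l = (real d - 2) / 2"
 define c where "c = 6 * (3::real) ^ (d - 2)"
 have d: "d >= 3" using assms(1) by (simp add: d_def)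
 have l: "l > 0" using d by (simp add: l_def)
 have Npos: "N p > 0" if "p \<in> P" for p using N[OF that] by simp
 have a0: "a p k = 0" if "p \<in> P" "real k < N p / 2 \<or> real k > 2 * N p" for p k
  using supp[OF that(1), of k] that(2) by force
 obtain C0 where C0: "C0 > 0" "!!p k. p \<in> P ==> N p > 0 ==> N p / 4 <= real k ==> \<bar>(fdiff ^^ 0) (a p) k\<bar> <= C0 / N p ^ (0 + 0)"
  using symbolsD[OF a] by metis
 obtain C1 where C1: "C1 > 0" "!!p k. p \<in> P ==> N p > 0 ==> N p / 4 <= real k ==> \<bar>(fdiff ^^ 0) (zonal_steps l M (a p)) k\<bar> <= C1 / N p ^ (2 * M + 0)"
  using symbolsD[OF symbols_zonal_steps[OF a l Npos]] by metis
 define S where "S = (%p K t. \<Sum>k<K. a p k * zonal d k t)"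
 have B0: "\<bar>S p K t\<bar> <= c * C0 * N p ^ (d - 1)" if p: "p \<in> P" and t: "\<bar>t\<bar> <= 1" for p K t
 proof -
  have "\<bar>a p k\<bar> <= C0" for k
   using C0(2)[OF p Npos[OF p], of k] a0[OF p, of k] C0(1) Npos[OF p] by (cases "N p / 4 <= real k") auto
  from zonal_sum_le[where s=0 and N="N p" and K=K and b="a p", OF d t _ this] show ?thesis using N[OF p] a0[OF p] by (simp add: S_def c_def)
 qed
 define C2 where "C2 = max C1 (2 ^ M * C0 * (8 * real M + 8) ^ (2 * M))"
 have BM: "(1 - t) ^ M * \<bar>S p K t\<bar> <= c * C2 / N p ^ (2 * M) * N p ^ (d - 1)"
  if p: "p \<in> P" and t: "\<bar>t\<bar> <= 1" and K: "2 * N p < real K" for p K t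
 proof (cases "N p >= 8 * real M + 8")
  case True
  have z: "zonal_steps l M (a p) k = 0" if "real k + 2 * real M < N p / 2 \<or> real k > 2 * N p" for k
   by (rule zonal_steps_support[OF _ _ that]) (use a0[OF p] in auto)
  have b: "\<bar>zonal_steps l M (a p) k\<bar> <= C1 / N p ^ (2 * M)" for k
  proof (cases "N p / 4 <= real k")
   case False
   hence "zonal_steps l M (a p) k = 0" using True by (intro z) auto
   thus ?thesis using C1(1) Npos[OF p] by simp
  qed (use C1(2)[OF p Npos[OF p], of k] in simp)
  have "(1 - t) ^ M * S p K t = (\<Sum>k<K. zonal_steps l M (a p) k * zonal d (k + M) t)"
   unfolding S_def l_def by (rule zonal_steps_sum[OF d, of "N p / 2" _ "2 * N p"]) (use a0[OF p] True K in auto)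
  hence "\<bar>(1 - t) ^ M * S p K t\<bar> <= c * (C1 / N p ^ (2 * M)) * N p ^ (d - 1)"
   using zonal_sum_le[where s=M and N="N p" and K=K, OF d t _ b] True z by (simp add: c_def)
  also have "... <= c * (C2 / N p ^ (2 * M)) * N p ^ (d - 1)"
   using Npos[OF p] by (intro mult_right_mono mult_left_mono divide_right_mono) (auto simp: C2_def c_def)
  finally show ?thesis using t by (simp add: abs_mult power_abs)
 next
  case False
  have "(1 - t) ^ M * \<bar>S p K t\<bar> <= 2 ^ M * (c * C0 * N p ^ (d - 1))"
   using t by (intro mult_mono power_mono B0 p) (auto simp: c_def)
  also have "... <= 2 ^ M * (c * C0 * N p ^ (d - 1)) * ((8 * real M + 8) ^ (2 * M) / N p ^ (2 * M))"
  proof -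
   have "1 <= (8 * real M + 8) ^ (2 * M) / N p ^ (2 * M)"
    using False Npos[OF p] by (simp add: power_mono)
   from mult_left_mono[OF this, of "2 ^ M * (c * C0 * N p ^ (d - 1))"] show ?thesis
    using C0(1) Npos[OF p] by (simp add: c_def)
  qed
  also have "... = c * (2 ^ M * C0 * (8 * real M + 8) ^ (2 * M)) / N p ^ (2 * M) * N p ^ (d - 1)" by simp
  also have "... <= c * C2 / N p ^ (2 * M) * N p ^ (d - 1)"
   using Npos[OF p] by (intro mult_right_mono divide_right_mono mult_left_mono) (auto simp: C2_def c_def)
  finally show ?thesis .
 qed
 define C where "C = 4 ^ M * (c * C0 + 2 ^ M * (c * C2))"
 have C2: "C2 > 0" using C1(1) by (simp add: C2_def)
 show ?thesis
 proof (rule that[of C])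
  show "C > 0" using C0(1) C2 by (simp add: C_def c_def add_pos_pos)
  fix p and x y :: 'a and K
  assume p: "p \<in> P" and xy: "norm x = 1" "norm y = 1" and K: "2 * N p < real K"
  define t where "t = x \<bullet> y"
  define u where "u = N p * norm (x - y)"
  have t: "\<bar>t\<bar> <= 1" unfolding t_def by (rule abs_inner_sphere_le[OF xy])
  have u: "u >= 0" using Npos[OF p] by (simp add: u_def)
  have "u ^ (2 * M) = N p ^ (2 * M) * ((norm (x - y))\<^sup>2) ^ M"
   by (simp add: u_def power_mult_distrib flip: power_mult)
  also have "... = N p ^ (2 * M) * (2 ^ M * (1 - t) ^ M)"
   unfolding norm_diff_sphere[OF xy] power_mult_distrib t_def ..
  finally have "u ^ (2 * M) = N p ^ (2 * M) * (2 ^ M * (1 - t) ^ M)" .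
  hence "u ^ (2 * M) * \<bar>S p K t\<bar> = N p ^ (2 * M) * 2 ^ M * ((1 - t) ^ M * \<bar>S p K t\<bar>)" by simp
  also have "... <= N p ^ (2 * M) * 2 ^ M * (c * C2 / N p ^ (2 * M) * N p ^ (d - 1))"
   using Npos[OF p] by (intro mult_left_mono BM p t K) auto
  also have "... = 2 ^ M * (c * C2) * N p ^ (d - 1)" using Npos[OF p] by simp
  finally have 1: "u ^ (2 * M) * \<bar>S p K t\<bar> <= 2 ^ M * (c * C2) * N p ^ (d - 1)" .
  have "(1 + u) ^ (2 * M) <= (2 * max 1 u) ^ (2 * M)" using u by (intro power_mono) auto
  also have "... = 4 ^ M * max 1 u ^ (2 * M)" by (simp add: power_mult_distrib power_mult)
  also have "max 1 u ^ (2 * M) <= 1 + u ^ (2 * M)" using u by (auto simp: max_def)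
  finally have "(1 + u) ^ (2 * M) * \<bar>S p K t\<bar> <= 4 ^ M * (1 + u ^ (2 * M)) * \<bar>S p K t\<bar>"
   by (intro mult_right_mono) auto
  also have "... = 4 ^ M * (\<bar>S p K t\<bar> + u ^ (2 * M) * \<bar>S p K t\<bar>)" by (simp add: algebra_simps)
  also have "... <= 4 ^ M * (c * C0 * N p ^ (d - 1) + 2 ^ M * (c * C2) * N p ^ (d - 1))"
   by (intro mult_left_mono add_mono B0 p t 1) auto
  also have "... = C * N p ^ (d - 1)" by (simp add: C_def algebra_simps)
  finally show "\<bar>\<Sum>k<K. a p k * zonal DIM('a) k (x \<bullet> y)\<bar> <= C * N p ^ (DIM('a) - 1) / (1 + N p * norm (x - y)) ^ (2 * M)"
   using u by (simp add: pos_le_divide_eq S_def t_def d_def u_def mult.commute)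
 qed
qed

lemma cutoff_derivatives:
 assumes "cutoff \<phi>"
 obtains g where "g 0 = \<phi>" "!!i x. (g i has_real_derivative g (Suc i) x) (at x)" "!!i x. \<bar>x\<bar> > 2 ==> g i x = 0"
proof -
 define g where "g = (%i. iter_deriv (replicate i (1::real)) \<phi>)"
 have sm: "iter_deriv (replicate i 1) \<phi> differentiable (at x)" for i x
 proof -
  have "set (replicate i (1::real)) \<subseteq> Basis" by auto
  thus ?thesis using assms unfolding cutoff_def smooth_fun_on_def by blast
 qed
 have g: "(g i has_real_derivative g (Suc i) x) (at x)" for i x
 proof -
  have "(g i has_derivative frechet_derivative (g i) (at x)) (at x)"
   using sm[of i x] unfolding g_def by (rule frechet_derivative_works[THEN iffD1])
  moreover have "frechet_derivative (g i) (at x) = (*) (g (Suc i) x)"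
  proof
   fix h
   have "frechet_derivative (g i) (at x) (h *\<^sub>R 1) = h *\<^sub>R frechet_derivative (g i) (at x) 1"
    by (rule linear_scale[OF has_derivative_linear[OF calculation]])
   thus "frechet_derivative (g i) (at x) h = g (Suc i) x * h"
    unfolding real_scaleR_def mult_1_right by (simp only: g_def replicate_Suc iter_deriv.simps mult.commute)
  qed
  ultimately show ?thesis by (simp add: has_field_derivative_def)
 qed
 have g0: "g i x = 0" if "\<bar>x\<bar> > 2" for i x
  using that
 proof (induction i arbitrary: x)
  case 0
  thus ?case using assms by (force simp: g_def cutoff_def)
 next
  case (Suc i)
  have "open {x::real. \<bar>x\<bar> > 2}" by (intro open_Collect_less continuous_intros)
  moreover have "((%_. 0) has_real_derivative 0) (at x)" by simp
  ultimately have "(g i has_real_derivative 0) (at x)"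
   using Suc by (elim has_field_derivative_transform_within_open[where S="{x. \<bar>x\<bar> > 2}"]) auto
  thus ?case using g DERIV_unique by blast
 qed
 have "g 0 = \<phi>" by (simp add: g_def)
 thus ?thesis using g g0 by (rule that)
qed

lemma bounded_of_support:
 fixes g :: "real => real"
 assumes "!!x. (g has_real_derivative g' x) (at x)" "!!x. \<bar>x\<bar> > 2 ==> g x = 0"
 shows "\<exists>B. \<forall>x. \<bar>g x\<bar> <= B"
proof -
 have "compact (g ` {-2..2})"
  by (intro compact_continuous_image continuous_at_imp_continuous_on ballI DERIV_isCont[OF assms(1)]) auto
 then obtain B where B: "!!x. x \<in> {-2..2} ==> \<bar>g x\<bar> <= B"
  by (force dest!: compact_imp_bounded simp: bounded_iff)
 have "\<bar>g x\<bar> <= max B 0" for x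
 proof (cases "\<bar>x\<bar> > 2")
  case False
  hence "\<bar>g x\<bar> <= B" by (intro B) auto
  thus ?thesis by simp
 qed (simp add: assms(2))
 thus ?thesis by blast
qed

lemma cutoff_support:
 assumes "cutoff \<phi>" "N > 0" "\<phi> (real k / N) ~= 0"
 shows "N / 2 <= real k \<and> real k <= 2 * N"
proof -
 have "1 / 2 <= real k / N \<and> real k / N <= 2" using assms unfolding cutoff_def by force
 thus ?thesis using assms(2) by (simp add: field_simps)
qed

lemma poisson_kernel_decay:
 assumes d: "DIM('a::euclidean_space) >= 3" and \<phi>: "cutoff \<phi>"
 obtains C where "C > 0"
  "!!N r (x::'a) y K. N >= 1 ==> 0 <= r ==> r <= 1 ==> norm x = 1 ==> norm y = 1 ==> 2 * N < real K ==>
    \<bar>\<Sum>k<K. \<phi> (real k / N) * r ^ k * zonal DIM('a) k (x \<bullet> y)\<bar> <= C * N ^ (DIM('a) - 1) / (1 + N * norm (x - y)) ^ (2 * M)"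
proof -
 obtain g where g: "g 0 = \<phi>" "!!i x. (g i has_real_derivative g (Suc i) x) (at x)" "!!i x. \<bar>x\<bar> > 2 ==> g i x = 0"
  using cutoff_derivatives[OF \<phi>] by blast
 define P where "P = {(N::real, r::real). N >= 1 \<and> 0 <= r \<and> r <= 1}"
 have 1: "symbols P fst 0 (%p k. g 0 (real k / fst p))"
 proof (rule symbols_dilation[where g=g])
  show "\<exists>B. \<forall>x. \<bar>g i x\<bar> <= B" for i by (rule bounded_of_support[OF g(2,3)])
 qed (use g(2) in \<open>auto simp: P_def\<close>)
 have 2: "symbols P fst 0 (%p k. snd p ^ k)"
  by (rule symbols_geometric) (auto simp: P_def)
 have "symbols P fst (0 + 0) (%p k. g 0 (real k / fst p) * snd p ^ k)"
  by (rule symbols_mult[OF 1 2]) (auto simp: P_def)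
 hence s: "symbols P fst 0 (%p k. \<phi> (real k / fst p) * snd p ^ k)" by (simp add: g(1))
 show ?thesis
 proof (rule zonal_kernel_decay[OF d s, of M])
  fix C assume C: "C > 0" "!!p (x::'a) y K. p \<in> P ==> norm x = 1 ==> norm y = 1 ==> 2 * fst p < real K ==>
    \<bar>\<Sum>k<K. \<phi> (real k / fst p) * snd p ^ k * zonal DIM('a) k (x \<bullet> y)\<bar>
     <= C * fst p ^ (DIM('a) - 1) / (1 + fst p * norm (x - y)) ^ (2 * M)"
  show ?thesis
   by (rule that[OF C(1)]) (use C(2)[of "(N, r)" for N r] in \<open>auto simp: P_def\<close>)
 next
  fix p k assume "p \<in> P" "\<phi> (real k / fst p) * snd p ^ k ~= 0"
  thus "fst p / 2 <= real k \<and> real k <= 2 * fst p"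
   by (intro cutoff_support[OF \<phi>]) (auto simp: P_def)
 qed (auto simp: P_def)
qed

text \<open>Here the symbol is the dilation of \<open>\<phi> x * exp x\<close>, which is again smooth with compact support. In the proof
 \<open>h i l\<close> is the \<open>l\<close>-th derivative of the function obtained from \<open>\<phi>\<close> by \<open>i\<close> applications of \<open>F \<mapsto> F + F'\<close>, so that
 \<open>exp x * h i 0 x\<close> is the \<open>i\<close>-th derivative of \<open>\<phi> x * exp x\<close>.\<close>

lemma inverse_poisson_kernel_decay:
 assumes d: "DIM('a::euclidean_space) >= 3" and \<phi>: "cutoff \<phi>"
 obtains C where "C > 0"
  "!!N (x::'a) y K. N >= 1 ==> norm x = 1 ==> norm y = 1 ==> 2 * N < real K ==>
    \<bar>\<Sum>k<K. \<phi> (real k / N) * exp (real k / N) * zonal DIM('a) k (x \<bullet> y)\<bar> <= C * N ^ (DIM('a) - 1) / (1 + N * norm (x - y)) ^ (2 * M)"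
proof -
 obtain f where f: "f 0 = \<phi>" "!!i x. (f i has_real_derivative f (Suc i) x) (at x)" "!!i x. \<bar>x\<bar> > 2 ==> f i x = 0"
  using cutoff_derivatives[OF \<phi>] by blast
 define h where "h = rec_nat f (%_ F l x. F l x + F (Suc l) x)"
 have h_simps: "h 0 = f" "h (Suc i) = (%l x. h i l x + h i (Suc l) x)" for i by (simp_all add: h_def)
 have h': "(h i l has_real_derivative h i (Suc l) x) (at x)" for i l x
  by (induction i arbitrary: l) (auto simp: h_simps intro!: DERIV_add f(2))
 have h0: "h i l x = 0" if "\<bar>x\<bar> > 2" for i l x
  by (induction i arbitrary: l) (auto simp: h_simps f(3) that)
 define g where "g = (%i x. exp x * h i 0 x)"
 have g': "(g i has_real_derivative g (Suc i) x) (at x)" for i x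
  unfolding g_def by (auto simp: h_simps algebra_simps intro!: derivative_eq_intros h')
 have g0: "g i x = 0" if "\<bar>x\<bar> > 2" for i x using h0[OF that] by (simp add: g_def)
 define P where "P = {N::real. N >= 1}"
 have "symbols P (%N. N) 0 (%N k. g 0 (real k / N))"
 proof (rule symbols_dilation[where g=g])
  show "\<exists>B. \<forall>x. \<bar>g i x\<bar> <= B" for i by (rule bounded_of_support[OF g' g0])
 qed (use g' in \<open>auto simp: P_def\<close>)
 hence s: "symbols P (%N. N) 0 (%N k. \<phi> (real k / N) * exp (real k / N))"
  by (simp add: g_def h_simps f(1) mult.commute)
 show ?thesis
 proof (rule zonal_kernel_decay[OF d s, of M])
  fix C assume C: "C > 0" "!!N (x::'a) y K. N \<in> P ==> norm x = 1 ==> norm y = 1 ==> 2 * N < real K ==>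
    \<bar>\<Sum>k<K. \<phi> (real k / N) * exp (real k / N) * zonal DIM('a) k (x \<bullet> y)\<bar>
     <= C * N ^ (DIM('a) - 1) / (1 + N * norm (x - y)) ^ (2 * M)"
  show ?thesis
   by (rule that[OF C(1)]) (use C(2) in \<open>auto simp: P_def\<close>)
 next
  fix N k assume "N \<in> P" "\<phi> (real k / N) * exp (real k / N) ~= 0"
  thus "N / 2 <= real k \<and> real k <= 2 * N"
   by (intro cutoff_support[OF \<phi>]) (auto simp: P_def)
 qed (auto simp: P_def)
qed

section \<open>Zonal test functions\<close>

text \<open>\<open>g k x z\<close> is a function of \<open>z ~= 0\<close> that depends on a frequency \<open>k\<close> and on a point \<open>x\<close> of the
 sphere. The class below is closed under differentiation in \<open>z\<close>, and its members grow at most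
 polynomially in \<open>k\<close>.\<close>

inductive tame :: "(nat => 'a::euclidean_space => 'a => real) => bool" where
 tame_coeff: "(!!k. \<bar>c k\<bar> <= C * (real k + 1) ^ A) ==> tame (%k x z. c k)"
| tame_x: "tame (%k x z. x \<bullet> b)"
| tame_z: "tame (%k x z. z \<bullet> b)"
| tame_xz: "tame (%k x z. x \<bullet> z)"
| tame_inverse: "tame (%k x z. inverse (norm z))"
| tame_sol: "m >= 1 ==> tame (%k x z. sol (real m / 2) (int k - int n) (x \<bullet> sgn z) 1)"
| tame_add: "tame g ==> tame h ==> tame (%k x z. g k x z + h k x z)"
| tame_mult: "tame g ==> tame h ==> tame (%k x z. g k x z * h k x z)"

lemma tame_const: "tame (%k x z. c)"
 by (rule tame_coeff[of "%_. c" "\<bar>c\<bar>" 0]) simp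

lemma tame_cmult: "tame g ==> tame (%k x z. c * g k x z)"
 by (rule tame_mult[OF tame_const])

lemma has_derivative_inverse_norm:
 fixes z :: "'a::euclidean_space"
 assumes "z ~= 0"
 shows "((%z. inverse (norm z)) has_derivative
   (%h. - 1 * (inverse (norm z) * (inverse (norm z) * (inverse (norm z) * (z \<bullet> h)))))) (at z)"
proof -
 have "(norm has_derivative (%h. h \<bullet> sgn z)) (at z)" using has_derivative_norm[OF assms] .
 from Deriv.has_derivative_inverse[OF _ this] show ?thesis
  using assms by (simp add: sgn_div_norm inner_commute mult_ac)
qed

lemma has_derivative_inner_sgn:
 fixes x z :: "'a::euclidean_space"
 assumes "z ~= 0"
 shows "((%z. x \<bullet> sgn z) has_derivative
   (%h. inverse (norm z) * (x \<bullet> h) + - 1 * (inverse (norm z) * (inverse (norm z) * (inverse (norm z) * ((x \<bullet> z) * (z \<bullet> h))))))) (at z)"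
proof -
 have "((%z. inverse (norm z) * (x \<bullet> z)) has_derivative
   (%h. inverse (norm z) * (x \<bullet> h) + - 1 * (inverse (norm z) * (inverse (norm z) * (inverse (norm z) * ((x \<bullet> z) * (z \<bullet> h))))))) (at z)"
  by (rule has_derivative_eq_rhs, rule has_derivative_mult[OF has_derivative_inverse_norm[OF assms]
    bounded_linear.has_derivative[OF bounded_linear_inner_right has_derivative_ident]])
   (simp add: mult_ac)
 thus ?thesis by (simp add: sgn_div_norm)
qed

lemma tame_deriv:
 "tame g ==> \<exists>G. (\<forall>h. tame (G h)) \<and> (\<forall>k x z. z ~= 0 --> (g k x has_derivative (%h. G h k x z)) (at z))"
proof (induction rule: tame.induct)
 case (tame_coeff c C A)
 show ?case by (rule exI[of _ "%h k x z. 0"]) (auto intro: tame_const)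
next
 case (tame_x b)
 show ?case by (rule exI[of _ "%h k x z. 0"]) (auto intro: tame_const)
next
 case (tame_z b)
 show ?case by (rule exI[of _ "%h k x z. h \<bullet> b"]) (auto intro!: tame_const derivative_eq_intros)
next
 case tame_xz
 show ?case by (rule exI[of _ "%h k x z. x \<bullet> h"]) (auto intro!: tame.intros derivative_eq_intros)
next
 case tame_inverse
 show ?case
 proof (intro exI[of _ "%h k x z. - 1 * (inverse (norm z) * (inverse (norm z) * (inverse (norm z) * (z \<bullet> h))))"] conjI allI impI)
  fix k :: nat and x z :: 'a assume z: "z ~= 0"
  show "((%z. inverse (norm z)) has_derivative
     (%h. - 1 * (inverse (norm z) * (inverse (norm z) * (inverse (norm z) * (z \<bullet> h)))))) (at z)"
   by (rule has_derivative_inverse_norm[OF z])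
 qed (intro tame_const tame.intros tame_cmult)
next
 case (tame_sol m n)
 define D :: "'a => nat => 'a => 'a => real" where "D = (%h k x z. inverse (norm z) * (x \<bullet> h) + - 1 * (inverse (norm z) * (inverse (norm z) * (inverse (norm z) * ((x \<bullet> z) * (z \<bullet> h))))))"
 have l: "real m / 2 + 1 = real (m + 2) / 2" by simp
 show ?case
 proof (intro exI[of _ "%h k x z. 2 * (real m / 2) * (sol (real (m + 2) / 2) (int k - int (Suc n)) (x \<bullet> sgn z) 1 * D h k x z)"] conjI allI impI)
  fix k :: nat and x z :: 'a assume z: "z ~= 0"
  have "((%z. sol (real m / 2) (int k - int n) (x \<bullet> sgn z) 1) has_derivative
    (%h. 2 * (real m / 2) * sol (real m / 2 + 1) (int k - int n - 1) (x \<bullet> sgn z) 1 * D h k x z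
     - (real m / 2) * sol (real m / 2 + 1) (int k - int n - 2) (x \<bullet> sgn z) 1 * 0)) (at z)"
   unfolding D_def by (intro has_derivative_sol has_derivative_inner_sgn z has_derivative_const)
  moreover have "int k - int n - 1 = int k - int (Suc n)" by simp
  ultimately show "((%z. sol (real m / 2) (int k - int n) (x \<bullet> sgn z) 1) has_derivative
    (%h. 2 * (real m / 2) * (sol (real (m + 2) / 2) (int k - int (Suc n)) (x \<bullet> sgn z) 1 * D h k x z))) (at z)"
   unfolding l by (simp only: mult.assoc mult_zero_right diff_zero)
 next
  fix h :: 'a
  show "tame (%k x z. 2 * (real m / 2) * (sol (real (m + 2) / 2) (int k - int (Suc n)) (x \<bullet> sgn z) 1 * D h k x z))"
   unfolding D_def by (intro tame_cmult tame_const tame.tame_mult tame.tame_add tame.tame_inverse tame.tame_x tame.tame_z tame.tame_xz tame.tame_sol) simp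
 qed
next
 case (tame_add g h)
 then obtain G H where "!!v. tame (G v)" "!!v. tame (H v)"
  "!!k x z. z ~= 0 ==> (g k x has_derivative (%v. G v k x z)) (at z)"
  "!!k x z. z ~= 0 ==> (h k x has_derivative (%v. H v k x z)) (at z)" by metis
 thus ?case
  by (intro exI[of _ "%v k x z. G v k x z + H v k x z"]) (auto intro!: tame.tame_add has_derivative_add)
next
 case (tame_mult g h)
 then obtain G H where GH: "!!v. tame (G v)" "!!v. tame (H v)"
  "!!k x z. z ~= 0 ==> (g k x has_derivative (%v. G v k x z)) (at z)"
  "!!k x z. z ~= 0 ==> (h k x has_derivative (%v. H v k x z)) (at z)" by metis
 show ?case
  by (intro exI[of _ "%v k x z. g k x z * H v k x z + G v k x z * h k x z"])
   (use GH tame_mult.hyps in \<open>auto intro!: tame.tame_add tame.tame_mult has_derivative_mult\<close>)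
qed

lemma abs_sol_half_le:
 assumes "m >= 1" "\<bar>t\<bar> <= 1"
 shows "\<bar>sol (real m / 2) (int k - int n) t 1\<bar> <= (real k + 1) ^ m"
proof (cases "int k - int n < 0")
 case False
 define j where "j = nat (int k - int n)"
 have j: "int j = int k - int n" "j <= k" using False by (auto simp: j_def)
 have "\<bar>gegenbauer (real m / 2) j t\<bar> <= (real j + 1) ^ (m - 1)" by (rule abs_gegenbauer_half_le[OF assms])
 also have "... <= (real j + 1) ^ m" by (intro power_increasing) auto
 also have "... <= (real k + 1) ^ m" using j by (intro power_mono) auto
 finally show ?thesis using False by (simp add: sol_def solid_1 j_def)
qed (simp add: sol_def)

lemma tame_bound:
 fixes g :: "nat => 'a::euclidean_space => 'a => real"
 assumes "tame g" and R: "R > 0"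
 shows "\<exists>C A. 0 <= C \<and> (\<forall>k x z. norm x = 1 --> 1 / R <= norm z --> norm z <= R --> \<bar>g k x z\<bar> <= C * (real k + 1) ^ A)"
 using assms(1)
proof (induction rule: tame.induct)
 case (tame_coeff c C A)
 have "0 <= C" using tame_coeff[of 0] by simp
 thus ?case using tame_coeff by auto
next
 case (tame_x b)
 have "\<bar>x \<bullet> b\<bar> <= norm b" if "norm x = 1" for x using Cauchy_Schwarz_ineq2[of x b] that by simp
 thus ?case by (intro exI[of _ "norm b"] exI[of _ 0]) auto
next
 case (tame_z b)
 have "\<bar>z \<bullet> b\<bar> <= R * norm b" if "norm z <= R" for z
  using order_trans[OF Cauchy_Schwarz_ineq2[of z b] mult_right_mono[OF that norm_ge_zero]] .
 thus ?case using R by (intro exI[of _ "R * norm b"] exI[of _ 0]) auto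
next
 case tame_xz
 have "\<bar>x \<bullet> z\<bar> <= R" if "norm x = 1" "norm z <= R" for x z :: 'a
  using order_trans[OF Cauchy_Schwarz_ineq2[of x z]] that by simp
 thus ?case using R by (intro exI[of _ R] exI[of _ 0]) auto
next
 case tame_inverse
 have "\<bar>inverse (norm z)\<bar> <= R" if "1 / R <= norm z" for z :: 'a
 proof -
  have "inverse (norm z) <= inverse (1 / R)" using that R by (intro le_imp_inverse_le) auto
  thus ?thesis using R by simp
 qed
 thus ?case using R by (intro exI[of _ R] exI[of _ 0]) auto
next
 case (tame_sol m n)
 have "\<bar>x \<bullet> sgn z\<bar> <= 1" if "norm x = 1" for x z :: 'a
  using Cauchy_Schwarz_ineq2[of x "sgn z"] that by (simp add: norm_sgn split: if_splits)
 thus ?case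
  using abs_sol_half_le[OF tame_sol] by (intro exI[of _ 1] exI[of _ m]) auto
next
 case (tame_add g h)
 then obtain C A D B where C: "0 <= C" "0 <= D"
  "!!k x z. norm x = 1 ==> 1 / R <= norm z ==> norm z <= R ==> \<bar>g k x z\<bar> <= C * (real k + 1) ^ A"
  "!!k x z. norm x = 1 ==> 1 / R <= norm z ==> norm z <= R ==> \<bar>h k x z\<bar> <= D * (real k + 1) ^ B" by metis
 have "\<bar>g k x z + h k x z\<bar> <= (C + D) * (real k + 1) ^ (A + B)" if "norm x = 1" "1 / R <= norm z" "norm z <= R" for k x z
 proof -
  have "C * (real k + 1) ^ A <= C * (real k + 1) ^ (A + B)" "D * (real k + 1) ^ B <= D * (real k + 1) ^ (A + B)"
   using C(1,2) by (auto intro!: mult_left_mono power_increasing)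
  thus ?thesis using C(3,4)[OF that, of k] by (simp add: distrib_right)
 qed
 thus ?case using C(1,2) by (intro exI[of _ "C + D"] exI[of _ "A + B"]) auto
next
 case (tame_mult g h)
 then obtain C A D B where C: "0 <= C" "0 <= D"
  "!!k x z. norm x = 1 ==> 1 / R <= norm z ==> norm z <= R ==> \<bar>g k x z\<bar> <= C * (real k + 1) ^ A"
  "!!k x z. norm x = 1 ==> 1 / R <= norm z ==> norm z <= R ==> \<bar>h k x z\<bar> <= D * (real k + 1) ^ B" by metis
 have "\<bar>g k x z * h k x z\<bar> <= (C * D) * (real k + 1) ^ (A + B)" if "norm x = 1" "1 / R <= norm z" "norm z <= R" for k x z
  using mult_mono[OF C(3)[OF that, of k] C(4)[OF that, of k]] C(1) by (simp add: abs_mult power_add mult_ac)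
 thus ?case using C(1,2) by (intro exI[of _ "C * D"] exI[of _ "A + B"]) auto
qed

text \<open>The zonal series with such coefficients, among them the Poisson kernels, can be differentiated termwise any number of
 times, as the terms of the derivatives grow only polynomially.\<close>

definition geometric_decay :: "(nat => real) => bool" where
 "geometric_decay c \<longleftrightarrow> (\<exists>D r. 0 <= r \<and> r < 1 \<and> (\<forall>k. \<bar>c k\<bar> <= D * r ^ k))"

lemma geometric_decay_summable:
 assumes "geometric_decay c"
 shows "summable (%k. \<bar>c k\<bar> * (real k + 1) ^ A)"
proof -
 obtain D r where r: "0 <= r" "r < 1" "!!k. \<bar>c k\<bar> <= D * r ^ k" using assms unfolding geometric_decay_def by blast
 show ?thesis
 proof (rule summable_comparison_test)
  show "summable (%k. D * ((real k + 1) ^ A * r ^ k))"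
   by (intro summable_mult summable_power_mult_geometric) (use r in auto)
  show "\<exists>N. \<forall>k\<ge>N. norm (\<bar>c k\<bar> * (real k + 1) ^ A) <= D * ((real k + 1) ^ A * r ^ k)"
   using mult_right_mono[OF r(3), of "(real k + 1) ^ A" for k] by (intro exI[of _ 0]) (auto simp: abs_mult mult_ac)
 qed
qed

lemma tame_summable:
 fixes g :: "nat => 'a::euclidean_space => 'a => real"
 assumes "tame g" "geometric_decay c" "norm x = 1" "z ~= 0"
 shows "summable (%k. \<bar>c k * g k x z\<bar>)"
proof -
 define R where "R = max (norm z) (1 / norm z)"
 have R: "R > 0" "1 / R <= norm z" "norm z <= R" using assms(4) by (auto simp: R_def max_def field_simps)
 obtain C A where "!!k x z. norm x = 1 ==> 1 / R <= norm z ==> norm z <= R ==> \<bar>g k x z\<bar> <= C * (real k + 1) ^ A"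
  using tame_bound[OF assms(1) R(1)] by blast
 hence "\<bar>g k x z\<bar> <= C * (real k + 1) ^ A" for k using assms(3) R by blast
 thus ?thesis
  using mult_left_mono[of "\<bar>g k x z\<bar>" "C * (real k + 1) ^ A" "\<bar>c k\<bar>" for k]
  by (intro summable_comparison_test[OF _ summable_mult[OF geometric_decay_summable[OF assms(2), of A], of C]] exI[of _ 0])
   (auto simp: abs_mult mult_ac)
qed

text \<open>Termwise differentiation on a ball about \<open>z\<close> that stays away from the origin; there the series of the derivatives
 converges uniformly by the polynomial bounds.\<close>

lemma has_derivative_tame_series:
 fixes g :: "nat => 'a::euclidean_space => 'a => real"
 assumes G: "!!h. tame (G h)" "!!k x z. z ~= 0 ==> (g k x has_derivative (%h. G h k x z)) (at z)"
  and g: "tame g" and c: "geometric_decay c" and x: "norm x = 1" and z: "z ~= 0"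
 shows "((%z. \<Sum>k. c k * g k x z) has_derivative (%h. \<Sum>k. c k * G h k x z)) (at z)"
proof -
 define S where "S = ball z (norm z / 2)"
 define R where "R = max (2 * norm z) (2 / norm z)"
 have R: "R > 0" using z by (simp add: R_def max_def)
 have S: "y ~= 0" "1 / R <= norm y" "norm y <= R" if "y \<in> S" for y
 proof -
  have "norm (z - y) < norm z / 2" using that by (simp add: S_def dist_norm)
  hence y: "norm z / 2 < norm y" "norm y < 2 * norm z"
   using norm_triangle_ineq2[of z y] norm_triangle_ineq2[of y z] by (auto simp: norm_minus_commute)
  thus "y ~= 0" by auto
  have "1 / R <= 1 / (2 / norm z)" using z by (intro divide_left_mono) (auto simp: R_def max_def)
  thus "1 / R <= norm y" using y by simp
  show "norm y <= R" using y by (simp add: R_def)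
 qed
 have "\<forall>b. \<exists>p. 0 <= fst p \<and> (\<forall>k x z. norm x = 1 --> 1 / R <= norm z --> norm z <= R --> \<bar>G b k x z\<bar> <= fst p * (real k + 1) ^ snd p)"
  using tame_bound[OF G(1) R] by (simp add: split_paired_Ex)
 from choice[OF this] obtain p where p: "!!b. 0 <= fst (p b)"
  "!!b k x z. norm x = 1 ==> 1 / R <= norm z ==> norm z <= R ==> \<bar>G b k x z\<bar> <= fst (p b) * (real k + 1) ^ snd (p b)"
  by blast
 define C where "C = (%b. fst (p b))"
 define A where "A = (%b. snd (p b))"
 have CA: "0 <= C b" "norm x = 1 ==> 1 / R <= norm z ==> norm z <= R ==> \<bar>G b k x z\<bar> <= C b * (real k + 1) ^ A b" for b k x z
  using p by (auto simp: C_def A_def)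
 define E where "E = (%k. \<Sum>b\<in>Basis. C b * (\<bar>c k\<bar> * (real k + 1) ^ A b))"
 have E: "summable E" unfolding E_def
  by (intro summable_sum summable_mult geometric_decay_summable c)
 have lin: "G h k x y = (\<Sum>b\<in>Basis. (h \<bullet> b) * G b k x y)" if "y \<in> S" for h k y
 proof -
  interpret linear "%h. G h k x y" by (rule has_derivative_linear[OF G(2)[OF S(1)[OF that]]])
  have "G (\<Sum>b\<in>Basis. (h \<bullet> b) *\<^sub>R b) k x y = (\<Sum>b\<in>Basis. (h \<bullet> b) * G b k x y)"
   by (simp add: sum scale)
  thus ?thesis by (simp add: euclidean_representation)
 qed
 have Gle: "\<bar>c k * G h k x y\<bar> <= norm h * E k" if y: "y \<in> S" for h k y
 proof -
  have "\<bar>G h k x y\<bar> <= (\<Sum>b\<in>Basis. norm h * (C b * (real k + 1) ^ A b))"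
   by (subst lin[OF y], rule order_trans[OF sum_abs], rule sum_mono)
    (auto simp: abs_mult intro!: mult_mono Basis_le_norm CA x S[OF y])
  hence "\<bar>c k\<bar> * \<bar>G h k x y\<bar> <= \<bar>c k\<bar> * (\<Sum>b\<in>Basis. norm h * (C b * (real k + 1) ^ A b))"
   by (rule mult_left_mono) simp
  thus ?thesis by (simp add: abs_mult E_def sum_distrib_left mult_ac)
 qed
 have sm: "summable (%k. \<bar>c k * G h k x y\<bar>)" if "y \<in> S" for h y
  by (rule tame_summable[OF G(1) c x S(1)[OF that]])
 have "\<exists>F. \<forall>y\<in>S. (%k. c k * g k x y) sums F y \<and> (F has_derivative (%h. \<Sum>k. c k * G h k x y)) (at y within S)"
 proof (rule has_derivative_series)
  show "convex S" by (simp add: S_def)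
  show "z \<in> S" using z by (simp add: S_def)
  show "((%y. c k * g k x y) has_derivative (%h. c k * G h k x y)) (at y within S)" if "y \<in> S" for k y
   by (rule has_derivative_mult_right[OF has_derivative_at_withinI[OF G(2)[OF S(1)[OF that]]]])
  show "(%k. c k * g k x z) sums (\<Sum>k. c k * g k x z)"
   using summable_rabs_cancel[OF tame_summable[OF g c x z]] by (rule summable_sums)
  fix e :: real assume e: "e > 0"
  obtain n0 where n0: "!!n. n >= n0 ==> norm (\<Sum>i. E (i + n)) < e"
   using suminf_exist_split[OF e E] by blast
  have "\<bar>(\<Sum>i<n. c i * G h i x y) - (\<Sum>k. c k * G h k x y)\<bar> <= e * norm h" if n: "n >= n0" and y: "y \<in> S" for n h y
  proof -
   note s1 = summable_ignore_initial_segment[OF sm[OF y, of h], of n]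
   note s2 = summable_rabs[OF s1]
   have s: "summable (%k. c k * G h k x y)" using sm[OF y] by (rule summable_rabs_cancel)
   have "\<bar>(\<Sum>i<n. c i * G h i x y) - (\<Sum>k. c k * G h k x y)\<bar> = \<bar>\<Sum>k. c (k + n) * G h (k + n) x y\<bar>"
    using suminf_split_initial_segment[OF s, of n] by simp
   also have "... <= (\<Sum>k. \<bar>c (k + n) * G h (k + n) x y\<bar>)"
    by (rule s2)
   also have "... <= (\<Sum>k. norm h * E (k + n))"
    using suminf_le[OF Gle[OF y] s1 summable_mult[OF summable_ignore_initial_segment[OF E, of n]]] by simp
   also have "... = norm h * (\<Sum>k. E (k + n))"
    by (rule suminf_mult[OF summable_ignore_initial_segment[OF E, of n]])
   also have "... <= norm h * e" using n0[OF n] by (intro mult_left_mono) auto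
   finally show ?thesis by (simp add: mult.commute)
  qed
  thus "\<forall>\<^sub>F n in sequentially. \<forall>y\<in>S. \<forall>h. norm ((\<Sum>i<n. c i * G h i x y) - (\<Sum>k. c k * G h k x y)) <= e * norm h"
   by (intro eventually_sequentiallyI[of n0]) auto
 qed
 then obtain F where F: "!!y. y \<in> S ==> (%k. c k * g k x y) sums F y"
  "!!y. y \<in> S ==> (F has_derivative (%h. \<Sum>k. c k * G h k x y)) (at y within S)" by blast
 have z_S: "z \<in> S" "open S" using z by (auto simp: S_def)
 hence "(F has_derivative (%h. \<Sum>k. c k * G h k x z)) (at z)"
  using F(2)[OF z_S(1)] at_within_open[OF z_S] by simp
 thus ?thesis
  by (rule has_derivative_transform_within_open[OF _ z_S(2,1)]) (rule sums_unique[OF F(1)])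
qed

text \<open>Iterated derivatives only see the function on an open set.\<close>

lemma has_derivative_cong_open:
 assumes "open U" "z \<in> U" "!!z. z \<in> U ==> u z = v z"
 shows "(u has_derivative D) (at z) \<longleftrightarrow> (v has_derivative D) (at z)"
proof
 assume "(u has_derivative D) (at z)"
 thus "(v has_derivative D) (at z)"
  by (rule has_derivative_transform_within_open[OF _ assms])
next
 assume "(v has_derivative D) (at z)"
 thus "(u has_derivative D) (at z)"
  by (rule has_derivative_transform_within_open[OF _ assms(1,2)]) (rule assms(3)[symmetric])
qed

lemma iter_deriv_cong:
 assumes "open U" "!!z. z \<in> U ==> u z = v z"
 shows "z \<in> U ==> iter_deriv bs u z = iter_deriv bs v z"
proof (induction bs arbitrary: z)
 case (Cons b bs)
 show ?case
  unfolding iter_deriv.simps frechet_derivative_def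
  using has_derivative_cong_open[OF assms(1) Cons.prems, of "iter_deriv bs u" "iter_deriv bs v", OF Cons.IH] by simp
qed (use assms in auto)

lemma differentiable_cong_open:
 assumes "open U" "z \<in> U" "!!z. z \<in> U ==> u z = v z"
 shows "u differentiable (at z) \<longleftrightarrow> v differentiable (at z)"
 unfolding differentiable_def using has_derivative_cong_open[OF assms] by simp

lemma iter_deriv_tame_series:
 fixes g :: "nat => 'a::euclidean_space => 'a => real"
 assumes "tame g"
 shows "\<exists>g'. tame g' \<and> (\<forall>c x z. geometric_decay c --> norm x = 1 --> z ~= 0 -->
   iter_deriv bs (%z. of_real (\<Sum>k. c k * g k x z) :: 'b::{real_normed_field,euclidean_space}) z = of_real (\<Sum>k. c k * g' k x z) \<and>
   iter_deriv bs (%z. of_real (\<Sum>k. c k * g k x z) :: 'b) differentiable (at z))"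
proof -
 have D: "\<exists>G. (\<forall>h. tame (G h)) \<and> (\<forall>c x z. geometric_decay c --> norm x = 1 --> z ~= 0 -->
   ((%z. of_real (\<Sum>k. c k * g k x z) :: 'b) has_derivative (%h. of_real (\<Sum>k. c k * G h k x z))) (at z))"
  if g: "tame g" for g :: "nat => 'a => 'a => real"
 proof -
  obtain G where G: "!!h. tame (G h)" "!!k x z. z ~= 0 ==> (g k x has_derivative (%h. G h k x z)) (at z)"
   using tame_deriv[OF g] by metis
  show ?thesis
   by (rule exI[of _ G]) (auto intro!: G(1) has_derivative_of_real has_derivative_tame_series[OF G g])
 qed
 show ?thesis
 proof (induction bs)
  case Nil
  from D[OF assms] obtain G where "\<forall>c x z. geometric_decay c --> norm x = 1 --> z ~= 0 -->
    ((%z. of_real (\<Sum>k. c k * g k x z) :: 'b) has_derivative (%h. of_real (\<Sum>k. c k * G h k x z))) (at z)"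
   by (elim exE conjE)
  thus ?case by (intro exI[of _ g] conjI assms allI impI) (auto simp: differentiable_def)
 next
  case (Cons b bs)
  then obtain g' where g': "tame g'" and "\<forall>c x z. geometric_decay c --> norm x = 1 --> z ~= 0 -->
   iter_deriv bs (%z. of_real (\<Sum>k. c k * g k x z) :: 'b) z = of_real (\<Sum>k. c k * g' k x z) \<and>
   iter_deriv bs (%z. of_real (\<Sum>k. c k * g k x z) :: 'b) differentiable (at z)"
   by (elim exE conjE)
  hence it: "iter_deriv bs (%z. of_real (\<Sum>k. c k * g k x z) :: 'b) z = of_real (\<Sum>k. c k * g' k x z)"
   if "geometric_decay c" "norm x = 1" "z ~= 0" for c x z using that by simp
  from D[OF g'] obtain G where G1: "\<forall>h. tame (G h)" and G: "\<forall>c x z. geometric_decay c --> norm x = 1 --> z ~= 0 -->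
    ((%z. of_real (\<Sum>k. c k * g' k x z) :: 'b) has_derivative (%h. of_real (\<Sum>k. c k * G h k x z))) (at z)"
   by (elim exE conjE)
  from D[OF spec[OF G1, of b]] obtain G2 where G2: "\<forall>c x z. geometric_decay c --> norm x = 1 --> z ~= 0 -->
    ((%z. of_real (\<Sum>k. c k * G b k x z) :: 'b) has_derivative (%h. of_real (\<Sum>k. c k * G2 h k x z))) (at z)"
   by (elim exE conjE)
  have o: "open (- {0::'a})" by auto
  have eq: "iter_deriv (b # bs) (%z. of_real (\<Sum>k. c k * g k x z) :: 'b) z = of_real (\<Sum>k. c k * G b k x z)"
   if "geometric_decay c" "norm x = 1" "z ~= 0" for c x z
  proof -
   have "(iter_deriv bs (%z. of_real (\<Sum>k. c k * g k x z) :: 'b) has_derivative (%h. of_real (\<Sum>k. c k * G h k x z))) (at z)"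
    by (rule has_derivative_transform_within_open[OF G[rule_format, OF that] o]) (use that it in simp_all)
   from fun_cong[OF frechet_derivative_at[OF this], of b] show ?thesis by simp
  qed
  have "iter_deriv (b # bs) (%z. of_real (\<Sum>k. c k * g k x z) :: 'b) differentiable (at z)"
   if "geometric_decay c" "norm x = 1" "z ~= 0" for c x z
  proof -
   have "(iter_deriv (b # bs) (%z. of_real (\<Sum>k. c k * g k x z) :: 'b) has_derivative (%h. of_real (\<Sum>k. c k * G2 h k x z))) (at z)"
    by (rule has_derivative_transform_within_open[OF G2[rule_format, OF that] o]) (use that eq in simp_all)
   thus ?thesis unfolding differentiable_def by blast
  qed
  thus ?case using eq G1 by (intro exI[of _ "G b"] conjI allI impI) auto
 qed
qed

definition zonal_series :: "(nat => real) => 'a::euclidean_space => 'a => 'b::{real_normed_field,euclidean_space}" where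
 "zonal_series c x y = of_real (\<Sum>k. c k * zonal DIM('a) k (x \<bullet> y))"

lemma tame_zonal:
 assumes "DIM('a::euclidean_space) >= 3"
 shows "tame (%k x (z::'a). zonal DIM('a) k (x \<bullet> sgn z))"
proof -
 have eq: "zonal DIM('a) k t = (2 * real k + real DIM('a) - 2) / (real DIM('a) - 2) * sol (real (DIM('a) - 2) / 2) (int k - int 0) t 1" for k t
  using assms by (simp add: zonal_def sol_def solid_1 of_nat_diff)
 have bnd: "\<bar>(2 * real k + real DIM('a) - 2) / (real DIM('a) - 2)\<bar> <= 2 * (real k + 1) ^ 1" for k
 proof -
  have "2 * real k * 1 <= 2 * real k * (real DIM('a) - 2)" using assms by (intro mult_left_mono) auto
  thus ?thesis using assms by (simp add: divide_le_eq algebra_simps)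
 qed
 show ?thesis
  unfolding eq by (intro tame.tame_mult tame.tame_coeff[OF bnd] tame.tame_sol) (use assms in auto)
qed

lemma geometric_decayI: "0 <= r ==> r < 1 ==> (!!k. \<bar>c k\<bar> <= D * r ^ k) ==> geometric_decay c"
 unfolding geometric_decay_def by blast

lemma geometric_decay_bounded_by:
 assumes "geometric_decay c" "!!k. \<bar>c' k\<bar> <= \<bar>c k\<bar>"
 shows "geometric_decay c'"
 using assms order_trans unfolding geometric_decay_def by meson

lemma geometric_decay_finite:
 assumes "!!k. k >= K ==> c k = 0"
 shows "geometric_decay c"
proof (rule geometric_decayI)
 show "\<bar>c k\<bar> <= (\<Sum>j<K. \<bar>c j\<bar> * 2 ^ j) * (1 / 2) ^ k" for k
 proof (cases "k < K")
  case True
  have "\<bar>c k\<bar> * 2 ^ k <= (\<Sum>j<K. \<bar>c j\<bar> * 2 ^ j)" using True by (intro member_le_sum) auto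
  thus ?thesis by (simp add: power_divide field_simps)
 qed (use assms in \<open>auto intro!: mult_nonneg_nonneg sum_nonneg\<close>)
qed auto

lemma zonal_series_iter_deriv:
 assumes d: "DIM('a::euclidean_space) >= 3"
 shows "\<exists>g'. tame g' \<and> (\<forall>c (x::'a) z. geometric_decay c --> norm x = 1 --> z ~= 0 -->
   iter_deriv bs ((zonal_series c x :: 'a => 'b::{real_normed_field,euclidean_space}) \<circ> sgn) z = of_real (\<Sum>k. c k * g' k x z) \<and>
   iter_deriv bs ((zonal_series c x :: 'a => 'b) \<circ> sgn) differentiable (at z))"
 using iter_deriv_tame_series[OF tame_zonal[OF d], of bs] by (simp add: zonal_series_def[abs_def] o_def)

lemma zonal_series_test_fun:
 assumes "DIM('a::euclidean_space) >= 3" "geometric_decay c" "norm x = 1"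
 shows "(zonal_series c x :: 'a => 'b::{real_normed_field,euclidean_space}) \<in> test_funs"
 unfolding test_funs_def smooth_fun_on_def
 using zonal_series_iter_deriv[OF assms(1), where 'b='b] assms(2,3) by blast

lemma iter_deriv_sphere_cong:
 assumes "!!z. z \<in> sphere 0 1 ==> u z = v z" "z ~= (0::'a::euclidean_space)"
 shows "iter_deriv bs (u \<circ> sgn) z = iter_deriv bs (v \<circ> sgn) z"
proof (rule iter_deriv_cong[where U="- {0}"])
 show "open (- {0::'a})" by auto
qed (use assms in \<open>auto simp: norm_sgn\<close>)

lemma test_funs_cong:
 assumes "!!z. z \<in> sphere 0 1 ==> u z = v z" "u \<in> test_funs"
 shows "(v :: 'a::euclidean_space => 'b::real_normed_vector) \<in> test_funs"
 unfolding test_funs_def smooth_fun_on_def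
proof (intro CollectI allI impI ballI)
 fix bs :: "'a list" and z :: 'a assume bs: "set bs \<subseteq> Basis" and z: "z \<in> - {0}"
 have "iter_deriv bs (u \<circ> sgn) differentiable (at z)"
  using assms(2) bs z by (auto simp: test_funs_def smooth_fun_on_def)
 thus "iter_deriv bs (v \<circ> sgn) differentiable (at z)"
 proof (rule differentiable_cong_open[THEN iffD1, rotated -1])
  show "open (- {0::'a})" by auto
  show "iter_deriv bs (u \<circ> sgn) y = iter_deriv bs (v \<circ> sgn) y" if "y \<in> - {0}" for y
   by (rule iter_deriv_sphere_cong) (use assms(1) that in auto)
 qed (rule z)
qed

lemma iter_deriv_const: "iter_deriv bs (%_. c) = (%_. if bs = [] then c else 0)"
proof (induction bs)
 case (Cons b bs)
 have "frechet_derivative (%_. if bs = [] then c else 0) (at x) = (%_. 0)" for x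
  by (rule frechet_derivative_at[symmetric]) simp
 thus ?case unfolding iter_deriv.simps Cons by simp
qed auto

lemma zero_test_fun: "(%_. 0) \<in> test_funs" "test_seminorm N (%_. 0) = 0"
 by (auto simp: test_funs_def smooth_fun_on_def o_def iter_deriv_const test_seminorm_def)

locale distribution =
 fixes f :: "('a::euclidean_space, 'b::{real_normed_field,euclidean_space}) functional"
 assumes dist: "f \<in> distributions" and dim: "DIM('a) >= 3"
begin

lemma add: "u \<in> test_funs ==> v \<in> test_funs ==> f (%x. u x + v x) = f u + f v"
 using dist by (auto simp: distributions_def)

lemma cmult: "u \<in> test_funs ==> f (%x. c * u x) = c * f u"
 using dist by (auto simp: distributions_def)

lemma zero: "f (%_. 0) = 0"
 using cmult[OF zero_test_fun(1), of 0] by simp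

text \<open>The difference of the two functions vanishes on the sphere, hence so do all its seminorms.\<close>

lemma cong_sphere:
 assumes "!!z. z \<in> sphere 0 1 ==> u z = v z" "u \<in> test_funs"
 shows "f u = f v"
proof -
 define w where "w = (%z. v z - u z)"
 have w0: "w z = 0" if "z \<in> sphere 0 1" for z using assms(1)[OF that] by (simp add: w_def)
 have wt: "w \<in> test_funs" by (rule test_funs_cong[OF _ zero_test_fun(1)]) (use w0 in auto)
 have eq0: "iter_deriv bs (w \<circ> sgn) z = iter_deriv bs ((%_::'a. 0 :: 'b) \<circ> sgn) z" if "norm z = 1" for bs z
  by (rule iter_deriv_sphere_cong) (use w0 that in auto)
 have "test_seminorm N w = test_seminorm N (%_::'a. 0 :: 'b)" for N
  unfolding test_seminorm_def by (intro sum.cong refl arg_cong[where f=Sup] image_cong arg_cong[where f=norm] eq0) simp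
 hence "test_seminorm N w = 0" for N by (simp add: zero_test_fun)
 moreover obtain N C where "norm (f w) <= C * test_seminorm N w"
  using dist wt unfolding distributions_def by blast
 ultimately have "f w = 0" by simp
 moreover have "f (%z. u z + w z) = f u + f w" by (rule add[OF assms(2) wt])
 ultimately show ?thesis by (simp add: w_def)
qed

text \<open>Only finitely many iterated derivatives occur in the seminorm that controls \<open>f\<close>, and each of them is again a series
 with polynomially growing terms.\<close>

lemma zonal_series_bound:
 obtains C A where "C >= 0"
  "!!c x. geometric_decay c ==> norm x = 1 ==> norm (f (zonal_series c x)) <= C * (\<Sum>k. \<bar>c k\<bar> * (real k + 1) ^ A)"
proof -
 let ?n = "%bs c x z. norm (iter_deriv bs ((zonal_series c x :: 'a => 'b) \<circ> sgn) z)"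
 obtain N B where B: "!!u. u \<in> test_funs ==> norm (f u) <= B * test_seminorm N u"
  using dist unfolding distributions_def by blast
 define L where "L = {bs :: 'a list. set bs \<subseteq> Basis \<and> length bs <= N}"
 have fin: "finite L" unfolding L_def by (rule finite_lists_length_le) simp
 have "\<forall>bs. \<exists>p. 0 <= fst p \<and> (\<forall>c x z. geometric_decay c --> norm x = 1 --> z \<in> sphere 0 1 -->
   ?n bs c x z <= fst p * (\<Sum>k. \<bar>c k\<bar> * (real k + 1) ^ snd p))"
 proof
  fix bs :: "'a list"
  obtain g' where g': "tame g'" "\<forall>c (x::'a) z. geometric_decay c --> norm x = 1 --> z ~= 0 -->
   iter_deriv bs ((zonal_series c x :: 'a => 'b) \<circ> sgn) z = of_real (\<Sum>k. c k * g' k x z) \<and>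
   iter_deriv bs ((zonal_series c x :: 'a => 'b) \<circ> sgn) differentiable (at z)"
   using zonal_series_iter_deriv[OF dim, of bs, where 'b='b] by (elim exE conjE)
  obtain C A where CA: "0 <= C" "!!k x z. norm x = 1 ==> 1 / 1 <= norm z ==> norm z <= 1 ==> \<bar>g' k x z\<bar> <= C * (real k + 1) ^ A"
   using tame_bound[OF g'(1) zero_less_one] by (elim exE conjE) blast
  show "\<exists>p. 0 <= fst p \<and> (\<forall>c x z. geometric_decay c --> norm x = 1 --> z \<in> sphere 0 1 -->
   ?n bs c x z <= fst p * (\<Sum>k. \<bar>c k\<bar> * (real k + 1) ^ snd p))"
  proof (intro exI[of _ "(C, A)"] conjI allI impI)
   fix c and x z :: 'a assume c: "geometric_decay c" and x: "norm x = 1" and z: "z \<in> sphere 0 1"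
   have z0: "z ~= 0" using z by auto
   have le: "\<bar>c k * g' k x z\<bar> <= C * (\<bar>c k\<bar> * (real k + 1) ^ A)" for k
    using mult_left_mono[OF CA(2)[OF x, of z k], of "\<bar>c k\<bar>"] z by (simp add: abs_mult mult_ac)
   note sm = tame_summable[OF g'(1) c x z0]
   have "?n bs c x z = \<bar>\<Sum>k. c k * g' k x z\<bar>"
    using g'(2)[rule_format, OF c x z0] by simp
   also have "... <= (\<Sum>k. \<bar>c k * g' k x z\<bar>)" by (rule summable_rabs[OF sm])
   also have "... <= (\<Sum>k. C * (\<bar>c k\<bar> * (real k + 1) ^ A))"
    by (rule suminf_le[OF le sm summable_mult[OF geometric_decay_summable[OF c]]])
   also have "... = C * (\<Sum>k. \<bar>c k\<bar> * (real k + 1) ^ A)"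
    by (rule suminf_mult[OF geometric_decay_summable[OF c]])
   finally show "?n bs c x z <= fst (C, A) * (\<Sum>k. \<bar>c k\<bar> * (real k + 1) ^ snd (C, A))" by simp
  qed (use CA in simp)
 qed
 from choice[OF this] obtain p where p: "!!bs. 0 <= fst (p bs)"
  "!!bs c x z. geometric_decay c ==> norm x = 1 ==> z \<in> sphere 0 1 ==>
   ?n bs c x z <= fst (p bs) * (\<Sum>k. \<bar>c k\<bar> * (real k + 1) ^ snd (p bs))"
  by blast
 define A where "A = (\<Sum>bs\<in>L. snd (p bs))"
 define C where "C = (\<Sum>bs\<in>L. fst (p bs))"
 show ?thesis
 proof (rule that[of "\<bar>B\<bar> * C" A])
  show "\<bar>B\<bar> * C >= 0" unfolding C_def by (intro mult_nonneg_nonneg sum_nonneg p) auto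
  fix c and x :: 'a assume c: "geometric_decay c" and x: "norm x = 1"
  define S where "S = (\<Sum>k. \<bar>c k\<bar> * (real k + 1) ^ A)"
  have S: "S >= 0" unfolding S_def by (intro suminf_nonneg geometric_decay_summable c) auto
  have sup: "0 <= (SUP z\<in>sphere 0 1. ?n bs c x z) \<and>
   (SUP z\<in>sphere 0 1. ?n bs c x z) <= fst (p bs) * S" if bs: "bs \<in> L" for bs
  proof -
   have le: "?n bs c x z <= fst (p bs) * S" if z: "z \<in> sphere 0 1" for z
   proof -
    have "snd (p bs) <= A" unfolding A_def using bs fin by (intro member_le_sum) auto
    hence "\<bar>c k\<bar> * (real k + 1) ^ snd (p bs) <= \<bar>c k\<bar> * (real k + 1) ^ A" for k
     by (intro mult_left_mono power_increasing) auto
    hence "(\<Sum>k. \<bar>c k\<bar> * (real k + 1) ^ snd (p bs)) <= S"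
     unfolding S_def by (intro suminf_le geometric_decay_summable c)
    thus ?thesis using order_trans[OF p(2)[OF c x z, of bs] mult_left_mono[OF _ p(1)]] by blast
   qed
   have "x \<in> sphere 0 1" using x by simp
   hence "(SUP z\<in>sphere 0 1. ?n bs c x z) <= fst (p bs) * S"
    by (intro cSUP_least le) auto
   moreover have "?n bs c x x <= (SUP z\<in>sphere 0 1. ?n bs c x z)"
    using \<open>x \<in> sphere 0 1\<close> le by (intro cSUP_upper bdd_aboveI2[where M="fst (p bs) * S"]) auto
   ultimately show ?thesis using order_trans[OF norm_ge_zero] by blast
  qed
  have ts: "0 <= test_seminorm N (zonal_series c x :: 'a => 'b)" "test_seminorm N (zonal_series c x :: 'a => 'b) <= C * S"
   unfolding test_seminorm_def C_def L_def[symmetric] sum_distrib_right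
   using sup by (auto intro!: sum_nonneg sum_mono)
  have "norm (f (zonal_series c x)) <= B * test_seminorm N (zonal_series c x :: 'a => 'b)"
   by (intro B zonal_series_test_fun dim c x)
  also have "... <= \<bar>B\<bar> * test_seminorm N (zonal_series c x :: 'a => 'b)" using ts(1) by (intro mult_right_mono) auto
  also have "... <= \<bar>B\<bar> * (C * S)" using ts(2) by (intro mult_left_mono) auto
  finally show "norm (f (zonal_series c x)) <= \<bar>B\<bar> * C * (\<Sum>k. \<bar>c k\<bar> * (real k + 1) ^ A)" by (simp add: S_def)
 qed
qed

end

lemma iter_deriv_add_cmult:
 fixes u v :: "'a::euclidean_space => 'b::real_normed_field"
 assumes "open U" "smooth_fun_on U u" "smooth_fun_on U v"
 shows "set bs \<subseteq> Basis ==> z \<in> U ==>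
  iter_deriv bs (%z. u z + c * v z) z = iter_deriv bs u z + c * iter_deriv bs v z \<and>
  iter_deriv bs (%z. u z + c * v z) differentiable (at z)"
proof (induction bs arbitrary: z)
 case Nil
 have "u differentiable (at z)" "v differentiable (at z)"
  using assms(2,3) Nil unfolding smooth_fun_on_def by (metis iter_deriv.simps(1))+
 thus ?case by (auto intro!: differentiable_add differentiable_mult)
next
 case (Cons b bs)
 have sm: "iter_deriv bs u differentiable (at z)" "iter_deriv bs v differentiable (at z)"
  "iter_deriv (b # bs) u differentiable (at z)" "iter_deriv (b # bs) v differentiable (at z)" if "z \<in> U" for z
  using assms(2,3) Cons.prems(1) that unfolding smooth_fun_on_def by (auto simp del: iter_deriv.simps)
 have eq: "iter_deriv (b # bs) (%z. u z + c * v z) z = iter_deriv (b # bs) u z + c * iter_deriv (b # bs) v z" if z: "z \<in> U" for z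
 proof -
  have "(iter_deriv bs u has_derivative frechet_derivative (iter_deriv bs u) (at z)) (at z)"
   "(iter_deriv bs v has_derivative frechet_derivative (iter_deriv bs v) (at z)) (at z)"
   using sm[OF z] by (auto simp: frechet_derivative_works)
  hence "((%z. iter_deriv bs u z + c * iter_deriv bs v z) has_derivative
    (%h. frechet_derivative (iter_deriv bs u) (at z) h + c * frechet_derivative (iter_deriv bs v) (at z) h)) (at z)"
   by (intro has_derivative_add has_derivative_mult_right)
  hence "(iter_deriv bs (%z. u z + c * v z) has_derivative
    (%h. frechet_derivative (iter_deriv bs u) (at z) h + c * frechet_derivative (iter_deriv bs v) (at z) h)) (at z)"
   by (rule has_derivative_transform_within_open[OF _ assms(1) z]) (use Cons in auto)
  from fun_cong[OF frechet_derivative_at[OF this], of b] show ?thesis by simp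
 qed
 have "(%z. iter_deriv (b # bs) u z + c * iter_deriv (b # bs) v z) differentiable (at z)"
  using sm(3,4)[OF Cons.prems(2)] by (intro differentiable_add differentiable_mult) auto
 hence "iter_deriv (b # bs) (%z. u z + c * v z) differentiable (at z)"
  by (rule differentiable_cong_open[OF assms(1) Cons.prems(2), THEN iffD1, rotated]) (rule eq[symmetric])
 thus ?case using eq[OF Cons.prems(2)] by blast
qed

lemma test_funs_add_cmult:
 fixes u v :: "'a::euclidean_space => 'b::real_normed_field"
 assumes "u \<in> test_funs" "v \<in> test_funs"
 shows "(%z. u z + c * v z) \<in> test_funs"
proof -
 have "open (- {0::'a})" by auto
 from iter_deriv_add_cmult[OF this, of "u \<circ> sgn" "v \<circ> sgn"] show ?thesis
  using assms unfolding test_funs_def smooth_fun_on_def by (auto simp: o_def)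
qed

lemma test_funs_add: "u \<in> test_funs ==> v \<in> test_funs ==> (%z. u z + v z :: 'b::real_normed_field) \<in> test_funs"
 using test_funs_add_cmult[of u v 1] by simp

lemma test_funs_cmult: "v \<in> test_funs ==> (%z. c * v z :: 'b::real_normed_field) \<in> test_funs"
 using test_funs_add_cmult[OF zero_test_fun(1), of v c] by simp

inductive mono_fun :: "('a::euclidean_space => real) => bool" where
 mono_fun_1: "mono_fun (%_. 1)"
| mono_fun_mult: "mono_fun e ==> mono_fun (%x. (x \<bullet> b) * e x)"

lemma mono_fun_test_fun:
 assumes "mono_fun (e :: 'a::euclidean_space => real)"
 shows "(%x. of_real (e x) :: 'b::{real_normed_field,euclidean_space}) \<in> test_funs"
proof -
 have "\<exists>g. tame g \<and> (\<forall>k x z. e (sgn z) = g k x z)"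
  using assms
 proof induction
  case mono_fun_1
  show ?case by (rule exI[of _ "%k x z. 1"]) (auto intro: tame_const)
 next
  case (mono_fun_mult e b)
  from mono_fun_mult.IH obtain g :: "nat => 'a => 'a => real" where g: "tame g" "\<forall>k x z. e (sgn z) = g k x z" by (elim exE conjE)
  have "sgn z \<bullet> b = inverse (norm z) * (z \<bullet> b)" for z :: 'a by (simp add: sgn_div_norm)
  hence "\<forall>k x z. (sgn z \<bullet> b) * e (sgn z) = (inverse (norm z) * (z \<bullet> b)) * g k x z"
   using g(2) by metis
  moreover have "tame (%k x z. (inverse (norm z) * (z \<bullet> b)) * g k x z)"
   by (intro tame.tame_mult tame.tame_inverse tame.tame_z g(1))
  ultimately show ?case by blast
 qed
 then obtain g :: "nat => 'a => 'a => real" where g: "tame g" "\<forall>k x z. e (sgn z) = g k x z" by (elim exE conjE)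
 define c :: "nat => real" where "c = (%k. if k = 0 then 1 else 0)"
 have c: "geometric_decay c" by (rule geometric_decay_finite[of 1]) (auto simp: c_def)
 obtain x :: 'a where x: "norm x = 1" using norm_Basis SOME_Basis by blast
 have "(\<Sum>k. c k * g k x z) = e (sgn z)" for z
 proof -
  have "(%k. c k * g k x z) sums (\<Sum>k\<in>{0}. c k * g k x z)"
   by (rule sums_finite) (auto simp: c_def)
  from sums_unique[OF this] show ?thesis using g(2)[rule_format, of z 0 x] by (simp add: c_def)
 qed
 note e = this
 have "iter_deriv bs (%z. of_real (e (sgn z)) :: 'b) differentiable (at z)" if z: "z ~= 0" for bs z
 proof -
  from iter_deriv_tame_series[OF g(1), of bs, where 'b='b] obtain g' where
   "\<forall>c x z. geometric_decay c --> norm x = 1 --> z ~= 0 -->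
    iter_deriv bs (%z. of_real (\<Sum>k. c k * g k x z) :: 'b) z = of_real (\<Sum>k. c k * g' k x z) \<and>
    iter_deriv bs (%z. of_real (\<Sum>k. c k * g k x z) :: 'b) differentiable (at z)" by (elim exE conjE)
  from this[rule_format, OF c x z] show ?thesis unfolding e by (elim conjE)
 qed
 thus ?thesis by (auto simp: test_funs_def smooth_fun_on_def o_def)
qed

text \<open>Kernels \<open>K z x = (\<Sum>i<n. c i z * e i x)\<close> for which a distribution that acts on \<open>x\<close> commutes with
 integration over \<open>z\<close>.\<close>

inductive degenerate :: "('a::euclidean_space => 'a => real) => bool" where
 degenerate_base: "continuous_on UNIV c ==> mono_fun e ==> degenerate (%z x. c z * e x)"
| degenerate_add: "degenerate K ==> degenerate L ==> degenerate (%z x. K z x + L z x)"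

lemma degenerate_mult: "degenerate K ==> continuous_on UNIV c ==> degenerate (%z x. c z * K z x)"
proof (induction rule: degenerate.induct)
 case (degenerate_base c' e)
 have "degenerate (%z x. (c z * c' z) * e x)"
  by (intro degenerate.degenerate_base continuous_on_mult degenerate_base)
 thus ?case by (simp add: mult.assoc)
next
 case (degenerate_add K L)
 thus ?case by (simp add: distrib_left degenerate.degenerate_add)
qed

lemma degenerate_const: "degenerate (%z x. c)"
 using degenerate_base[OF continuous_on_const[of UNIV c] mono_fun_1] by simp

lemma degenerate_sum: "finite B ==> (!!b. b \<in> B ==> degenerate (K b)) ==> degenerate (%z x. \<Sum>b\<in>B. K b z x)"
 by (induction B rule: finite_induct) (auto intro: degenerate_const degenerate_add)

lemma degenerate_inner: "degenerate K ==> degenerate (%z x. (x \<bullet> z) * K z x)"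
proof (induction rule: degenerate.induct)
 case (degenerate_base c e)
 have "degenerate (%z x. \<Sum>b\<in>Basis. ((z \<bullet> b) * c z) * ((x \<bullet> b) * e x))"
  by (intro degenerate_sum degenerate.degenerate_base mono_fun_mult degenerate_base continuous_intros) auto
 also have "(%z x. \<Sum>b\<in>Basis. ((z \<bullet> b) * c z) * ((x \<bullet> b) * e x)) = (%z x. (x \<bullet> z) * (c z * e x))"
  by (subst (3) euclidean_inner) (simp add: fun_eq_iff sum_distrib_left sum_distrib_right mult_ac)
 finally show ?case .
next
 case (degenerate_add K L)
 thus ?case by (simp add: distrib_left degenerate.degenerate_add)
qed

lemma degenerate_compose: "degenerate K ==> continuous_on UNIV h ==> degenerate (%z x. K (h z) x)"
proof (induction rule: degenerate.induct)
 case (degenerate_base c e)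
 have "continuous_on UNIV (%z. c (h z))"
  by (rule continuous_on_compose2[OF degenerate_base(1) degenerate_base(3)]) auto
 thus ?case by (rule degenerate.degenerate_base) (rule degenerate_base(2))
next
 case (degenerate_add K L)
 thus ?case by (auto intro: degenerate.degenerate_add)
qed

lemma degenerate_zsol: "degenerate (%z x. zsol k x z)"
proof -
 have "degenerate (%z x::'a. solid l n (x \<bullet> z) (z \<bullet> z))" for l n
 proof (induction n rule: induct_nat_012)
  case 0
  show ?case by (simp add: degenerate_const)
 next
  case 1
  have "degenerate (%z x::'a. (x \<bullet> z) * (2 * l))" by (rule degenerate_inner[OF degenerate_const])
  thus ?case by (simp add: mult_ac)
 next
  case (ge2 n)
  have a: "degenerate (%z x::'a. (2 * (real n + 1 + l) / (real n + 2)) * ((x \<bullet> z) * solid l (Suc n) (x \<bullet> z) (z \<bullet> z)))"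
   by (rule degenerate_mult[OF degenerate_inner[OF ge2(2)] continuous_on_const])
  have b: "degenerate (%z x::'a. (- (real n + 2 * l) / (real n + 2) * (z \<bullet> z)) * solid l n (x \<bullet> z) (z \<bullet> z))"
   by (rule degenerate_mult[OF ge2(1)]) (intro continuous_intros)
  have eq: "(e * s * u - g * q * v) / t = e / t * (s * u) + (- g / t * q) * v" for e s u g q v t :: real
   by (simp add: diff_divide_distrib)
  show ?case unfolding solid.simps eq by (rule degenerate_add[OF a b])
 qed
 hence "degenerate (%z x::'a. c * solid l k (x \<bullet> z) (z \<bullet> z))" for c l
  by (rule degenerate_mult) (rule continuous_on_const)
 moreover have "(%z x. zsol k x z) = (%z x :: 'a. ((2 * real k + real DIM('a) - 2) / (real DIM('a) - 2)) * solid ((real DIM('a) - 2) / 2) k (x \<bullet> z) (z \<bullet> z))"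
  by (simp add: zsol_def sol_def fun_eq_iff)
 ultimately show ?thesis by (simp only:)
qed

context distribution
begin

text \<open>For a product \<open>c z * e x\<close> both sides are the integral of \<open>c\<close> times the value of \<open>f\<close> at \<open>e\<close>. The first conjuncts make
 the property additive.\<close>

lemma degenerate_exchange:
 fixes M :: "'a measure"
 assumes "degenerate K" and M: "!!c :: 'a => real. continuous_on UNIV c ==> integrable M c"
 shows "(\<forall>z. (%x. of_real (K z x) :: 'b) \<in> test_funs) \<and> continuous_on UNIV (%z. f (%x. of_real (K z x))) \<and>
  (\<forall>x. integrable M (%z. K z x)) \<and> (%x. of_real (\<integral>z. K z x \<partial>M) :: 'b) \<in> test_funs \<and>
  integrable M (%z. f (%x. of_real (K z x))) \<and>
  f (%x. of_real (\<integral>z. K z x \<partial>M)) = (\<integral>z. f (%x. of_real (K z x)) \<partial>M)"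
 using assms(1)
proof (induction rule: degenerate.induct)
 case (degenerate_base c e)
 note e = mono_fun_test_fun[OF degenerate_base(2), where 'b='b]
 have fe: "f (%x. of_real (r * e x)) = of_real r * f (%x. of_real (e x))" for r
  using cmult[OF e, of "of_real r"] by simp
 have i: "integrable M c" by (rule M[OF degenerate_base(1)])
 have ib: "integrable M (%z. of_real (c z) :: 'b)" using integrable_of_real[OF i] .
 have t: "(%x. of_real (r * e x) :: 'b) \<in> test_funs" for r
  using test_funs_cmult[OF e, of "of_real r"] by simp
 have 1: "(\<integral>z. c z * e x \<partial>M) = (\<integral>z. c z \<partial>M) * e x" for x
  by simp
 have 2: "(\<integral>z. of_real (c z) * f (%x. of_real (e x)) \<partial>M) = of_real (\<integral>z. c z \<partial>M) * f (%x. of_real (e x))"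
  using ib i by (simp add: integral_of_real)
 show ?case unfolding fe 1 2
  using t i ib degenerate_base(1) by (intro conjI allI continuous_intros integrable_mult_left) auto
next
 case (degenerate_add K L)
 thus ?case
  by (simp add: add test_funs_add continuous_on_add)
qed

text \<open>The homogeneous harmonic components of \<open>f\<close>, as functions on the whole space.\<close>

definition component :: "nat => 'a => 'b" where
 "component k z = f (%y. of_real (zsol k y z))"

definition harmonic_ext :: "'a => 'b" where
 "harmonic_ext z = f (%y. of_real (poisson z y))"

lemma continuous_component: "continuous_on UNIV (component k)"
 unfolding component_def
 using degenerate_exchange[OF degenerate_zsol[of k] integrable_sphere_continuous] by blast

lemma zsol_test_fun: "(%y::'a. of_real (zsol k y v) :: 'b) \<in> test_funs"
proof -
 have "\<forall>z. (%y::'a. of_real (zsol k y z) :: 'b) \<in> test_funs"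
  by (rule degenerate_exchange[OF degenerate_zsol integrable_sphere_continuous, THEN conjunct1])
 thus ?thesis ..
qed

lemma component_scale:
 assumes "norm x = 1"
 shows "component k (r *\<^sub>R x) = of_real (r ^ k) * component k x"
proof -
 have t: "(%y. of_real (zsol k y x) :: 'b) \<in> test_funs"
  by (rule zsol_test_fun)
 show ?thesis unfolding component_def zsol_scale using cmult[OF t, of "of_real (r ^ k)"] by simp
qed

text \<open>After \<open>n\<close> terms have been split off by linearity, the tail is again a zonal series, and its coefficients are small in
 the norm of \<open>zonal_series_bound\<close>.\<close>

lemma zonal_series_sums:
 assumes c: "geometric_decay c" and x: "norm x = 1"
 shows "(%k. of_real (c k) * component k x) sums f (zonal_series c x)"
proof -
 define cut where "cut = (%n k. if k < n then 0 else c k)"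
 have cut: "geometric_decay (cut n)" for n by (rule geometric_decay_bounded_by[OF c]) (simp add: cut_def)
 note t = zonal_series_test_fun[OF dim cut x, where 'b='b]
 have tz: "(%y. of_real (c n) * of_real (zsol n y x) :: 'b) \<in> test_funs" for n
  by (rule test_funs_cmult[OF zsol_test_fun])
 have split: "f (zonal_series c x) = (\<Sum>k<n. of_real (c k) * component k x) + f (zonal_series (cut n) x)" for n
 proof (induction n)
  case 0
  show ?case by (simp add: cut_def)
 next
  case (Suc n)
  have "f (zonal_series (cut n) x) = f (%y. of_real (c n) * of_real (zsol n y x) + zonal_series (cut (Suc n)) x y)"
  proof (rule cong_sphere[OF _ t])
   fix y :: 'a assume y: "y \<in> sphere 0 1"
   hence "sgn y = y" "y ~= 0" by (auto simp: sgn_div_norm)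
   hence "summable (%k. \<bar>cut (Suc n) k * zonal DIM('a) k (x \<bullet> y)\<bar>)"
    using tame_summable[OF tame_zonal[OF dim] cut x, of y] by simp
   hence "(%k. (if k = n then c k * zonal DIM('a) k (x \<bullet> y) else 0) + cut (Suc n) k * zonal DIM('a) k (x \<bullet> y)) sums
     (c n * zonal DIM('a) n (x \<bullet> y) + (\<Sum>k. cut (Suc n) k * zonal DIM('a) k (x \<bullet> y)))"
    by (rule sums_add[OF sums_single summable_sums[OF summable_rabs_cancel]])
   moreover have "(%k. (if k = n then c k * zonal DIM('a) k (x \<bullet> y) else 0) + cut (Suc n) k * zonal DIM('a) k (x \<bullet> y)) =
     (%k. cut n k * zonal DIM('a) k (x \<bullet> y))" by (auto simp: cut_def less_Suc_eq)
   ultimately show "zonal_series (cut n) x y = (of_real (c n) * of_real (zsol n y x) + zonal_series (cut (Suc n)) x y :: 'b)"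
    by (simp add: zonal_series_def zsol_sphere[OF x] inner_commute sums_iff)
  qed
  thus ?case using Suc add[OF tz t] cmult[OF zsol_test_fun] by (simp add: component_def)
 qed
 obtain C A where CA: "C >= 0"
  "!!c x. geometric_decay c ==> norm x = 1 ==> norm (f (zonal_series c x)) <= C * (\<Sum>k. \<bar>c k\<bar> * (real k + 1) ^ A)"
  by (rule zonal_series_bound[OF that])
 define s where "s = (%k. \<bar>c k\<bar> * (real k + 1) ^ A)"
 have s: "summable s" unfolding s_def by (rule geometric_decay_summable[OF c])
 have le: "norm (f (zonal_series c x) - (\<Sum>k<n. of_real (c k) * component k x)) <= C * (suminf s - (\<Sum>k<n. s k))" for n
 proof -
  have "norm (f (zonal_series (cut n) x)) <= C * (\<Sum>k. \<bar>cut n k\<bar> * (real k + 1) ^ A)"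
   by (rule CA(2)[OF cut x])
  also have "(\<Sum>k. \<bar>cut n k\<bar> * (real k + 1) ^ A) = (\<Sum>k. if k < n then 0 else s k)"
   by (rule arg_cong[where f=suminf]) (auto simp: cut_def s_def)
  also have "... = suminf s - (\<Sum>k<n. s k)"
  proof -
   have "(%k. s k - (if k < n then s k else 0)) sums (suminf s - (\<Sum>k<n. if k < n then s k else 0))"
    by (intro sums_diff summable_sums s sums_finite) auto
   moreover have "(%k. s k - (if k < n then s k else 0)) = (%k. if k < n then 0 else s k)" by auto
   ultimately show ?thesis using sums_unique[of "%k. if k < n then 0 else s k"] by simp
  qed
  finally show ?thesis using split[of n] by simp
 qed
 have "(%n. C * (suminf s - (\<Sum>k<n. s k))) \<longlonglongrightarrow> C * (suminf s - suminf s)"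
  by (intro tendsto_intros summable_LIMSEQ s)
 hence "(%n. C * (suminf s - (\<Sum>k<n. s k))) \<longlonglongrightarrow> 0" by simp
 hence "(%n. f (zonal_series c x) - (\<Sum>k<n. of_real (c k) * component k x)) \<longlonglongrightarrow> 0"
  by (rule Lim_null_comparison[rotated]) (intro always_eventually allI le)
 hence "(%n. f (zonal_series c x) - (f (zonal_series c x) - (\<Sum>k<n. of_real (c k) * component k x))) \<longlonglongrightarrow> f (zonal_series c x) - 0"
  by (intro tendsto_intros)
 thus ?thesis by (simp add: sums_def)
qed

lemma component_bound:
 obtains C A where "C >= 0" "!!k z. norm (component k z) <= C * (real k + 1) ^ A * norm z ^ k"
proof -
 obtain C A where CA: "C >= 0"
  "!!c x. geometric_decay c ==> norm x = 1 ==> norm (f (zonal_series c x)) <= C * (\<Sum>k. \<bar>c k\<bar> * (real k + 1) ^ A)"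
  by (rule zonal_series_bound[OF that])
 have 1: "norm (component k x) <= C * (real k + 1) ^ A" if x: "norm x = 1" for k x
 proof -
  define c where "c = (%j. if j = k then 1 else (0::real))"
  have c: "geometric_decay c" by (rule geometric_decay_finite[of "Suc k"]) (auto simp: c_def)
  have "(%j. of_real (c j) * component j x) sums (of_real (c k) * component k x)"
   using sums_finite[of "{k}" "%j. of_real (c j) * component j x"] by (simp add: c_def)
  hence "f (zonal_series c x) = component k x"
   using zonal_series_sums[OF c x] sums_unique2 by (fastforce simp: c_def)
  moreover have "(\<Sum>j. \<bar>c j\<bar> * (real j + 1) ^ A) = (real k + 1) ^ A"
   by (subst suminf_finite[of "{k}"]) (auto simp: c_def)
  ultimately show ?thesis using CA(2)[OF c x] by simp
 qed
 have "norm (component k z) <= C * (real k + 1) ^ A * norm z ^ k" for k z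
 proof (cases "z = 0")
  case True
  obtain x :: 'a where x: "norm x = 1" using norm_Basis SOME_Basis by blast
  show ?thesis using component_scale[OF x, of k 0] 1[OF x, of k] True CA(1) by (cases k) (auto simp: norm_mult)
 next
  case False
  have x: "norm (sgn z) = 1" using False by (simp add: norm_sgn)
  have "norm z *\<^sub>R sgn z = z" using False by (simp add: sgn_div_norm)
  hence "norm (component k z) = norm z ^ k * norm (component k (sgn z))"
   using component_scale[OF x, of k "norm z"] by (simp add: norm_mult norm_power)
  also have "... <= norm z ^ k * (C * (real k + 1) ^ A)" by (intro mult_left_mono 1 x) auto
  finally show ?thesis by (simp add: mult_ac)
 qed
 thus ?thesis using that CA(1) by blast
qed

lemma harmonic_ext_sums:
 assumes "norm z < 1"
 shows "(%k. component k z) sums harmonic_ext z"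
proof -
 obtain x where x: "norm x = 1" "z = norm z *\<^sub>R x"
 proof (cases "z = 0")
  case True
  thus ?thesis using that norm_Basis SOME_Basis by (metis norm_zero scaleR_zero_left)
 next
  case False
  thus ?thesis using that[of "sgn z"] by (simp add: norm_sgn sgn_div_norm)
 qed
 define r where "r = norm z"
 have r: "0 <= r" "r < 1" using assms by (auto simp: r_def)
 have c: "geometric_decay (%k. r ^ k)" by (rule geometric_decayI[OF r, of _ 1]) (use r in auto)
 have "f (zonal_series (%k. r ^ k) x) = harmonic_ext z"
  unfolding harmonic_ext_def
 proof (rule cong_sphere)
  show "(zonal_series (%k. r ^ k) x :: 'a => 'b) \<in> test_funs" by (rule zonal_series_test_fun[OF dim c x(1)])
  fix y :: 'a assume "y \<in> sphere 0 1"
  hence "(%k. zonal DIM('a) k (x \<bullet> y) * r ^ k) sums poisson (r *\<^sub>R x) y"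
   by (intro poisson_sums[OF dim x(1) _ r]) auto
  thus "zonal_series (%k. r ^ k) x y = (of_real (poisson z y) :: 'b)"
   using x(2) by (simp add: zonal_series_def sums_iff mult.commute flip: r_def)
 qed
 moreover have "component k z = of_real (r ^ k) * component k x" for k
  using component_scale[OF x(1), of k r] x(2) by (simp add: r_def)
 ultimately show ?thesis using zonal_series_sums[OF c x(1)] by simp
qed

text \<open>A linear identity between zonal harmonics, in the argument that is integrated, carries over to the components of \<open>f\<close>.\<close>

lemma component_exchange:
 fixes M :: "'a measure"
 assumes M: "!!c :: 'a => real. continuous_on UNIV c ==> integrable M c" and c: "continuous_on UNIV c" "continuous_on UNIV h"
  and I: "!!y. norm y = 1 ==> (\<integral>w. c w * zsol k y (h w) \<partial>M) = r * zsol k y z"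
 shows "(\<integral>w. c w *\<^sub>R component k (h w) \<partial>M) = r *\<^sub>R component k z"
proof -
 note ex = degenerate_exchange[OF degenerate_mult[OF degenerate_compose[OF degenerate_zsol c(2), of k] c(1)] M]
 have e: "a *\<^sub>R component k v = f (%y. of_real (a * zsol k y v))" for a v
  using cmult[OF zsol_test_fun, of "of_real a"] by (simp add: component_def scaleR_conv_of_real)
 have "(\<integral>w. c w *\<^sub>R component k (h w) \<partial>M) = f (%y. of_real (\<integral>w. c w * zsol k y (h w) \<partial>M))"
  unfolding e using ex by simp
 also have "... = r *\<^sub>R component k z"
  unfolding e using ex I by (intro cong_sphere) auto
 finally show ?thesis .
qed

lemma component_mean_value:
 "(\<integral>w. bump w *\<^sub>R component k (z + r *\<^sub>R w) \<partial>unif_ball) = (\<integral>w. bump w \<partial>(unif_ball :: 'a measure)) *\<^sub>R component k z"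
 by (rule component_exchange[OF integrable_unif_ball_continuous])
  (auto simp: bump_def zsol_mean_value[unfolded bump_def] intro!: continuous_intros)

lemma component_reproducing:
 assumes "norm x = 1"
 shows "(\<integral>y. zsol m x y *\<^sub>R component k y \<partial>\<sigma>) = (if k = m then component k x else 0)"
proof -
 have "(\<integral>y. zsol m x y *\<^sub>R component k y \<partial>\<sigma>) = (if k = m then 1 else 0) *\<^sub>R component k x"
  by (rule component_exchange[OF integrable_sphere_continuous, where h="%y. y"])
   (auto simp: zsol_reproducing[OF dim assms] intro!: continuous_intros)
 thus ?thesis by simp
qed

end

section \<open>Sums over well-separated families of caps\<close>

lemma geometric_sum_levels:
 fixes e :: real
 assumes e: "e > 0" and J: "finite J" "inj_on h J"
 shows "(\<Sum>j\<in>J. (1 / 2 ^ h j) powr e) <= 1 / (1 - 2 powr - e)"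
proof -
 have q: "0 <= 2 powr - e" "2 powr - e < (1::real)" using e by (auto simp: powr_less_one)
 have "(1 / 2 ^ n) powr e = (2 powr - e) ^ n" for n
  by (simp add: powr_divide powr_minus powr_powr mult.commute power_inverse inverse_eq_divide flip: powr_realpow)
 hence "(\<Sum>j\<in>J. (1 / 2 ^ h j) powr e) = (\<Sum>i\<in>h ` J. (2 powr - e) ^ i)" using J(2) by (simp add: sum.reindex)
 also have "... <= (\<Sum>i. (2 powr - e) ^ i)" using q J(1) by (intro sum_le_suminf summable_geometric) auto
 also have "... = 1 / (1 - 2 powr - e)" using q by (intro suminf_geometric) auto
 finally show ?thesis .
qed

lemma sum_powr_le:
 fixes b :: real
 assumes b: "0 < b" "b <= 1"
 shows "(\<Sum>k<n. (real k + 1) powr (b - 1)) <= 1 / b * real n powr b"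
proof (induction n)
 case (Suc n)
 have "real n powr b + b * (real n + 1) powr (b - 1) <= (real n + 1) powr b"
 proof (cases "n = 0")
  case False
  have "real n powr b * (real n + 1) powr (1 - b) <= b * real n + (1 - b) * (real n + 1)"
   using b False by (intro Youngs_inequality_0) auto
  hence "(real n powr b * (real n + 1) powr (1 - b)) * (real n + 1) powr (b - 1) <= (real n + 1 - b) * (real n + 1) powr (b - 1)"
   by (intro mult_right_mono) (auto simp: algebra_simps)
  thus ?thesis
   using powr_add[of "real n + 1" "1 - b" "b - 1"] powr_add[of "real n + 1" 1 "b - 1"]
   by (simp add: mult.assoc left_diff_distrib)
 qed (use b in auto)
 hence "1 / b * (real n powr b + b * (real n + 1) powr (b - 1)) <= 1 / b * (real n + 1) powr b"
  using b by (intro mult_left_mono) auto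
 thus ?case using Suc b by (simp add: algebra_simps)
qed simp

definition entry :: "(nat => nat => 'c) => nat \<times> nat => 'c" where
 "entry y B = y (fst B) (snd B)"

text \<open>What the estimates use of the points and weights, for finitely many caps. Constants that depend on \<open>c\<close> and \<open>C0\<close> only are
 uniform in the number of caps because the centres on each level are separated.\<close>

definition cap_family ::
 "real => real => (nat => nat => 'a::euclidean_space) => (nat => nat => real) => (nat \<times> nat) set => bool" where
 "cap_family c C0 y w S \<longleftrightarrow> finite S \<and>
   (\<forall>B\<in>S. norm (entry y B) = 1 \<and> 0 <= entry w B \<and> entry w B <= C0 / 2 ^ (fst B * (DIM('a) - 1)) \<and>
    (fst B = 0 --> B = (0, 0) \<and> entry w B = 1)) \<and>
   (\<forall>A\<in>S. \<forall>B\<in>S. fst A = fst B --> A ~= B --> c / 2 ^ fst A <= norm (entry y A - entry y B))"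

lemma cap_family_subset: "cap_family c C0 y w S ==> R \<subseteq> S ==> cap_family c C0 y w R"
 unfolding cap_family_def by (auto intro: finite_subset)

lemma cap_familyD:
 assumes "cap_family c C0 y w S"
 shows "finite S"
  and "B \<in> S ==> norm (entry y B :: 'a::euclidean_space) = 1"
  and "B \<in> S ==> 0 <= entry w B"
  and "B \<in> S ==> entry w B <= C0 / 2 ^ (fst B * (DIM('a) - 1))"
  and "B \<in> S ==> fst B = 0 ==> B = (0, 0) \<and> entry w B = 1"
  and "A \<in> S ==> B \<in> S ==> fst A = fst B ==> A ~= B ==> c / 2 ^ fst A <= norm (entry y A - entry y B)"
 using assms unfolding cap_family_def by simp_all

definition rel_dist :: "(nat => nat => 'a::euclidean_space) => nat \<times> nat => 'a => real" where
 "rel_dist y B x = 1 + 2 ^ fst B * norm (x - entry y B)"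

lemma rel_dist_ge_1: "1 <= rel_dist y B x"
 by (simp add: rel_dist_def)

lemma rel_dist_pos: "0 < rel_dist y B x"
 using rel_dist_ge_1[of y B x] by simp

text \<open>On each level the centres are separated on the scale \<open>1 / 2 ^ j\<close> of the kernel, which bounds the sum over the level.\<close>

lemma sum_caps_le_sum_levels:
 fixes c :: real
 assumes "c > 0"
 obtains C where "C > 0" "!!C0 (y :: nat => nat => 'a::euclidean_space) w S g x.
  cap_family c C0 y w S ==> norm x = 1 ==> (!!j. 0 <= g j) ==>
  (\<Sum>B\<in>S. g (fst B) / rel_dist y B x ^ DIM('a)) <= C * (\<Sum>j\<in>fst ` S. g j)"
proof -
 obtain C where C: "C > 0" "!!(x::'a) N P. norm x = 1 ==> N >= 1 ==> finite P ==> P \<subseteq> sphere 0 1 ==>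
   (!!y z. y \<in> P ==> z \<in> P ==> y ~= z ==> c / N <= norm (y - z)) ==>
   (\<Sum>y\<in>P. 1 / (1 + N * norm (x - y)) ^ DIM('a)) <= C"
  by (rule sum_decay_separated[OF assms, where 'a='a], rule that, assumption, simp)
 show ?thesis
 proof (rule that[OF C(1)])
  fix C0 S and y :: "nat => nat => 'a" and w and g :: "nat => real" and x :: 'a
  assume S: "cap_family c C0 y w S" and x: "norm x = 1" and g: "!!j. 0 <= g j"
  note D = cap_familyD[OF S]
  have lev: "(\<Sum>B\<in>{B \<in> S. fst B = j}. g (fst B) / rel_dist y B x ^ DIM('a)) <= C * g j" for j
  proof -
   define F where "F = {B \<in> S. fst B = j}"
   have F: "B \<in> F ==> B \<in> S" "B \<in> F ==> fst B = j" for B by (auto simp: F_def)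
   have sep: "c / 2 ^ j <= norm (entry y A - entry y B)" if "A \<in> F" "B \<in> F" "A ~= B" for A B
    using D(6)[of A B] F that by auto
   have "c / 2 ^ j > 0" using assms by simp
   hence inj: "inj_on (entry y) F" using sep by (fastforce intro!: inj_onI)
   have "(\<Sum>B\<in>F. 1 / rel_dist y B x ^ DIM('a)) = (\<Sum>z\<in>entry y ` F. 1 / (1 + 2 ^ j * norm (x - z)) ^ DIM('a))"
    using F(2) inj by (simp add: sum.reindex rel_dist_def)
   also have "... <= C"
   proof (rule C(2)[OF x])
    show "finite (entry y ` F)" using D(1) by (simp add: F_def)
    show "entry y ` F \<subseteq> sphere 0 1" using D(2) F(1) by auto
    show "c / 2 ^ j <= norm (u - v)" if "u \<in> entry y ` F" "v \<in> entry y ` F" "u ~= v" for u v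
     using that sep by blast
   qed simp
   finally have "g j * (\<Sum>B\<in>F. 1 / rel_dist y B x ^ DIM('a)) <= g j * C"
    using g by (intro mult_left_mono) auto
   thus ?thesis by (simp add: F_def sum_distrib_left mult.commute)
  qed
  have "(\<Sum>B\<in>S. g (fst B) / rel_dist y B x ^ DIM('a)) = (\<Sum>j\<in>fst ` S. \<Sum>B\<in>{B \<in> S. fst B = j}. g (fst B) / rel_dist y B x ^ DIM('a))"
   using D(1) by (rule sum.image_gen)
  also have "... <= (\<Sum>j\<in>fst ` S. C * g j)" by (intro sum_mono lev)
  finally show "(\<Sum>B\<in>S. g (fst B) / rel_dist y B x ^ DIM('a)) <= C * (\<Sum>j\<in>fst ` S. g j)"
   by (simp add: sum_distrib_left)
 qed
qed

text \<open>A sum is at most the total weight times the largest quotient of a term and its weight. Since the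
 weights chosen here (decaying in the distance and geometrically in the level) have a bounded sum,
 this compares a power of the sum with the sum of the powers, for exponents above and below \<open>1\<close>
 alike.\<close>

lemma powr_sum_caps_le:
 fixes c e T :: real
 assumes "c > 0" "e > 0" "T > 0" and M: "real DIM('a::euclidean_space) * (1 + 1 / T) <= real M"
 obtains C where "C > 0" "!!C0 (y :: nat => nat => 'a) w S b m x.
  cap_family c C0 y w S ==> norm x = 1 ==> m > 0 ==> (\<forall>B\<in>S. m <= 2 ^ fst B) ==> (!!B. 0 <= b B) ==>
  (\<Sum>B\<in>S. b B / rel_dist y B x ^ M) powr T <= C * (\<Sum>B\<in>S. b B powr T * (2 ^ fst B / m) powr e / rel_dist y B x ^ DIM('a))"
proof -
 obtain C where C: "C > 0" "!!C0 (y :: nat => nat => 'a) w S g x.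
  cap_family c C0 y w S ==> norm x = 1 ==> (!!j. 0 <= g j) ==>
  (\<Sum>B\<in>S. g (fst B) / rel_dist y B x ^ DIM('a)) <= C * (\<Sum>j\<in>fst ` S. g j)"
  by (rule sum_caps_le_sum_levels[OF assms(1), where 'a='a], rule that, assumption, simp)
 define W where "W = C * (1 / (1 - 2 powr - (e / T)))"
 have eT: "e / T > 0" using assms by simp
 hence W: "W > 0" using C(1) by (simp add: W_def powr_less_one)
 show ?thesis
 proof (rule that[of "W powr T"])
  fix C0 S and y :: "nat => nat => 'a" and w and b :: "nat \<times> nat => real" and m :: real and x :: 'a
  assume S: "cap_family c C0 y w S" and x: "norm x = 1" and m: "m > 0" "\<forall>B\<in>S. m <= 2 ^ fst B"
   and b: "!!B. 0 <= b B"
  note fin = cap_familyD(1)[OF S]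
  \<comment> \<open>the weights, of bounded sum\<close>
  define h where "h = (%B. (m / 2 ^ fst B) powr (e / T) / rel_dist y B x ^ DIM('a))"
  have h: "h B > 0" for B unfolding h_def using m(1) rel_dist_pos[of y B x] by (intro divide_pos_pos zero_less_power) auto
  define v where "v = (%B. b B / rel_dist y B x ^ M / h B)"
  have v0: "v B >= 0" for B unfolding v_def using b h[of B] rel_dist_pos[of y B x] by simp
  show "(\<Sum>B\<in>S. b B / rel_dist y B x ^ M) powr T <= W powr T * (\<Sum>B\<in>S. b B powr T * (2 ^ fst B / m) powr e / rel_dist y B x ^ DIM('a))"
  proof (cases "S = {}")
   case False
   define i where "i = Min (fst ` S)"
   have i: "i \<in> fst ` S" "!!j. j \<in> fst ` S ==> i <= j" using fin False by (auto simp: i_def)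
   have "sum h S <= C * (\<Sum>j\<in>fst ` S. (m / 2 ^ j) powr (e / T))"
    unfolding h_def by (rule C(2)[OF S x]) simp
   also have "... <= C * (\<Sum>j\<in>fst ` S. (1 / 2 ^ (j - i)) powr (e / T))"
   proof (intro mult_left_mono sum_mono powr_mono2)
    fix j assume "j \<in> fst ` S"
    hence "(2::real) ^ j = 2 ^ i * 2 ^ (j - i)" using i(2) by (simp flip: power_add)
    thus "m / 2 ^ j <= 1 / 2 ^ (j - i)" using m i(1) by (auto simp: field_simps)
   qed (use C(1) m(1) eT in auto)
   also have "... <= W" unfolding W_def using C(1) eT fin i(2)
    by (intro mult_left_mono geometric_sum_levels inj_onI) (auto simp: eq_diff_iff)
   finally have sw: "sum h S <= W" .
   define V where "V = Max (v ` S)"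
   have V: "V \<in> v ` S" "!!B. B \<in> S ==> v B <= V" using fin False by (auto simp: V_def)
   obtain A where A: "A \<in> S" "V = v A" using V(1) by auto
   have "(\<Sum>B\<in>S. b B / rel_dist y B x ^ M) = (\<Sum>B\<in>S. h B * v B)"
    using h by (intro sum.cong) (auto simp: v_def less_imp_neq[symmetric])
   also have "... <= (\<Sum>B\<in>S. h B * V)" using h V(2) by (intro sum_mono mult_left_mono) (auto intro: less_imp_le)
   also have "... = sum h S * V" by (simp add: sum_distrib_right)
   also have "... <= W * V" using sw v0 A by (intro mult_right_mono) auto
   finally have "(\<Sum>B\<in>S. b B / rel_dist y B x ^ M) powr T <= (W * V) powr T"
    by (intro powr_mono2 sum_nonneg divide_nonneg_nonneg zero_le_power b rel_dist_pos[THEN less_imp_le])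
     (use assms in auto)
   also have "... = W powr T * V powr T" by (rule powr_mult)
   also have "... <= W powr T * (\<Sum>B\<in>S. v B powr T)"
    unfolding A(2) using A(1) fin by (intro mult_left_mono member_le_sum) auto
   also have "... <= W powr T * (\<Sum>B\<in>S. b B powr T * (2 ^ fst B / m) powr e / rel_dist y B x ^ DIM('a))"
   proof (intro mult_left_mono sum_mono)
    fix B
    define u where "u = rel_dist y B x"
    have u: "u >= 1" "u > 0" unfolding u_def by (rule rel_dist_ge_1, rule rel_dist_pos)
    define s where "s = m / 2 ^ fst B"
    have s: "s > 0" using m(1) by (simp add: s_def)
    have "v B = b B / u ^ M / (s powr (e / T) / u ^ DIM('a))" by (simp add: v_def h_def s_def u_def)
    also have "... = b B * ((1 / s) powr (e / T) * u powr (real DIM('a) - real M))"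
     using u s by (simp add: powr_diff powr_realpow powr_divide)
    finally have "v B powr T = b B powr T * ((1 / s) powr e * u powr ((real DIM('a) - real M) * T))"
     using assms by (simp add: powr_mult powr_powr)
    also have "... <= b B powr T * ((1 / s) powr e * u powr (- real DIM('a)))"
    proof (intro mult_left_mono powr_mono u)
     have "real DIM('a) * (1 + 1 / T) * T <= real M * T" using M assms by (intro mult_right_mono) auto
     thus "(real DIM('a) - real M) * T <= - real DIM('a)" using assms by (simp add: algebra_simps)
    qed auto
    finally show "v B powr T <= b B powr T * (2 ^ fst B / m) powr e / rel_dist y B x ^ DIM('a)"
     using u by (simp add: s_def powr_minus powr_realpow field_simps flip: u_def)
   qed auto
   finally show ?thesis .
  qed simp
 qed (use W in simp)
qed

lemma nn_integral_Hoelder: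
 fixes u v :: "'c => real"
 assumes [measurable]: "u \<in> borel_measurable M" "v \<in> borel_measurable M"
  and pos: "!!x. 0 <= u x" "!!x. 0 <= v x" and t: "0 < s" "0 < t" "s + t = 1" and A: "A >= 0" "B >= 0"
  and int: "(\<integral>\<^sup>+x. ennreal (u x) \<partial>M) <= ennreal A" "(\<integral>\<^sup>+x. ennreal (v x) \<partial>M) <= ennreal B"
 shows "(\<integral>\<^sup>+x. ennreal (u x powr s * v x powr t) \<partial>M) <= ennreal (A powr s * B powr t)"
proof (cases "A = 0 \<or> B = 0")
 case True
 have zero: "u x = 0 \<longleftrightarrow> u x <= 0" "v x = 0 \<longleftrightarrow> v x <= 0" for x using pos[of x] by auto
 have "AE x in M. u x powr s * v x powr t = 0"
  using True
 proof
  assume "A = 0"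
  hence "AE x in M. u x = 0" using int(1) by (simp add: nn_integral_0_iff_AE ennreal_eq_0_iff zero)
  thus ?thesis by eventually_elim simp
 next
  assume "B = 0"
  hence "AE x in M. v x = 0" using int(2) by (simp add: nn_integral_0_iff_AE ennreal_eq_0_iff zero)
  thus ?thesis by eventually_elim simp
 qed
 hence "(\<integral>\<^sup>+x. ennreal (u x powr s * v x powr t) \<partial>M) = 0"
  by (subst nn_integral_0_iff_AE) auto
 thus ?thesis by simp
next
 case False
 hence A: "A > 0" "B > 0" using A by auto
 define K where "K = A powr s * B powr t"
 have K: "K >= 0" by (simp add: K_def)
 have le: "u x powr s * v x powr t <= K * (s / A) * u x + K * (t / B) * v x" for x
 proof (cases "u x = 0 \<or> v x = 0")
  case True
  thus ?thesis using K t A pos[of x] by auto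
 next
  case False
  hence p: "u x / A > 0" "v x / B > 0" using pos[of x] A by auto
  have "u x powr s * v x powr t = K * ((u x / A) powr s * (v x / B) powr t)"
   using A pos[of x] by (simp add: K_def powr_divide)
  also have "... <= K * (s * (u x / A) + t * (v x / B))"
   by (intro mult_left_mono Youngs_inequality_0 K p) (use t in auto)
  finally show ?thesis by (simp add: algebra_simps)
 qed
 have "(\<integral>\<^sup>+x. ennreal (u x powr s * v x powr t) \<partial>M) <= (\<integral>\<^sup>+x. ennreal (K * (s / A)) * ennreal (u x) + ennreal (K * (t / B)) * ennreal (v x) \<partial>M)"
 proof (intro nn_integral_mono)
  fix x
  have "ennreal (K * (s / A)) * ennreal (u x) + ennreal (K * (t / B)) * ennreal (v x) = ennreal (K * (s / A) * u x + K * (t / B) * v x)"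
   using K t A pos by (simp flip: ennreal_mult ennreal_plus del: times_divide_eq_right)
  thus "ennreal (u x powr s * v x powr t) <= ennreal (K * (s / A)) * ennreal (u x) + ennreal (K * (t / B)) * ennreal (v x)"
   using le[of x] by (simp only: ennreal_leI)
 qed
 also have "... = ennreal (K * (s / A)) * (\<integral>\<^sup>+x. ennreal (u x) \<partial>M) + ennreal (K * (t / B)) * (\<integral>\<^sup>+x. ennreal (v x) \<partial>M)"
  by (simp add: nn_integral_add nn_integral_cmult)
 also have "... <= ennreal (K * (s / A)) * ennreal A + ennreal (K * (t / B)) * ennreal B"
  by (intro add_mono mult_left_mono int) auto
 also have "... = ennreal (K * s + K * t)"
  using K t A by (simp flip: ennreal_mult ennreal_plus)
 also have "K * s + K * t = K" using t by (simp flip: distrib_left)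
 finally show ?thesis by (simp add: K_def)
qed

lemma cap_of_entry: "cap_of y B = cap (entry y B) (pi / 2 ^ fst B)"
 by (simp add: cap_of_def case_prod_beta entry_def)

lemma norm_diff_le_cap_of:
 assumes "norm (entry y B) = 1" "x \<in> cap_of y B"
 shows "norm (x - entry y B) <= pi / 2 ^ fst B"
 using assms cap_subset_cball[OF assms(1), of "pi / 2 ^ fst B"]
 by (force simp: cap_of_entry dist_norm norm_minus_commute)

lemma cap_of_sets:
 fixes y :: "nat => nat => 'a::euclidean_space"
 assumes "norm (entry y B) = 1"
 shows "cap_of y B \<in> sets borel" "cap_of y B \<in> sets \<sigma>"
proof -
 note b = cap_borel[OF assms, of "pi / 2 ^ fst B", folded cap_of_entry]
 show "cap_of y B \<in> sets borel" by (rule b)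
 have "cap_of y B \<inter> sphere 0 1 = cap_of y B" by (auto simp: cap_of_entry cap_def)
 thus "cap_of y B \<in> sets \<sigma>" using sphere_measure_sets[OF b] by simp
qed

text \<open>The caps of \<open>S\<close> that contain \<open>x\<close> have geometrically growing weights, so that any positive power
 of the weights adds up to the same power of the sum of the weights.\<close>

lemma sum_powr_caps_le:
 fixes c e \<delta> :: real
 assumes c: "c > 0" and e: "e > 0" and \<delta>: "e = real (DIM('a::euclidean_space) - 1) * \<delta>"
 obtains C where "C > 0" "!!C0 (y :: nat => nat => 'a) w S x.
  cap_family c C0 y w S ==> norm x = 1 ==>
  (\<Sum>B\<in>S. (2 ^ fst B) powr e * indicator (cap_of y B) x) <=
   C * (\<Sum>B\<in>S. 2 ^ (fst B * (DIM('a) - 1)) * indicator (cap_of y B) x) powr \<delta>"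
proof -
 obtain C where C: "C > 0" "!!C0 (y :: nat => nat => 'a) w S g x.
  cap_family c C0 y w S ==> norm x = 1 ==> (!!j. 0 <= g j) ==>
  (\<Sum>B\<in>S. g (fst B) / rel_dist y B x ^ DIM('a)) <= C * (\<Sum>j\<in>fst ` S. g j)"
  by (rule sum_caps_le_sum_levels[OF c, where 'a='a], rule that, assumption, simp)
 let ?k = "(1 + pi) ^ DIM('a)"
 define W where "W = ?k * (C * (1 / (1 - 2 powr - e)))"
 have q: "2 powr - e < (1::real)" using e by (auto simp: powr_less_one)
 have W: "W > 0" using C(1) q pi_gt_zero unfolding W_def by (intro mult_pos_pos zero_less_power divide_pos_pos add_pos_pos) auto
 have \<delta>0: "\<delta> > 0" using e unfolding \<delta> by (simp add: zero_less_mult_iff)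
 show ?thesis
 proof (rule that[OF W])
  fix C0 S and y :: "nat => nat => 'a" and w and x :: 'a
  assume S: "cap_family c C0 y w S" and x: "norm x = 1"
  note D = cap_familyD[OF S]
  define R where "R = {B \<in> S. x \<in> cap_of y B}"
  have R: "R \<subseteq> S" "finite R" using D(1) by (auto simp: R_def)
  have ind: "(\<Sum>B\<in>S. g B * indicator (cap_of y B) x) = sum g R" for g :: "nat \<times> nat => real"
   unfolding R_def by (subst sum.inter_filter[OF D(1)]) (auto intro!: sum.cong simp: indicator_def)
  show "(\<Sum>B\<in>S. (2 ^ fst B) powr e * indicator (cap_of y B) x) <=
   W * (\<Sum>B\<in>S. 2 ^ (fst B * (DIM('a) - 1)) * indicator (cap_of y B) x) powr \<delta>"
   unfolding ind
  proof (cases "R = {}")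
   case False
   define m where "m = Max (fst ` R)"
   have m: "m \<in> fst ` R" "!!B. B \<in> R ==> fst B <= m" using R(2) False by (auto simp: m_def)
   obtain A where A: "A \<in> R" "m = fst A" using m(1) by auto
   have inj: "inj_on (%j. m - j) (fst ` R)" using m(2) by (intro inj_onI) (metis diff_diff_cancel imageE)
   have "(\<Sum>B\<in>R. (2 ^ fst B) powr e) <= (\<Sum>B\<in>R. ?k * ((2 ^ fst B) powr e / rel_dist y B x ^ DIM('a)))"
   proof (rule sum_mono)
    fix B assume B: "B \<in> R"
    have "norm (x - entry y B) <= pi / 2 ^ fst B"
     using B D(2) by (intro norm_diff_le_cap_of) (auto simp: R_def)
    hence "rel_dist y B x <= 1 + pi" by (simp add: rel_dist_def field_simps)
    hence "(2 ^ fst B) powr e * rel_dist y B x ^ DIM('a) <= (2 ^ fst B) powr e * ?k"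
     using rel_dist_pos[of y B x] by (intro mult_left_mono power_mono) auto
    thus "(2 ^ fst B) powr e <= ?k * ((2 ^ fst B) powr e / rel_dist y B x ^ DIM('a))"
     using rel_dist_pos[of y B x] by (simp add: le_divide_eq mult_ac)
   qed
   also have "... = ?k * (\<Sum>B\<in>R. (2 ^ fst B) powr e / rel_dist y B x ^ DIM('a))"
    by (simp add: sum_distrib_left)
   also have "... <= ?k * (C * (\<Sum>j\<in>fst ` R. (2 ^ j) powr e))"
    by (intro mult_left_mono C(2)[OF cap_family_subset[OF S R(1)] x]) auto
   also have "(\<Sum>j\<in>fst ` R. (2 ^ j) powr e) = (\<Sum>j\<in>fst ` R. (1 / 2 ^ (m - j)) powr e * (2 ^ m) powr e)"
    using m by (intro sum.cong) (auto simp: power_diff simp flip: powr_mult)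
   also have "... = (\<Sum>j\<in>fst ` R. (1 / 2 ^ (m - j)) powr e) * (2 ^ m) powr e" by (simp add: sum_distrib_right)
   also have "?k * (C * ...) <= ?k * (C * ((1 / (1 - 2 powr - e)) * (2 ^ m) powr e))"
    using C(1) R(2) e by (intro mult_left_mono mult_right_mono geometric_sum_levels inj) auto
   also have "... = W * (2 ^ m) powr e" by (simp add: W_def)
   also have "(2 ^ m) powr e = (2 ^ (m * (DIM('a) - 1))) powr \<delta>"
    unfolding \<delta> by (simp add: powr_powr flip: powr_realpow) (simp add: mult_ac)
   also have "... <= (\<Sum>B\<in>R. 2 ^ (fst B * (DIM('a) - 1))) powr \<delta>"
   proof (rule powr_mono2)
    show "2 ^ (m * (DIM('a) - 1)) <= (\<Sum>B\<in>R. 2 ^ (fst B * (DIM('a) - 1)) :: real)"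
     unfolding A(2) by (rule member_le_sum[where f="%B. 2 ^ (fst B * (DIM('a) - 1)) :: real", OF A(1) _ R(2)]) simp
   qed (use \<delta>0 in auto)
   finally show "(\<Sum>B\<in>R. (2 ^ fst B) powr e) <= W * (\<Sum>B\<in>R. 2 ^ (fst B * (DIM('a) - 1))) powr \<delta>"
    using W by simp
  qed simp
 qed
qed

text \<open>This is the sum over \<open>k\<close> in the Besov norm, for one cap: \<open>m\<close> is the degree of its frame element.\<close>

lemma sum_levels_Besov_le:
 fixes b v :: real
 assumes b: "0 < b" "b <= 1" and v: "v >= 0"
 shows "(\<Sum>k<n. (real k + 1) powr (a - 1) * (if k < m then v * (real m / (real k + 1)) powr (a - b) else 0)) <= v * (1 / b) * real m powr a"
proof -
 have "(\<Sum>k<n. (real k + 1) powr (a - 1) * (if k < m then v * (real m / (real k + 1)) powr (a - b) else 0))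
   = (\<Sum>k<n. if k < m then v * real m powr (a - b) * (real k + 1) powr (b - 1) else 0)"
 proof (rule sum.cong)
  fix k
  have "(real k + 1) powr (a - 1) = (real k + 1) powr (a - b) * (real k + 1) powr (b - 1)" by (simp flip: powr_add)
  thus "(real k + 1) powr (a - 1) * (if k < m then v * (real m / (real k + 1)) powr (a - b) else 0)
    = (if k < m then v * real m powr (a - b) * (real k + 1) powr (b - 1) else 0)" by (simp add: powr_divide)
 qed simp
 also have "... = (\<Sum>k\<in>{k\<in>{..<n}. k < m}. v * real m powr (a - b) * (real k + 1) powr (b - 1))"
  by (rule sum.inter_filter[symmetric]) simp
 also have "... <= (\<Sum>k<m. v * real m powr (a - b) * (real k + 1) powr (b - 1))"
  using v by (intro sum_mono2) auto
 also have "... = v * real m powr (a - b) * (\<Sum>k<m. (real k + 1) powr (b - 1))"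
  by (simp add: sum_distrib_left)
 also have "... <= v * real m powr (a - b) * (1 / b * real m powr b)"
  using v by (intro mult_left_mono sum_powr_le b) auto
 also have "... = v * (1 / b) * (real m powr (a - b) * real m powr b)" by simp
 also have "real m powr (a - b) * real m powr b = real m powr a" by (simp flip: powr_add)
 finally show ?thesis .
qed

text \<open>For \<open>b = cap_coeff y a\<close> this is the maximal function of the normalized coefficients.\<close>

definition cap_sup :: "(nat => nat => 'a::euclidean_space) => (nat \<times> nat) set => (nat \<times> nat => real) => 'a => ennreal" where
 "cap_sup y S b x = (SUP B\<in>S. ennreal (b B) * indicator (cap_of y B) x)"

lemma cap_sup_real:
 fixes y :: "nat => nat => 'a::euclidean_space"
 assumes S: "finite S" "!!B. B \<in> S ==> norm (entry y B) = 1" and b: "!!B. 0 <= b B"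
 obtains s where "s \<in> borel_measurable \<sigma>" "cap_sup y S b = (%x. ennreal (s x))"
  "!!x. 0 <= s x" "!!x. s x <= sum b S" "!!B x. B \<in> S ==> x \<in> cap_of y B ==> b B <= s x"
proof
 define s where "s = (%x. enn2real (cap_sup y S b x))"
 have le: "cap_sup y S b x <= ennreal (sum b S)" for x
  unfolding cap_sup_def
 proof (rule SUP_least)
  fix B assume "B \<in> S"
  hence "b B <= sum b S" using S b by (intro member_le_sum) auto
  thus "ennreal (b B) * indicator (cap_of y B) x <= ennreal (sum b S)"
   by (auto simp: indicator_def intro: ennreal_leI)
 qed
 show s: "cap_sup y S b = (%x. ennreal (s x))"
  using le unfolding s_def fun_eq_iff by (metis ennreal_enn2real ennreal_less_top le_less_trans)
 have "(%x. SUP B\<in>S. ennreal (b B) * indicator (cap_of y B) x) \<in> borel_measurable borel"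
  using S by (intro borel_measurable_SUP borel_measurable_times_ennreal borel_measurable_const borel_measurable_indicator
   countable_finite cap_of_sets(1))
 hence "cap_sup y S b \<in> borel_measurable \<sigma>"
  by (intro borel_measurable_sphere_measure) (simp add: cap_sup_def[abs_def])
 thus "s \<in> borel_measurable \<sigma>" unfolding s_def by measurable
 show s0: "0 <= s x" for x by (simp add: s_def)
 show "s x <= sum b S" for x using le[of x] b by (simp add: s sum_nonneg)
 show "b B <= s x" if "B \<in> S" "x \<in> cap_of y B" for B x
 proof -
  have "ennreal (b B) * indicator (cap_of y B) x <= cap_sup y S b x" unfolding cap_sup_def by (rule SUP_upper[OF that(1)])
  thus ?thesis using that(2) by (simp add: s s0)
 qed
qed

lemma epow_ennreal: "0 <= x ==> epow (ennreal x) a = ennreal (x powr a)"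
 by (simp add: epow_def)

lemma enn2real_inverse_finite:
 assumes "p > 0" "p ~= \<infinity>"
 shows "enn2real p > 0" "enn2real (inverse p) = 1 / enn2real p"
proof -
 show 1: "enn2real p > 0" using assms by (simp add: enn2real_positive_iff top.not_eq_extremum)
 have "p = ennreal (enn2real p)" using assms by (simp add: ennreal_enn2real_if)
 hence "inverse p = ennreal (inverse (enn2real p))" using 1 by (metis inverse_ennreal)
 thus "enn2real (inverse p) = 1 / enn2real p" using 1 by (simp add: inverse_eq_divide)
qed

text \<open>Hoelder's inequality with the exponents \<open>p / T\<close> and \<open>1 / \<delta>\<close>; for \<open>p = \<infinity>\<close> these are \<open>\<infinity>\<close> and \<open>1\<close>.\<close>

lemma Hoelder_Lp_norm:
 fixes s Z :: "'a::euclidean_space => real"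
 assumes m [measurable]: "s \<in> borel_measurable \<sigma>" "Z \<in> borel_measurable \<sigma>"
  and s: "!!x. 0 <= s x" "!!x. s x <= K" and Z: "!!x. 0 <= Z x" "(\<integral>\<^sup>+x. ennreal (Z x) \<partial>\<sigma>) <= ennreal A" "A >= 0"
  and e: "p > 0" "T > 0" "\<delta> > 0" "T * enn2real (inverse p) + \<delta> = 1"
 obtains L where "L >= 0" "Lp_norm p (%x. ennreal (s x)) = ennreal L"
  "(\<integral>\<^sup>+x. ennreal (s x powr T * Z x powr \<delta>) \<partial>\<sigma>) <= ennreal (L powr T * A powr \<delta>)"
proof (cases "p = \<infinity>")
 case True
 have \<delta>: "\<delta> = 1" using e True by simp
 define E where "E = esssup \<sigma> (%x. ennreal (s x))"
 have "E <= ennreal K" unfolding E_def by (rule esssup_I) (auto intro!: ennreal_leI s)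
 hence E: "E = ennreal (enn2real E)" by (metis ennreal_enn2real ennreal_less_top le_less_trans)
 have "AE x in sphere_measure. ennreal (s x) <= E" unfolding E_def by (rule esssup_AE)
 hence ae: "AE x in sphere_measure. s x <= enn2real E"
  by eventually_elim (metis E enn2real_nonneg ennreal_le_iff)
 have "AE x in sphere_measure. ennreal (s x powr T * Z x powr \<delta>) <= ennreal (enn2real E powr T) * ennreal (Z x)"
  using ae
 proof eventually_elim
  case (elim x)
  have "s x powr T * Z x <= enn2real E powr T * Z x"
   using elim s(1)[of x] e(2) Z(1)[of x] by (intro mult_right_mono powr_mono2) auto
  thus ?case using Z(1)[of x] by (simp add: \<delta> ennreal_leI flip: ennreal_mult)
 qed
 hence "(\<integral>\<^sup>+x. ennreal (s x powr T * Z x powr \<delta>) \<partial>\<sigma>) <= (\<integral>\<^sup>+x. ennreal (enn2real E powr T) * ennreal (Z x) \<partial>\<sigma>)"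
  by (rule nn_integral_mono_AE)
 also have "... = ennreal (enn2real E powr T) * (\<integral>\<^sup>+x. ennreal (Z x) \<partial>\<sigma>)"
  by (intro nn_integral_cmult) measurable
 also have "... <= ennreal (enn2real E powr T) * ennreal A" by (intro mult_left_mono Z) auto
 also have "... = ennreal (enn2real E powr T * A powr \<delta>)" using Z(3) by (simp add: \<delta> flip: ennreal_mult)
 finally show ?thesis using E by (intro that[of "enn2real E"]) (simp_all add: Lp_norm_def True E_def)
next
 case False
 define q where "q = enn2real p"
 have q: "q > 0" "enn2real (inverse p) = 1 / q" using enn2real_inverse_finite[OF e(1) False] by (auto simp: q_def)
 define B where "B = enn2real (\<integral>\<^sup>+x. ennreal (s x powr q) \<partial>\<sigma>)"
 have "(\<integral>\<^sup>+x. ennreal (s x powr q) \<partial>\<sigma>) <= (\<integral>\<^sup>+x. ennreal (K powr q) \<partial>(\<sigma> :: 'a measure))"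
  using s q(1) by (intro nn_integral_mono ennreal_leI powr_mono2) auto
 also have "... = ennreal (K powr q)" using sphere_measure.emeasure_space_1[where 'a='a] by simp
 finally have B: "(\<integral>\<^sup>+x. ennreal (s x powr q) \<partial>\<sigma>) = ennreal B"
  unfolding B_def by (metis ennreal_enn2real ennreal_less_top le_less_trans)
 have B0: "B >= 0" by (simp add: B_def)
 have "(\<integral>\<^sup>+x. ennreal ((s x powr q) powr (T / q) * Z x powr \<delta>) \<partial>\<sigma>) <= ennreal (B powr (T / q) * A powr \<delta>)"
  using e q by (intro nn_integral_Hoelder) (auto simp: B B0 Z)
 thus ?thesis
  using s(1) q(1) False B B0 by (intro that[of "B powr (1 / q)"]) (simp_all add: powr_powr Lp_norm_def epow_ennreal flip: q_def)
qed

lemma cap_measure_bounds: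
 obtains c0 where "c0 >= 1"
  "!!(y :: nat => nat => 'a::euclidean_space) B. norm (entry y B) = 1 ==> measure \<sigma> (cap_of y B) <= c0 / 2 ^ (fst B * (DIM('a) - 1))"
  "!!(y :: nat => nat => 'a) B. norm (entry y B) = 1 ==> 1 / 2 ^ (fst B * (DIM('a) - 1)) <= c0 * measure \<sigma> (cap_of y B)"
proof -
 obtain c0 where c0: "c0 >= 1"
  "!!(x::'a) j. norm x = 1 ==> measure \<sigma> (cap x (pi / 2 ^ j)) <= c0 / 2 ^ (j * (DIM('a) - 1))"
  "!!(x::'a) j. norm x = 1 ==> 1 / 2 ^ (j * (DIM('a) - 1)) <= c0 * measure \<sigma> (cap x (pi / 2 ^ j))"
  by (rule measure_cap_bounds[where 'a='a], rule that, assumption, simp, simp)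
 show ?thesis
  by (rule that[OF c0(1)]; unfold cap_of_entry) (erule c0(2), erule c0(3))
qed

lemma measure_cap_of_pos:
 fixes y :: "nat => nat => 'a::euclidean_space"
 assumes "norm (entry y B) = 1"
 shows "measure \<sigma> (cap_of y B) > 0"
proof -
 obtain c0 where c0: "c0 >= 1"
  "!!(y :: nat => nat => 'a) B. norm (entry y B) = 1 ==> 1 / 2 ^ (fst B * (DIM('a) - 1)) <= c0 * measure \<sigma> (cap_of y B)"
  by (rule cap_measure_bounds[where 'a='a], rule that, assumption, simp)
 have "0 < (1::real) / 2 ^ (fst B * (DIM('a) - 1))" by simp
 also note c0(2)[OF assms]
 finally show ?thesis using c0(1) by (simp add: zero_less_mult_iff)
qed

text \<open>The cap volumes on the left-hand side turn the sum into an integral of a \<open>T\<close>-th power of the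
 maximal function of the coefficients against a power of the total weight of the caps, to which
 Hoelder's inequality applies.\<close>

lemma sum_caps_le_Lp_norm:
 fixes c \<alpha> T :: real and p :: ennreal
 assumes c: "c > 0" and d: "DIM('a::euclidean_space) >= 3" and \<alpha>: "\<alpha> > 0" and T: "T > 0" and p: "p > 0"
  and pT: "1 / T = enn2real (inverse p) + \<alpha> / (real DIM('a) - 1)"
 obtains C where "C > 0" "!!C0 (y :: nat => nat => 'a) w S b.
  cap_family c C0 y w S ==> (!!B. 0 <= b B) ==>
  \<exists>L\<ge>0. Lp_norm p (cap_sup y S b) = ennreal L \<and>
   (\<Sum>B\<in>S. b B powr T * (2 ^ fst B) powr (\<alpha> * T) / 2 ^ (fst B * (DIM('a) - 1)))
    <= C * real (card S) powr (\<alpha> * T / (real DIM('a) - 1)) * L powr T"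
proof -
 define \<delta> where "\<delta> = \<alpha> * T / (real DIM('a) - 1)"
 have d1: "real DIM('a) - 1 > 0" using d by simp
 have \<delta>: "\<delta> > 0" "\<alpha> * T = real (DIM('a) - 1) * \<delta>" using \<alpha> T d1 d by (auto simp: \<delta>_def of_nat_diff)
 have "T * (1 / T) = T * enn2real (inverse p) + T * (\<alpha> / (real DIM('a) - 1))" unfolding pT by (simp add: distrib_left)
 hence pT': "T * enn2real (inverse p) + \<delta> = 1" using T by (simp add: \<delta>_def mult.commute)
 obtain c0 where c0: "c0 >= 1"
  "!!(y :: nat => nat => 'a) B. norm (entry y B) = 1 ==> measure \<sigma> (cap_of y B) <= c0 / 2 ^ (fst B * (DIM('a) - 1))"
  "!!(y :: nat => nat => 'a) B. norm (entry y B) = 1 ==> 1 / 2 ^ (fst B * (DIM('a) - 1)) <= c0 * measure \<sigma> (cap_of y B)"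
  by (rule cap_measure_bounds[where 'a='a], rule that, assumption, simp, simp)
 have aT: "\<alpha> * T > 0" using \<alpha> T by simp
 obtain W where W: "W > 0" "!!C0 (y :: nat => nat => 'a) w S x. cap_family c C0 y w S ==> norm x = 1 ==>
  (\<Sum>B\<in>S. (2 ^ fst B) powr (\<alpha> * T) * indicator (cap_of y B) x) <=
   W * (\<Sum>B\<in>S. 2 ^ (fst B * (DIM('a) - 1)) * indicator (cap_of y B) x) powr \<delta>"
  by (rule sum_powr_caps_le[OF c aT \<delta>(2)], rule that, assumption, simp)
 show ?thesis
 proof (rule that[of "c0 * W * c0 powr \<delta>"])
  show "c0 * W * c0 powr \<delta> > 0" using c0(1) W(1) by simp
  fix C0 S and y :: "nat => nat => 'a" and w and b :: "nat \<times> nat => real"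
  assume S: "cap_family c C0 y w S" and b: "!!B. 0 <= b B"
  note D = cap_familyD[OF S]
  let ?\<mu> = "%B. measure \<sigma> (cap_of y B)" and ?I = "%B x. indicator (cap_of y B) x :: real"
  define n where "n = real (card S)"
  have cm: "?\<mu> B <= c0 / 2 ^ (fst B * (DIM('a) - 1))" "1 / 2 ^ (fst B * (DIM('a) - 1)) <= c0 * ?\<mu> B" if "B \<in> S" for B
   using c0(2,3) D(2)[OF that] by auto
  have int: "(\<integral>\<^sup>+x. ennreal (\<Sum>B\<in>S. g B * ?I B x) \<partial>\<sigma>) = ennreal (\<Sum>B\<in>S. g B * ?\<mu> B)"
   if g: "!!B. g B >= 0" for g
  proof -
   have "(\<integral>\<^sup>+x. ennreal (\<Sum>B\<in>S. g B * ?I B x) \<partial>\<sigma>) = (\<integral>\<^sup>+x. (\<Sum>B\<in>S. ennreal (g B) * indicator (cap_of y B) x) \<partial>\<sigma>)"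
    using g by (intro nn_integral_cong) (simp add: ennreal_mult ennreal_indicator flip: sum_ennreal)
   also have "... = (\<Sum>B\<in>S. \<integral>\<^sup>+x. ennreal (g B) * indicator (cap_of y B) x \<partial>\<sigma>)"
    using D(2) by (intro nn_integral_sum borel_measurable_times_ennreal borel_measurable_const borel_measurable_indicator cap_of_sets(2))
   also have "... = (\<Sum>B\<in>S. ennreal (g B * ?\<mu> B))"
    using D(2) g by (intro sum.cong refl) (simp add: nn_integral_cmult_indicator cap_of_sets(2) sphere_measure.emeasure_eq_measure ennreal_mult)
   finally show ?thesis using g by (simp add: sum_ennreal)
  qed
  obtain s where s: "s \<in> borel_measurable \<sigma>" "cap_sup y S b = (%x. ennreal (s x))"
   "!!x. 0 <= s x" "!!x. s x <= sum b S" "!!B x. B \<in> S ==> x \<in> cap_of y B ==> b B <= s x"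
   by (rule cap_sup_real[OF D(1,2), of b]) (assumption, rule b, rule that)
  note s(1) [measurable]
  define Z where "Z = (%x. \<Sum>B\<in>S. 2 ^ (fst B * (DIM('a) - 1)) * ?I B x)"
  have Zm [measurable]: "Z \<in> borel_measurable \<sigma>" unfolding Z_def
   using D(2) by (intro borel_measurable_sum borel_measurable_times borel_measurable_const borel_measurable_indicator cap_of_sets(2))
  have "(\<integral>\<^sup>+x. ennreal (Z x) \<partial>\<sigma>) = ennreal (\<Sum>B\<in>S. 2 ^ (fst B * (DIM('a) - 1)) * ?\<mu> B)"
   unfolding Z_def by (rule int) simp
  also have "... <= ennreal (\<Sum>B\<in>S. c0)"
   using cm(1) by (intro ennreal_leI sum_mono) (simp add: field_simps)
  finally have ZI: "(\<integral>\<^sup>+x. ennreal (Z x) \<partial>\<sigma>) <= ennreal (c0 * n)" by (simp add: n_def mult.commute)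
  have cn: "c0 * n >= 0" using c0(1) by (simp add: n_def)
  have Z0: "Z x >= 0" for x unfolding Z_def by (intro sum_nonneg) auto
  obtain L where L: "L >= 0" "Lp_norm p (%x. ennreal (s x)) = ennreal L"
   "(\<integral>\<^sup>+x. ennreal (s x powr T * Z x powr \<delta>) \<partial>\<sigma>) <= ennreal (L powr T * (c0 * n) powr \<delta>)"
   by (rule Hoelder_Lp_norm[OF s(1) Zm s(3,4) Z0 ZI cn p T \<delta>(1) pT']) (rule that)
  define a where "a = (%B. b B powr T * (2 ^ fst B) powr (\<alpha> * T))"
  have a0: "a B >= 0" for B by (simp add: a_def)
  have "ennreal (\<Sum>B\<in>S. a B / 2 ^ (fst B * (DIM('a) - 1))) <= ennreal (\<Sum>B\<in>S. (c0 * a B) * ?\<mu> B)"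
   using mult_left_mono[OF cm(2) a0] by (intro ennreal_leI sum_mono) (simp add: mult_ac)
  also have "... = (\<integral>\<^sup>+x. ennreal (\<Sum>B\<in>S. (c0 * a B) * ?I B x) \<partial>\<sigma>)"
   using c0(1) a0 by (intro int[symmetric]) auto
  also have "... <= (\<integral>\<^sup>+x. ennreal (c0 * W) * ennreal (s x powr T * Z x powr \<delta>) \<partial>\<sigma>)"
  proof (intro nn_integral_mono)
   fix x :: 'a assume "x \<in> space \<sigma>"
   hence x: "norm x = 1" by simp
   have "(\<Sum>B\<in>S. (c0 * a B) * ?I B x) <= (\<Sum>B\<in>S. c0 * s x powr T * ((2 ^ fst B) powr (\<alpha> * T) * ?I B x))"
   proof (rule sum_mono)
    fix B assume B: "B \<in> S"
    have "b B powr T <= s x powr T" if "x \<in> cap_of y B"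
     using s(5)[OF B that] b[of B] T by (intro powr_mono2) auto
    thus "(c0 * a B) * ?I B x <= c0 * s x powr T * ((2 ^ fst B) powr (\<alpha> * T) * ?I B x)"
     using c0(1) by (auto simp: a_def indicator_def intro!: mult_left_mono mult_right_mono)
   qed
   also have "... = c0 * s x powr T * (\<Sum>B\<in>S. (2 ^ fst B) powr (\<alpha> * T) * ?I B x)"
    by (simp add: sum_distrib_left)
   also have "... <= c0 * s x powr T * (W * Z x powr \<delta>)"
    unfolding Z_def using c0(1) by (intro mult_left_mono W(2)[OF S x]) auto
   also have "... = c0 * W * (s x powr T * Z x powr \<delta>)" by simp
   finally show "ennreal (\<Sum>B\<in>S. (c0 * a B) * ?I B x) <= ennreal (c0 * W) * ennreal (s x powr T * Z x powr \<delta>)"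
    using c0(1) W(1) by (simp add: ennreal_leI flip: ennreal_mult)
  qed
  also have "... = ennreal (c0 * W) * (\<integral>\<^sup>+x. ennreal (s x powr T * Z x powr \<delta>) \<partial>\<sigma>)"
   by (intro nn_integral_cmult) measurable
  also have "... <= ennreal (c0 * W) * ennreal (L powr T * (c0 * n) powr \<delta>)" by (rule mult_left_mono[OF L(3)]) simp
  also have "... = ennreal (c0 * W * c0 powr \<delta> * n powr \<delta> * L powr T)"
   using c0(1) W(1) by (simp add: powr_mult mult_ac flip: ennreal_mult)
  finally have "(\<Sum>B\<in>S. a B / 2 ^ (fst B * (DIM('a) - 1))) <= c0 * W * c0 powr \<delta> * n powr \<delta> * L powr T"
   using c0(1) W(1) by (subst (asm) ennreal_le_iff) auto
  thus "\<exists>L\<ge>0. Lp_norm p (cap_sup y S b) = ennreal L \<and>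
   (\<Sum>B\<in>S. b B powr T * (2 ^ fst B) powr (\<alpha> * T) / 2 ^ (fst B * (DIM('a) - 1)))
    <= c0 * W * c0 powr \<delta> * real (card S) powr (\<alpha> * T / (real DIM('a) - 1)) * L powr T"
   using L(1,2) by (auto simp: a_def n_def \<delta>_def s(2))
 qed
qed

section \<open>The frame elements as polynomials\<close>

abbreviation multi_poly :: "nat => (('a::euclidean_space => nat) => 'b::real_normed_field) => 'a => 'b" where
 "multi_poly n c x \<equiv> \<Sum>m\<in>multi_indices n. c m * of_real (\<Prod>b\<in>Basis. (x \<bullet> b) ^ m b)"

lemma sphere_polys_cong: "g \<in> sphere_polys n ==> (!!x. x \<in> sphere 0 1 ==> h x = g x) ==> h \<in> sphere_polys n"
 unfolding sphere_polys_def by force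

lemma sphere_polys_add: "g \<in> sphere_polys n ==> h \<in> sphere_polys n ==> (%x. g x + h x) \<in> sphere_polys n"
proof -
 assume "g \<in> sphere_polys n" "h \<in> sphere_polys n"
 then obtain c c' where "\<forall>x\<in>sphere 0 1. g x = multi_poly n c x"
  "\<forall>x\<in>sphere 0 1. h x = multi_poly n c' x"
  unfolding sphere_polys_def by blast
 hence "\<forall>x\<in>sphere 0 1. g x + h x = multi_poly n (%m. c m + c' m) x"
  by (simp add: sum.distrib distrib_right)
 thus ?thesis unfolding sphere_polys_def by (intro CollectI exI)
qed

lemma sphere_polys_cmult: "g \<in> sphere_polys n ==> (%x. a * g x) \<in> sphere_polys n"
proof -
 assume "g \<in> sphere_polys n"
 then obtain c where "\<forall>x\<in>sphere 0 1. g x = multi_poly n c x"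
  unfolding sphere_polys_def by blast
 hence "\<forall>x\<in>sphere 0 1. a * g x = multi_poly n (%m. a * c m) x"
  by (simp add: sum_distrib_left mult_ac)
 thus ?thesis unfolding sphere_polys_def by (intro CollectI exI)
qed

lemma sphere_polys_const: "(%x::'a::euclidean_space. a) \<in> sphere_polys n"
proof -
 define c :: "('a => nat) => _" where "c = (%m. if m = (%_. 0) then a else 0)"
 have "(%_. 0) \<in> multi_indices n" by (simp add: multi_indices_def)
 hence "multi_poly n c x = a" for x
  by (subst sum.mono_neutral_right[of _ "{%_. 0}"]) (auto simp: finite_multi_indices c_def)
 thus ?thesis unfolding sphere_polys_def by (intro CollectI exI[of _ c]) simp
qed

lemma sphere_polys_sum: "finite A ==> (!!i. i \<in> A ==> g i \<in> sphere_polys n) ==> (%x::'a::euclidean_space. \<Sum>i\<in>A. g i x) \<in> sphere_polys n"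
 by (induction A rule: finite_induct) (auto intro: sphere_polys_const sphere_polys_add)

lemma sphere_polys_mono:
 assumes "n <= m" "g \<in> sphere_polys n"
 shows "g \<in> sphere_polys m"
proof -
 obtain c where c: "\<forall>x\<in>sphere 0 1. g x = multi_poly n c x"
  using assms(2) unfolding sphere_polys_def by blast
 have sub: "multi_indices n \<subseteq> multi_indices m" using assms(1) by (auto simp: multi_indices_def)
 have "multi_poly n c x =
   (\<Sum>i\<in>multi_indices m. (if i \<in> multi_indices n then c i else 0) * of_real (\<Prod>b\<in>Basis. (x \<bullet> b) ^ i b))" for x
  using sub by (intro sum.mono_neutral_cong_left) (auto simp: finite_multi_indices)
 thus ?thesis using c unfolding sphere_polys_def by (intro CollectI exI[of _ "%i. if i \<in> multi_indices n then c i else 0"]) simp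
qed

text \<open>Multiplication by \<open>x \<bullet> b\<close> raises the component \<open>b\<close> of every multi-index by one, and this map \<open>h\<close> is injective.\<close>

lemma sphere_polys_mult_coordinate:
 assumes b: "b \<in> Basis" and g: "g \<in> sphere_polys n"
 shows "(%x. of_real (x \<bullet> b) * g x) \<in> sphere_polys (Suc n)"
proof -
 obtain c where c: "\<forall>x\<in>sphere 0 1. g x = multi_poly n c x"
  using g unfolding sphere_polys_def by blast
 define h where "h = (%m::'a => nat. m(b := Suc (m b)))"
 have inj: "inj_on h A" for A
 proof (rule inj_onI)
  fix m m' assume "h m = h m'"
  hence "h m z = h m' z" for z by simp
  hence "m z = m' z" for z by (auto simp: h_def fun_upd_def split: if_splits elim!: meta_allE[of _ z])
  thus "m = m'" by auto
 qed
 have h: "h ` multi_indices n \<subseteq> multi_indices (Suc n)"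
 proof safe
  fix m :: "'a => nat" assume m: "m \<in> multi_indices n"
  have "(\<Sum>z\<in>Basis. h m z) = Suc (m b) + (\<Sum>z\<in>Basis - {b}. m z)"
   by (subst sum.remove[OF finite_Basis b]) (auto simp: h_def intro!: sum.cong)
  also have "... = Suc (\<Sum>z\<in>Basis. m z)" by (subst sum.remove[OF finite_Basis b]) simp
  finally show "h m \<in> multi_indices (Suc n)" using m b by (auto simp: multi_indices_def h_def)
 qed
 define c' where "c' = (%m. if m \<in> h ` multi_indices n then c (the_inv_into UNIV h m) else 0)"
 have "of_real (x \<bullet> b) * g x = multi_poly (Suc n) c' x" if "x \<in> sphere 0 1" for x
 proof -
  have P: "(\<Prod>z\<in>Basis. (x \<bullet> z) ^ h m z) = (x \<bullet> b) * (\<Prod>z\<in>Basis. (x \<bullet> z) ^ m z)" for m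
  proof -
   have "(\<Prod>z\<in>Basis. (x \<bullet> z) ^ h m z) = (x \<bullet> b) ^ Suc (m b) * (\<Prod>z\<in>Basis - {b}. (x \<bullet> z) ^ m z)"
    by (subst prod.remove[OF finite_Basis b]) (auto simp: h_def intro!: prod.cong)
   also have "... = (x \<bullet> b) * (\<Prod>z\<in>Basis. (x \<bullet> z) ^ m z)" by (subst prod.remove[OF finite_Basis b]) simp
   finally show ?thesis .
  qed
  have "multi_poly (Suc n) c' x = (\<Sum>m\<in>h ` multi_indices n. c' m * of_real (\<Prod>b\<in>Basis. (x \<bullet> b) ^ m b))"
   using h by (intro sum.mono_neutral_right) (auto simp: finite_multi_indices c'_def)
  also have "... = (\<Sum>m\<in>multi_indices n. c' (h m) * of_real (\<Prod>b\<in>Basis. (x \<bullet> b) ^ h m b))"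
   using inj by (simp add: sum.reindex)
  also have "... = (\<Sum>m\<in>multi_indices n. of_real (x \<bullet> b) * (c m * of_real (\<Prod>b\<in>Basis. (x \<bullet> b) ^ m b)))"
   by (intro sum.cong) (auto simp: c'_def the_inv_into_f_f[OF inj] P mult_ac simp del: of_real_prod)
  finally show ?thesis using c that by (simp add: sum_distrib_left)
 qed
 thus ?thesis unfolding sphere_polys_def by (intro CollectI exI[of _ c']) simp
qed

lemma sphere_polys_mult_inner:
 assumes "g \<in> sphere_polys n"
 shows "(%x::'a::euclidean_space. of_real (x \<bullet> y) * g x) \<in> sphere_polys (Suc n)"
proof -
 have "(%x. \<Sum>b\<in>Basis. of_real (y \<bullet> b) * (of_real (x \<bullet> b) * g x)) \<in> sphere_polys (Suc n)"
  by (intro sphere_polys_sum sphere_polys_cmult sphere_polys_mult_coordinate assms) auto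
 thus ?thesis
  by (rule sphere_polys_cong) (simp add: euclidean_inner[of _ y] sum_distrib_left sum_distrib_right mult_ac)
qed

lemma gegenbauer_sphere_poly:
 "(%x::'a::euclidean_space. of_real (gegenbauer l n (x \<bullet> y)) :: 'b::real_normed_field) \<in> sphere_polys n"
proof (induction n rule: induct_nat_012)
 case 0
 show ?case by (simp add: sphere_polys_const)
next
 case 1
 show ?case using sphere_polys_cmult[OF sphere_polys_mult_inner[OF sphere_polys_const[of 1 0]], of "of_real (2 * l)"] by (simp add: mult_ac)
next
 case (ge2 n)
 have "n <= Suc (Suc n)" by simp
 note p = sphere_polys_add[OF sphere_polys_cmult[OF sphere_polys_mult_inner[OF ge2(2)], of "of_real (2 * (real n + 1 + l) / (real n + 2))"]
   sphere_polys_cmult[OF sphere_polys_mono[OF this ge2(1)], of "of_real (- (real n + 2 * l) / (real n + 2))"]]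
 have eq: "(e * s * u - g * v) / t = e / t * (s * u) + - g / t * v" for e s u g v t :: real
  by (simp add: diff_divide_distrib)
 show ?case unfolding gegenbauer.simps eq using p by (simp add: mult_ac)
qed

lemma frame_elem_sphere_poly:
 assumes "2 ^ fst B <= k \<or> fst B = 0"
 shows "(frame_elem \<phi> y w B :: 'a::euclidean_space => 'b::real_normed_field) \<in> sphere_polys k"
proof (cases "fst B = 0")
 case True
 thus ?thesis
  by (cases B) (simp add: frame_elem_def frame_kernel_def sphere_polys_const)
next
 case False
 define z where "z = y (fst B) (snd B)"
 have "(%x. \<Sum>n = 2 ^ fst B div 4..2 ^ fst B. of_real (sqrt (w (fst B) (snd B)) * (\<phi> (real n / 2 ^ (fst B - 1)) * ((2 * real n + real DIM('a) - 2) / (real DIM('a) - 2)))) *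
   (of_real (gegenbauer ((real DIM('a) - 2) / 2) n (x \<bullet> z)) :: 'b)) \<in> sphere_polys k"
  using assms False by (intro sphere_polys_sum sphere_polys_cmult sphere_polys_mono[OF _ gegenbauer_sphere_poly]) auto
 thus ?thesis
  by (rule sphere_polys_cong)
   (use False in \<open>simp add: frame_elem_def case_prod_beta frame_kernel_def zonal_def sum_distrib_left mult_ac flip: z_def\<close>)
qed

lemma frame_kernel_eq:
 assumes "cutoff \<phi>" "j >= 1"
 shows "frame_kernel d \<phi> j t = (\<Sum>k<Suc (2 ^ j). \<phi> (real k / 2 ^ (j - 1)) * zonal d k t)"
proof -
 have "(\<Sum>k = 2 ^ j div 4..2 ^ j. \<phi> (real k / 2 ^ (j - 1)) * zonal d k t) = (\<Sum>k<Suc (2 ^ j). \<phi> (real k / 2 ^ (j - 1)) * zonal d k t)"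
 proof (rule sum.mono_neutral_left)
  show "\<forall>k\<in>{..<Suc (2 ^ j)} - {2 ^ j div 4..2 ^ j}. \<phi> (real k / 2 ^ (j - 1)) * zonal d k t = 0"
  proof
   fix k assume "k \<in> {..<Suc (2 ^ j)} - {2 ^ j div 4..2 ^ j}"
   hence "k < 2 ^ j div 4" by auto
   hence "4 * k < 2 ^ j" by auto
   hence "real (4 * k) < real (2 ^ j)" by (simp only: of_nat_less_iff)
   also have "real (2 ^ j) = 2 * 2 ^ (j - 1)" using assms(2) by (cases j) auto
   finally have "\<phi> (real k / 2 ^ (j - 1)) = 0"
    using cutoff_support[OF assms(1), of "2 ^ (j - 1)" k] by force
   thus "\<phi> (real k / 2 ^ (j - 1)) * zonal d k t = 0" by simp
  qed
 qed auto
 thus ?thesis using assms(2) by (simp add: frame_kernel_def)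
qed

section \<open>Bernstein's inequality\<close>

lemma one_test_fun: "(%_::'a::euclidean_space. 1 :: 'b::{real_normed_field,euclidean_space}) \<in> test_funs"
 using mono_fun_test_fun[OF mono_fun_1, where 'b='b] by simp

lemma poisson_test_fun:
 fixes x :: "'a::euclidean_space"
 assumes d: "DIM('a) >= 3" and x: "norm x = 1" and r: "0 <= r" "r < 1"
 shows "(%y. of_real (poisson (r *\<^sub>R x) y) :: 'b::{real_normed_field,euclidean_space}) \<in> test_funs"
proof (rule test_funs_cong)
 have c: "geometric_decay (%k. r ^ k)" by (rule geometric_decayI[OF r, of _ 1]) (use r in auto)
 show "(zonal_series (%k. r ^ k) x :: 'a => 'b) \<in> test_funs" by (rule zonal_series_test_fun[OF d c x])
 fix y :: 'a assume "y \<in> sphere 0 1"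
 hence "(%k. zonal DIM('a) k (x \<bullet> y) * r ^ k) sums poisson (r *\<^sub>R x) y"
  by (intro poisson_sums[OF d x _ r]) auto
 thus "zonal_series (%k. r ^ k) x y = (of_real (poisson (r *\<^sub>R x) y) :: 'b)"
  by (simp add: zonal_series_def sums_iff mult.commute)
qed

abbreviation cap_kernel :: "(real => real) => (nat => nat => 'a::euclidean_space) => nat \<times> nat => 'a => real" where
 "cap_kernel \<phi> y B u \<equiv> frame_kernel DIM('a) \<phi> (fst B) (u \<bullet> entry y B)"

lemma frame_elem_cap_kernel: "frame_elem \<phi> y w B u = of_real (sqrt (entry w B) * cap_kernel \<phi> y B u)"
 by (simp add: frame_elem_def case_prod_beta entry_def)

lemma frame_kernel_sphere:
 assumes "cutoff \<phi>" "j >= 1" "norm (u :: 'a::euclidean_space) = 1"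
 shows "frame_kernel DIM('a) \<phi> j (u \<bullet> z) = (\<Sum>k<Suc (2 ^ j). \<phi> (real k / 2 ^ (j - 1)) * zsol k z u)"
 using assms by (simp add: frame_kernel_eq zsol_sphere inner_commute del: sum.lessThan_Suc)

lemma poisson_integral_frame_kernel:
 fixes x z :: "'a::euclidean_space"
 assumes d: "DIM('a) >= 3" and \<phi>: "cutoff \<phi>" and j: "j >= 1" and xz: "norm x = 1" "norm z = 1" and r: "0 <= r" "r < 1"
 shows "integrable \<sigma> (%u. frame_kernel DIM('a) \<phi> j (u \<bullet> z) * poisson (r *\<^sub>R x) u)" (is "integrable _ ?f")
  and "(\<integral>u. frame_kernel DIM('a) \<phi> j (u \<bullet> z) * poisson (r *\<^sub>R x) u \<partial>\<sigma>) =
    (\<Sum>k<Suc (2 ^ j). \<phi> (real k / 2 ^ (j - 1)) * r ^ k * zonal DIM('a) k (x \<bullet> z))"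
proof -
 let ?g = "%u. \<Sum>k<Suc (2 ^ j). \<phi> (real k / 2 ^ (j - 1)) * (poisson (r *\<^sub>R x) u * zsol k z u)"
 have eq: "?f u = ?g u" if "u \<in> space \<sigma>" for u
  using that by (simp add: frame_kernel_sphere[OF \<phi> j] sum_distrib_left mult_ac del: sum.lessThan_Suc)
 have i: "integrable \<sigma> (%u. \<phi> (real k / 2 ^ (j - 1)) * (poisson (r *\<^sub>R x) u * zsol k z u))" for k
  by (intro integrable_mult_right poisson_integral_zsol(1)[OF d xz r])
 show "integrable \<sigma> ?f"
  by (rule Bochner_Integration.integrable_cong[THEN iffD2, OF refl eq], assumption, intro Bochner_Integration.integrable_sum i)
 have "integral\<^sup>L \<sigma> ?f = integral\<^sup>L \<sigma> ?g" by (rule Bochner_Integration.integral_cong[OF refl eq])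
 also have "... = (\<Sum>k<Suc (2 ^ j). \<phi> (real k / 2 ^ (j - 1)) * (\<integral>u. poisson (r *\<^sub>R x) u * zsol k z u \<partial>\<sigma>))"
  by (subst Bochner_Integration.integral_sum[OF i]) (simp del: sum.lessThan_Suc)
 also have "... = (\<Sum>k<Suc (2 ^ j). \<phi> (real k / 2 ^ (j - 1)) * r ^ k * zonal DIM('a) k (x \<bullet> z))"
  using xz by (intro sum.cong) (auto simp: poisson_integral_zsol(2)[OF d xz r] zsol_reproducing[OF d xz] zsol_sphere inner_commute)
 finally show "integral\<^sup>L \<sigma> ?f = (\<Sum>k<Suc (2 ^ j). \<phi> (real k / 2 ^ (j - 1)) * r ^ k * zonal DIM('a) k (x \<bullet> z))" .
qed

lemma integral_frame_kernel:
 fixes z :: "'a::euclidean_space"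
 assumes d: "DIM('a) >= 3" and \<phi>: "cutoff \<phi>" and z: "norm z = 1"
 shows "integrable \<sigma> (%u. frame_kernel DIM('a) \<phi> j (u \<bullet> z))" (is "integrable _ ?f")
  and "(\<integral>u. frame_kernel DIM('a) \<phi> j (u \<bullet> z) \<partial>\<sigma>) = (if j = 0 then 1 else 0)"
proof -
 have "integrable \<sigma> ?f \<and> integral\<^sup>L \<sigma> ?f = (if j = 0 then 1 else 0)"
 proof (cases "j = 0")
  case True
  thus ?thesis by (simp add: frame_kernel_def)
 next
  case False
  hence j: "j >= 1" by simp
  note P = poisson_integral_frame_kernel[OF d \<phi> j z z order_refl zero_less_one]
  have eq: "?f u = ?f u * poisson (0 *\<^sub>R z) u" if "u \<in> space \<sigma>" for u
   using that by (simp add: poisson_def)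
  have "\<phi> 0 = 0" using \<phi> unfolding cutoff_def by fastforce
  hence "(\<Sum>k<Suc (2 ^ j). \<phi> (real k / 2 ^ (j - 1)) * 0 ^ k * zonal DIM('a) k (z \<bullet> z)) = 0"
   by (intro sum.neutral) (auto simp: power_0_left)
  moreover have "integrable \<sigma> ?f"
   by (rule Bochner_Integration.integrable_cong[THEN iffD2, OF refl eq P(1)])
  moreover have "integral\<^sup>L \<sigma> ?f = (\<integral>u. ?f u * poisson (0 *\<^sub>R z) u \<partial>\<sigma>)"
   by (rule Bochner_Integration.integral_cong[OF refl eq])
  ultimately show ?thesis using P(2) j by simp
 qed
 thus "integrable \<sigma> ?f" "integral\<^sup>L \<sigma> ?f = (if j = 0 then 1 else 0)" by auto
qed

lemma distr_of_frame_sum: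
 fixes a :: "nat \<times> nat => 'b::{real_normed_field,euclidean_space}"
 assumes "!!B. B \<in> S ==> integrable \<sigma> (%u::'a::euclidean_space. cap_kernel \<phi> y B u * h u)"
 shows "distr_of (%u::'a. \<Sum>B\<in>S. a B * frame_elem \<phi> y w B u) (%u. of_real (h u)) =
  (\<Sum>B\<in>S. a B * of_real (sqrt (entry w B) * (\<integral>u. cap_kernel \<phi> y B u * h u \<partial>\<sigma>)))"
proof -
 have "distr_of (%u::'a. \<Sum>B\<in>S. a B * frame_elem \<phi> y w B u) (%u. of_real (h u)) =
  (\<integral>u. (\<Sum>B\<in>S. (a B * of_real (sqrt (entry w B))) * of_real (cap_kernel \<phi> y B u * h u)) \<partial>\<sigma>)"
  unfolding distr_of_def by (simp add: sum_distrib_left sum_distrib_right frame_elem_cap_kernel mult_ac)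
 also have "... = (\<Sum>B\<in>S. \<integral>u. (a B * of_real (sqrt (entry w B))) * of_real (cap_kernel \<phi> y B u * h u) \<partial>\<sigma>)"
  by (intro Bochner_Integration.integral_sum integrable_mult_right integrable_of_real assms)
 also have "... = (\<Sum>B\<in>S. a B * of_real (sqrt (entry w B) * (\<integral>u. cap_kernel \<phi> y B u * h u \<partial>\<sigma>)))"
  by (intro sum.cong refl, subst integral_mult_right_zero, subst integral_of_real[OF assms]) (simp_all add: mult.assoc)
 finally show ?thesis .
qed

definition cap_coeff :: "(nat => nat => 'a::euclidean_space) => (nat \<times> nat => 'b::real_normed_vector) => nat \<times> nat => real" where
 "cap_coeff y a B = norm (a B) * measure \<sigma> (cap_of y B) powr (- 1 / 2)"

lemma cap_coeff_nonneg: "0 <= cap_coeff y a B"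
 by (simp add: cap_coeff_def)

text \<open>Applied to the Poisson kernel at \<open>r x\<close>, a frame element is its kernel with the damped coefficients
 \<open>\<phi> (k / N) * r ^ k\<close>, which is as well localized as the frame element itself, uniformly in \<open>r\<close>.\<close>

lemma radial_max_frame_sum:
 fixes C0 :: real
 assumes d: "DIM('a::euclidean_space) >= 3" and \<phi>: "cutoff \<phi>"
 obtains C where "C > 0" "!!c (y :: nat => nat => 'a) w S (a :: nat \<times> nat => 'b::{real_normed_field,euclidean_space}) x.
  cap_family c C0 y w S ==> (\<forall>B\<in>S. fst B >= 1) ==> norm x = 1 ==>
  radial_max (distr_of (%x. \<Sum>B\<in>S. a B * frame_elem \<phi> y w B x)) x <= ennreal (C * (\<Sum>B\<in>S. cap_coeff y a B / rel_dist y B x ^ (2 * M)))"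
proof -
 obtain C where C: "C > 0"
  "!!N r (x::'a) y K. N >= 1 ==> 0 <= r ==> r <= 1 ==> norm x = 1 ==> norm y = 1 ==> 2 * N < real K ==>
    \<bar>\<Sum>k<K. \<phi> (real k / N) * r ^ k * zonal DIM('a) k (x \<bullet> y)\<bar> <= C * N ^ (DIM('a) - 1) / (1 + N * norm (x - y)) ^ (2 * M)"
  by (rule poisson_kernel_decay[OF d \<phi>, of M], rule that, assumption, simp)
 obtain c0 where c0: "c0 >= 1"
  "!!(y :: nat => nat => 'a) B. norm (entry y B) = 1 ==> measure \<sigma> (cap_of y B) <= c0 / 2 ^ (fst B * (DIM('a) - 1))"
  by (rule cap_measure_bounds[where 'a='a], rule that, assumption, simp)
 define E where "E = sqrt (c0 * \<bar>C0\<bar>) * (C * 2 ^ (2 * M))"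
 have E: "E >= 0" using c0(1) C(1) by (simp add: E_def)
 show ?thesis
 proof (rule that[of "E + 1"])
  show "E + 1 > 0" using E by simp
  fix c S and y :: "nat => nat => 'a" and w and a :: "nat \<times> nat => 'b" and x :: 'a
  assume S: "cap_family c C0 y w S" and j: "\<forall>B\<in>S. fst B >= 1" and x: "norm x = 1"
  note D = cap_familyD[OF S]
  show "radial_max (distr_of (%x. \<Sum>B\<in>S. a B * frame_elem \<phi> y w B x)) x <= ennreal ((E + 1) * (\<Sum>B\<in>S. cap_coeff y a B / rel_dist y B x ^ (2 * M)))"
   unfolding radial_max_def
  proof (intro SUP_least ennreal_leI)
   fix r :: real assume "r \<in> {0..<1}"
   hence r: "0 <= r" "r < 1" by auto
   define I where "I = (%B. \<integral>u. cap_kernel \<phi> y B u * poisson (r *\<^sub>R x) u \<partial>\<sigma>)"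
   have bnd: "norm (a B * of_real (sqrt (entry w B) * I B)) <= (E + 1) * (cap_coeff y a B / rel_dist y B x ^ (2 * M))" if B: "B \<in> S" for B
   proof -
    define q where "q = (2::real) ^ (fst B * (DIM('a) - 1))"
    define N where "N = (2::real) ^ (fst B - 1)"
    have q: "q > 0" by (simp add: q_def)
    have jB: "fst B >= 1" using j B by blast
    have N: "N >= 1" "2 ^ fst B = 2 * N" using jB by (auto simp: N_def simp flip: power_Suc)
    note z = D(2)[OF B]
    note p = rel_dist_pos[of y B x]
    have "\<bar>I B\<bar> <= C * N ^ (DIM('a) - 1) / (1 + N * norm (x - entry y B)) ^ (2 * M)"
     unfolding I_def poisson_integral_frame_kernel(2)[OF d \<phi> jB x z r]
     using C(2)[OF N(1) r(1) less_imp_le[OF r(2)] x z, of "Suc (2 ^ fst B)"] N(2)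
     by (simp add: N_def del: sum.lessThan_Suc)
    also have "... <= C * q / (rel_dist y B x / 2) ^ (2 * M)"
    proof (intro frac_le mult_left_mono power_mono)
     have "N ^ (DIM('a) - 1) <= (2 ^ fst B) ^ (DIM('a) - 1)" using N by (intro power_mono) auto
     thus "N ^ (DIM('a) - 1) <= q" by (simp add: q_def power_mult)
     show "rel_dist y B x / 2 <= 1 + N * norm (x - entry y B)" by (simp add: rel_dist_def N(2))
     show "0 < (rel_dist y B x / 2) ^ (2 * M)" using p by simp
    qed (use C(1) q p in auto)
    also have "... = C * 2 ^ (2 * M) * q / rel_dist y B x ^ (2 * M)" by (simp add: power_divide)
    finally have I: "\<bar>I B\<bar> <= C * 2 ^ (2 * M) * q / rel_dist y B x ^ (2 * M)" .
    define m where "m = measure \<sigma> (cap_of y B)"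
    have m: "m <= c0 / q" "m > 0" using c0(2)[OF z] measure_cap_of_pos[OF z] by (auto simp: m_def q_def)
    have "entry w B <= \<bar>C0\<bar> / q"
     using D(4)[OF B] divide_right_mono[OF abs_ge_self[of C0], of q] q by (simp add: q_def)
    hence "m * entry w B <= (c0 / q) * (\<bar>C0\<bar> / q)"
     using m q c0(1) D(3)[OF B] by (intro mult_mono) auto
    hence "sqrt (m * entry w B) <= sqrt ((c0 * \<bar>C0\<bar>) / q\<^sup>2)" by (simp add: power2_eq_square)
    hence mw: "sqrt (m * entry w B) <= sqrt (c0 * \<bar>C0\<bar>) / q" using q by (simp add: real_sqrt_divide)
    have "norm (a B) = cap_coeff y a B * sqrt m"
     using m by (simp add: cap_coeff_def powr_minus powr_half_sqrt flip: m_def)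
    hence "norm (a B * of_real (sqrt (entry w B) * I B)) = cap_coeff y a B * (sqrt (m * entry w B) * \<bar>I B\<bar>)"
     using D(3)[OF B] by (simp add: norm_mult real_sqrt_mult)
    also have "... <= cap_coeff y a B * ((sqrt (c0 * \<bar>C0\<bar>) / q) * (C * 2 ^ (2 * M) * q / rel_dist y B x ^ (2 * M)))"
     using D(3)[OF B] m(2) q c0(1) by (intro mult_left_mono mult_mono mw I cap_coeff_nonneg) auto
    also have "... = E * (cap_coeff y a B / rel_dist y B x ^ (2 * M))" using q by (simp add: E_def)
    also have "... <= (E + 1) * (cap_coeff y a B / rel_dist y B x ^ (2 * M))"
     using cap_coeff_nonneg[of y a B] p by (intro mult_right_mono) auto
    finally show ?thesis .
   qed
   have "integrable \<sigma> (%u. cap_kernel \<phi> y B u * poisson (r *\<^sub>R x) u)" if "B \<in> S" for B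
    using j that by (intro poisson_integral_frame_kernel(1)[OF d \<phi> _ x D(2) r]) auto
   hence "distr_of (%u. \<Sum>B\<in>S. a B * frame_elem \<phi> y w B u) (%u. of_real (poisson (r *\<^sub>R x) u)) = (\<Sum>B\<in>S. a B * of_real (sqrt (entry w B) * I B))"
    unfolding I_def by (rule distr_of_frame_sum)
   also have "norm ... <= (\<Sum>B\<in>S. (E + 1) * (cap_coeff y a B / rel_dist y B x ^ (2 * M)))"
    by (rule order_trans[OF norm_sum sum_mono[OF bnd]])
   finally show "norm (distr_of (%x. \<Sum>B\<in>S. a B * frame_elem \<phi> y w B x) (%y. of_real (poisson (r *\<^sub>R x) y))) <= (E + 1) * (\<Sum>B\<in>S. cap_coeff y a B / rel_dist y B x ^ (2 * M))"
    by (simp add: sum_distrib_left)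
  qed
 qed
qed

lemma epow_mono: "x <= y ==> 0 <= a ==> epow x a <= epow y a"
proof (cases "y = \<infinity>")
 case False
 assume *: "x <= y" "0 <= a"
 hence "x ~= \<infinity>" using False by (auto simp: top_unique)
 thus ?thesis using * False
  by (auto simp: epow_def intro!: ennreal_leI powr_mono2 enn2real_mono simp: less_top[symmetric])
qed (simp add: epow_def)

lemma epow_epow: "T > 0 ==> epow (epow x (1 / T)) T = x"
 by (auto simp: epow_def powr_powr ennreal_enn2real_if)

lemma Lp_norm_ge_const:
 assumes p: "p > 0" and c: "c >= 0" and g: "!!x::'a::euclidean_space. x \<in> sphere 0 1 ==> ennreal c <= g x"
 shows "ennreal c <= Lp_norm p g"
proof (cases "p = \<infinity>")
 case True
 show ?thesis
 proof (cases "g \<in> borel_measurable \<sigma>")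
  case m: True
  have "AE x in sphere_measure. g x <= esssup \<sigma> g" by (rule esssup_AE)
  moreover have "AE x in sphere_measure. ennreal c <= g x" using g by (intro AE_I2) simp
  ultimately have "AE x in (\<sigma> :: 'a measure). ennreal c <= esssup \<sigma> g"
   by eventually_elim (rule order_trans)
  thus ?thesis using True by (simp add: Lp_norm_def sphere_measure.AE_const)
 qed (simp add: True Lp_norm_def esssup_non_measurable)
next
 case False
 define q where "q = enn2real p"
 have q: "q > 0" using enn2real_inverse_finite[OF p False] by (simp add: q_def)
 have "ennreal (c powr q) = (\<integral>\<^sup>+x. ennreal (c powr q) \<partial>(\<sigma> :: 'a measure))"
  using sphere_measure.emeasure_space_1[where 'a='a] by simp
 also have "... <= (\<integral>\<^sup>+x. epow (g x) q \<partial>\<sigma>)"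
  using epow_mono[OF g, of _ q] q c by (intro nn_integral_mono) (auto simp: epow_ennreal)
 finally have "epow (ennreal (c powr q)) (1 / q) <= epow (\<integral>\<^sup>+x. epow (g x) q \<partial>\<sigma>) (1 / q)"
  using q by (intro epow_mono) auto
 thus ?thesis using False q c by (simp add: Lp_norm_def epow_ennreal powr_powr flip: q_def)
qed

lemma critical_exponent:
 assumes p: "p > 0" and c: "c > 0" and \<tau>: "\<tau> = inverse (inverse p + ennreal c)"
 shows "\<tau> ~= \<infinity>" "\<tau> > 0" "enn2real \<tau> > 0" "1 / enn2real \<tau> = enn2real (inverse p) + c"
proof -
 define q where "q = enn2real (inverse p)"
 have pos: "q + c > 0" using c by (simp add: q_def add_nonneg_pos)
 have "inverse p ~= \<infinity>" using p by (metis ennreal_inverse_eq_top_iff infinity_ennreal_def not_gr_zero)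
 hence "inverse p = ennreal q" by (simp add: q_def ennreal_enn2real_if)
 hence "\<tau> = inverse (ennreal (q + c))" unfolding \<tau> using c by (simp add: q_def)
 hence "\<tau> = ennreal (inverse (q + c))" using pos by (simp add: inverse_ennreal)
 thus "\<tau> ~= \<infinity>" "\<tau> > 0" "enn2real \<tau> > 0" "1 / enn2real \<tau> = enn2real (inverse p) + c"
  using pos by (auto simp: q_def[symmetric] inverse_eq_divide)
qed

text \<open>The low levels of a frame sum are a polynomial, so that the error of best approximation is at
 most the norm of the high levels. The exponent \<open>\<epsilon>\<close> is free because the sum over the high
 levels is geometric; it will be chosen below \<open>\<alpha> * T\<close>.\<close>

lemma best_approx_frame_sum_le:
 fixes c C0 \<epsilon> :: real and \<tau> :: ennreal
 assumes d: "DIM('a::euclidean_space) >= 3" and \<phi>: "cutoff \<phi>" and c: "c > 0" and \<epsilon>: "\<epsilon> > 0"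
  and \<tau>: "\<tau> ~= \<infinity>" "enn2real \<tau> > 0"
 obtains C where "C > 0" "!!(y :: nat => nat => 'a) w S (a :: nat \<times> nat => 'b::{real_normed_field,euclidean_space}) f k.
  cap_family c C0 y w S ==> distr_eq f (distr_of (%x. \<Sum>B\<in>S. a B * frame_elem \<phi> y w B x)) ==>
  epow (best_approx k \<tau> f) (enn2real \<tau>) <= ennreal (C * (\<Sum>B\<in>S. if k < 2 ^ fst B then
    cap_coeff y a B powr enn2real \<tau> / 2 ^ (fst B * (DIM('a) - 1)) * (2 ^ fst B / (real k + 1)) powr \<epsilon> else 0))"
proof -
 define T where "T = enn2real \<tau>"
 have T: "T > 0" using \<tau> by (simp add: T_def)
 define M where "M = nat \<lceil>real DIM('a) * (1 + 1 / T)\<rceil>"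
 have "real DIM('a) * (1 + 1 / T) <= real M" unfolding M_def by linarith
 hence M: "real DIM('a) * (1 + 1 / T) <= real (2 * M)" by simp
 obtain C1 where C1: "C1 > 0" "!!c (y :: nat => nat => 'a) w S (a :: nat \<times> nat => 'b) x.
  cap_family c C0 y w S ==> (\<forall>B\<in>S. fst B >= 1) ==> norm x = 1 ==>
  radial_max (distr_of (%x. \<Sum>B\<in>S. a B * frame_elem \<phi> y w B x)) x <= ennreal (C1 * (\<Sum>B\<in>S. cap_coeff y a B / rel_dist y B x ^ (2 * M)))"
  by (rule radial_max_frame_sum[OF d \<phi>, of C0 M, where 'b='b], rule that, assumption, simp)
 obtain C2 where C2: "C2 > 0" "!!C0 (y :: nat => nat => 'a) w S b m x.
  cap_family c C0 y w S ==> norm x = 1 ==> m > 0 ==> (\<forall>B\<in>S. m <= 2 ^ fst B) ==> (!!B. 0 <= b B) ==>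
  (\<Sum>B\<in>S. b B / rel_dist y B x ^ (2 * M)) powr T <= C2 * (\<Sum>B\<in>S. b B powr T * (2 ^ fst B / m) powr \<epsilon> / rel_dist y B x ^ DIM('a))"
  by (rule powr_sum_caps_le[OF c \<epsilon> T M], rule that, assumption, simp)
 define C where "C = C1 powr T * C2 * 4 ^ DIM('a)"
 have C0: "C > 0" using C1(1) C2(1) by (simp add: C_def)
 show ?thesis
 proof (rule that[OF C0])
  fix S and y :: "nat => nat => 'a" and w and a :: "nat \<times> nat => 'b" and f :: "('a, 'b) functional" and k :: nat
  assume S: "cap_family c C0 y w S" and f: "distr_eq f (distr_of (%x. \<Sum>B\<in>S. a B * frame_elem \<phi> y w B x))"
  note D = cap_familyD[OF S]
  define R where "R = {B \<in> S. fst B ~= 0 \<and> k < 2 ^ fst B}"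
  have R: "R \<subseteq> S" "\<forall>B\<in>R. fst B >= 1" by (auto simp: R_def Suc_le_eq)
  note RF = cap_family_subset[OF S R(1)]
  let ?sum = "%A x. \<Sum>B\<in>A. a B * frame_elem \<phi> y w B x"
  let ?d = "%u. f u - distr_of (?sum (S - R)) u"
  define b where "b = cap_coeff y a"
  have b: "b B >= 0" for B by (simp add: b_def cap_coeff_nonneg)
  define K where "K = (%B. b B powr T * (2 ^ fst B / (real k + 1)) powr \<epsilon>)"
  have K: "K B >= 0" for B by (simp add: K_def)
  let ?q = "%B x. 1 / (1 + 2 ^ fst B * norm (entry y B - x)) ^ DIM('a)"
  have "?sum (S - R) \<in> sphere_polys k"
   using D(1) by (intro sphere_polys_sum sphere_polys_cmult frame_elem_sphere_poly) (auto simp: R_def)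
  hence "best_approx k \<tau> f <= Hardy_norm \<tau> ?d"
   unfolding best_approx_def by (rule INF_lower)
  also have "... = Lp_norm \<tau> (radial_max ?d)" using \<tau>(1) by (simp add: Hardy_norm_def)
  finally have "epow (best_approx k \<tau> f) T <= epow (Lp_norm \<tau> (radial_max ?d)) T"
   using T by (intro epow_mono) auto
  also have "... = (\<integral>\<^sup>+x. epow (radial_max ?d x) T \<partial>\<sigma>)"
   using \<tau>(1) T by (simp add: Lp_norm_def epow_epow flip: T_def)
  also have "... <= (\<integral>\<^sup>+x. (\<Sum>B\<in>R. ennreal (C1 powr T * C2 * K B) * ennreal (?q B x)) \<partial>\<sigma>)"
  proof (intro nn_integral_mono)
   fix x :: 'a assume "x \<in> space \<sigma>"
   hence x: "norm x = 1" by simp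
   have "radial_max ?d x = radial_max (distr_of (?sum R)) x"
    unfolding radial_max_def
   proof (intro SUP_cong refl arg_cong[where f=ennreal] arg_cong[where f=norm])
    fix r :: real assume "r \<in> {0..<1}"
    hence r: "0 <= r" "r < 1" by auto
    let ?u = "%z. of_real (poisson (r *\<^sub>R x) z) :: 'b"
    define F where "F = (%B. a B * of_real (sqrt (entry w B) * (\<integral>u. cap_kernel \<phi> y B u * poisson (r *\<^sub>R x) u \<partial>\<sigma>)))"
    have int: "integrable \<sigma> (%u. cap_kernel \<phi> y B u * poisson (r *\<^sub>R x) u)" if "B \<in> S" for B
    proof (cases "fst B = 0")
     case True
     have "integrable \<sigma> (%u. poisson (r *\<^sub>R x) u * zsol 0 x u)"
      by (rule poisson_integral_zsol(1)[OF d x x r])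
     moreover have "zsol 0 x u = 1" for u using d by (simp add: zsol_def sol_def)
     ultimately show ?thesis using True by (simp add: frame_kernel_def)
    qed (use poisson_integral_frame_kernel(1)[OF d \<phi> _ x D(2)[OF that] r] in auto)
    have F: "distr_of (?sum A) ?u = sum F A" if "A \<subseteq> S" for A
     unfolding F_def using that by (intro distr_of_frame_sum int) auto
    have "f ?u = distr_of (?sum S) ?u"
     using f poisson_test_fun[OF d x r, where 'b='b] by (simp add: distr_eq_def)
    thus "?d ?u = distr_of (?sum R) ?u"
     using F[OF order_refl] F[OF Diff_subset] F[OF R(1)] sum.subset_diff[OF R(1) D(1), of F] by simp
   qed
   also have "... <= ennreal (C1 * (\<Sum>B\<in>R. b B / rel_dist y B x ^ (2 * M)))"
    unfolding b_def by (rule C1(2)[OF RF R(2) x])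
   finally have "epow (radial_max ?d x) T <= epow (ennreal (C1 * (\<Sum>B\<in>R. b B / rel_dist y B x ^ (2 * M)))) T"
    using T by (intro epow_mono) auto
   also have "... = ennreal ((C1 * (\<Sum>B\<in>R. b B / rel_dist y B x ^ (2 * M))) powr T)"
    using C1(1) by (intro epow_ennreal mult_nonneg_nonneg sum_nonneg divide_nonneg_nonneg zero_le_power b
      rel_dist_pos[THEN less_imp_le]) auto
   also have "(C1 * (\<Sum>B\<in>R. b B / rel_dist y B x ^ (2 * M))) powr T = C1 powr T * (\<Sum>B\<in>R. b B / rel_dist y B x ^ (2 * M)) powr T"
    by (rule powr_mult)
   also have "... <= C1 powr T * (C2 * (\<Sum>B\<in>R. K B / rel_dist y B x ^ DIM('a)))"
    unfolding K_def
   proof (intro mult_left_mono C2(2)[OF RF x] b ballI)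
    fix B assume "B \<in> R"
    hence "k + 1 <= 2 ^ fst B" by (auto simp: R_def)
    hence "real (k + 1) <= real (2 ^ fst B)" by (simp only: of_nat_le_iff)
    thus "real k + 1 <= 2 ^ fst B" by simp
   qed auto
   also have "... = (\<Sum>B\<in>R. (C1 powr T * C2 * K B) * ?q B x)"
    by (simp add: sum_distrib_left rel_dist_def norm_minus_commute mult_ac)
   also have "ennreal ... = (\<Sum>B\<in>R. ennreal ((C1 powr T * C2 * K B) * ?q B x))"
    using C2(1) K by (intro sum_ennreal[symmetric]) auto
   also have "... = (\<Sum>B\<in>R. ennreal (C1 powr T * C2 * K B) * ennreal (?q B x))"
    using C2(1) K by (intro sum.cong refl ennreal_mult) auto
   finally show "epow (radial_max ?d x) T <= ..." by (simp add: ennreal_leI)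
  qed
  also have "... = (\<Sum>B\<in>R. ennreal (C1 powr T * C2 * K B) * (\<integral>\<^sup>+x. ennreal (?q B x) \<partial>\<sigma>))"
   by (subst nn_integral_sum) (auto intro!: sum.cong nn_integral_cmult)
  also have "... <= (\<Sum>B\<in>R. ennreal (C1 powr T * C2 * K B) * ennreal (4 ^ DIM('a) / (2 ^ fst B) ^ (DIM('a) - 1)))"
   using D(2) R(1) by (intro sum_mono mult_left_mono nn_integral_decay) auto
  also have "... = (\<Sum>B\<in>R. ennreal (C * (K B / 2 ^ (fst B * (DIM('a) - 1)))))"
   using C2(1) K by (intro sum.cong refl) (simp add: C_def power_mult mult_ac flip: ennreal_mult)
  also have "... = ennreal (\<Sum>B\<in>R. C * (K B / 2 ^ (fst B * (DIM('a) - 1))))"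
   using C0 K by (intro sum_ennreal) simp
  also have "(\<Sum>B\<in>R. C * (K B / 2 ^ (fst B * (DIM('a) - 1)))) = (\<Sum>B\<in>R. C * (if k < 2 ^ fst B then K B / 2 ^ (fst B * (DIM('a) - 1)) else 0))"
   by (intro sum.cong) (auto simp: R_def)
  also have "... <= C * (\<Sum>B\<in>S. if k < 2 ^ fst B then K B / 2 ^ (fst B * (DIM('a) - 1)) else 0)"
   unfolding sum_distrib_left using R(1) D(1) C0 K by (intro sum_mono2 mult_nonneg_nonneg) auto
  finally show "epow (best_approx k \<tau> f) (enn2real \<tau>) <= ennreal (C * (\<Sum>B\<in>S. if k < 2 ^ fst B then
    cap_coeff y a B powr enn2real \<tau> / 2 ^ (fst B * (DIM('a) - 1)) * (2 ^ fst B / (real k + 1)) powr \<epsilon> else 0))"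
   by (simp add: T_def b_def K_def ennreal_leI cong: if_cong)
 qed
qed

text \<open>Summation of the preceding estimate over \<open>k\<close>. The term \<open>norm (f (\<lambda>_. 1))\<close> of the Besov norm is the coefficient of the
 single cap of level \<open>0\<close>, which is the whole sphere, because the frame elements of higher levels have mean \<open>0\<close>.\<close>

lemma Besov_norm_frame_sum_le:
 fixes c C0 \<alpha> :: real and p \<tau> :: ennreal
 assumes d: "DIM('a::euclidean_space) >= 3" and \<phi>: "cutoff \<phi>" and c: "c > 0" and \<alpha>: "\<alpha> > 0" and p: "p > 0"
  and \<tau>: "\<tau> = inverse (inverse p + ennreal (\<alpha> / (real DIM('a) - 1)))"
 obtains C where "C > 0" "!!(y :: nat => nat => 'a) w S (a :: nat \<times> nat => 'b::{real_normed_field,euclidean_space}) f.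
  cap_family c C0 y w S ==> distr_eq f (distr_of (%x. \<Sum>B\<in>S. a B * frame_elem \<phi> y w B x)) ==>
  Besov_norm \<alpha> \<tau> \<tau> f <= ennreal (C * real (card S) powr (\<alpha> / (real DIM('a) - 1))) * Lp_norm p (cap_sup y S (cap_coeff y a))"
proof -
 have cpos: "\<alpha> / (real DIM('a) - 1) > 0" using d \<alpha> by simp
 note ce = critical_exponent[OF p cpos \<tau>]
 define T where "T = enn2real \<tau>"
 have T: "T > 0" "1 / T = enn2real (inverse p) + \<alpha> / (real DIM('a) - 1)" using ce by (auto simp: T_def)
 have aT: "\<alpha> * T > 0" using \<alpha> T(1) by simp
 \<comment> \<open>The sum over \<open>k\<close> of \<open>(k + 1) powr (\<alpha> * T - 1 - \<epsilon>)\<close> up to the degree of a frame element behaves like an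
  integral for \<open>\<epsilon> = \<alpha> * T - \<beta>\<close>; the bound \<open>\<beta> <= 1\<close> keeps the exponent \<open>\<beta> - 1\<close> nonpositive.\<close>
 define \<beta> where "\<beta> = min 1 (\<alpha> * T / 2)"
 have "\<beta> <= \<alpha> * T / 2" unfolding \<beta>_def by (rule min.cobounded2)
 hence \<beta>: "0 < \<beta>" "\<beta> <= 1" "\<alpha> * T - \<beta> > 0"
  using aT by (linarith | simp add: \<beta>_def)+
 obtain C1 where C1: "C1 > 0" "!!(y :: nat => nat => 'a) w S (a :: nat \<times> nat => 'b) f k.
  cap_family c C0 y w S ==> distr_eq f (distr_of (%x. \<Sum>B\<in>S. a B * frame_elem \<phi> y w B x)) ==>
  epow (best_approx k \<tau> f) T <= ennreal (C1 * (\<Sum>B\<in>S. if k < 2 ^ fst B then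
    cap_coeff y a B powr T / 2 ^ (fst B * (DIM('a) - 1)) * (2 ^ fst B / (real k + 1)) powr (\<alpha> * T - \<beta>) else 0))"
  by (rule best_approx_frame_sum_le[OF d \<phi> c \<beta>(3) ce(1,3), of C0, where 'b='b, folded T_def], rule that, assumption, simp)
 obtain C2 where C2: "C2 > 0" "!!C0 (y :: nat => nat => 'a) w S b. cap_family c C0 y w S ==> (!!B. 0 <= b B) ==>
  \<exists>L\<ge>0. Lp_norm p (cap_sup y S b) = ennreal L \<and>
   (\<Sum>B\<in>S. b B powr T * (2 ^ fst B) powr (\<alpha> * T) / 2 ^ (fst B * (DIM('a) - 1)))
    <= C2 * real (card S) powr (\<alpha> * T / (real DIM('a) - 1)) * L powr T"
  by (rule sum_caps_le_Lp_norm[OF c d \<alpha> T(1) p T(2)], rule that, assumption, simp)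
 define C where "C = (C1 * (1 / \<beta>) * C2) powr (1 / T)"
 show ?thesis
 proof (rule that[of "C + 1"])
  show "C + 1 > 0" by (simp add: C_def add_nonneg_pos)
  fix S and y :: "nat => nat => 'a" and w and a :: "nat \<times> nat => 'b" and f :: "('a, 'b) functional"
  assume S: "cap_family c C0 y w S" and f: "distr_eq f (distr_of (%x. \<Sum>B\<in>S. a B * frame_elem \<phi> y w B x))"
  note D = cap_familyD[OF S]
  define b where "b = cap_coeff y a"
  have b0: "b B >= 0" for B by (simp add: b_def cap_coeff_nonneg)
  define V where "V = (%B. b B powr T / 2 ^ (fst B * (DIM('a) - 1)))"
  have V: "V B >= 0" for B by (simp add: V_def)
  define Q where "Q = (\<Sum>B\<in>S. b B powr T * (2 ^ fst B) powr (\<alpha> * T) / 2 ^ (fst B * (DIM('a) - 1)))"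
  have Q0: "Q >= 0" unfolding Q_def by (intro sum_nonneg) auto
  define k' where "k' = (%k. (real k + 1) powr (\<alpha> * T - 1))"
  have part: "(\<Sum>k<n. ennreal (k' k) * epow (best_approx k \<tau> f) T) <= ennreal (C1 * (1 / \<beta>) * Q)" for n
  proof -
   define F where "F = (%k B. if k < 2 ^ fst B then V B * (real (2 ^ fst B) / (real k + 1)) powr (\<alpha> * T - \<beta>) else 0)"
   have h: "epow (best_approx k \<tau> f) T <= ennreal (C1 * (\<Sum>B\<in>S. F k B))" for k
    using C1(2)[OF S f, of k] by (simp add: F_def V_def b_def cong: if_cong)
   have F: "F k B >= 0" for k B using V by (auto simp: F_def)
   have "(\<Sum>k<n. ennreal (k' k) * epow (best_approx k \<tau> f) T) <= (\<Sum>k<n. ennreal (k' k) * ennreal (C1 * (\<Sum>B\<in>S. F k B)))"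
    by (intro sum_mono mult_left_mono h) simp
   also have "... = (\<Sum>k<n. ennreal (C1 * (\<Sum>B\<in>S. k' k * F k B)))"
    using C1(1) F by (intro sum.cong) (auto simp: k'_def sum_nonneg sum_distrib_left sum_distrib_right mult_ac simp flip: ennreal_mult)
   also have "... = ennreal (\<Sum>k<n. C1 * (\<Sum>B\<in>S. k' k * F k B))"
    using C1(1) F by (intro sum_ennreal mult_nonneg_nonneg sum_nonneg) (auto simp: k'_def)
   also have "(\<Sum>k<n. C1 * (\<Sum>B\<in>S. k' k * F k B)) = C1 * (\<Sum>B\<in>S. \<Sum>k<n. k' k * F k B)"
    by (subst sum.swap) (simp add: sum_distrib_left)
   also have "... <= C1 * (\<Sum>B\<in>S. V B * (1 / \<beta>) * real (2 ^ fst B) powr (\<alpha> * T))"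
    unfolding F_def k'_def using C1(1) \<beta> by (intro mult_left_mono sum_mono sum_levels_Besov_le V) auto
   also have "... = C1 * (1 / \<beta>) * Q"
    by (simp add: Q_def V_def sum_distrib_left mult_ac)
   finally show ?thesis by (simp add: ennreal_leI)
  qed
  have "(\<Sum>k. ennreal (k' k) * epow (best_approx k \<tau> f) T) <= ennreal (C1 * (1 / \<beta>) * Q)"
   unfolding suminf_eq_SUP by (rule SUP_least) (rule part)
  hence "epow (\<Sum>k. ennreal (k' k) * epow (best_approx k \<tau> f) T) (1 / T) <= epow (ennreal (C1 * (1 / \<beta>) * Q)) (1 / T)"
   using T(1) by (intro epow_mono) auto
  also have "... = ennreal ((C1 * (1 / \<beta>) * Q) powr (1 / T))"
   using C1(1) \<beta>(1) Q0 by (intro epow_ennreal) auto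
  finally have B: "Besov_norm \<alpha> \<tau> \<tau> f <= ennreal ((C1 * (1 / \<beta>) * Q) powr (1 / T)) + ennreal (norm (f (%_. 1)))"
   using ce(1) by (simp add: Besov_norm_def k'_def add_mono flip: T_def)
  have "\<exists>L\<ge>0. Lp_norm p (cap_sup y S b) = ennreal L \<and> Q <= C2 * real (card S) powr (\<alpha> * T / (real DIM('a) - 1)) * L powr T"
   unfolding Q_def by (rule C2(2)[OF S]) (rule b0)
  then obtain L where L: "L >= 0" "Lp_norm p (cap_sup y S b) = ennreal L"
   "Q <= C2 * real (card S) powr (\<alpha> * T / (real DIM('a) - 1)) * L powr T" by (elim exE conjE)
  define n where "n = real (card S) powr (\<alpha> / (real DIM('a) - 1))"
  have "(C1 * (1 / \<beta>) * Q) powr (1 / T) <= (C1 * (1 / \<beta>) * (C2 * real (card S) powr (\<alpha> * T / (real DIM('a) - 1)) * L powr T)) powr (1 / T)"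
   using C1(1) \<beta>(1) Q0 T(1) L(3) by (intro powr_mono2 mult_left_mono) auto
  also have "... = ((C1 * (1 / \<beta>) * C2) * (n * L) powr T) powr (1 / T)"
   by (simp add: n_def powr_powr powr_mult mult_ac)
  also have "... = C * (n * L)"
   unfolding C_def powr_mult[of _ "(n * L) powr T"] using L(1) T(1) by (simp add: n_def powr_powr)
  finally have 1: "(C1 * (1 / \<beta>) * Q) powr (1 / T) <= C * (n * L)" .
  have 2: "norm (f (%_. 1)) <= n * L"
  proof -
   have int1: "integrable \<sigma> (%u. cap_kernel \<phi> y B u * 1)" if "B \<in> S" for B
    unfolding mult_1_right by (rule integral_frame_kernel(1)[OF d \<phi> D(2)[OF that]])
   have "f (%_. 1) = distr_of (%x. \<Sum>B\<in>S. a B * frame_elem \<phi> y w B x) (%_. of_real 1)"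
    using bspec[OF f[unfolded distr_eq_def] one_test_fun] by (simp only: of_real_1)
   also have "... = (\<Sum>B\<in>S. a B * of_real (sqrt (entry w B) * (\<integral>u. cap_kernel \<phi> y B u * 1 \<partial>\<sigma>)))"
    by (rule distr_of_frame_sum[where h="%_. 1", OF int1])
   also have "... = (\<Sum>B\<in>S. if B = (0, 0) then a B else 0)"
   proof (intro sum.cong refl)
    fix B assume B: "B \<in> S"
    show "a B * of_real (sqrt (entry w B) * (\<integral>u. cap_kernel \<phi> y B u * 1 \<partial>\<sigma>)) = (if B = (0, 0) then a B else 0)"
    proof (cases "fst B = 0")
     case True
     thus ?thesis using D(5)[OF B True] integral_frame_kernel(2)[OF d \<phi> D(2)[OF B], of 0] by auto
    next
     case False
     hence "B ~= (0, 0)" by auto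
     thus ?thesis using False integral_frame_kernel(2)[OF d \<phi> D(2)[OF B], of "fst B"] by simp
    qed
   qed
   also have "... = (if (0, 0) \<in> S then a (0, 0) else 0)" using D(1) by simp
   finally have f1: "f (%_. 1) = (if (0, 0) \<in> S then a (0, 0) else 0)" .
   show ?thesis
   proof (cases "(0, 0) \<in> S")
    case True
    have "geod_dist (y 0 0) z <= pi" if "z \<in> sphere 0 1" for z
     using abs_inner_sphere_le[of "y 0 0" z] D(2)[OF True] that unfolding geod_dist_def
     by (intro arccos_ubound) (auto simp: abs_le_iff entry_def)
    hence cap0: "cap_of y (0, 0) = sphere 0 1" by (auto simp: cap_of_def cap_def)
    have "ennreal (b (0, 0)) <= Lp_norm p (cap_sup y S b)"
    proof (rule Lp_norm_ge_const[OF p b0])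
     fix x :: 'a assume "x \<in> sphere 0 1"
     hence "ennreal (b (0, 0)) = ennreal (b (0, 0)) * indicator (cap_of y (0, 0)) x" by (simp add: cap0)
     also have "... <= cap_sup y S b x" unfolding cap_sup_def by (rule SUP_upper[OF True])
     finally show "ennreal (b (0, 0)) <= cap_sup y S b x" .
    qed
    hence "norm (a (0, 0)) <= L" using L(1,2) by (simp add: b_def cap_coeff_def cap0)
    have "card S > 0" using D(1) True by (auto simp: card_gt_0_iff)
    hence "n >= 1" unfolding n_def using cpos by (intro ge_one_powr_ge_zero) auto
    hence "L <= n * L" using L(1) by (simp add: mult_le_cancel_right1)
    moreover note \<open>norm (a (0, 0)) <= L\<close>
    ultimately show ?thesis by (simp add: f1 True)
   qed (use L(1) in \<open>simp add: f1 n_def\<close>)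
  qed
  have "Besov_norm \<alpha> \<tau> \<tau> f <= ennreal (C * (n * L)) + ennreal (n * L)"
   using B 1 2 by (meson add_mono ennreal_leI order_trans)
  also have "... = ennreal ((C + 1) * n * L)"
   using L(1) by (simp add: C_def n_def algebra_simps flip: ennreal_plus)
  also have "... = ennreal ((C + 1) * n) * ennreal L"
   using L(1) by (intro ennreal_mult) (auto simp: C_def n_def add_nonneg_nonneg)
  finally show "Besov_norm \<alpha> \<tau> \<tau> f <= ennreal ((C + 1) * real (card S) powr (\<alpha> / (real DIM('a) - 1))) * Lp_norm p (cap_sup y S (cap_coeff y a))"
   using L(2) by (simp add: n_def b_def)
 qed
qed

section \<open>A maximal inequality on the sphere\<close>

abbreviation cap_integral :: "('a::euclidean_space => ennreal) => 'a => real => ennreal" where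
 "cap_integral h x r \<equiv> \<integral>\<^sup>+y. h y * indicator (cball x r) y \<partial>\<sigma>"

text \<open>The power \<open>DIM('a) - 1\<close> of the radius stands for the measure of a cap, up to constants.\<close>

definition maxfun :: "('a::euclidean_space => ennreal) => 'a => ennreal" where
 "maxfun h x = (SUP r\<in>{0<..}. cap_integral h x r / ennreal (r ^ (DIM('a) - 1)))"

lemma integral_cball_le_maxfun:
 fixes x :: "'a::euclidean_space"
 assumes "r > 0"
 shows "cap_integral h x r <= maxfun h x * ennreal (r ^ (DIM('a) - 1))"
proof -
 have p: "ennreal (r ^ (DIM('a) - 1)) / ennreal (r ^ (DIM('a) - 1)) = 1"
  using assms by (intro ennreal_divide_self) (auto simp: ennreal_eq_0_iff not_le)
 have "cap_integral h x r / ennreal (r ^ (DIM('a) - 1)) <= maxfun h x"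
  unfolding maxfun_def using assms by (intro SUP_upper) auto
 hence "cap_integral h x r / ennreal (r ^ (DIM('a) - 1)) * ennreal (r ^ (DIM('a) - 1)) <= maxfun h x * ennreal (r ^ (DIM('a) - 1))"
  by (rule mult_right_mono) simp
 thus ?thesis unfolding ennreal_divide_times p by simp
qed

text \<open>By Vitali's covering lemma \<open>E\<close> is covered by the fivefold enlargements of disjoint balls \<open>cball x r\<close> with the given
 property, and an enlarged cap has measure at most \<open>2 ^ d * (5 * r) ^ (d - 1)\<close>.\<close>

lemma covering_estimate:
 fixes g :: "'a::euclidean_space => ennreal"
 assumes g [measurable]: "g \<in> borel_measurable \<sigma>" and E: "E \<in> sets \<sigma>" and s: "s > 0"
  and cov: "!!x. x \<in> E ==> \<exists>r>0. ennreal (s * r ^ (DIM('a) - 1)) <= cap_integral g x r"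
 shows "ennreal s * emeasure \<sigma> E <= ennreal (2 ^ DIM('a) * 5 ^ (DIM('a) - 1)) * (\<integral>\<^sup>+y. g y \<partial>\<sigma>)"
proof -
 define K :: real where "K = 2 ^ DIM('a) * 5 ^ (DIM('a) - 1)"
 have Es: "E \<subseteq> sphere 0 1" using sets.sets_into_space[OF E] by simp
 have "\<forall>x\<in>E. \<exists>r. 0 < r \<and> r <= 2 \<and> ennreal (s * r ^ (DIM('a) - 1)) <= cap_integral g x r"
 proof
  fix x assume x: "x \<in> E"
  obtain r where r: "r > 0" "ennreal (s * r ^ (DIM('a) - 1)) <= cap_integral g x r"
   using cov[OF x] by blast
  have "cap_integral g x r <= cap_integral g x (min r 2)"
  proof (rule nn_integral_mono)
   fix y :: 'a assume "y \<in> space \<sigma>"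
   hence "dist x y <= 2" using x Es norm_triangle_ineq4[of x y] by (auto simp: dist_norm)
   thus "g y * indicator (cball x r) y <= g y * indicator (cball x (min r 2)) y"
    by (auto simp: indicator_def)
  qed
  moreover have "ennreal (s * (min r 2) ^ (DIM('a) - 1)) <= ennreal (s * r ^ (DIM('a) - 1))"
   using r(1) s by (intro ennreal_leI mult_left_mono power_mono) auto
  ultimately show "\<exists>r. 0 < r \<and> r <= 2 \<and> ennreal (s * r ^ (DIM('a) - 1)) <= cap_integral g x r"
   using r by (intro exI[of _ "min r 2"]) auto
 qed
 from bchoice[OF this] obtain r where r: "\<forall>x\<in>E. 0 < r x \<and> r x <= 2 \<and> ennreal (s * r x ^ (DIM('a) - 1)) <= cap_integral g x (r x)"
  by (elim exE)
 have r2: "0 < r x \<and> r x <= 2" if "x \<in> E" for x using bspec[OF r that] by simp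
 have "E \<subseteq> (\<Union>i\<in>E. cball i (r i))"
 proof
  fix x assume "x \<in> E"
  thus "x \<in> (\<Union>i\<in>E. cball i (r i))" using r2[of x] by (intro UN_I[of x]) auto
 qed
 then obtain C where C: "countable C" "C \<subseteq> E" "pairwise (%i j. disjnt (cball i (r i)) (cball j (r j))) C"
  "E \<subseteq> (\<Union>i\<in>C. cball i (5 * r i))"
  by (rule Vitali_covering_lemma_cballs[of E "%x. x" r E 2]) (use r2 in auto)
 define T where "T = to_nat_on C ` C"
 define A where "A = (%n. if n \<in> T then cball (from_nat_into C n) (5 * r (from_nat_into C n)) \<inter> sphere 0 1 else {})"
 define D where "D = (%n. if n \<in> T then cball (from_nat_into C n) (r (from_nat_into C n)) \<inter> sphere 0 1 else {})"
 have T: "from_nat_into C n \<in> C \<and> to_nat_on C (from_nat_into C n) = n" if "n \<in> T" for n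
  using that C(1) by (auto simp: T_def)
 have Am: "range A \<subseteq> sets \<sigma>" by (auto simp: A_def)
 have Dm [measurable]: "D n \<in> sets \<sigma>" for n by (auto simp: D_def)
 have "E \<subseteq> (\<Union>n. A n)"
 proof
  fix x assume x: "x \<in> E"
  then obtain i where i: "i \<in> C" "x \<in> cball i (5 * r i)" using C(4) by blast
  hence "x \<in> A (to_nat_on C i)" using C(1) x Es by (auto simp: A_def T_def)
  thus "x \<in> (\<Union>n. A n)" by blast
 qed
 moreover have "(\<Union>n. A n) \<in> sets \<sigma>" using Am by blast
 ultimately have "emeasure \<sigma> E <= emeasure \<sigma> (\<Union>n. A n)" by (rule emeasure_mono)
 also have "... <= (\<Sum>n. emeasure \<sigma> (A n))" by (rule emeasure_subadditive_countably[OF Am])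
 finally have "ennreal s * emeasure \<sigma> E <= ennreal s * (\<Sum>n. emeasure \<sigma> (A n))"
  by (rule mult_left_mono) simp
 also have "... = (\<Sum>n. ennreal s * emeasure \<sigma> (A n))" by simp
 also have "... <= (\<Sum>n. ennreal K * (\<integral>\<^sup>+y. g y * indicator (D n) y \<partial>\<sigma>))"
 proof (intro suminf_le)
  fix n
  show "ennreal s * emeasure \<sigma> (A n) <= ennreal K * (\<integral>\<^sup>+y. g y * indicator (D n) y \<partial>\<sigma>)"
  proof (cases "n \<in> T")
   case True
   define i where "i = from_nat_into C n"
   have i: "i \<in> E" "norm i = 1" using T[OF True] C(2) Es by (auto simp: i_def)
   note ri = bspec[OF r i(1)]
   have "ennreal s * emeasure \<sigma> (A n) <= ennreal s * ennreal (2 ^ DIM('a) * (5 * r i) ^ (DIM('a) - 1))"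
    using True measure_sphere_cball_le[OF i(2), of "5 * r i"] ri
    by (intro mult_left_mono) (auto simp: A_def i_def sphere_measure.emeasure_eq_measure intro!: ennreal_leI)
   also have "... = ennreal K * ennreal (s * r i ^ (DIM('a) - 1))"
    using s ri by (simp add: K_def power_mult_distrib mult_ac flip: ennreal_mult)
   also have "... <= ennreal K * cap_integral g i (r i)"
    using ri by (intro mult_left_mono) auto
   also have "cap_integral g i (r i) = (\<integral>\<^sup>+y. g y * indicator (D n) y \<partial>\<sigma>)"
    using True by (intro nn_integral_cong) (auto simp: D_def i_def indicator_def)
   finally show ?thesis .
  qed (simp add: A_def)
 qed auto
 also have "... = ennreal K * (\<Sum>n. \<integral>\<^sup>+y. g y * indicator (D n) y \<partial>\<sigma>)" by simp
 also have "(\<Sum>n. \<integral>\<^sup>+y. g y * indicator (D n) y \<partial>\<sigma>) = (\<integral>\<^sup>+y. (\<Sum>n. g y * indicator (D n) y) \<partial>\<sigma>)"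
  by (rule nn_integral_suminf[symmetric]) measurable
 also have "... <= (\<integral>\<^sup>+y. g y \<partial>\<sigma>)"
 proof (rule nn_integral_mono)
  fix y :: 'a
  have "disjoint_family D" unfolding disjoint_family_on_def
  proof (intro ballI impI)
   fix n m :: nat assume nm: "n ~= m"
   show "D n \<inter> D m = {}"
   proof (cases "n \<in> T \<and> m \<in> T")
    case True
    hence "from_nat_into C n ~= from_nat_into C m" using T nm by metis
    thus ?thesis using C(3) T True unfolding pairwise_def disjnt_def D_def by auto
   qed (auto simp: D_def)
  qed
  from suminf_indicator[OF this, of y] have "(\<Sum>n. g y * indicator (D n) y) = g y * indicator (\<Union>n. D n) y" by simp
  also have "... <= g y * 1" by (intro mult_left_mono) (auto simp: indicator_def)
  finally show "(\<Sum>n. g y * indicator (D n) y) <= g y" by simp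
 qed
 finally show ?thesis by (simp add: K_def mult_left_mono)
qed

text \<open>Marcinkiewicz's argument. In the estimate of \<open>{v \<ge> t}\<close> the function \<open>h\<close> may be replaced by its part \<open>G t\<close> above the
 height \<open>t / L\<close>: by the choice of \<open>L\<close> the rest contributes at most \<open>t / 4 * r ^ (d - 1)\<close> to an integral that exceeds
 \<open>t / 2 * r ^ (d - 1)\<close>. Integration over the levels \<open>t\<close> then gives the squares.\<close>

lemma maximal_inequality:
 obtains C where "C > 0" "!!(h :: 'a::euclidean_space => ennreal) v. h \<in> borel_measurable \<sigma> ==> v \<in> borel_measurable \<sigma> ==>
  (!!x. 0 <= v x) ==> (!!x. x \<in> sphere 0 1 ==> ennreal (v x) <= maxfun h x) ==>
  (\<integral>\<^sup>+x. ennreal ((v x)\<^sup>2) \<partial>\<sigma>) <= ennreal C * (\<integral>\<^sup>+x. h x * h x \<partial>\<sigma>)"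
proof -
 define K :: real where "K = 2 ^ DIM('a) * 5 ^ (DIM('a) - 1)"
 \<comment> \<open>the measure of a cap is at most \<open>L / 4 * r ^ (d - 1)\<close>\<close>
 define L :: real where "L = 2 ^ (DIM('a) + 2)"
 have K: "K > 0" and L: "L > 0" by (auto simp: K_def L_def)
 show ?thesis
 proof (rule that[of "8 * K * L"])
  show "8 * K * L > 0" using K L by simp
  fix h :: "'a => ennreal" and v :: "'a => real"
  assume [measurable]: "h \<in> borel_measurable \<sigma>" "v \<in> borel_measurable \<sigma>"
   and v0: "!!x. 0 <= v x" and v: "!!x. x \<in> sphere 0 1 ==> ennreal (v x) <= maxfun h x"
  define G where "G = (%t x. if 0 < t \<and> ennreal (t / L) < h x then h x else 0)"
  let ?E = "%t. {x \<in> space sphere_measure. t <= v x}"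
  have level: "ennreal (2 * t) * emeasure \<sigma> (?E t) <= ennreal (8 * K) * (\<integral>\<^sup>+x. G t x \<partial>\<sigma>)"
   if t: "t > 0" for t
  proof -
   have "ennreal (t / 4) * emeasure \<sigma> (?E t) <= ennreal K * (\<integral>\<^sup>+x. G t x \<partial>\<sigma>)"
    unfolding K_def
   proof (rule covering_estimate)
    show "G t \<in> borel_measurable \<sigma>" unfolding G_def by measurable
    show "(?E t) \<in> sets \<sigma>" by measurable
    fix x :: 'a assume "x \<in> (?E t)"
    hence x: "norm x = 1" "t <= v x" by auto
    have "ennreal (t / 2) < ennreal (v x)" using x(2) t by (simp add: ennreal_less_iff)
    also have "... <= maxfun h x" using v x(1) by simp
    finally obtain r where r: "r > 0" "ennreal (t / 2) < cap_integral h x r / ennreal (r ^ (DIM('a) - 1))"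
     unfolding maxfun_def less_SUP_iff by auto
    have le: "ennreal (t / 2) * ennreal (r ^ (DIM('a) - 1)) <= cap_integral h x r"
    proof (rule ccontr)
     assume "\<not> ?thesis"
     hence "cap_integral h x r / ennreal (r ^ (DIM('a) - 1)) <= ennreal (t / 2)"
      using r(1) by (intro divide_le_posI_ennreal) (auto simp: not_le mult.commute)
     thus False using r(2) by simp
    qed
    also have "... <= (\<integral>\<^sup>+y. G t y * indicator (cball x r) y + ennreal (t / L) * indicator (cball x r \<inter> sphere 0 1) y \<partial>\<sigma>)"
     using t by (intro nn_integral_mono) (auto simp: G_def indicator_def not_less)
    also have "... = cap_integral (G t) x r + ennreal (t / L) * emeasure \<sigma> (cball x r \<inter> sphere 0 1)"
    proof (subst nn_integral_add)
     have "(%y. indicator (cball x r) y :: ennreal) \<in> borel_measurable \<sigma>"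
      by (rule borel_measurable_sphere_measure) (auto intro!: borel_measurable_indicator)
     thus "(%y. G t y * indicator (cball x r) y) \<in> borel_measurable \<sigma>" unfolding G_def by measurable
    qed (auto simp: nn_integral_cmult_indicator)
    also have "... <= cap_integral (G t) x r + ennreal (t / L) * ennreal (2 ^ DIM('a) * r ^ (DIM('a) - 1))"
     using measure_sphere_cball_le[OF x(1) r(1)]
     by (intro add_left_mono mult_left_mono) (auto simp: sphere_measure.emeasure_eq_measure intro!: ennreal_leI)
    also have "ennreal (t / L) * ennreal (2 ^ DIM('a) * r ^ (DIM('a) - 1)) = ennreal (t / 4 * r ^ (DIM('a) - 1))"
     using t r(1) L by (simp add: L_def power_add flip: ennreal_mult)
    finally have *: "ennreal (t / 2 * r ^ (DIM('a) - 1)) <= cap_integral (G t) x r + ennreal (t / 4 * r ^ (DIM('a) - 1))"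
     using t r(1) by (simp flip: ennreal_mult)
    have "ennreal (t / 4 * r ^ (DIM('a) - 1)) <= cap_integral (G t) x r"
    proof (cases "cap_integral (G t) x r")
     case (real z)
     have "t / 2 * r ^ (DIM('a) - 1) <= z + t / 4 * r ^ (DIM('a) - 1)"
      using * real t r(1) by (simp flip: ennreal_plus)
     thus ?thesis using real by (simp add: ennreal_leI)
    qed simp
    thus "\<exists>r>0. ennreal (t / 4 * r ^ (DIM('a) - 1)) <= cap_integral (G t) x r"
     using r(1) by blast
   qed (use t in simp)
   hence "ennreal 8 * (ennreal (t / 4) * emeasure \<sigma> (?E t)) <= ennreal 8 * (ennreal K * (\<integral>\<^sup>+x. G t x \<partial>\<sigma>))"
    by (rule mult_left_mono) simp
   moreover have "ennreal (2 * t) = ennreal 8 * ennreal (t / 4)" using t by (subst ennreal_mult[symmetric]) auto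
   moreover have "ennreal (8 * K) = ennreal 8 * ennreal K" using K by (intro ennreal_mult) auto
   ultimately show ?thesis by (simp only: mult.assoc)
  qed
  interpret pair_sigma_finite "\<sigma> :: 'a measure" "lborel :: real measure" ..
  have sq: "ennreal ((v x)\<^sup>2) = (\<integral>\<^sup>+t. ennreal (2 * t) * indicator {t. 0 < t \<and> t <= v x} t \<partial>lborel)" for x
  proof -
   have "(\<integral>\<^sup>+t. ennreal (2 * t) * indicator {0..v x} t \<partial>lborel) = ennreal ((v x)\<^sup>2 - 0\<^sup>2)"
    by (rule nn_integral_FTC_Icc) (auto intro!: derivative_eq_intros v0)
   also have "(\<integral>\<^sup>+t. ennreal (2 * t) * indicator {0..v x} t \<partial>lborel) = (\<integral>\<^sup>+t. ennreal (2 * t) * indicator {t. 0 < t \<and> t <= v x} t \<partial>lborel)"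
    by (intro nn_integral_cong) (auto simp: indicator_def)
   finally show ?thesis by simp
  qed
  have "(\<integral>\<^sup>+x. ennreal ((v x)\<^sup>2) \<partial>\<sigma>) = (\<integral>\<^sup>+x. (\<integral>\<^sup>+t. ennreal (2 * t) * indicator {t. 0 < t \<and> t <= v x} t \<partial>lborel) \<partial>\<sigma>)"
   unfolding sq ..
  also have "... = (\<integral>\<^sup>+t. (\<integral>\<^sup>+x. ennreal (2 * t) * indicator {t. 0 < t \<and> t <= v x} t \<partial>\<sigma>) \<partial>lborel)"
   by (rule Fubini'[symmetric]) measurable
  also have "... <= (\<integral>\<^sup>+t. ennreal (8 * K) * (\<integral>\<^sup>+x. G t x \<partial>\<sigma>) \<partial>lborel)"
  proof (rule nn_integral_mono)
   fix t :: real
   show "(\<integral>\<^sup>+x. ennreal (2 * t) * indicator {t. 0 < t \<and> t <= v x} t \<partial>\<sigma>) <= ennreal (8 * K) * (\<integral>\<^sup>+x. G t x \<partial>\<sigma>)"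
   proof (cases "t > 0")
    case True
    have "(\<integral>\<^sup>+x. ennreal (2 * t) * indicator {t. 0 < t \<and> t <= v x} t \<partial>\<sigma>) = (\<integral>\<^sup>+x. ennreal (2 * t) * indicator (?E t) x \<partial>\<sigma>)"
     using True by (intro nn_integral_cong) (auto simp: indicator_def)
    also have "... = ennreal (2 * t) * emeasure \<sigma> (?E t)"
     by (intro nn_integral_cmult_indicator) measurable
    finally show ?thesis using level[OF True] by simp
   qed simp
  qed
  also have "... = ennreal (8 * K) * (\<integral>\<^sup>+t. (\<integral>\<^sup>+x. G t x \<partial>\<sigma>) \<partial>lborel)"
   unfolding G_def by (intro nn_integral_cmult) measurable
  also have "(\<integral>\<^sup>+t. (\<integral>\<^sup>+x. G t x \<partial>\<sigma>) \<partial>lborel) = (\<integral>\<^sup>+x. (\<integral>\<^sup>+t. G t x \<partial>lborel) \<partial>\<sigma>)"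
   unfolding G_def by (rule Fubini') measurable
  also have "... <= (\<integral>\<^sup>+x. ennreal L * (h x * h x) \<partial>\<sigma>)"
  proof (rule nn_integral_mono)
   fix x :: 'a
   show "(\<integral>\<^sup>+t. G t x \<partial>lborel) <= ennreal L * (h x * h x)"
   proof (cases "h x")
    case (real z)
    have "(\<integral>\<^sup>+t. G t x \<partial>lborel) <= (\<integral>\<^sup>+t. h x * indicator {0..L * z} t \<partial>lborel)"
    proof (rule nn_integral_mono)
     fix t
     have "t <= L * z" if "0 < t" "ennreal (t / L) < h x"
      using that real L by (auto simp: ennreal_less_iff field_simps)
     thus "G t x <= h x * indicator {0..L * z} t" by (auto simp: G_def indicator_def)
    qed
    also have "... = h x * ennreal (L * z)" using L real by (simp add: nn_integral_cmult_indicator)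
    finally show ?thesis using real L by (simp add: ennreal_mult mult_ac)
   next
    case top
    thus ?thesis using L by (simp add: ennreal_mult_top ennreal_top_mult)
   qed
  qed
  also have "... = ennreal L * (\<integral>\<^sup>+x. h x * h x \<partial>\<sigma>)"
   by (intro nn_integral_cmult) measurable
  finally show "(\<integral>\<^sup>+x. ennreal ((v x)\<^sup>2) \<partial>\<sigma>) <= ennreal (8 * K * L) * (\<integral>\<^sup>+x. h x * h x \<partial>\<sigma>)"
   using K L by (simp add: ennreal_mult mult.assoc mult_left_mono)
 qed
qed

section \<open>Powers of subharmonic functions\<close>

lemma nn_integral_unif_ball_rescale:
 fixes h :: "'a::euclidean_space => ennreal"
 assumes [measurable]: "h \<in> borel_measurable borel" and s: "s > 0" and sub: "ball c s \<subseteq> ball 0 1"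
 shows "(\<integral>\<^sup>+v. h (c + s *\<^sub>R v) \<partial>unif_ball) = ennreal (1 / s ^ DIM('a)) * (\<integral>\<^sup>+w. h w * indicator (ball c s) w \<partial>unif_ball)"
proof -
 let ?I = "\<integral>\<^sup>+v. h (c + s *\<^sub>R v) * indicator (ball 0 1) v \<partial>lborel"
 define V where "V = emeasure lborel (ball (0::'a) 1)"
 define g where "g = (%w. h w * indicator (ball c s) w)"
 have [measurable]: "ball x r \<in> sets borel" "ball x r \<in> sets lborel" for x :: 'a and r by auto
 have [measurable]: "g \<in> borel_measurable borel" unfolding g_def by measurable
 have "(\<integral>\<^sup>+w. g w \<partial>lborel) = (\<integral>\<^sup>+w. g w \<partial>density (distr lborel borel (%v. c + s *\<^sub>R v)) (%_. \<bar>s\<bar> ^ DIM('a)))"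
  using lborel_affine[of s c] s by simp
 also have "... = ennreal (s ^ DIM('a)) * (\<integral>\<^sup>+v. g (c + s *\<^sub>R v) \<partial>lborel)"
  using s by (simp add: nn_integral_density nn_integral_distr nn_integral_cmult)
 also have "(\<integral>\<^sup>+v. g (c + s *\<^sub>R v) \<partial>lborel) = ?I"
  using s by (intro nn_integral_cong) (auto simp: g_def indicator_def dist_norm)
 finally have eq: "(\<integral>\<^sup>+w. g w \<partial>lborel) = ennreal (s ^ DIM('a)) * ?I" .
 have "(\<integral>\<^sup>+w. h w * indicator (ball c s) w \<partial>unif_ball) = (\<integral>\<^sup>+w. g w * indicator (ball 0 1) w \<partial>lborel) / V"
  unfolding unif_ball_def V_def g_def by (rule nn_integral_uniform_measure) measurable
 also have "(\<integral>\<^sup>+w. g w * indicator (ball 0 1) w \<partial>lborel) = (\<integral>\<^sup>+w. g w \<partial>lborel)"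
  using sub by (intro nn_integral_cong) (auto simp: g_def indicator_def)
 finally have 1: "(\<integral>\<^sup>+w. h w * indicator (ball c s) w \<partial>unif_ball) = ennreal (s ^ DIM('a)) * ?I / V"
  by (simp only: eq)
 have 2: "(\<integral>\<^sup>+v. h (c + s *\<^sub>R v) \<partial>unif_ball) = ?I / V"
  unfolding unif_ball_def V_def by (rule nn_integral_uniform_measure) measurable
 have "ennreal (1 / s ^ DIM('a)) * (\<integral>\<^sup>+w. h w * indicator (ball c s) w \<partial>unif_ball) = (ennreal (1 / s ^ DIM('a)) * ennreal (s ^ DIM('a))) * (\<integral>\<^sup>+v. h (c + s *\<^sub>R v) \<partial>unif_ball)"
  unfolding 1 2 by (simp add: ennreal_times_divide mult.assoc)
 also have "ennreal (1 / s ^ DIM('a)) * ennreal (s ^ DIM('a)) = 1"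
  using s by (simp flip: ennreal_mult)
 finally show ?thesis by simp
qed

text \<open>This is an argument of Fefferman and Stein: the supremum \<open>S\<close> over the ball of \<open>U\<close>, weighted by the power \<open>d / q\<close> of
 the distance to the boundary, is at most \<open>S powr (1 - q)\<close> times the average of \<open>U powr q\<close>. The exponent \<open>d / q\<close> makes
 the powers of the distance to the boundary cancel.\<close>

lemma power_sub_mean_value_small:
 fixes U :: "'a::euclidean_space => real"
 assumes q: "0 < q" "q <= 1" and K: "K > 0"
  and [measurable]: "U \<in> borel_measurable borel" and cont: "continuous_on (ball 0 1) U" and U: "!!z. 0 <= U z"
  and sub: "!!z \<rho>. \<rho> > 0 ==> norm z + \<rho> < 1 ==> ennreal (U z) <= ennreal K * (\<integral>\<^sup>+w. ennreal (U (z + \<rho> *\<^sub>R w)) \<partial>unif_ball)"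
  and \<rho>: "\<rho> > 0" "norm z + \<rho> < 1"
 shows "ennreal (U z powr q) <= ennreal (K * 2 powr (real DIM('a) / q)) * (\<integral>\<^sup>+w. ennreal (U (z + \<rho> *\<^sub>R w) powr q) \<partial>unif_ball)"
proof -
 let ?J = "\<integral>\<^sup>+w. ennreal (U (z + \<rho> *\<^sub>R w) powr q) \<partial>unif_ball"
 define e where "e = real DIM('a) / q"
 have e: "e > 0" using q by (simp add: e_def)
 have cb: "cball z \<rho> \<subseteq> ball 0 1"
 proof
  fix w assume "w \<in> cball z \<rho>"
  thus "w \<in> ball 0 1" using \<rho>(2) norm_triangle_sub[of w z] by (simp add: dist_norm norm_minus_commute)
 qed
 have "compact (U ` cball z \<rho>)" by (intro compact_continuous_image continuous_on_subset[OF cont cb] compact_cball)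
 then obtain B where B: "!!w. w \<in> cball z \<rho> ==> \<bar>U w\<bar> <= B"
  using compact_imp_bounded bounded_real by (metis imageI)
 have B0: "B >= 0" using B[of z] \<rho> by auto
 have in_cb: "z + \<rho> *\<^sub>R w \<in> cball z \<rho>" if "norm w <= 1" for w using \<rho>(1) that by (simp add: dist_norm)
 define F where "F = (%w. (1 - norm w) powr e * U (z + \<rho> *\<^sub>R w))"
 have FB: "F w <= B" if "w \<in> ball 0 1" for w
 proof -
  have "(1 - norm w) powr e <= 1" using that e by (intro powr_le1) auto
  hence "F w <= 1 * B" unfolding F_def using B[OF in_cb[of w]] that U[of "z + \<rho> *\<^sub>R w"] by (intro mult_mono) auto
  thus ?thesis by simp
 qed
 define S where "S = (SUP w\<in>ball 0 1. F w)"
 have bdd: "bdd_above (F ` ball 0 1)" using FB by (intro bdd_aboveI2)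
 have FS: "F w <= S" if "w \<in> ball 0 1" for w unfolding S_def by (rule cSUP_upper[OF that bdd])
 have UzS: "U z <= S" using FS[of 0] by (simp add: F_def)
 define J where "J = enn2real ?J"
 have "?J <= (\<integral>\<^sup>+w. ennreal (B powr q) \<partial>(unif_ball :: 'a measure))"
 proof (rule nn_integral_mono_AE, rule AE_mp[OF AE_unif_ball_less_1], intro AE_I2 impI ennreal_leI powr_mono2)
  fix w :: 'a assume "norm w < 1"
  thus "U (z + \<rho> *\<^sub>R w) <= B" using B[OF in_cb[of w]] by simp
 qed (use U q in auto)
 also have "... = ennreal (B powr q)" using unif_ball.emeasure_space_1[where 'a='a] by simp
 finally have J: "?J = ennreal J" "J >= 0"
  unfolding J_def by (metis ennreal_enn2real ennreal_less_top le_less_trans, simp)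
 have "U z powr q <= K * 2 powr e * J"
 proof (cases "S <= 0")
  case True
  hence "U z = 0" using UzS U[of z] by simp
  thus ?thesis using K J(2) q by simp
 next
  case False
  hence S: "S > 0" by simp
  have step: "F w <= K * 2 powr e * S powr (1 - q) * J" if w: "w \<in> ball 0 1" for w
  proof -
   define c where "c = 1 - norm w"
   have c: "c > 0" using w by (simp add: c_def)
   define s where "s = c / 2"
   have s: "s > 0" using c by (simp add: s_def)
   have ws: "norm (w + s *\<^sub>R v) <= 1 - s" if "norm v < 1" for v
   proof -
    have "norm (w + s *\<^sub>R v) <= norm w + s * norm v" using norm_triangle_ineq[of w "s *\<^sub>R v"] s by simp
    also have "s * norm v <= s * 1" using s that by (intro mult_left_mono) auto
    finally show ?thesis by (simp add: s_def c_def field_simps)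
   qed
   have "norm w + s = 1 - s" by (simp add: s_def c_def field_simps)
   hence "norm (z + \<rho> *\<^sub>R w) + \<rho> * s <= norm z + \<rho> * (1 - s)"
   proof -
    have "norm (z + \<rho> *\<^sub>R w) <= norm z + \<rho> * norm w" using norm_triangle_ineq[of z "\<rho> *\<^sub>R w"] \<rho>(1) by simp
    moreover have "\<rho> * (norm w + s) = \<rho> * (1 - s)" using \<open>norm w + s = 1 - s\<close> by simp
    ultimately show ?thesis by (simp add: distrib_left)
   qed
   also have "... < 1" using \<rho> mult_pos_pos[OF \<rho>(1) s] unfolding right_diff_distrib by linarith
   finally have "ennreal (U (z + \<rho> *\<^sub>R w)) <= ennreal K * (\<integral>\<^sup>+v. ennreal (U ((z + \<rho> *\<^sub>R w) + (\<rho> * s) *\<^sub>R v)) \<partial>unif_ball)"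
    using \<rho>(1) s by (intro sub) auto
   also have "... <= ennreal K * (\<integral>\<^sup>+v. ennreal ((S * (1 / s) powr e) powr (1 - q)) * ennreal (U (z + \<rho> *\<^sub>R (w + s *\<^sub>R v)) powr q) \<partial>unif_ball)"
   proof (intro mult_left_mono nn_integral_mono_AE, rule AE_mp[OF AE_unif_ball_less_1], intro AE_I2 impI)
    fix v :: 'a assume v: "norm v < 1"
    define t where "t = U (z + \<rho> *\<^sub>R (w + s *\<^sub>R v))"
    have t0: "t >= 0" by (simp add: t_def U)
    have "norm (w + s *\<^sub>R v) < 1" using ws[OF v] s by simp
    hence "F (w + s *\<^sub>R v) <= S" by (intro FS) simp
    moreover have "s powr e * t <= F (w + s *\<^sub>R v)"
     unfolding F_def t_def[symmetric] using ws[OF v] s e t0 by (intro mult_right_mono powr_mono2) auto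
    ultimately have "s powr e * t <= S" by simp
    hence tS: "t <= S * (1 / s) powr e" using s by (simp add: powr_divide field_simps)
    have "t = t powr (1 - q) * t powr q" using t0 by (cases "t = 0") (auto simp flip: powr_add)
    also have "... <= (S * (1 / s) powr e) powr (1 - q) * t powr q"
     using tS t0 q by (intro mult_right_mono powr_mono2) auto
    finally show "ennreal (U ((z + \<rho> *\<^sub>R w) + (\<rho> * s) *\<^sub>R v)) <= ennreal ((S * (1 / s) powr e) powr (1 - q)) * ennreal (U (z + \<rho> *\<^sub>R (w + s *\<^sub>R v)) powr q)"
     by (simp add: t_def scaleR_add_right add.assoc ennreal_leI flip: ennreal_mult)
   qed simp
   also have "... = ennreal K * (ennreal ((S * (1 / s) powr e) powr (1 - q)) * (\<integral>\<^sup>+v. ennreal (U (z + \<rho> *\<^sub>R (w + s *\<^sub>R v)) powr q) \<partial>unif_ball))"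
    by (subst nn_integral_cmult) auto
   also have "(\<integral>\<^sup>+v. ennreal (U (z + \<rho> *\<^sub>R (w + s *\<^sub>R v)) powr q) \<partial>unif_ball) <= ennreal (1 / s ^ DIM('a)) * ennreal J"
   proof -
    have "ball w s \<subseteq> ball 0 1"
    proof
     fix x assume "x \<in> ball w s"
     thus "x \<in> ball 0 1" using \<open>norm w + s = 1 - s\<close> s norm_triangle_sub[of x w] by (simp add: dist_norm norm_minus_commute)
    qed
    hence "(\<integral>\<^sup>+v. ennreal (U (z + \<rho> *\<^sub>R (w + s *\<^sub>R v)) powr q) \<partial>unif_ball) = ennreal (1 / s ^ DIM('a)) * (\<integral>\<^sup>+x. ennreal (U (z + \<rho> *\<^sub>R x) powr q) * indicator (ball w s) x \<partial>unif_ball)"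
     by (intro nn_integral_unif_ball_rescale s) auto
    also have "... <= ennreal (1 / s ^ DIM('a)) * (\<integral>\<^sup>+x. ennreal (U (z + \<rho> *\<^sub>R x) powr q) \<partial>unif_ball)"
     by (intro mult_left_mono nn_integral_mono) (auto simp: indicator_def)
    finally show ?thesis by (simp only: J(1))
   qed
   finally have "ennreal (U (z + \<rho> *\<^sub>R w)) <= ennreal K * (ennreal ((S * (1 / s) powr e) powr (1 - q)) * (ennreal (1 / s ^ DIM('a)) * ennreal J))"
    by (simp add: mult_left_mono)
   also have "... = ennreal (K * ((S * (1 / s) powr e) powr (1 - q) * (1 / s ^ DIM('a) * J)))"
    using K s J(2) by (simp flip: ennreal_mult)
   finally have "U (z + \<rho> *\<^sub>R w) <= K * ((S * (1 / s) powr e) powr (1 - q) * (1 / s ^ DIM('a) * J))"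
    using K s J(2) by (subst (asm) ennreal_le_iff) auto
   hence "F w <= c powr e * (K * ((S * (1 / s) powr e) powr (1 - q) * (1 / s ^ DIM('a) * J)))"
    unfolding F_def c_def[symmetric] by (rule mult_left_mono) simp
   also have "... = K * (c powr e * ((1 / s) powr (e * (1 - q)) * (1 / s) powr real DIM('a))) * S powr (1 - q) * J"
    using s by (simp add: powr_mult powr_powr powr_realpow power_one_over mult_ac)
   also have "(1 / s) powr (e * (1 - q)) * (1 / s) powr real DIM('a) = (1 / s) powr e"
   proof -
    have "e * (1 - q) + real DIM('a) = e" using q by (simp add: e_def field_simps)
    thus ?thesis by (simp flip: powr_add)
   qed
   also have "c powr e * (1 / s) powr e = 2 powr e"
    using c by (simp add: s_def flip: powr_mult)
   finally show ?thesis .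
  qed
  have "S <= K * 2 powr e * S powr (1 - q) * J"
   unfolding S_def by (rule cSUP_least) (use step in \<open>auto simp: S_def\<close>)
  hence "S * S powr (q - 1) <= (K * 2 powr e * S powr (1 - q) * J) * S powr (q - 1)" by (rule mult_right_mono) simp
  moreover have "S * S powr (q - 1) = S powr q" using S powr_add[of S 1 "q - 1"] by simp
  moreover have "S powr (1 - q) * S powr (q - 1) = 1" using S by (simp flip: powr_add)
  hence "(K * 2 powr e * S powr (1 - q) * J) * S powr (q - 1) = K * 2 powr e * J" by (simp add: mult_ac)
  ultimately have "S powr q <= K * 2 powr e * J" by simp
  moreover have "U z powr q <= S powr q" using UzS U q by (intro powr_mono2) auto
  ultimately show ?thesis by simp
 qed
 thus ?thesis
  unfolding J(1) e_def[symmetric] using K J(2) by (simp add: ennreal_leI flip: ennreal_mult)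
qed

text \<open>Here \<open>U z\<close> is at most \<open>K\<close> times the average of \<open>U\<close>, which Hoelder's inequality compares with that of \<open>U powr q\<close>.\<close>

lemma power_sub_mean_value_large:
 fixes U :: "'a::euclidean_space => real"
 assumes q: "1 < q" and K: "K > 0"
  and [measurable]: "U \<in> borel_measurable borel" and U: "!!z. 0 <= U z"
  and sub: "ennreal (U z) <= ennreal K * (\<integral>\<^sup>+w. ennreal (U (z + \<rho> *\<^sub>R w)) \<partial>unif_ball)"
 shows "ennreal (U z powr q) <= ennreal (K powr q) * (\<integral>\<^sup>+w. ennreal (U (z + \<rho> *\<^sub>R w) powr q) \<partial>unif_ball)"
proof (cases "(\<integral>\<^sup>+w. ennreal (U (z + \<rho> *\<^sub>R w) powr q) \<partial>unif_ball)")
 case (real A)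
 have "(\<integral>\<^sup>+w. ennreal (U (z + \<rho> *\<^sub>R w)) \<partial>unif_ball) = (\<integral>\<^sup>+w. ennreal ((U (z + \<rho> *\<^sub>R w) powr q) powr (1 / q) * 1 powr (1 - 1 / q)) \<partial>unif_ball)"
  using q U by (simp add: powr_powr)
 also have "... <= ennreal (A powr (1 / q) * 1 powr (1 - 1 / q))"
  using q real unif_ball.emeasure_space_1[where 'a='a]
  by (intro nn_integral_Hoelder) (auto intro: ennreal_leI)
 finally have "ennreal (U z) <= ennreal K * ennreal (A powr (1 / q))"
  by (intro order_trans[OF sub mult_left_mono]) auto
 hence "U z <= K * A powr (1 / q)" using K by (simp flip: ennreal_mult)
 hence "U z powr q <= (K * A powr (1 / q)) powr q" using U q by (intro powr_mono2) auto
 also have "... = K powr q * A" using q real by (simp add: powr_mult powr_powr)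
 finally have "U z powr q <= K powr q * A" .
 thus ?thesis using real by (simp add: ennreal_leI flip: ennreal_mult)
next
 case top
 thus ?thesis using K by (simp add: ennreal_mult_top)
qed

section \<open>The harmonic extension of a distribution\<close>

text \<open>The absolute value of the harmonic extension, continued by \<open>0\<close> to a function on the whole space.\<close>

definition hext_norm :: "('a::euclidean_space, 'b::{real_normed_field,euclidean_space}) functional => 'a => real" where
 "hext_norm f z = (if norm z < 1 then norm (f (%y. of_real (poisson z y))) else 0)"

lemma hext_norm_nonneg: "0 <= hext_norm f z"
 by (simp add: hext_norm_def)

lemma hext_norm_le_radial_max:
 assumes "z ~= 0"
 shows "ennreal (hext_norm f z) <= radial_max f (sgn z)"
proof (cases "norm z < 1")
 case True
 have "norm z *\<^sub>R sgn z = z" using assms by (simp add: sgn_div_norm)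
 hence "hext_norm f z = norm (f (%y. of_real (poisson (norm z *\<^sub>R sgn z) y)))" using True by (simp add: hext_norm_def)
 thus ?thesis unfolding radial_max_def using True by (intro SUP_upper2[of "norm z"]) auto
qed (simp add: hext_norm_def)

lemma hext_norm_0_le_radial_max: "ennreal (hext_norm f 0) <= radial_max f x"
 unfolding radial_max_def by (intro SUP_upper2[of 0]) (auto simp: hext_norm_def)

context distribution
begin

lemma borel_measurable_component [measurable]: "component k \<in> borel_measurable borel"
 using continuous_component by (rule borel_measurable_continuous_onI)

text \<open>The expansion into components converges uniformly for \<open>norm z \<le> R\<close> and can be integrated termwise.\<close>

lemma integral_harmonic_ext:
 fixes g :: "'c => real" and h :: "'c => 'a"
 assumes M: "prob_space M" and [measurable]: "g \<in> borel_measurable M" "h \<in> borel_measurable M"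
  and g: "AE x in M. \<bar>g x\<bar> <= G" and h: "AE x in M. norm (h x) <= R" and R: "0 <= R" "R < 1"
 shows "integrable M (%x. g x *\<^sub>R (if norm (h x) < 1 then harmonic_ext (h x) else 0))"
  and "(\<integral>x. g x *\<^sub>R (if norm (h x) < 1 then harmonic_ext (h x) else 0) \<partial>M) = (\<Sum>k. \<integral>x. g x *\<^sub>R component k (h x) \<partial>M)"
proof -
 interpret prob_space M by (rule M)
 obtain C A where C: "C >= 0" "!!k z. norm (component k z) <= C * (real k + 1) ^ A * norm z ^ k"
  by (rule component_bound[OF that])
 define F where "F = (%k x. g x *\<^sub>R component k (h x))"
 have G: "G >= 0"
 proof -
  have "AE x in M. 0 <= G" using g by eventually_elim simp
  thus ?thesis by simp
 qed
 define c where "c = (%k. G * C * ((real k + 1) ^ A * R ^ k))"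
 have sc: "summable c" unfolding c_def by (intro summable_mult summable_power_mult_geometric) (use R in auto)
 have Fm [measurable]: "F k \<in> borel_measurable M" for k unfolding F_def by measurable
 have bnd: "norm (F k x) <= c k" if "\<bar>g x\<bar> <= G" "norm (h x) <= R" for k x
 proof -
  have "norm (component k (h x)) <= C * (real k + 1) ^ A * R ^ k"
   by (rule order_trans[OF C(2)]) (use C(1) that in \<open>auto intro!: mult_left_mono power_mono\<close>)
  hence "\<bar>g x\<bar> * norm (component k (h x)) <= G * (C * (real k + 1) ^ A * R ^ k)"
   using that(1) G by (intro mult_mono) auto
  thus ?thesis by (simp add: F_def c_def mult_ac)
 qed
 have Fc: "AE x in M. norm (F k x) <= c k" for k using g h by eventually_elim (rule bnd)
 have Fi: "integrable M (F k)" for k by (rule integrable_const_bound[OF Fc Fm])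
 have sm: "AE x in M. summable (%k. norm (F k x))"
  using g h
 proof eventually_elim
  case (elim x)
  show ?case by (rule summable_comparison_test[OF _ sc]) (use bnd[OF elim] in auto)
 qed
 have sn: "summable (%k. \<integral>x. norm (F k x) \<partial>M)"
 proof (rule summable_comparison_test[OF _ sc], intro exI[of _ 0] allI impI)
  fix k
  have "(\<integral>x. norm (F k x) \<partial>M) <= (\<integral>x. c k \<partial>M)"
   using Fc[of k] Fi[of k] by (intro integral_mono_AE) auto
  thus "norm (\<integral>x. norm (F k x) \<partial>M) <= c k" by (simp add: prob_space)
 qed
 have eq: "AE x in M. g x *\<^sub>R (if norm (h x) < 1 then harmonic_ext (h x) else 0) = (\<Sum>k. F k x)"
  using h
 proof eventually_elim
  case (elim x)
  hence "norm (h x) < 1" using R by simp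
  from harmonic_ext_sums[OF this] have "(%k. F k x) sums (g x *\<^sub>R harmonic_ext (h x))"
   unfolding F_def by (rule bounded_linear.sums[OF bounded_linear_scaleR_right])
  thus ?case using \<open>norm (h x) < 1\<close> by (simp add: sums_unique)
 qed
 have int: "integrable M (%x. \<Sum>k. F k x)" by (rule integrable_suminf[OF Fi sm sn])
 have meas: "(%x. g x *\<^sub>R (if norm (h x) < 1 then harmonic_ext (h x) else 0)) \<in> borel_measurable M"
 proof -
  have "(%x. g x *\<^sub>R (if norm (h x) < 1 then (\<Sum>k. component k (h x)) else 0)) \<in> borel_measurable M" by measurable
  moreover have "(%x. g x *\<^sub>R (if norm (h x) < 1 then (\<Sum>k. component k (h x)) else 0)) = (%x. g x *\<^sub>R (if norm (h x) < 1 then harmonic_ext (h x) else 0))"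
   using sums_unique[OF harmonic_ext_sums] by auto
  ultimately show ?thesis by simp
 qed
 show "integrable M (%x. g x *\<^sub>R (if norm (h x) < 1 then harmonic_ext (h x) else 0))"
  by (rule integrable_cong_AE_imp[OF int meas]) (use eq in \<open>auto elim: eventually_mono\<close>)
 have "(\<integral>x. g x *\<^sub>R (if norm (h x) < 1 then harmonic_ext (h x) else 0) \<partial>M) = (\<integral>x. (\<Sum>k. F k x) \<partial>M)"
  by (rule integral_cong_AE[OF meas _ eq]) measurable
 also have "... = (\<Sum>k. \<integral>x. F k x \<partial>M)" by (rule integral_suminf[OF Fi sm sn])
 finally show "(\<integral>x. g x *\<^sub>R (if norm (h x) < 1 then harmonic_ext (h x) else 0) \<partial>M) = (\<Sum>k. \<integral>x. g x *\<^sub>R component k (h x) \<partial>M)"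
  by (simp only: F_def)
qed

lemma continuous_harmonic_ext: "continuous_on (ball 0 1) harmonic_ext"
proof -
 obtain C A where C: "C >= 0" "!!k z. norm (component k z) <= C * (real k + 1) ^ A * norm z ^ k"
  by (rule component_bound[OF that])
 have "isCont harmonic_ext z" if z: "z \<in> ball 0 1" for z
 proof -
  define R where "R = (1 + norm z) / 2"
  have R: "0 <= R" "R < 1" "norm z < R" using z by (auto simp: R_def)
  have "uniform_limit (ball 0 R) (%n x. \<Sum>k<n. component k x) (%x. \<Sum>k. component k x) sequentially"
  proof (rule Weierstrass_m_test)
   fix k and x :: 'a assume "x \<in> ball 0 R"
   thus "norm (component k x) <= C * ((real k + 1) ^ A * R ^ k)"
    by (intro order_trans[OF C(2)]) (use C(1) in \<open>auto simp: mult.assoc intro!: mult_left_mono power_mono\<close>)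
  qed (intro summable_mult summable_power_mult_geometric, use R in auto)
  hence "continuous_on (ball 0 R) (%x. \<Sum>k. component k x)"
   by (rule uniform_limit_theorem[rotated])
    (auto intro!: always_eventually continuous_on_sum continuous_on_subset[OF continuous_component])
  moreover have "(\<Sum>k. component k x) = harmonic_ext x" if "x \<in> ball 0 R" for x
   using sums_unique[OF harmonic_ext_sums, of x] that R by simp
  ultimately have "continuous_on (ball 0 R) harmonic_ext" by (rule continuous_on_eq)
  thus ?thesis using R(3) by (simp add: continuous_on_eq_continuous_at)
 qed
 thus ?thesis by (simp add: continuous_on_eq_continuous_at)
qed

lemma hext_norm_eq: "norm z < 1 ==> hext_norm f z = norm (harmonic_ext z)"
 by (simp add: hext_norm_def harmonic_ext_def)

lemma continuous_hext_norm: "continuous_on (ball 0 1) (hext_norm f)"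
proof -
 have "continuous_on (ball 0 1) (%z. norm (harmonic_ext z))" by (intro continuous_on_norm continuous_harmonic_ext)
 thus ?thesis by (rule continuous_on_eq) (simp add: hext_norm_eq)
qed

lemma borel_measurable_hext_norm [measurable]: "hext_norm f \<in> borel_measurable borel"
proof -
 have "(%z. indicator (ball 0 1) z *\<^sub>R hext_norm f z) \<in> borel_measurable borel"
  by (rule borel_measurable_continuous_on_indicator[OF _ continuous_hext_norm]) simp
 moreover have "(%z. indicator (ball 0 1) z *\<^sub>R hext_norm f z) = hext_norm f" by (auto simp: indicator_def hext_norm_def)
 ultimately show ?thesis by simp
qed

text \<open>The mean value property of the components, summed up, holds for the harmonic extension with the weight \<open>bump \<le> 1\<close>.\<close>

lemma hext_norm_sub_mean_value:
 assumes \<rho>: "\<rho> > 0" "norm z + \<rho> < 1"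
 shows "ennreal (hext_norm f z) <= ennreal (1 / (\<integral>w. bump w \<partial>(unif_ball :: 'a measure))) * (\<integral>\<^sup>+w. ennreal (hext_norm f (z + \<rho> *\<^sub>R w)) \<partial>unif_ball)"
proof -
 define b where "b = (\<integral>w. bump w \<partial>(unif_ball :: 'a measure))"
 have b: "b > 0" unfolding b_def by (rule bump_average_pos)
 define u where "u = (%w. if norm (z + \<rho> *\<^sub>R w) < 1 then harmonic_ext (z + \<rho> *\<^sub>R w) else 0)"
 have ae: "AE w in unif_ball. norm (z + \<rho> *\<^sub>R w) <= norm z + \<rho>"
  using AE_unif_ball_less_1
 proof eventually_elim
  case (elim w)
  have "norm (z + \<rho> *\<^sub>R w) <= norm z + \<rho> * norm w" using norm_triangle_ineq[of z "\<rho> *\<^sub>R w"] \<rho>(1) by simp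
  also have "\<rho> * norm w <= \<rho> * 1" using elim \<rho>(1) by (intro mult_left_mono) auto
  finally show ?case by simp
 qed
 have R: "0 <= norm z + \<rho>" using \<rho>(1) by simp
 have m: "(%w. z + \<rho> *\<^sub>R w) \<in> borel_measurable unif_ball" "bump \<in> borel_measurable (unif_ball :: 'a measure)" by measurable
 have bm: "AE w in (unif_ball :: 'a measure). \<bar>bump w\<bar> <= 1"
 proof (rule AE_I2)
  fix w :: 'a
  show "\<bar>bump w\<bar> <= 1" using bump_bounds(1,2)[of w] by simp
 qed
 have I: "integrable unif_ball (%w. bump w *\<^sub>R u w)"
  "(\<integral>w. bump w *\<^sub>R u w \<partial>unif_ball) = (\<Sum>k. \<integral>w. bump w *\<^sub>R component k (z + \<rho> *\<^sub>R w) \<partial>unif_ball)"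
  unfolding u_def by (rule integral_harmonic_ext[OF unif_ball.prob_space_axioms m(2,1) bm ae R \<rho>(2)])+
 have "norm z < 1" using \<rho> by simp
 note s = harmonic_ext_sums[OF this]
 have "(\<Sum>k. \<integral>w. bump w *\<^sub>R component k (z + \<rho> *\<^sub>R w) \<partial>unif_ball) = b *\<^sub>R harmonic_ext z"
  unfolding component_mean_value b_def[symmetric]
  by (rule sums_unique[OF bounded_linear.sums[OF bounded_linear_scaleR_right s], symmetric])
 hence "b * hext_norm f z = norm (\<integral>w. bump w *\<^sub>R u w \<partial>unif_ball)"
  using b \<open>norm z < 1\<close> by (simp add: I(2) hext_norm_eq)
 hence "ennreal (b * hext_norm f z) <= (\<integral>\<^sup>+w. norm (bump w *\<^sub>R u w) \<partial>unif_ball)"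
  using integral_norm_bound_ennreal[OF I(1)] by simp
 also have "... <= (\<integral>\<^sup>+w. ennreal (hext_norm f (z + \<rho> *\<^sub>R w)) \<partial>unif_ball)"
 proof (intro nn_integral_mono ennreal_leI)
  fix w
  have "norm (u w) = hext_norm f (z + \<rho> *\<^sub>R w)" by (auto simp: u_def hext_norm_eq) (simp add: hext_norm_def)
  thus "norm (bump w *\<^sub>R u w) <= hext_norm f (z + \<rho> *\<^sub>R w)"
   using bump_bounds(1,2)[of w] mult_right_mono[of "bump w" 1 "hext_norm f (z + \<rho> *\<^sub>R w)"] hext_norm_nonneg[of f "z + \<rho> *\<^sub>R w"] by simp
 qed
 finally have "ennreal (1 / b) * ennreal (b * hext_norm f z) <= ennreal (1 / b) * (\<integral>\<^sup>+w. ennreal (hext_norm f (z + \<rho> *\<^sub>R w)) \<partial>unif_ball)"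
  by (rule mult_left_mono) simp
 moreover have "ennreal (1 / b) * ennreal (b * hext_norm f z) = ennreal (hext_norm f z)"
  using b hext_norm_nonneg[of f z] by (simp flip: ennreal_mult)
 ultimately show ?thesis by (simp add: b_def)
qed

text \<open>A supremum of continuous functions: the sets where it exceeds \<open>t\<close> are open.\<close>

lemma borel_measurable_radial_max: "radial_max f \<in> borel_measurable \<sigma>"
proof (rule borel_measurableI_greater)
 fix t :: ennreal
 define V where "V = (%r. {x. norm (r *\<^sub>R x) < 1 \<and> t < ennreal (hext_norm f (r *\<^sub>R x))})"
 have "open (V r)" for r
 proof -
  have o: "open ((%x::'a. r *\<^sub>R x) -` ball 0 1)" by (intro continuous_open_vimage continuous_intros) auto
  have "continuous_on ((%x. r *\<^sub>R x) -` ball 0 1) (%x. ennreal (hext_norm f (r *\<^sub>R x)))"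
   by (intro continuous_on_ennreal continuous_on_compose2[OF continuous_hext_norm] continuous_intros) auto
  hence "open ((%x. r *\<^sub>R x) -` ball 0 1 \<inter> (%x. ennreal (hext_norm f (r *\<^sub>R x))) -` {t<..})"
   by (rule continuous_open_preimage[OF _ o]) simp
  also have "(%x. r *\<^sub>R x) -` ball 0 1 \<inter> (%x. ennreal (hext_norm f (r *\<^sub>R x))) -` {t<..} = V r"
   by (auto simp: V_def)
  finally show ?thesis .
 qed
 hence "(\<Union>r\<in>{0..<1}. V r) \<in> sets borel" by (intro borel_open open_UN) auto
 hence "(\<Union>r\<in>{0..<1}. V r) \<inter> sphere 0 1 \<in> sets \<sigma>" by (rule sphere_measure_sets)
 also have "(\<Union>r\<in>{0..<1}. V r) \<inter> sphere 0 1 = {x \<in> space sphere_measure. t < radial_max f x}"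
  unfolding radial_max_def V_def less_SUP_iff by (auto simp: hext_norm_def)
 finally show "{x \<in> space sphere_measure. t < radial_max f x} \<in> sets \<sigma>" .
qed

end

lemma power_diff_le:
 fixes s t :: real
 assumes "0 <= s" "s <= t" "t <= 1"
 shows "t ^ n - s ^ n <= real n * (t - s)"
proof (induction n)
 case (Suc n)
 have "t ^ Suc n - s ^ Suc n = t ^ n * (t - s) + s * (t ^ n - s ^ n)" by (simp add: algebra_simps)
 also have "... <= 1 * (t - s) + 1 * (real n * (t - s))"
  using assms Suc by (intro add_mono mult_mono power_le_one) (auto intro: power_mono)
 finally show ?case by (simp add: algebra_simps)
qed simp

lemma exp_minus_bounds:
 assumes "N >= (1::real)"
 shows "1 / 3 <= exp (- 1 / N)" "1 / (2 * N) <= 1 - exp (- 1 / N)" "1 - exp (- 1 / N) <= 1 / N"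
proof -
 have "- 1 <= - 1 / N" using assms by (simp add: field_simps)
 hence "exp (- 1) <= exp (- 1 / N)" by (simp only: exp_le_cancel_iff)
 moreover have "exp (- 1 :: real) >= 1 / 3" using exp_le by (simp add: exp_minus field_simps)
 ultimately show "1 / 3 <= exp (- 1 / N)" by (rule order_trans[rotated])
 show "1 - exp (- 1 / N) <= 1 / N" using exp_ge_add_one_self[of "- 1 / N"] by simp
 have "1 + 1 / N <= exp (1 / N)" by (rule exp_ge_add_one_self)
 hence "exp (- 1 / N) <= 1 / (1 + 1 / N)"
  using assms le_imp_inverse_le[of "1 + 1 / N" "exp (1 / N)"] by (simp add: exp_minus inverse_eq_divide add_pos_pos)
 also have "... <= 1 - 1 / (2 * N)" using assms by (simp add: field_simps)
 finally show "1 / (2 * N) <= 1 - exp (- 1 / N)" by simp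
qed

text \<open>The ball about \<open>z = exp (- 1 / N) *\<^sub>R y\<close> whose radius \<open>\<rho>\<close> is half the distance of \<open>z\<close> to the sphere lies in an annulus
 of width \<open>2 * \<rho>\<close>, and its points have directions in the cap of radius \<open>3 / N\<close> about \<open>y\<close>. At these points the harmonic
 extension is at most the radial maximal function of the direction.\<close>

lemma hext_norm_le_cap_average:
 fixes q :: real
 assumes d: "DIM('a::euclidean_space) >= 3" and q: "q > 0"
 obtains C where "C > 0" "!!(f :: ('a, 'b::{real_normed_field,euclidean_space}) functional) N y. f \<in> distributions ==> N >= 1 ==> norm y = 1 ==>
  ennreal (hext_norm f (exp (- 1 / N) *\<^sub>R y) powr q) <=
   ennreal (C * N ^ (DIM('a) - 1)) * cap_integral (%x. epow (radial_max f x) q) y (3 / N)"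
proof -
 define K0 where "K0 = 1 / (\<integral>w. bump w \<partial>(unif_ball :: 'a measure))"
 have K0: "K0 > 0" using bump_average_pos[where 'a='a] by (simp add: K0_def)
 define K where "K = (if q <= 1 then K0 * 2 powr (real DIM('a) / q) else K0 powr q)"
 have K: "K > 0" using K0 by (simp add: K_def)
 show ?thesis
 proof (rule that[of "K * (2 * real DIM('a) * 4 ^ (DIM('a) - 1))"])
  show "K * (2 * real DIM('a) * 4 ^ (DIM('a) - 1)) > 0" using K by simp
  fix f :: "('a, 'b) functional" and N :: real and y :: 'a
  assume f: "f \<in> distributions" and N: "N >= 1" and y: "norm y = 1"
  let ?A = "cap_integral (%x. epow (radial_max f x) q) y (3 / N)"
  interpret distribution f by unfold_locales (rule f, rule d)
  define r where "r = exp (- 1 / N)"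
  note r = exp_minus_bounds[OF N, folded r_def]
  have r1: "r < 1" "r > 0" using r N by (auto simp: r_def)
  define z where "z = r *\<^sub>R y"
  define \<rho> where "\<rho> = (1 - r) / 2"
  have nz: "norm z = r" using y r1 by (simp add: z_def)
  have \<rho>: "\<rho> > 0" "norm z + \<rho> < 1" using r1 by (auto simp: \<rho>_def nz field_simps)
  have \<rho>N: "1 / (4 * N) <= \<rho>" "\<rho> <= 1 / (2 * N)" using r by (auto simp: \<rho>_def)
  have "ennreal (hext_norm f z powr q) <= ennreal K * (\<integral>\<^sup>+w. ennreal (hext_norm f (z + \<rho> *\<^sub>R w) powr q) \<partial>unif_ball)"
  proof (cases "q <= 1")
   case True
   show ?thesis unfolding K_def if_P[OF True]
    by (rule power_sub_mean_value_small[OF q True K0 borel_measurable_hext_norm continuous_hext_norm hext_norm_nonneg _ \<rho>])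
     (unfold K0_def, rule hext_norm_sub_mean_value)
  next
   case False
   hence "1 < q" by simp
   thus ?thesis unfolding K_def if_not_P[OF False]
    by (rule power_sub_mean_value_large[OF _ K0 borel_measurable_hext_norm hext_norm_nonneg])
     (unfold K0_def, rule hext_norm_sub_mean_value[OF \<rho>])
  qed
  also have "(\<integral>\<^sup>+w. ennreal (hext_norm f (z + \<rho> *\<^sub>R w) powr q) \<partial>unif_ball) =
   ennreal (1 / \<rho> ^ DIM('a)) * (\<integral>\<^sup>+w. ennreal (hext_norm f w powr q) * indicator (ball z \<rho>) w \<partial>unif_ball)"
  proof (rule nn_integral_unif_ball_rescale[OF _ \<rho>(1)])
   show "ball z \<rho> \<subseteq> ball 0 1"
   proof
    fix w assume "w \<in> ball z \<rho>"
    thus "w \<in> ball 0 1" using \<rho>(2) norm_triangle_sub[of w z] by (simp add: dist_norm norm_minus_commute)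
   qed
  qed measurable
  also have "(\<integral>\<^sup>+w. ennreal (hext_norm f w powr q) * indicator (ball z \<rho>) w \<partial>unif_ball) <=
   ennreal (2 * real DIM('a) * \<rho>) * ?A"
  proof -
   define h where "h = (%x. epow (radial_max f x) q * indicator (cball y (3 / N)) x)"
   define g where "g = (%x. if x \<in> sphere 0 1 then h x else 0)"
   have em: "(%x. epow x q) \<in> borel_measurable borel" unfolding epow_def by measurable
   have [measurable]: "(%x. epow (radial_max f x) q) \<in> borel_measurable \<sigma>"
    by (rule measurable_compose[OF borel_measurable_radial_max em])
   have [measurable]: "(%x. indicator (cball y (3 / N)) x :: ennreal) \<in> borel_measurable \<sigma>"
    by (rule borel_measurable_sphere_measure) (auto intro!: borel_measurable_indicator)
   have "h \<in> borel_measurable \<sigma>" unfolding h_def by measurable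
   hence "h \<in> borel_measurable (restrict_space borel (sphere 0 1))"
    by (simp add: measurable_cong_sets[OF sets_sphere_measure refl])
   hence [measurable]: "g \<in> borel_measurable borel" unfolding g_def
    by (subst (asm) measurable_restrict_space_iff[of _ _ 0]) auto
   have "(\<integral>\<^sup>+w. ennreal (hext_norm f w powr q) * indicator (ball z \<rho>) w \<partial>unif_ball) <=
     (\<integral>\<^sup>+w. indicator {r - \<rho>..<r + \<rho>} (norm w) * g (sgn w) \<partial>unif_ball)"
   proof (rule nn_integral_mono)
    fix w
    show "ennreal (hext_norm f w powr q) * indicator (ball z \<rho>) w <= indicator {r - \<rho>..<r + \<rho>} (norm w) * g (sgn w)"
    proof (cases "w \<in> ball z \<rho>")
     case True
     hence wz: "norm (w - z) < \<rho>" by (simp add: dist_norm norm_minus_commute)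
     have nw: "r - \<rho> <= norm w" "norm w < r + \<rho>"
      using wz norm_triangle_ineq2[of w z] norm_triangle_ineq3[of w z] by (auto simp: nz)
     have "r - \<rho> > 0 \<or> w ~= 0" using r(1) r1 wz nz by (auto simp: \<rho>_def field_simps)
     hence w0: "w ~= 0" using nw by auto
     have "z ~= 0" using nz r1 by auto
     have "sgn z = y" using y r1 by (simp add: z_def sgn_scaleR) (simp add: sgn_div_norm)
     hence "norm (sgn w - y) <= 2 * norm (w - z) / r" using norm_sgn_diff_le[OF \<open>z ~= 0\<close>, of w] by (simp add: nz)
     also have "... <= 2 * \<rho> / (1 / 3)" using wz r \<rho>(1) by (intro frac_le) auto
     also have "... <= 3 / N" using \<rho>N(2) by (simp add: field_simps)
     finally have cb: "sgn w \<in> cball y (3 / N)" by (simp add: dist_norm norm_minus_commute)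
     have "epow (ennreal (hext_norm f w)) q <= epow (radial_max f (sgn w)) q"
      using q by (intro epow_mono hext_norm_le_radial_max w0) auto
     hence "ennreal (hext_norm f w powr q) <= epow (radial_max f (sgn w)) q" by (simp add: epow_ennreal hext_norm_nonneg)
     thus ?thesis using True nw cb w0 by (simp add: g_def h_def norm_sgn)
    qed simp
   qed
   also have "... = ennreal ((r + \<rho>) ^ DIM('a) - (r - \<rho>) ^ DIM('a)) * (\<integral>\<^sup>+x. g x \<partial>\<sigma>)"
    using r(1) r1 by (intro nn_integral_annulus) (auto simp: \<rho>_def field_simps)
   also have "(\<integral>\<^sup>+x. g x \<partial>\<sigma>) = (\<integral>\<^sup>+x. h x \<partial>\<sigma>)"
    by (intro nn_integral_cong) (simp add: g_def)
   also have "ennreal ((r + \<rho>) ^ DIM('a) - (r - \<rho>) ^ DIM('a)) <= ennreal (2 * real DIM('a) * \<rho>)"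
    using power_diff_le[of "r - \<rho>" "r + \<rho>" "DIM('a)"] r(1) r1 by (intro ennreal_leI) (auto simp: \<rho>_def field_simps)
   finally show ?thesis by (simp add: h_def mult_right_mono)
  qed
  also have "ennreal K * (ennreal (1 / \<rho> ^ DIM('a)) * (ennreal (2 * real DIM('a) * \<rho>) * ?A))
    = ennreal (K * (1 / \<rho> ^ DIM('a) * (2 * real DIM('a) * \<rho>))) * ?A"
  proof -
   have "ennreal a * (ennreal b * (ennreal c * X)) = ennreal (a * (b * c)) * X" if "a >= 0" "b >= 0" "c >= 0" for a b c X
    using that by (simp add: ennreal_mult mult.assoc)
   thus ?thesis using K \<rho>(1) by (simp only: less_imp_le divide_nonneg_nonneg mult_nonneg_nonneg zero_le_one zero_le_power of_nat_0_le_iff zero_le_numeral)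
  qed
  also have "K * (1 / \<rho> ^ DIM('a) * (2 * real DIM('a) * \<rho>)) <= K * (2 * real DIM('a) * 4 ^ (DIM('a) - 1)) * N ^ (DIM('a) - 1)"
  proof -
   have "DIM('a) = Suc (DIM('a) - 1)" using d by simp
   hence "\<rho> ^ DIM('a) = \<rho> * \<rho> ^ (DIM('a) - 1)" by (metis power_Suc)
   hence "1 / \<rho> ^ DIM('a) * (2 * real DIM('a) * \<rho>) = 2 * real DIM('a) * (1 / \<rho>) ^ (DIM('a) - 1)"
    using \<rho>(1) by (simp add: power_one_over)
   also have "... <= 2 * real DIM('a) * (4 * N) ^ (DIM('a) - 1)"
    using \<rho>N(1) \<rho>(1) N by (intro mult_left_mono power_mono) (auto simp: field_simps)
   finally have "K * (1 / \<rho> ^ DIM('a) * (2 * real DIM('a) * \<rho>)) <= K * (2 * real DIM('a) * (4 * N) ^ (DIM('a) - 1))"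
    using K by (intro mult_left_mono) auto
   thus ?thesis by (simp only: power_mult_distrib mult.assoc)
  qed
  finally show "ennreal (hext_norm f (exp (- 1 / N) *\<^sub>R y) powr q) <=
   ennreal (K * (2 * real DIM('a) * 4 ^ (DIM('a) - 1)) * N ^ (DIM('a) - 1)) * ?A"
   by (simp add: z_def r_def mult_left_mono mult_right_mono ennreal_leI)
 qed
qed

section \<open>Frame coefficients and the maximal function\<close>

lemma (in distribution) frame_kernel_functional:
 assumes \<phi>: "cutoff \<phi>" and j: "j >= 1" and x: "norm x = 1"
 shows "(%u. of_real (frame_kernel DIM('a) \<phi> j (u \<bullet> x)) :: 'b) \<in> test_funs" (is "?K \<in> _")
  and "f (%u. of_real (frame_kernel DIM('a) \<phi> j (u \<bullet> x))) = (\<Sum>k<Suc (2 ^ j). of_real (\<phi> (real k / 2 ^ (j - 1))) * component k x)"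
proof -
 define c where "c = (%k. if k < Suc (2 ^ j) then \<phi> (real k / 2 ^ (j - 1)) else 0)"
 have c: "geometric_decay c" by (rule geometric_decay_finite[of "Suc (2 ^ j)"]) (simp add: c_def)
 have eq: "zonal_series c x u = (of_real (frame_kernel DIM('a) \<phi> j (u \<bullet> x)) :: 'b)" for u :: 'a
 proof -
  have "(\<Sum>k. c k * zonal DIM('a) k (x \<bullet> u)) = (\<Sum>k<Suc (2 ^ j). c k * zonal DIM('a) k (x \<bullet> u))"
   by (rule suminf_finite) (auto simp: c_def)
  also have "... = frame_kernel DIM('a) \<phi> j (u \<bullet> x)"
   unfolding frame_kernel_eq[OF \<phi> j] by (intro sum.cong) (auto simp: c_def inner_commute)
  finally show ?thesis by (simp add: zonal_series_def)
 qed
 have zs: "zonal_series c x = ?K" by (rule ext) (rule eq)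
 show "?K \<in> test_funs"
  using zonal_series_test_fun[OF dim c x, where 'b='b] by (simp only: zs)
 have "(%k. of_real (c k) * component k x) sums f (zonal_series c x)" by (rule zonal_series_sums[OF c x])
 moreover have "(%k. of_real (c k) * component k x) sums (\<Sum>k<Suc (2 ^ j). of_real (c k) * component k x)"
  by (rule sums_finite) (auto simp: c_def)
 ultimately have "f (zonal_series c x) = (\<Sum>k<Suc (2 ^ j). of_real (c k) * component k x)" by (rule sums_unique2)
 also have "... = (\<Sum>k<Suc (2 ^ j). of_real (\<phi> (real k / 2 ^ (j - 1))) * component k x)"
  by (intro sum.cong) (auto simp: c_def)
 finally show "f ?K = (\<Sum>k<Suc (2 ^ j). of_real (\<phi> (real k / 2 ^ (j - 1))) * component k x)"
  by (simp only: zs)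
qed

text \<open>On the sphere of radius \<open>exp (- 1 / N)\<close> the harmonic extension has the components of \<open>f\<close> multiplied by \<open>exp (- k / N)\<close>.
 The factor \<open>exp (k / N)\<close> in the kernel makes up for this.\<close>

lemma (in distribution) norm_frame_kernel_le:
 assumes \<phi>: "cutoff \<phi>" and j: "j >= 1" and x: "norm x = 1" and N: "N = 2 ^ (j - 1)"
 shows "ennreal (norm (f (%u. of_real (frame_kernel DIM('a) \<phi> j (u \<bullet> x))))) <=
  (\<integral>\<^sup>+y. ennreal (\<bar>\<Sum>k<Suc (2 ^ j). \<phi> (real k / N) * exp (real k / N) * zonal DIM('a) k (x \<bullet> y)\<bar> * hext_norm f (exp (- 1 / N) *\<^sub>R y)) \<partial>\<sigma>)"
proof -
 define r where "r = exp (- 1 / N)"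
 have N1: "N >= 1" by (simp add: N)
 have r: "0 <= r" "r < 1" using N1 by (auto simp: r_def)
 define u where "u = (%y. if norm (r *\<^sub>R y) < 1 then harmonic_ext (r *\<^sub>R y) else 0)"
 define c where "c = (%k. \<phi> (real k / N) * exp (real k / N))"
 let ?S = "%y. \<Sum>m<Suc (2 ^ j). c m *\<^sub>R (zsol m x y *\<^sub>R u y)"
 let ?f = "f (%u. of_real (frame_kernel DIM('a) \<phi> j (u \<bullet> x)))"
 have ae: "AE y in sphere_measure. norm (r *\<^sub>R (y::'a)) <= r" using r by (intro AE_I2) simp
 have zm: "zsol m x \<in> borel_measurable \<sigma>" "(%y. r *\<^sub>R (y::'a)) \<in> borel_measurable \<sigma>" for m
  by (auto intro!: borel_measurable_sphere_measure zsol_measurable)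
 have zb: "AE y in sphere_measure. \<bar>zsol m x y\<bar> <= 2 * (real m + 1) ^ (DIM('a) - 2)" for m
 proof (rule AE_I2)
  fix y :: 'a assume "y \<in> space \<sigma>"
  hence "norm y = 1" by simp
  thus "\<bar>zsol m x y\<bar> <= 2 * (real m + 1) ^ (DIM('a) - 2)"
   using abs_zonal_le[OF dim, of "x \<bullet> y" m] abs_inner_sphere_le[OF x] by (simp add: zsol_sphere)
 qed
 note H = integral_harmonic_ext[OF sphere_measure.prob_space_axioms zm zb ae r]
 have comp: "(\<integral>y. zsol m x y *\<^sub>R u y \<partial>\<sigma>) = of_real (r ^ m) * component m x" for m
 proof -
  have "(\<integral>y. zsol m x y *\<^sub>R u y \<partial>\<sigma>) = (\<Sum>k. \<integral>y. zsol m x y *\<^sub>R component k (r *\<^sub>R y) \<partial>\<sigma>)"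
   unfolding u_def by (rule H(2))
  also have "... = (\<Sum>k. if k = m then of_real (r ^ m) * component m x else 0)"
  proof (rule arg_cong[where f=suminf], rule ext)
   fix k
   have "(\<integral>y. zsol m x y *\<^sub>R component k (r *\<^sub>R y) \<partial>\<sigma>) = (\<integral>y. of_real (r ^ k) * (zsol m x y *\<^sub>R component k y) \<partial>\<sigma>)"
    by (rule Bochner_Integration.integral_cong[OF refl]) (simp add: component_scale)
   also have "... = of_real (r ^ k) * (\<integral>y. zsol m x y *\<^sub>R component k y \<partial>\<sigma>)"
    by (rule integral_mult_right_zero)
   finally show "(\<integral>y. zsol m x y *\<^sub>R component k (r *\<^sub>R y) \<partial>\<sigma>) = (if k = m then of_real (r ^ m) * component m x else 0)"
    by (simp add: component_reproducing[OF x])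
  qed
  also have "... = of_real (r ^ m) * component m x"
   by (subst suminf_finite[of "{m}"]) auto
  finally show ?thesis .
 qed
 have I: "integrable \<sigma> (%y. c m *\<^sub>R (zsol m x y *\<^sub>R u y))" for m
  unfolding u_def by (intro integrable_scaleR_right H(1))
 have cr: "c m *\<^sub>R (of_real (r ^ m) * component m x) = of_real (\<phi> (real m / N)) * component m x" for m
 proof -
  have "exp (real m / N) * r ^ m = 1" by (simp add: r_def flip: exp_of_nat_mult exp_add)
  hence "c m * r ^ m = \<phi> (real m / N)" by (simp add: c_def mult.assoc)
  moreover have "c m *\<^sub>R (of_real (r ^ m) * component m x) = of_real (c m * r ^ m) * component m x"
   by (simp add: scaleR_conv_of_real mult.assoc)
  ultimately show ?thesis by simp
 qed
 have "(\<integral>y. ?S y \<partial>\<sigma>) = (\<Sum>m<Suc (2 ^ j). \<integral>y. c m *\<^sub>R (zsol m x y *\<^sub>R u y) \<partial>\<sigma>)"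
  by (rule Bochner_Integration.integral_sum[OF I])
 also have "... = (\<Sum>m<Suc (2 ^ j). c m *\<^sub>R (of_real (r ^ m) * component m x))"
  by (simp only: integral_scaleR_right comp)
 also have "... = ?f"
  unfolding cr frame_kernel_functional(2)[OF \<phi> j x] N ..
 finally have fe: "?f = (\<integral>y. ?S y \<partial>\<sigma>)" by simp
 have "integrable \<sigma> ?S"
  by (rule Bochner_Integration.integrable_sum[OF I])
 from integral_norm_bound_ennreal[OF this]
 have "ennreal (norm (?f)) <= (\<integral>\<^sup>+y. ennreal (norm (?S y)) \<partial>\<sigma>)"
  unfolding fe .
 also have "... = (\<integral>\<^sup>+y. ennreal (\<bar>\<Sum>k<Suc (2 ^ j). c k * zonal DIM('a) k (x \<bullet> y)\<bar> * hext_norm f (r *\<^sub>R y)) \<partial>\<sigma>)"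
 proof (intro nn_integral_cong arg_cong[where f=ennreal])
  fix y :: 'a assume "y \<in> space \<sigma>"
  hence y: "norm y = 1" by simp
  have "?S y = (\<Sum>m<Suc (2 ^ j). c m * zonal DIM('a) m (x \<bullet> y)) *\<^sub>R u y"
   using y by (simp add: scaleR_sum_left zsol_sphere del: sum.lessThan_Suc)
  moreover have "norm (u y) = hext_norm f (r *\<^sub>R y)" using y r by (simp add: u_def hext_norm_eq)
  ultimately show "norm (?S y) = \<bar>\<Sum>k<Suc (2 ^ j). c k * zonal DIM('a) k (x \<bullet> y)\<bar> * hext_norm f (r *\<^sub>R y)"
   by (simp only: norm_scaleR)
 qed
 finally show ?thesis by (simp only: c_def r_def)
qed

text \<open>A cap of radius \<open>3 / N\<close> about \<open>y\<close> lies in one about \<open>x\<close> whose radius is at most \<open>5 * (1 + N * norm (z - y)) / N\<close>. So the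
 average over the former is at most \<open>(1 + N * norm (z - y)) ^ (d - 1)\<close> times the maximal function at \<open>x\<close>. The order
 \<open>2 * M\<close> of the decay of the kernel is chosen to absorb the power \<open>1 / q\<close> of this factor.\<close>

lemma frame_kernel_le_maxfun:
 fixes q :: real
 assumes d: "DIM('a::euclidean_space) >= 3" and q: "q > 0" and \<phi>: "cutoff \<phi>"
 obtains C where "C > 0" "!!(f :: ('a, 'b::{real_normed_field,euclidean_space}) functional) j z x. f \<in> distributions ==>
  norm z = 1 ==> norm x = 1 ==> norm (x - z) <= 4 / 2 ^ j ==>
  ennreal (norm (f (%u. of_real (frame_kernel DIM('a) \<phi> j (u \<bullet> z)))) powr q) <= ennreal C * maxfun (%x. epow (radial_max f x) q) x"
proof -
 define d where "d = DIM('a)"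
 define M where "M = nat \<lceil>real (d - 1) / q + real d\<rceil>"
 have M: "real (d - 1) / q + real d <= real (2 * M)"
 proof -
  have "real (d - 1) / q + real d <= real M" unfolding M_def by linarith
  thus ?thesis by simp
 qed
 obtain C1 where C1: "C1 > 0" "!!(f :: ('a, 'b) functional) N y. f \<in> distributions ==> N >= 1 ==> norm y = 1 ==>
  ennreal (hext_norm f (exp (- 1 / N) *\<^sub>R y) powr q) <=
   ennreal (C1 * N ^ (DIM('a) - 1)) * cap_integral (%x. epow (radial_max f x) q) y (3 / N)"
  by (rule hext_norm_le_cap_average[OF assms(1) q that])
 obtain C2 where C2: "C2 > 0"
  "!!N (x::'a) y K. N >= 1 ==> norm x = 1 ==> norm y = 1 ==> 2 * N < real K ==>
    \<bar>\<Sum>k<K. \<phi> (real k / N) * exp (real k / N) * zonal DIM('a) k (x \<bullet> y)\<bar> <= C2 * N ^ (DIM('a) - 1) / (1 + N * norm (x - y)) ^ (2 * M)"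
  by (rule inverse_poisson_kernel_decay[OF assms(1) \<phi>, of M], rule that, assumption, simp)
 define C3 where "C3 = C1 * 5 ^ (d - 1)"
 have C3: "C3 > 0" using C1(1) by (simp add: C3_def)
 define C where "C = max ((C2 * 4 ^ d) powr q * C3) (2 ^ (d - 1))"
 have "(0::real) < 2 ^ (d - 1)" by simp
 hence C: "C > 0" unfolding C_def by (rule less_le_trans[OF _ max.cobounded2])
 show ?thesis
 proof (rule that[OF C])
  fix f :: "('a, 'b) functional" and j and z x :: 'a
  assume f: "f \<in> distributions" and z: "norm z = 1" and x: "norm x = 1" and xz: "norm (x - z) <= 4 / 2 ^ j"
  interpret distribution f by unfold_locales (rule f, rule assms(1))
  define h where "h = (%x. epow (radial_max f x) q)"
  define c where "c = norm (f (%u. of_real (frame_kernel DIM('a) \<phi> j (u \<bullet> z))))"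
  show "ennreal (c powr q) <= ennreal C * maxfun h x"
  proof (cases "j = 0")
   case True
   have c0: "c = hext_norm f 0"
   proof -
    have "f (%u. of_real (poisson (0::'a) u)) = f (%u. 1)"
    proof (rule cong_sphere)
     show "(%u. of_real (poisson (0::'a) u) :: 'b) \<in> test_funs" using poisson_test_fun[OF assms(1) x order_refl zero_less_one, where 'b='b] by simp
    qed (simp add: poisson_def)
    thus ?thesis using True by (simp add: c_def hext_norm_def frame_kernel_def)
   qed
   have "ennreal (c powr q) = (\<integral>\<^sup>+y. ennreal (c powr q) \<partial>(\<sigma> :: 'a measure))"
    using sphere_measure.emeasure_space_1[where 'a='a] by simp
   also have "... <= cap_integral h x 2"
   proof (rule nn_integral_mono)
    fix y :: 'a assume "y \<in> space \<sigma>"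
    hence "y \<in> cball x 2" using x norm_triangle_ineq4[of x y] by (simp add: dist_norm)
    moreover have "epow (ennreal c) q <= h y" unfolding h_def c0 using q by (intro epow_mono hext_norm_0_le_radial_max) auto
    ultimately show "ennreal (c powr q) <= h y * indicator (cball x 2) y" by (simp add: epow_ennreal c_def)
   qed
   also have "... <= maxfun h x * ennreal (2 ^ (DIM('a) - 1))" by (rule integral_cball_le_maxfun) simp
   also have "... <= maxfun h x * ennreal C" by (intro mult_left_mono ennreal_leI) (auto simp: C_def d_def)
   finally show ?thesis by (simp add: mult.commute)
  next
   case False
   hence j: "j >= 1" by simp
   define N where "N = (2::real) ^ (j - 1)"
   have N: "N >= 1" "2 * N = 2 ^ j" using j by (auto simp: N_def simp flip: power_Suc)
   let ?D = "C1 * N ^ (DIM('a) - 1)" and ?H = "%y. hext_norm f (exp (- 1 / N) *\<^sub>R y)"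
   let ?K = "%y. \<bar>\<Sum>k<Suc (2 ^ j). \<phi> (real k / N) * exp (real k / N) * zonal DIM('a) k (z \<bullet> y)\<bar>"
   let ?q = "%y. 1 / (1 + N * norm (z - y)) ^ DIM('a)"
   show ?thesis
   proof (cases "maxfun h x")
    case (real m)
    define E where "E = (C3 * m) powr (1 / q)"
    have hx: "?H y <= E * (1 + N * norm (z - y)) powr (real (d - 1) / q)" if y: "norm y = 1" for y
    proof -
     define s where "s = 1 + N * norm (z - y)"
     have s: "s >= 1" using N by (simp add: s_def)
     define t where "t = norm (x - y) + 3 / N"
     have t: "t > 0" using N by (simp add: t_def add_nonneg_pos)
     have Nt: "N * t <= 5 * s"
     proof -
      have "norm (x - y) <= norm (x - z) + norm (z - y)" using norm_triangle_ineq[of "x - z" "z - y"] by simp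
      also have "... <= 2 / N + norm (z - y)" using xz by (simp flip: N(2))
      finally have "N * norm (x - y) <= N * (2 / N + norm (z - y))" using N by (intro mult_left_mono) auto
      moreover have "N * norm (z - y) >= 0" "N * (2 / N) = 2" "N * (3 / N) = 3" using N by auto
      ultimately show ?thesis by (simp add: t_def s_def distrib_left)
     qed
     have "ennreal (?H y powr q) <= ennreal ?D * cap_integral h y (3 / N)"
      unfolding h_def by (rule C1(2)[OF f N(1) y])
     also have "... <= ennreal ?D * cap_integral h x t"
     proof (rule mult_left_mono[OF nn_integral_mono])
      fix w
      have "dist x w <= t" if "dist y w <= 3 / N" using dist_triangle[of x w y] that by (simp add: t_def dist_norm)
      thus "h w * indicator (cball y (3 / N)) w <= h w * indicator (cball x t) w" by (auto simp: indicator_def)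
     qed simp
     also have "... <= ennreal ?D * (maxfun h x * ennreal (t ^ (DIM('a) - 1)))"
      by (intro mult_left_mono integral_cball_le_maxfun t) simp
     also have "... = ennreal (C1 * (N * t) ^ (d - 1) * m)"
      using C1(1) N t real by (simp add: d_def power_mult_distrib mult_ac flip: ennreal_mult)
     also have "... <= ennreal (C1 * (5 * s) ^ (d - 1) * m)"
      using C1(1) N t Nt real by (intro ennreal_leI mult_right_mono mult_left_mono power_mono) auto
     also have "C1 * (5 * s) ^ (d - 1) * m = C3 * m * s ^ (d - 1)" by (simp add: C3_def power_mult_distrib)
     finally have "?H y powr q <= C3 * m * s ^ (d - 1)"
      using C3 real s by (subst (asm) ennreal_le_iff) auto
     hence "(?H y powr q) powr (1 / q) <= (C3 * m * s ^ (d - 1)) powr (1 / q)"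
      using q by (intro powr_mono2) auto
     moreover have "(?H y powr q) powr (1 / q) = ?H y"
      using q hext_norm_nonneg[of f] by (simp add: powr_powr)
     moreover have "(C3 * m * s ^ (d - 1)) powr (1 / q) = E * s powr (real (d - 1) / q)"
      using s by (simp add: E_def powr_mult powr_powr flip: powr_realpow)
     ultimately show ?thesis by (simp add: s_def)
    qed
    have E: "E >= 0" by (simp add: E_def)
    have "ennreal c <= (\<integral>\<^sup>+y. ennreal (?K y * ?H y) \<partial>\<sigma>)"
     unfolding c_def by (rule norm_frame_kernel_le[OF \<phi> j z N_def])
    also have "... <= (\<integral>\<^sup>+y. ennreal (C2 * N ^ (d - 1) * E) * ennreal (?q y) \<partial>\<sigma>)"
    proof (rule nn_integral_mono)
     fix y :: 'a assume "y \<in> space \<sigma>"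
     hence y: "norm y = 1" by simp
     define s where "s = 1 + N * norm (z - y)"
     have s: "s >= 1" "s > 0" using N by (auto simp: s_def add_pos_nonneg)
     have "?K y * ?H y
       <= (C2 * N ^ (d - 1) / s ^ (2 * M)) * (E * s powr (real (d - 1) / q))"
      unfolding s_def d_def using N(2) N(1) C2(1)
      by (intro mult_mono C2(2)[OF N(1) z y] hx[OF y, unfolded d_def] hext_norm_nonneg divide_nonneg_nonneg mult_nonneg_nonneg zero_le_power) auto
     also have "... = C2 * N ^ (d - 1) * E * s powr (real (d - 1) / q - real (2 * M))"
      using s by (simp add: powr_diff powr_realpow del: of_nat_mult)
     also have "... <= C2 * N ^ (d - 1) * E * s powr (- real d)"
      using M s C2(1) N E by (intro mult_left_mono powr_mono) auto
     also have "s powr (- real d) = 1 / s ^ DIM('a)" using s by (simp add: powr_minus powr_realpow d_def inverse_eq_divide)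
     finally show "ennreal (?K y * ?H y)
      <= ennreal (C2 * N ^ (d - 1) * E) * ennreal (?q y)"
      using C2(1) N E s(2) by (subst ennreal_mult[symmetric]) (auto simp: s_def intro!: ennreal_leI)
    qed
    also have "... = ennreal (C2 * N ^ (d - 1) * E) * (\<integral>\<^sup>+y. ennreal (?q y) \<partial>\<sigma>)"
     by (rule nn_integral_cmult) (auto intro!: borel_measurable_sphere_measure)
    also have "... <= ennreal (C2 * N ^ (d - 1) * E) * ennreal (4 ^ DIM('a) / N ^ (DIM('a) - 1))"
     using N by (intro mult_left_mono nn_integral_decay z) auto
    also have "... = ennreal (C2 * 4 ^ d * E)"
     using C2(1) N E by (simp add: d_def flip: ennreal_mult)
    finally have "c <= C2 * 4 ^ d * E" using C2(1) E by (subst (asm) ennreal_le_iff) auto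
    hence "c powr q <= (C2 * 4 ^ d * E) powr q" using q by (intro powr_mono2) (auto simp: c_def)
    also have "... = (C2 * 4 ^ d) powr q * (C3 * m)"
     using q C3 real by (simp add: E_def powr_mult powr_powr)
    also have "... = ((C2 * 4 ^ d) powr q * C3) * m" by simp
    also have "... <= C * m" using real by (intro mult_right_mono) (auto simp: C_def)
    finally show ?thesis using real C by (simp add: ennreal_leI flip: ennreal_mult)
   next
    case top
    thus ?thesis using C by (simp add: ennreal_mult_top)
   qed
  qed
 qed
qed

section \<open>Frame coefficients of elements of Hardy spaces\<close>

lemma ennreal_cancel: "k > 0 ==> ennreal (1 / k) * (ennreal k * x) = x" "k > 0 ==> ennreal k * (ennreal (1 / k) * x) = x"
 by (simp_all flip: mult.assoc ennreal_mult)

lemma epow_cmult: "D > 0 ==> epow (ennreal D * x) a = ennreal (D powr a) * epow x a"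
proof (cases x)
 case (real r)
 assume "D > 0"
 thus ?thesis using real by (simp add: epow_ennreal powr_mult flip: ennreal_mult)
qed (simp add: epow_def ennreal_mult_top)

lemma epow_mult_self: "a > 0 ==> epow x a * epow x a = epow x (2 * a)"
 by (cases x) (auto simp: epow_ennreal ennreal_top_mult epow_def simp flip: ennreal_mult powr_add)

lemma (in distribution) cap_kernel_test_fun:
 fixes y :: "nat => nat => 'a"
 assumes "cutoff \<phi>" "norm (entry y B) = 1"
 shows "(%u. of_real (cap_kernel \<phi> y B u) :: 'b) \<in> test_funs"
proof (cases "fst B = 0")
 case True
 thus ?thesis using one_test_fun by (simp add: frame_kernel_def)
next
 case False
 thus ?thesis by (intro frame_kernel_functional(1) assms) simp
qed

text \<open>The weight of a cap is at most a multiple of its measure, so that the factor \<open>sqrt (entry w B)\<close> of the frame element and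
 the normalization \<open>|B| powr (- 1 / 2)\<close> compensate each other.\<close>

lemma cap_coeff_le_frame_kernel:
 fixes C0 :: real
 assumes d: "DIM('a::euclidean_space) >= 3" and \<phi>: "cutoff \<phi>"
 obtains K where "K > 0" "!!c (y :: nat => nat => 'a) w S (f :: ('a, 'b::{real_normed_field,euclidean_space}) functional) B.
  f \<in> distributions ==> cap_family c C0 y w S ==> B \<in> S ==>
  cap_coeff y (%B. f (frame_elem \<phi> y w B)) B <= K * norm (f (%u. of_real (cap_kernel \<phi> y B u)))"
proof -
 obtain c0 where c0: "c0 >= 1"
  "!!(y :: nat => nat => 'a) B. norm (entry y B) = 1 ==> 1 / 2 ^ (fst B * (DIM('a) - 1)) <= c0 * measure \<sigma> (cap_of y B)"
  by (rule cap_measure_bounds[where 'a='a], rule that, assumption, simp)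
 show ?thesis
 proof (rule that[of "sqrt (\<bar>C0\<bar> * c0) + 1"])
  show "sqrt (\<bar>C0\<bar> * c0) + 1 > 0" using c0(1) by (intro add_nonneg_pos) auto
  fix c S and y :: "nat => nat => 'a" and w and f :: "('a, 'b) functional" and B
  assume f: "f \<in> distributions" and S: "cap_family c C0 y w S" "B \<in> S"
  interpret distribution f by unfold_locales (rule f, rule d)
  note D = cap_familyD[OF S(1)]
  note y = D(2)[OF S(2)] and w = D(3)[OF S(2)]
  define n where "n = norm (f (%u. of_real (cap_kernel \<phi> y B u)))"
  have "(frame_elem \<phi> y w B :: 'a => 'b) = (%u. of_real (sqrt (entry w B)) * of_real (cap_kernel \<phi> y B u))"
   by (simp add: frame_elem_cap_kernel fun_eq_iff)
  hence fB: "norm (f (frame_elem \<phi> y w B)) = sqrt (entry w B) * n"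
   using w by (simp add: cmult[OF cap_kernel_test_fun[OF \<phi> y]] norm_mult n_def)
  define m where "m = measure \<sigma> (cap_of y B)"
  have m: "m > 0" using measure_cap_of_pos[OF y] by (simp add: m_def)
  have "entry w B <= \<bar>C0\<bar> * (1 / 2 ^ (fst B * (DIM('a) - 1)))"
   using D(4)[OF S(2)] divide_right_mono[OF abs_ge_self[of C0], of "2 ^ (fst B * (DIM('a) - 1))"] by simp
  also have "... <= \<bar>C0\<bar> * (c0 * m)" unfolding m_def using c0(2)[OF y] by (rule mult_left_mono) simp
  finally have "entry w B / m <= \<bar>C0\<bar> * c0" using m by (simp add: divide_le_eq mult_ac)
  hence "sqrt (entry w B / m) <= sqrt (\<bar>C0\<bar> * c0)" by (rule real_sqrt_le_mono)
  hence "(sqrt (entry w B) * m powr (- 1 / 2)) * n <= (sqrt (\<bar>C0\<bar> * c0) + 1) * n"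
   using m by (intro mult_right_mono) (simp_all add: n_def real_sqrt_divide powr_minus powr_half_sqrt inverse_eq_divide)
  thus "cap_coeff y (%B. f (frame_elem \<phi> y w B)) B <= (sqrt (\<bar>C0\<bar> * c0) + 1) * norm (f (%u. of_real (cap_kernel \<phi> y B u)))"
   by (simp add: cap_coeff_def fB m_def n_def mult_ac)
 qed
qed

text \<open>On each cap the power \<open>q = p / 2\<close> of a coefficient is at most a multiple of the maximal function of
 \<open>h = epow (radial_max f) q\<close>. The square of \<open>h\<close> is the power \<open>p\<close> of the radial maximal function, as needed for
 the maximal inequality.\<close>

lemma cap_sup_le_Hardy_norm_finite:
 fixes C0 :: real and p :: ennreal
 assumes d: "DIM('a::euclidean_space) >= 3" and \<phi>: "cutoff \<phi>" and p: "p > 0" "p ~= \<infinity>"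
 obtains C where "C > 0" "!!c (y :: nat => nat => 'a) w (f :: ('a, 'b::{real_normed_field,euclidean_space}) functional) S.
  f \<in> distributions ==> cap_family c C0 y w S ==>
  Lp_norm p (cap_sup y S (cap_coeff y (%B. f (frame_elem \<phi> y w B)))) <= ennreal C * Hardy_norm p f"
proof -
 define P where "P = enn2real p"
 have P: "P > 0" using enn2real_inverse_finite[OF p] by (simp add: P_def)
 define q where "q = P / 2"
 have q: "q > 0" "P = 2 * q" using P by (auto simp: q_def)
 obtain K where K: "K > 0" "!!c (y :: nat => nat => 'a) w S (f :: ('a, 'b) functional) B.
  f \<in> distributions ==> cap_family c C0 y w S ==> B \<in> S ==>
  cap_coeff y (%B. f (frame_elem \<phi> y w B)) B <= K * norm (f (%u. of_real (cap_kernel \<phi> y B u)))"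
  by (rule cap_coeff_le_frame_kernel[OF d \<phi>, of C0, where 'b='b, OF that])
 obtain C1 where C1: "C1 > 0" "!!(f :: ('a, 'b) functional) j z x. f \<in> distributions ==>
  norm z = 1 ==> norm x = 1 ==> norm (x - z) <= 4 / 2 ^ j ==>
  ennreal (norm (f (%u. of_real (frame_kernel DIM('a) \<phi> j (u \<bullet> z)))) powr q) <= ennreal C1 * maxfun (%x. epow (radial_max f x) q) x"
  by (rule frame_kernel_le_maxfun[OF d q(1) \<phi> that])
 obtain C2 where C2: "C2 > 0" "!!(h :: 'a => ennreal) v. h \<in> borel_measurable \<sigma> ==> v \<in> borel_measurable \<sigma> ==>
  (!!x. 0 <= v x) ==> (!!x. x \<in> sphere 0 1 ==> ennreal (v x) <= maxfun h x) ==>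
  (\<integral>\<^sup>+x. ennreal ((v x)\<^sup>2) \<partial>\<sigma>) <= ennreal C2 * (\<integral>\<^sup>+x. h x * h x \<partial>\<sigma>)"
  by (rule maximal_inequality[where 'a='a], rule that, assumption, simp)
 define D where "D = K powr q * C1"
 have D: "D > 0" using K(1) C1(1) by (simp add: D_def)
 show ?thesis
 proof (rule that[of "(D\<^sup>2 * C2) powr (1 / P)"])
  show "(D\<^sup>2 * C2) powr (1 / P) > 0" using D C2(1) by simp
  fix c and y :: "nat => nat => 'a" and w and f :: "('a, 'b) functional" and S
  assume f: "f \<in> distributions" and S: "cap_family c C0 y w S"
  interpret distribution f by unfold_locales (rule f, rule d)
  note SD = cap_familyD[OF S]
  define b where "b = cap_coeff y (%B. f (frame_elem \<phi> y w B))"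
  have b: "b B >= 0" for B by (simp add: b_def cap_coeff_nonneg)
  define h where "h = (%x. epow (radial_max f x) q)"
  have em: "(%x. epow x a) \<in> borel_measurable borel" for a unfolding epow_def by measurable
  have hm: "h \<in> borel_measurable \<sigma>" unfolding h_def
   by (rule measurable_compose[OF borel_measurable_radial_max em])
  obtain s where s: "s \<in> borel_measurable \<sigma>" "cap_sup y S b = (%x. ennreal (s x))" "!!x. 0 <= s x"
   by (rule cap_sup_real[OF SD(1,2), of b]) (assumption, rule b, rule that)
  define v where "v = (%x. s x powr q / D)"
  have vm: "v \<in> borel_measurable \<sigma>" unfolding v_def using s(1) by measurable
  have v0: "v x >= 0" for x using D by (simp add: v_def)
  have v: "ennreal (v x) <= maxfun h x" if x: "x \<in> sphere 0 1" for x
  proof -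
   have "cap_sup y S b x <= epow (ennreal D * maxfun h x) (1 / q)"
    unfolding cap_sup_def
   proof (rule SUP_least)
    fix B assume B: "B \<in> S"
    show "ennreal (b B) * indicator (cap_of y B) x <= epow (ennreal D * maxfun h x) (1 / q)"
    proof (cases "x \<in> cap_of y B")
     case True
     note z = SD(2)[OF B]
     have "norm (x - entry y B) <= pi / 2 ^ fst B" by (rule norm_diff_le_cap_of[OF z True])
     also have "... <= 4 / 2 ^ fst B" using pi_less_4 by (intro divide_right_mono) auto
     finally have xz: "norm (x - entry y B) <= 4 / 2 ^ fst B" .
     define n where "n = norm (f (%u. of_real (cap_kernel \<phi> y B u)))"
     have "b B <= K * n" unfolding b_def n_def by (rule K(2)[OF f S B])
     hence "b B powr q <= (K * n) powr q" using b q(1) by (intro powr_mono2) auto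
     hence "ennreal (b B powr q) <= ennreal (K powr q) * ennreal (n powr q)"
      by (simp add: powr_mult ennreal_leI flip: ennreal_mult)
     also have "... <= ennreal (K powr q) * (ennreal C1 * maxfun h x)"
      unfolding n_def h_def using x by (intro mult_left_mono C1(2) f z xz) auto
     also have "... = ennreal D * maxfun h x"
      using K(1) C1(1) by (simp add: D_def ennreal_mult mult.assoc)
     finally have "epow (ennreal (b B powr q)) (1 / q) <= epow (ennreal D * maxfun h x) (1 / q)"
      using q(1) by (intro epow_mono) auto
     thus ?thesis using True b[of B] q(1) by (simp add: epow_ennreal powr_powr)
    qed simp
   qed
   hence "epow (cap_sup y S b x) q <= epow (epow (ennreal D * maxfun h x) (1 / q)) q"
    using q(1) by (intro epow_mono) auto
   hence "ennreal (s x powr q) <= ennreal D * maxfun h x"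
    by (simp add: s epow_ennreal epow_epow[OF q(1)])
   hence "ennreal (1 / D) * ennreal (s x powr q) <= ennreal (1 / D) * (ennreal D * maxfun h x)"
    by (rule mult_left_mono) simp
   thus ?thesis unfolding ennreal_cancel[OF D] using D by (simp add: v_def flip: ennreal_mult)
  qed
  have "(\<integral>\<^sup>+x. epow (cap_sup y S b x) P \<partial>\<sigma>) = (\<integral>\<^sup>+x. ennreal (D\<^sup>2) * ennreal ((v x)\<^sup>2) \<partial>\<sigma>)"
  proof (rule nn_integral_cong)
   fix x
   have "s x powr P = (s x powr q)\<^sup>2" by (simp add: q(2) power2_eq_square flip: powr_add)
   thus "epow (cap_sup y S b x) P = ennreal (D\<^sup>2) * ennreal ((v x)\<^sup>2)"
    using D by (simp add: s epow_ennreal v_def power_divide flip: ennreal_mult)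
  qed
  also have "... = ennreal (D\<^sup>2) * (\<integral>\<^sup>+x. ennreal ((v x)\<^sup>2) \<partial>\<sigma>)"
   by (intro nn_integral_cmult measurable_compose[OF borel_measurable_power[OF vm] measurable_ennreal])
  also have "... <= ennreal (D\<^sup>2) * (ennreal C2 * (\<integral>\<^sup>+x. h x * h x \<partial>\<sigma>))"
   by (intro mult_left_mono C2(2) hm vm v0 v) auto
  also have "... = ennreal (D\<^sup>2 * C2) * (\<integral>\<^sup>+x. epow (radial_max f x) P \<partial>\<sigma>)"
   using C2(1) by (simp add: h_def epow_mult_self[OF q(1)] q(2) ennreal_mult mult.assoc)
  finally have "epow (\<integral>\<^sup>+x. epow (cap_sup y S b x) P \<partial>\<sigma>) (1 / P)
    <= epow (ennreal (D\<^sup>2 * C2) * (\<integral>\<^sup>+x. epow (radial_max f x) P \<partial>\<sigma>)) (1 / P)"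
   using P by (intro epow_mono) auto
  also have "... = ennreal ((D\<^sup>2 * C2) powr (1 / P)) * epow (\<integral>\<^sup>+x. epow (radial_max f x) P \<partial>\<sigma>) (1 / P)"
   using D C2(1) by (intro epow_cmult) simp
  finally show "Lp_norm p (cap_sup y S (cap_coeff y (%B. f (frame_elem \<phi> y w B)))) <= ennreal ((D\<^sup>2 * C2) powr (1 / P)) * Hardy_norm p f"
   using p(2) by (simp add: Hardy_norm_def Lp_norm_def b_def flip: P_def)
 qed
qed

lemma integral_frame_kernel_le:
 assumes d: "DIM('a::euclidean_space) >= 3" and \<phi>: "cutoff \<phi>"
 obtains C where "C > 0" "!!j (z :: 'a). norm z = 1 ==> (\<integral>\<^sup>+u. ennreal \<bar>frame_kernel DIM('a) \<phi> j (u \<bullet> z)\<bar> \<partial>\<sigma>) <= ennreal C"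
proof -
 obtain C where C: "C > 0"
  "!!N r (x::'a) y K. N >= 1 ==> 0 <= r ==> r <= 1 ==> norm x = 1 ==> norm y = 1 ==> 2 * N < real K ==>
    \<bar>\<Sum>k<K. \<phi> (real k / N) * r ^ k * zonal DIM('a) k (x \<bullet> y)\<bar> <= C * N ^ (DIM('a) - 1) / (1 + N * norm (x - y)) ^ (2 * DIM('a))"
  by (rule poisson_kernel_decay[OF d \<phi>, of "DIM('a)"], rule that, assumption, simp)
 show ?thesis
 proof (rule that[of "max 1 (C * 4 ^ DIM('a))"])
  show "max 1 (C * 4 ^ DIM('a)) > 0" by simp
  fix j and z :: 'a assume z: "norm z = 1"
  show "(\<integral>\<^sup>+u. ennreal \<bar>frame_kernel DIM('a) \<phi> j (u \<bullet> z)\<bar> \<partial>\<sigma>) <= ennreal (max 1 (C * 4 ^ DIM('a)))"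
  proof (cases "j = 0")
   case True
   thus ?thesis using sphere_measure.emeasure_space_1[where 'a='a] by (simp add: frame_kernel_def)
  next
   case False
   hence j: "j >= 1" by simp
   define N where "N = (2::real) ^ (j - 1)"
   have N: "N >= 1" "2 * N = 2 ^ j" using j by (auto simp: N_def simp flip: power_Suc)
   let ?A = "C * N ^ (DIM('a) - 1)" and ?q = "%u. 1 / (1 + N * norm (z - u)) ^ DIM('a)"
   have "(\<integral>\<^sup>+u. ennreal \<bar>frame_kernel DIM('a) \<phi> j (u \<bullet> z)\<bar> \<partial>\<sigma>) <= (\<integral>\<^sup>+u. ennreal ?A * ennreal (?q u) \<partial>\<sigma>)"
   proof (rule nn_integral_mono)
    fix u :: 'a assume "u \<in> space \<sigma>"
    hence u: "norm u = 1" by simp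
    define s where "s = 1 + N * norm (z - u)"
    have s: "s >= 1" using N(1) by (simp add: s_def)
    have "frame_kernel DIM('a) \<phi> j (u \<bullet> z) = (\<Sum>k<Suc (2 ^ j). \<phi> (real k / N) * 1 ^ k * zonal DIM('a) k (z \<bullet> u))"
     by (simp add: frame_kernel_eq[OF \<phi> j] N_def inner_commute del: sum.lessThan_Suc)
    hence "\<bar>frame_kernel DIM('a) \<phi> j (u \<bullet> z)\<bar> <= ?A / s ^ (2 * DIM('a))"
     using C(2)[OF N(1) zero_le_one order_refl z u, of "Suc (2 ^ j)"] N(2) by (simp add: s_def del: sum.lessThan_Suc)
    also have "... <= ?A / s ^ DIM('a)"
     using C(1) N(1) s by (intro divide_left_mono power_increasing mult_nonneg_nonneg mult_pos_pos zero_less_power) auto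
    finally have "\<bar>frame_kernel DIM('a) \<phi> j (u \<bullet> z)\<bar> <= ?A * (1 / s ^ DIM('a))" by simp
    thus "ennreal \<bar>frame_kernel DIM('a) \<phi> j (u \<bullet> z)\<bar> <= ennreal ?A * ennreal (?q u)"
     using C(1) N(1) s by (subst ennreal_mult[symmetric]) (auto simp: s_def intro!: ennreal_leI)
   qed
   also have "... = ennreal ?A * (\<integral>\<^sup>+u. ennreal (?q u) \<partial>\<sigma>)"
    by (rule nn_integral_cmult) (auto intro!: borel_measurable_sphere_measure)
   also have "... <= ennreal ?A * ennreal (4 ^ DIM('a) / N ^ (DIM('a) - 1))"
    using N by (intro mult_left_mono nn_integral_decay z) auto
   also have "... = ennreal (C * 4 ^ DIM('a))" using C(1) N(1) by (simp flip: ennreal_mult)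
   also have "... <= ennreal (max 1 (C * 4 ^ DIM('a)))" by (intro ennreal_leI) simp
   finally show ?thesis .
  qed
 qed
qed

text \<open>For \<open>p = \<infinity>\<close> the functional is integration against a continuous function, and the frame kernels
 have bounded \<open>L\<^sup>1\<close> norms.\<close>

lemma cap_sup_le_Hardy_norm_infinite:
 fixes C0 :: real
 assumes d: "DIM('a::euclidean_space) >= 3" and \<phi>: "cutoff \<phi>"
 obtains C where "C > 0" "!!c (y :: nat => nat => 'a) w (f :: ('a, 'b::{real_normed_field,euclidean_space}) functional) S.
  f \<in> distributions ==> cap_family c C0 y w S ==>
  Lp_norm \<infinity> (cap_sup y S (cap_coeff y (%B. f (frame_elem \<phi> y w B)))) <= ennreal C * Hardy_norm \<infinity> f"
proof -
 obtain K where K: "K > 0" "!!c (y :: nat => nat => 'a) w S (f :: ('a, 'b) functional) B.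
  f \<in> distributions ==> cap_family c C0 y w S ==> B \<in> S ==>
  cap_coeff y (%B. f (frame_elem \<phi> y w B)) B <= K * norm (f (%u. of_real (cap_kernel \<phi> y B u)))"
  by (rule cap_coeff_le_frame_kernel[OF d \<phi>, of C0, where 'b='b, OF that])
 obtain C1 where C1: "C1 > 0" "!!j (z :: 'a). norm z = 1 ==> (\<integral>\<^sup>+u. ennreal \<bar>frame_kernel DIM('a) \<phi> j (u \<bullet> z)\<bar> \<partial>\<sigma>) <= ennreal C1"
  by (rule integral_frame_kernel_le[OF d \<phi> that])
 show ?thesis
 proof (rule that[of "K * C1"])
  show KC: "K * C1 > 0" using K(1) C1(1) by simp
  fix c and y :: "nat => nat => 'a" and w and f :: "('a, 'b) functional" and S
  assume f: "f \<in> distributions" and S: "cap_family c C0 y w S"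
  interpret distribution f by unfold_locales (rule f, rule d)
  note SD = cap_familyD[OF S]
  define b where "b = cap_coeff y (%B. f (frame_elem \<phi> y w B))"
  have b: "b B >= 0" for B by (simp add: b_def cap_coeff_nonneg)
  obtain s where s: "s \<in> borel_measurable \<sigma>" "cap_sup y S b = (%x. ennreal (s x))"
   by (rule cap_sup_real[OF SD(1,2), of b]) (assumption, rule b, rule that)
  have csm: "cap_sup y S b \<in> borel_measurable \<sigma>" unfolding s(2) using s(1) by measurable
  have "ennreal (1 / (K * C1)) * Lp_norm \<infinity> (cap_sup y S b) <= Hardy_norm \<infinity> f"
   unfolding Hardy_norm_def if_P[OF refl]
  proof (rule INF_greatest)
   fix g :: "'a => 'b" assume "g \<in> {g. continuous_on (sphere 0 1) g \<and> distr_eq f (distr_of g)}"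
   hence g: "distr_eq f (distr_of g)" by simp
   define X where "X = (SUP x\<in>sphere 0 1. ennreal (norm (g x)))"
   have fk: "ennreal (norm (f (%u. of_real (cap_kernel \<phi> y B u)))) <= ennreal C1 * X" if B: "B \<in> S" for B
   proof -
    note z = SD(2)[OF B]
    let ?k = "cap_kernel \<phi> y B"
    have "f (%u. of_real (?k u)) = (\<integral>u. g u * of_real (?k u) \<partial>\<sigma>)"
     using g cap_kernel_test_fun[OF \<phi> z] by (simp add: distr_eq_def distr_of_def)
    also have "ennreal (norm ...) <= (\<integral>\<^sup>+u. ennreal (norm (g u * of_real (?k u))) \<partial>\<sigma>)"
     by (cases "integrable \<sigma> (%u. g u * of_real (?k u))") (simp_all add: integral_norm_bound_ennreal not_integrable_integral_eq)
    also have "... <= (\<integral>\<^sup>+u. X * ennreal \<bar>?k u\<bar> \<partial>\<sigma>)"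
    proof (rule nn_integral_mono)
     fix u :: 'a assume "u \<in> space \<sigma>"
     hence "ennreal (norm (g u)) <= X" unfolding X_def by (intro SUP_upper) simp
     thus "ennreal (norm (g u * of_real (?k u))) <= X * ennreal \<bar>?k u\<bar>"
      by (simp add: norm_mult ennreal_mult mult_right_mono)
    qed
    also have "... = X * (\<integral>\<^sup>+u. ennreal \<bar>?k u\<bar> \<partial>\<sigma>)"
    proof (rule nn_integral_cmult)
     show "(%u. ennreal \<bar>?k u\<bar>) \<in> borel_measurable \<sigma>"
      using borel_measurable_integrable[OF integral_frame_kernel(1)[OF d \<phi> z, of "fst B"]] by measurable
    qed
    also have "... <= X * ennreal C1" by (intro mult_left_mono C1(2) z) simp
    finally show ?thesis by (simp add: mult.commute)
   qed
   have "Lp_norm \<infinity> (cap_sup y S b) <= ennreal (K * C1) * X"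
    unfolding Lp_norm_def if_P[OF refl]
   proof (rule esssup_I[OF csm], rule AE_I2)
    fix x :: 'a
    show "cap_sup y S b x <= ennreal (K * C1) * X"
     unfolding cap_sup_def
    proof (rule SUP_least)
     fix B assume B: "B \<in> S"
     define n where "n = norm (f (%u. of_real (cap_kernel \<phi> y B u)))"
     have "ennreal (b B) * indicator (cap_of y B) x <= ennreal (b B) * 1" by (intro mult_left_mono) (auto simp: indicator_def)
     also have "... <= ennreal (K * n)" unfolding b_def n_def mult_1_right by (intro ennreal_leI K(2)[OF f S B])
     also have "... = ennreal K * ennreal n" using K(1) by (intro ennreal_mult) (auto simp: n_def)
     also have "... <= ennreal K * (ennreal C1 * X)" unfolding n_def by (intro mult_left_mono fk B) simp
     also have "... = ennreal (K * C1) * X" using K(1) C1(1) by (simp add: ennreal_mult mult.assoc)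
     finally show "ennreal (b B) * indicator (cap_of y B) x <= ennreal (K * C1) * X" .
    qed
   qed
   hence "ennreal (1 / (K * C1)) * Lp_norm \<infinity> (cap_sup y S b) <= ennreal (1 / (K * C1)) * (ennreal (K * C1) * X)"
    by (rule mult_left_mono) simp
   thus "ennreal (1 / (K * C1)) * Lp_norm \<infinity> (cap_sup y S b) <= (SUP x\<in>sphere 0 1. ennreal (norm (g x)))"
    unfolding ennreal_cancel[OF KC] X_def .
  qed
  hence "ennreal (K * C1) * (ennreal (1 / (K * C1)) * Lp_norm \<infinity> (cap_sup y S b)) <= ennreal (K * C1) * Hardy_norm \<infinity> f"
   by (rule mult_left_mono) simp
  thus "Lp_norm \<infinity> (cap_sup y S (cap_coeff y (%B. f (frame_elem \<phi> y w B)))) <= ennreal (K * C1) * Hardy_norm \<infinity> f"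
   unfolding ennreal_cancel[OF KC] b_def .
 qed
qed

lemma cap_sup_le_Hardy_norm:
 fixes C0 :: real and p :: ennreal
 assumes d: "DIM('a::euclidean_space) >= 3" and \<phi>: "cutoff \<phi>" and p: "p > 0"
 obtains C where "C > 0" "!!c (y :: nat => nat => 'a) w (f :: ('a, 'b::{real_normed_field,euclidean_space}) functional) S.
  f \<in> distributions ==> cap_family c C0 y w S ==>
  Lp_norm p (cap_sup y S (cap_coeff y (%B. f (frame_elem \<phi> y w B)))) <= ennreal C * Hardy_norm p f"
proof (cases "p = \<infinity>")
 case True
 show ?thesis unfolding True by (rule cap_sup_le_Hardy_norm_infinite[OF d \<phi>, of C0, where 'b='b, OF that[unfolded True]])
next
 case False
 show ?thesis by (rule cap_sup_le_Hardy_norm_finite[OF d \<phi> p False, of C0, where 'b='b, OF that])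
qed

text \<open>The factor \<open>32\<close> combines \<open>2 ^ 4\<close> from the separation \<open>\<gamma> / 2 ^ (j + 4)\<close> with the factor \<open>2\<close> between geodesic distances
 and chords; \<open>max 1 C0\<close> takes the weight \<open>1\<close> on level \<open>0\<close> into account.\<close>

lemma cap_family_point_system:
 fixes y :: "nat => nat => 'a::euclidean_space"
 assumes ps: "point_system \<gamma> C0 c1 c2 I y w" and S: "finite S" "S \<subseteq> cap_indices I"
 shows "cap_family (\<gamma> / 32) (max 1 C0) y w S"
proof -
 note P = ps[unfolded point_system_def]
 note Q = P[THEN conjunct2, THEN conjunct2, THEN conjunct2, THEN spec, THEN mp, THEN conjunct2, THEN conjunct2]
 have I: "I 0 = {0}" and w0: "w 0 0 = 1" by (rule P[THEN conjunct1], rule P[THEN conjunct2, THEN conjunct1])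
 have y0: "norm (y 0 0) = 1" using P[THEN conjunct2, THEN conjunct2, THEN conjunct1] by simp
 have mem: "snd B \<in> I (fst B)" if "B \<in> S" for B using S(2) that by (auto simp: cap_indices_def)
 have n: "norm (entry y B) = 1" if "B \<in> S" for B
 proof (cases "fst B = 0")
  case True
  thus ?thesis using mem[OF that] I y0 by (simp add: entry_def)
 next
  case False
  thus ?thesis using Q[of "fst B", THEN conjunct1] mem[OF that] by (auto simp: entry_def)
 qed
 have w: "0 <= entry w B \<and> entry w B <= max 1 C0 / 2 ^ (fst B * (DIM('a) - 1)) \<and> (fst B = 0 --> B = (0, 0) \<and> entry w B = 1)"
  if "B \<in> S" for B
 proof (cases "fst B = 0")
  case True
  hence "B = (0, 0)" using mem[OF that] I by (cases B) auto
  thus ?thesis using w0 by (simp add: entry_def)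
 next
  case False
  hence "0 <= entry w B \<and> entry w B <= C0 / 2 ^ (fst B * (DIM('a) - 1))"
   unfolding entry_def using mem[OF that]
   by (intro Q[THEN conjunct2, THEN conjunct2, THEN conjunct2, THEN conjunct1, THEN bspec]) auto
  moreover have "C0 / 2 ^ (fst B * (DIM('a) - 1)) <= max 1 C0 / 2 ^ (fst B * (DIM('a) - 1))"
   by (intro divide_right_mono) auto
  ultimately show ?thesis using False by (auto intro: order_trans)
 qed
 have "\<gamma> / 32 / 2 ^ fst A <= norm (entry y A - entry y B)" if A: "A \<in> S" and B: "B \<in> S" and e: "fst A = fst B" "A ~= B" for A B
 proof -
  have k: "snd A \<in> I (fst A)" "snd B \<in> I (fst A)" "snd A ~= snd B" using mem[OF A] mem[OF B] e by (auto simp: prod_eq_iff)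
  hence "fst A > 0" using I by (cases "fst A") auto
  hence "\<gamma> / 2 ^ (fst A + 4) <= geod_dist (entry y A) (entry y B)"
   using Q[of "fst A", THEN conjunct2, THEN conjunct1, THEN bspec, OF _ k(1), THEN bspec, OF _ k(2)] k(3) e(1) by (simp add: entry_def)
  also have "... <= 2 * norm (entry y A - entry y B)" by (rule geod_dist_le_chord[OF n[OF A] n[OF B]])
  finally show ?thesis by (simp add: power_add field_simps)
 qed
 thus ?thesis using S(1) n w unfolding cap_family_def by blast
qed

theorem theorem1p4:
  fixes \<alpha> \<gamma> C0 :: real and p \<tau> :: ennreal and \<phi> :: "real \<Rightarrow> real"
    and c1 c2 :: "ennreal \<Rightarrow> real"
  assumes "DIM('a::euclidean_space) \<ge> 3"
    and "\<gamma> > 0"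
    and "equiv_consts c1 c2"
    and "cutoff \<phi>"
    and "\<alpha> > 0"
    and "p > 0"
    and "\<tau> = inverse (inverse p + ennreal (\<alpha> / (real DIM('a) - 1)))"
  shows "\<exists>C>0. \<forall>I (y :: nat \<Rightarrow> nat \<Rightarrow> 'a) w. point_system \<gamma> C0 c1 c2 I y w \<longrightarrow>
    (\<forall>(f :: ('a, 'b::{real_normed_field,euclidean_space}) functional) n.
       f \<in> Hardy_space p \<longrightarrow> n > 0 \<longrightarrow>
         (\<forall>G. greedy_set p \<phi> I y w f n G \<longrightarrow>
            Besov_norm \<alpha> \<tau> \<tau> (distr_of (greedy_approx \<phi> y w f G))
              \<le> ennreal (C * real n powr (\<alpha> / (real DIM('a) - 1))) * Hardy_norm p f) \<and>
         (\<forall>a :: nat \<times> nat \<Rightarrow> 'b.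
            finite {B \<in> cap_indices I. a B \<noteq> 0} \<longrightarrow>
            card {B \<in> cap_indices I. a B \<noteq> 0} \<le> n \<longrightarrow>
            distr_eq f (distr_of (\<lambda>x. \<Sum>B | B \<in> cap_indices I \<and> a B \<noteq> 0. a B * frame_elem \<phi> y w B x)) \<longrightarrow>
            Besov_norm \<alpha> \<tau> \<tau> f
              \<le> ennreal (C * real n powr (\<alpha> / (real DIM('a) - 1))) *
                 Lp_norm p (\<lambda>x. SUP B\<in>cap_indices I.
                   ennreal (norm (a B) * measure sphere_measure (cap_of y B) powr (- 1 / 2))
                     * indicator (cap_of y B) x)))"
proof -
 have c: "\<gamma> / 32 > 0" using assms(2) by simp
 define e where "e = \<alpha> / (real DIM('a) - 1)"
 have e: "e > 0" using assms(1,5) by (simp add: e_def)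
 obtain C where C: "C > 0" "!!(y :: nat => nat => 'a) w S (a :: nat \<times> nat => 'b) f. cap_family (\<gamma> / 32) (max 1 C0) y w S ==>
  distr_eq f (distr_of (%x. \<Sum>B\<in>S. a B * frame_elem \<phi> y w B x)) ==>
  Besov_norm \<alpha> \<tau> \<tau> f <= ennreal (C * real (card S) powr e) * Lp_norm p (cap_sup y S (cap_coeff y a))"
  by (rule Besov_norm_frame_sum_le[OF assms(1,4) c assms(5-7), of "max 1 C0", where 'b='b, folded e_def, OF that])
 obtain D where D: "D > 0" "!!c (y :: nat => nat => 'a) w (f :: ('a, 'b) functional) S.
  f \<in> distributions ==> cap_family c (max 1 C0) y w S ==>
  Lp_norm p (cap_sup y S (cap_coeff y (%B. f (frame_elem \<phi> y w B)))) <= ennreal D * Hardy_norm p f"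
  by (rule cap_sup_le_Hardy_norm[OF assms(1,4,6), of "max 1 C0", where 'b='b, OF that])
 define A where "A = C * max 1 D"
 have A: "A > 0" "C * D <= A" "C <= A" using C(1) by (auto simp: A_def)
 show ?thesis
  unfolding e_def[symmetric]
 proof (rule exI[of _ A], intro conjI allI impI)
  show "A > 0" by (rule A(1))
 next
  fix I and y :: "nat => nat => 'a" and w and f :: "('a, 'b) functional" and n :: nat
  assume ps: "point_system \<gamma> C0 c1 c2 I y w" and f: "f \<in> Hardy_space p"
  {
   fix G assume G: "greedy_set p \<phi> I y w f n G"
   hence S: "cap_family (\<gamma> / 32) (max 1 C0) y w G" and card: "card G = n"
    by (auto simp: greedy_set_def intro!: cap_family_point_system[OF ps])
   have "Besov_norm \<alpha> \<tau> \<tau> (distr_of (greedy_approx \<phi> y w f G)) <=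
    ennreal (C * real (card G) powr e) * Lp_norm p (cap_sup y G (cap_coeff y (%B. f (frame_elem \<phi> y w B))))"
    by (rule C(2)[OF S]) (simp add: distr_eq_def greedy_approx_def[abs_def])
   also have "... <= ennreal (C * real n powr e) * (ennreal D * Hardy_norm p f)"
    unfolding card using f by (intro mult_left_mono D(2)[OF _ S]) (auto simp: Hardy_space_def)
   also have "... = ennreal (C * D * real n powr e) * Hardy_norm p f"
    using C(1) D(1) by (simp add: ennreal_mult mult_ac)
   also have "... <= ennreal (A * real n powr e) * Hardy_norm p f"
    using A(2) by (intro mult_right_mono ennreal_leI) auto
   finally show "Besov_norm \<alpha> \<tau> \<tau> (distr_of (greedy_approx \<phi> y w f G)) <= ennreal (A * real n powr e) * Hardy_norm p f" .
  }
  {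
   fix a :: "nat \<times> nat => 'b"
   define S where "S = {B \<in> cap_indices I. a B ~= 0}"
   let ?X = "%x B. ennreal (norm (a B) * measure \<sigma> (cap_of y B) powr (- 1 / 2)) * indicator (cap_of y B) x"
   assume fin: "finite {B \<in> cap_indices I. a B ~= 0}" and card: "card {B \<in> cap_indices I. a B ~= 0} <= n"
    and eq: "distr_eq f (distr_of (%x. \<Sum>B | B \<in> cap_indices I \<and> a B ~= 0. a B * frame_elem \<phi> y w B x))"
   have "cap_family (\<gamma> / 32) (max 1 C0) y w S"
    using fin by (intro cap_family_point_system[OF ps]) (auto simp: S_def)
   hence "Besov_norm \<alpha> \<tau> \<tau> f <= ennreal (C * real (card S) powr e) * Lp_norm p (cap_sup y S (cap_coeff y a))"
    by (rule C(2)) (rule eq[folded S_def])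
   also have "... <= ennreal (A * real n powr e) * Lp_norm p (cap_sup y S (cap_coeff y a))"
    using A C(1) card e by (intro mult_right_mono ennreal_leI mult_mono powr_mono2) (auto simp: S_def)
   also have "cap_sup y S (cap_coeff y a) = (%x. SUP B\<in>cap_indices I. ?X x B)"
   proof (rule ext, rule antisym)
    fix x
    show "cap_sup y S (cap_coeff y a) x <= (SUP B\<in>cap_indices I. ?X x B)"
     unfolding cap_sup_def cap_coeff_def by (rule SUP_subset_mono) (auto simp: S_def)
    show "(SUP B\<in>cap_indices I. ?X x B) <= cap_sup y S (cap_coeff y a) x"
    proof (rule SUP_least)
     fix B assume B: "B \<in> cap_indices I"
     show "?X x B <= cap_sup y S (cap_coeff y a) x"
     proof (cases "a B = 0")
      case False
      thus ?thesis unfolding cap_sup_def cap_coeff_def using B by (intro SUP_upper) (simp add: S_def)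
     qed simp
    qed
   qed
   finally show "Besov_norm \<alpha> \<tau> \<tau> f <= ennreal (A * real n powr e) * Lp_norm p (%x. SUP B\<in>cap_indices I. ?X x B)" .
  }
 qed
qed

end
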